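(* Let $p>n\ge 3$ be integers, let $C$ be a $p\times p$ positive definite matrix, let $K>1$, $\eta\in(0,1)$, and let $\mathcal{M}$ be a nonempty collection of graphs ($\mathcal{M}\subset\mathcal{G}$) or of directed graphs ($\mathcal{M}\subset\mathcal{G}^+$) on $\{1,\ldots,p\}$ whose degree $D_{\mathcal{M}}=\max\{\deg(m):\ m\in\mathcal{M}\}$ satisfies $$1\le D_{\mathcal{M}}\le \eta\,\frac{n}{2\left(1.1+\sqrt{\log p}\right)^2}.$$ Let $\tilde\theta$ be the truncated selected estimator defined in the context, built from $\mathcal{M}$, the constant $K$ and the $n$-sample $X_1,\ldots,X_n$ of the law $\mathcal{N}(0,C)$. Then $$\mathbb{E}\left[\|C^{1/2}(\tilde\theta-\theta)\|^2\right]\le c(K,\eta)\min_{m\in\mathcal{M}}\left\{\|C^{1/2}(\theta-\theta_m)\|^2\left(1+\frac{\mathrm{pen}(\deg(m))}{n-\deg(m)}\right)+\frac1n\sum_{j=1}^p\left(\mathrm{pen}(|m_j|)+K\log n\right)\sigma_j^2\right\}+R_n(\eta,C),$$ where $c(K,\eta)=\dfrac{K}{(K-1)(1-\sqrt\eta)^4}$ and the residual term $R_n(\eta,C)$ (defined in the context) is of order $p^2n^{-4\log n}$, i.e. $R_n(\eta,C)\le \kappa\, p^2 n^{-4\log n}$ with $\kappa$ depending only on $\eta$ and on the smallest and largest eigenvalues of $C$.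
   Context: Graphs. $\mathcal{G}^+$ is the set of subsets $g\subset\{1,\ldots,p\}^2$ with $(j,j)\notin g$ for all $j$ (directed graphs); $\mathcal{G}\subset\mathcal{G}^+$ is the set of those $g$ that are symmetric: $(i,j)\in g\Rightarrow(j,i)\in g$ (graphs). For $g\in\mathcal{G}^+$, $g_j=\{i:(i,j)\in g\}$, $|g_j|$ is its cardinality, and $\deg(g)=\max_j|g_j|$. Norms and columns. $\|\cdot\|$ is the Frobenius (Euclidean) norm. For a matrix $A$, $A^{(j)}$ is its $j$-th column and $A_i^{(j)}$ the $i$-th entry of this column. $C^{1/2}$ is the positive square root of $C$. Target. $\theta\in\mathbb{R}^{p\times p}$ is the matrix of regression coefficients of $\mathcal{N}(0,C)$: $\theta_j^{(j)}=0$ and, for $\mathrm{X}=(\mathrm{X}^{(1)},\ldots,\mathrm{X}^{(p)})^T\sim\mathcal{N}(0,C)$, $\mathbb{E}[\mathrm{X}^{(j)}\mid \mathrm{X}^{(k)},k\ne j]=\sum_{k\ne j}\theta_k^{(j)}\mathrm{X}^{(k)}$ a.s.; equivalently $\theta_i^{(j)}=-(C^{-1})_{i,j}/(C^{-1})_{j,j}$ for $i\neq j$. Moreover $\sigma_j^2=1/(C^{-1})_{j,j}=\mathrm{Var}(\mathrm{X}^{(j)}\mid\mathrm{X}^{(k)},k\ne j)$. Data. $X_1,\ldots,X_n$ are i.i.d. $\mathcal{N}(0,C)$ in $\mathbb{R}^p$ and $X=[X_1,\ldots,X_n]^T$ is the $n\times p$ data matrix. Models and estimators. For $m\in\mathcal{M}$,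 $\Theta_m=\{A\in\mathbb{R}^{p\times p}:\ (i,j)\notin m\Rightarrow A_i^{(j)}=0\}$. The matrix $\theta_m\in\Theta_m$ satisfies $\|C^{1/2}(\theta-\theta_m)\|^2=\min_{A\in\Theta_m}\|C^{1/2}(\theta-A)\|^2$, and $\hat\theta_m\in\Theta_m$ is the (a.s. unique) matrix with $\|X(I-\hat\theta_m)\|^2=\min_{A\in\Theta_m}\|X(I-A)\|^2$. Penalty. For $d,N\geq 1$ and $x>0$, with $F_{a,b}$ a Fisher random variable with $a$ and $b$ degrees of freedom, $$\mathrm{Dkhi}(d,N,x)=\mathbb{P}\left(F_{d+2,N}\ge\tfrac{x}{d+2}\right)-\tfrac xd\,\mathbb{P}\left(F_{d,N+2}\ge\tfrac{N+2}{Nd}x\right),$$ extended by continuity by $\mathrm{Dkhi}(d,N,0)=1$. The function $x\mapsto\mathrm{Dkhi}(d,N,x)$ is decreasing, and $\mathrm{EDkhi}[d,N,\cdot]$ denotes its inverse. For integers $0\le d\le n-2$, $$\mathrm{pen}(d)=K\,\frac{n-d}{n-d-1}\,\mathrm{EDkhi}\left[d+1,\,n-d-1,\,\left(\tbinom{p-1}{d}(d+1)^2\right)^{-1}\right].$$ Selection. $\hat\theta=\hat\theta_{\hat m}$ where $\hat m$ is any minimizer over $m\in\mathcal{M}$ of $$\mathrm{Crit}(m)=\sum_{j=1}^p\|X^{(j)}-X\hat\theta_m^{(j)}\|^2\left(1+\frac{\mathrm{pen}(|m_j|)}{n-|m_j|}\right).$$ The truncated estimator $\tilde\theta$ has columns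 $\tilde\theta^{(j)}=\hat\theta^{(j)}\mathbf{1}_{\{\|\hat\theta^{(j)}\|\le\sqrt p\,T_n\}}$, $j=1,\ldots,p$, with $T_n=n^{2\log n}$. Residual term. Put $\lambda_0=(1-\sqrt\eta)^2$ and, for each $j$, $$\lambda_j^*=\inf\left\{\frac{\|Xu\|/\sqrt n}{\|C^{1/2}u\|}:\ u\ne0,\ u\in\mathrm{span}\left(\theta^{(j)},\,e_i,\ i\in S\right)\text{ for some }S\subset\{1,\ldots,p\}\setminus\{j\}\text{ with }|S|=D_{\mathcal{M}}\right\},$$ where $e_1,\ldots,e_p$ is the canonical basis of $\mathbb{R}^p$. Then $$R_n(\eta,C)=\sum_{j=1}^p\left(\mathbb{E}\left[\|C^{1/2}\theta^{(j)}\|^2\mathbf{1}_{\{\lambda_j^*\ge\lambda_0,\ \tilde\theta^{(j)}\ne\hat\theta^{(j)}\}}\right]+\mathbb{E}\left[\|C^{1/2}(\tilde\theta^{(j)}-\theta^{(j)})\|^2\mathbf{1}_{\{\lambda_j^*<\lambda_0\}}\right]\right).$$ *)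

theory Defs
  imports
    "HOL-Probability.Probability"
    "Jordan_Normal_Form.Spectral_Radius"
begin

text \<open>
  Matrices are those of \<open>Jordan_Normal_Form\<close>, so that the dimension \<open>p\<close> can be quantified over.
  Vertices, variables and matrix indices are numbered from \<open>0\<close>: they range over \<open>{..<p}\<close>, and
  observations over \<open>{..<n}\<close>.
\<close>

definition frob_norm :: "real mat \<Rightarrow> real" where
  "frob_norm A = sqrt (\<Sum>i<dim_row A. \<Sum>j<dim_col A. (A $$ (i, j))\<^sup>2)"

definition vnorm :: "real Matrix.vec \<Rightarrow> real" where
  "vnorm v = sqrt (scalar_prod v v)"

definition pos_def :: "nat \<Rightarrow> real mat \<Rightarrow> bool" where
  "pos_def p C \<longleftrightarrow> C \<in> carrier_mat p p \<and> transpose_mat C = C \<and>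
    (\<forall>v \<in> carrier_vec p. v \<noteq> 0\<^sub>v p \<longrightarrow> scalar_prod v (C *\<^sub>v v) > 0)"

text \<open>For positive definite \<open>C\<close> the positive square root exists, is unique and is itself positive
  definite. Likewise \<open>inv_mat\<close> is only meant for invertible matrices.\<close>

definition sqrt_mat :: "nat \<Rightarrow> real mat \<Rightarrow> real mat" where
  "sqrt_mat p C = (THE B. pos_def p B \<and> B * B = C)"

definition inv_mat :: "real mat \<Rightarrow> real mat" where
  "inv_mat C = the (mat_inverse C)"

definition digraphs :: "nat \<Rightarrow> (nat \<times> nat) set set" where
  "digraphs p = {g. g \<subseteq> {..<p} \<times> {..<p} \<and> (\<forall>j. (j, j) \<notin> g)}"

definition graphs :: "nat \<Rightarrow> (nat \<times> nat) set set" where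
  "graphs p = {g \<in> digraphs p. sym g}"

definition nbrs :: "(nat \<times> nat) set \<Rightarrow> nat \<Rightarrow> nat set" where
  "nbrs g j = {i. (i, j) \<in> g}"

definition gdeg :: "nat \<Rightarrow> (nat \<times> nat) set \<Rightarrow> nat" where
  "gdeg p g = Max ((\<lambda>j. card (nbrs g j)) ` {..<p})"

definition max_deg :: "nat \<Rightarrow> (nat \<times> nat) set set \<Rightarrow> nat" where
  "max_deg p \<M> = Max (gdeg p ` \<M>)"

definition Theta :: "nat \<Rightarrow> (nat \<times> nat) set \<Rightarrow> real mat set" where
  "Theta p m = {A \<in> carrier_mat p p. \<forall>i<p. \<forall>j<p. (i, j) \<notin> m \<longrightarrow> A $$ (i, j) = 0}"

text \<open>\<open>N(0, C)\<close> for positive definite \<open>C\<close>, through its Lebesgue density; a vector is an extensional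
  function on \<open>{..<p}\<close>.\<close>

definition normal_dist :: "nat \<Rightarrow> real mat \<Rightarrow> (nat \<Rightarrow> real) measure" where
  "normal_dist p C = density (\<Pi>\<^sub>M j\<in>{..<p}. lborel)
     (\<lambda>x. ennreal (exp (- scalar_prod (Matrix.vec p x) (inv_mat C *\<^sub>v Matrix.vec p x) / 2)
                   / sqrt ((2 * pi) ^ p * Determinant.det C)))"

definition normal_sample ::
  "'a measure \<Rightarrow> (nat \<Rightarrow> 'a \<Rightarrow> nat \<Rightarrow> real) \<Rightarrow> nat \<Rightarrow> nat \<Rightarrow> real mat \<Rightarrow> bool" where
  "normal_sample \<Omega> X n p C \<longleftrightarrow> prob_space \<Omega> \<and>
     prob_space.indep_vars \<Omega> (\<lambda>_. \<Pi>\<^sub>M j\<in>{..<p}. borel) X {..<n} \<and>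
     (\<forall>k<n. distr \<Omega> (\<Pi>\<^sub>M j\<in>{..<p}. borel) (X k) = normal_dist p C)"

text \<open>\<open>sample_law\<close> is the joint law of such a sample. Statistics are functions of the data matrix, so
  quantities that depend only on the law of the data are expectations under \<open>sample_law\<close>.\<close>

definition sample_law :: "nat \<Rightarrow> nat \<Rightarrow> real mat \<Rightarrow> (nat \<Rightarrow> nat \<Rightarrow> real) measure" where
  "sample_law n p C = (\<Pi>\<^sub>M k\<in>{..<n}. normal_dist p C)"

definition data_mat :: "nat \<Rightarrow> nat \<Rightarrow> (nat \<Rightarrow> nat \<Rightarrow> real) \<Rightarrow> real mat" where
  "data_mat n p x = Matrix.mat n p (\<lambda>(k, j). x k j)"

definition others_sigma :: "nat \<Rightarrow> nat \<Rightarrow> (nat \<Rightarrow> real) measure" where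
  "others_sigma p j = vimage_algebra (space (\<Pi>\<^sub>M k\<in>{..<p}. (borel :: real measure)))
     (\<lambda>x. restrict x ({..<p} - {j})) (\<Pi>\<^sub>M k\<in>{..<p} - {j}. borel)"

definition regression_mat :: "nat \<Rightarrow> real mat \<Rightarrow> real mat \<Rightarrow> bool" where
  "regression_mat p C \<theta> \<longleftrightarrow> \<theta> \<in> carrier_mat p p \<and>
     (\<forall>j<p. \<theta> $$ (j, j) = 0 \<and>
       (AE x in normal_dist p C. real_cond_exp (normal_dist p C) (others_sigma p j) (\<lambda>x. x j) x
          = (\<Sum>k\<in>{..<p} - {j}. \<theta> $$ (k, j) * x k)))"

text \<open>\<open>1 / (C\<^sup>-\<^sup>1)\<^sub>j\<^sub>j\<close> is the conditional variance of the \<open>j\<close>-th coordinate of \<open>N(0, C)\<close> given the others.\<close>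

definition sigma2 :: "real mat \<Rightarrow> nat \<Rightarrow> real" where
  "sigma2 C j = 1 / inv_mat C $$ (j, j)"

text \<open>Fisher distribution: law of \<open>(U / a) / (V / b)\<close>, where \<open>U\<close> and \<open>V\<close> are independent
  chi-squared variables with \<open>a\<close> and \<open>b\<close> degrees of freedom.\<close>

definition fisher_dist :: "nat \<Rightarrow> nat \<Rightarrow> real measure" where
  "fisher_dist a b = distr (\<Pi>\<^sub>M i\<in>{..<a + b}. std_normal_distribution) borel
     (\<lambda>z. ((\<Sum>i<a. (z i)\<^sup>2) / a) / ((\<Sum>i=a..<a + b. (z i)\<^sup>2) / b))"

definition Dkhi :: "nat \<Rightarrow> nat \<Rightarrow> real \<Rightarrow> real" where
  "Dkhi d N x = measure (fisher_dist (d + 2) N) {x / (real d + 2)..}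
     - x / d * measure (fisher_dist d (N + 2)) {(real N + 2) / (real N * real d) * x..}"

text \<open>\<open>Dkhi d N\<close> is decreasing on \<open>{0..}\<close> with value \<open>1\<close> at \<open>0\<close>; the inverse is taken there.\<close>

definition EDkhi :: "nat \<Rightarrow> nat \<Rightarrow> real \<Rightarrow> real" where
  "EDkhi d N = inv_into {0..} (Dkhi d N)"

text \<open>Meant for \<open>d + 2 \<le> n\<close>, where the subtraction on \<open>nat\<close> does not truncate.\<close>

definition pen :: "real \<Rightarrow> nat \<Rightarrow> nat \<Rightarrow> nat \<Rightarrow> real" where
  "pen K n p d = K * ((real n - real d) / (real n - real d - 1)) *
     EDkhi (d + 1) (n - d - 1) (1 / (real ((p - 1) choose d) * (real d + 1)\<^sup>2))"

definition crit ::
  "real \<Rightarrow> nat \<Rightarrow> nat \<Rightarrow> real mat \<Rightarrow> ((nat \<times> nat) set \<Rightarrow> real mat) \<Rightarrow> (nat \<times> nat) set \<Rightarrow> real" where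
  "crit K n p X \<theta>h m = (\<Sum>j<p. (vnorm (col X j - X *\<^sub>v col (\<theta>h m) j))\<^sup>2 *
     (1 + pen K n p (card (nbrs m j)) / (real n - real (card (nbrs m j)))))"

definition truncation :: "nat \<Rightarrow> nat \<Rightarrow> real mat \<Rightarrow> real mat" where
  "truncation n p A = Matrix.mat p p (\<lambda>(i, j).
     if vnorm (col A j) \<le> sqrt p * (real n powr (2 * ln n)) then A $$ (i, j) else 0)"

definition lambda_star ::
  "nat \<Rightarrow> nat \<Rightarrow> real mat \<Rightarrow> real mat \<Rightarrow> nat \<Rightarrow> real mat \<Rightarrow> nat \<Rightarrow> real" where
  "lambda_star n p C \<theta> D X j = Inf {(vnorm (X *\<^sub>v u) / sqrt n) / vnorm (sqrt_mat p C *\<^sub>v u) | u.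
     u \<noteq> 0\<^sub>v p \<and> (\<exists>S \<subseteq> {..<p} - {j}. card S = D \<and>
       u \<in> LinearCombinations.module.span class_ring (module_vec TYPE(real) p)
             (insert (col \<theta> j) (unit_vec p ` S)))}"

text \<open>The argument \<open>\<theta>sel\<close> is the selected estimator (before truncation) as a function of the data
  matrix. The value is in \<^typ>\<open>ennreal\<close>, so that no integrability has to be presupposed.\<close>

definition residual ::
  "nat \<Rightarrow> nat \<Rightarrow> real \<Rightarrow> real mat \<Rightarrow> real mat \<Rightarrow> nat \<Rightarrow> (real mat \<Rightarrow> real mat) \<Rightarrow> ennreal" where
  "residual n p \<eta> C \<theta> D \<theta>sel = (\<Sum>j<p.
     (\<integral>\<^sup>+x. (let X = data_mat n p x in ennreal (
         if lambda_star n p C \<theta> D X j \<ge> (1 - sqrt \<eta>)\<^sup>2 \<and>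
            col (truncation n p (\<theta>sel X)) j \<noteq> col (\<theta>sel X) j
         then (vnorm (sqrt_mat p C *\<^sub>v col \<theta> j))\<^sup>2 else 0)) \<partial>sample_law n p C) +
     (\<integral>\<^sup>+x. (let X = data_mat n p x in ennreal (
         if lambda_star n p C \<theta> D X j < (1 - sqrt \<eta>)\<^sup>2
         then (vnorm (sqrt_mat p C *\<^sub>v (col (truncation n p (\<theta>sel X)) j - col \<theta> j)))\<^sup>2
         else 0)) \<partial>sample_law n p C))"

end

theory Submission
  imports Defs "HOL-Real_Asymp.Real_Asymp"
begin

text \<open>
  Everything decouples over the columns. Write \<open>\<epsilon>\<close> for the noise of the regression of the \<open>j\<close>-th
  variable on the others; it is independent of these. For a neighbourhood \<open>S\<close> of size \<open>d\<close> let \<open>r\<close> be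
  the squared distance of \<open>\<epsilon>\<close> to the span of \<open>X \<theta>\<^sup>(\<^sup>j\<^sup>)\<close> and \<open>X\<^sub>i\<close>, \<open>i \<in> S\<close>. Up to a term with mean
  controlled by the oracle, the prediction loss exceeds the criterion by at most
  \<open>\<parallel>\<epsilon>\<parallel>\<^sup>2 - (1 + pen(d) / (K (n - d))) r\<close>, a difference of two independent chi-squared variables with
  \<open>d + 1\<close> and \<open>n - d - 1\<close> degrees of freedom. By size-biasing of chi-squared laws, \<open>Dkhi\<close> is the
  normalized mean of the positive part of such a difference, so the penalty is exactly what makes
  the sum of these means over all \<open>S\<close> at most \<open>\<sigma>\<^sub>j\<^sup>2 (1 + 1/2 + \<dots> + 1/(D + 1)) \<le> \<sigma>\<^sub>j\<^sup>2 ln n\<close>.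

  Where \<open>\<lambda>\<^sub>j\<^sup>* \<ge> \<lambda>\<^sub>0\<close>, the prediction loss divided by \<open>n \<lambda>\<^sub>0\<^sup>2\<close> dominates the loss in the norm of
  \<open>C\<^sup>1\<^sup>/\<^sup>2\<close>, unless the column has been truncated; the residual term collects the rest. Truncation is
  rare by Markov's inequality. For \<open>\<lambda>\<^sub>j\<^sup>* < \<lambda>\<^sub>0\<close>, round the offending vector, in coordinates orthonormal
  for \<open>C\<close>, to a lattice with mesh of order \<open>D\<^sup>-\<^sup>1\<^sup>/\<^sup>2\<close> in such a way that the quadratic form hardly
  grows, and use the chi-squared lower tail in a union bound over supports and lattice points.
\<close>

section \<open>Orthogonal reduction and positive definite matrices\<close>

text \<open>The square in the threshold (1 - sqrt \<eta>)^2 has two origins. With \<epsilon> = 1 -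
  sqrt \<eta>, a fixed vector has a ratio below \<epsilon> with probability at most exp (- n
  \<eta>), and the choice of a support costs at most exp (n \<eta> / 2); the second factor
  \<epsilon> is the room in which the rounding takes place. The truncation level is a compromise
  too: its square n^(4 log n) divides in Markov's inequality and multiplies the loss on the bad
  event, whose probability is therefore driven down to the order n^(-8 log n). Two obstacles shape
  the proof. Neither the minimizing vector in \<open>lambda_star\<close> nor the selected model is
  fixed before the data are seen; the former is handled by an event with countably many rational
  coefficients, the latter by a sum over all supports of size at most \<open>D\<close>. And no
  integrability is available in advance: means are \<open>nn_integral\<close>s, identities are
  arranged as sums, and the noise level is subtracted only after finiteness is known. Independence
  of the noise enters through one device, redrawing it without changing the law of the
  sample.\<close>

definition ip :: "nat \<Rightarrow> (nat \<Rightarrow> real) \<Rightarrow> (nat \<Rightarrow> real) \<Rightarrow> real" where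
  "ip n x y = (\<Sum>i<n. x i * y i)"

text \<open>A vector is a function of which only the arguments below \<open>n\<close> count. The
  result of \<open>mv\<close> is not cut off at \<open>n\<close>, so vector equations are stated
  pointwise for \<open>i < n\<close> and carried into \<open>ip\<close> and \<open>mv\<close> by
  \<open>ip_cong\<close> and \<open>mv_cong\<close>.\<close>

definition mv :: "nat \<Rightarrow> (nat \<Rightarrow> nat \<Rightarrow> real) \<Rightarrow> (nat \<Rightarrow> real) \<Rightarrow> nat \<Rightarrow> real" where
  "mv n t x = (\<lambda>i. \<Sum>j<n. t i j * x j)"

definition orthm :: "nat \<Rightarrow> (nat \<Rightarrow> nat \<Rightarrow> real) \<Rightarrow> bool" where
  "orthm n t \<longleftrightarrow> (\<forall>i<n. \<forall>j<n. (\<Sum>k<n. t k i * t k j) = of_bool (i = j))"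

lemma ip_commute: "ip n x y = ip n y x"
  by (simp add: ip_def mult.commute)

lemma ip_add: "ip n x (\<lambda>i. y i + z i) = ip n x y + ip n x z"
  and ip_diff: "ip n x (\<lambda>i. y i - z i) = ip n x y - ip n x z"
  and ip_scale: "ip n x (\<lambda>i. c * y i) = c * ip n x y"
  by (simp_all add: ip_def algebra_simps sum.distrib sum_subtractf sum_distrib_left)

lemma ip_add_left: "ip n (\<lambda>i. y i + z i) x = ip n y x + ip n z x"
  and ip_diff_left: "ip n (\<lambda>i. y i - z i) x = ip n y x - ip n z x"
  and ip_scale_left: "ip n (\<lambda>i. c * y i) x = c * ip n y x"
  by (simp_all add: ip_def algebra_simps sum.distrib sum_subtractf sum_distrib_left)

lemmas ip_linear = ip_add ip_diff ip_scale ip_add_left ip_diff_left ip_scale_left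

lemma ip_nonneg [simp]: "0 \<le> ip n x x"
  by (simp add: ip_def sum_nonneg)

lemma ip_self: "ip n x x = (\<Sum>i<n. (x i)\<^sup>2)"
  by (simp add: ip_def power2_eq_square)

lemma ip_self_eq_0: "ip n x x = 0 \<longleftrightarrow> (\<forall>i<n. x i = 0)"
  unfolding ip_self by (subst sum_nonneg_eq_0_iff) auto

lemma ip_cong: "(\<And>i. i < n \<Longrightarrow> x i = x' i) \<Longrightarrow> (\<And>i. i < n \<Longrightarrow> y i = y' i) \<Longrightarrow> ip n x y = ip n x' y'"
  by (simp add: ip_def)

lemma mv_cong: "(\<And>i. i < n \<Longrightarrow> x i = x' i) \<Longrightarrow> mv n t x = mv n t x'"
  by (simp add: mv_def)

lemma mv_add: "mv n t (\<lambda>i. x i + y i) i = mv n t x i + mv n t y i"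
  and mv_diff: "mv n t (\<lambda>i. x i - y i) i = mv n t x i - mv n t y i"
  and mv_scale: "mv n t (\<lambda>i. c * x i) i = c * mv n t x i"
  by (simp_all add: mv_def algebra_simps sum.distrib sum_subtractf sum_distrib_left)

lemma mv_mv: "mv n s (mv n t x) = mv n (\<lambda>i j. \<Sum>k<n. s i k * t k j) x"
proof
  fix i
  have "mv n s (mv n t x) i = (\<Sum>k<n. \<Sum>j<n. s i k * t k j * x j)"
    by (simp add: mv_def sum_distrib_left mult.assoc)
  also have "\<dots> = (\<Sum>j<n. \<Sum>k<n. s i k * t k j * x j)" by (rule sum.swap)
  finally show "mv n s (mv n t x) i = mv n (\<lambda>i j. \<Sum>k<n. s i k * t k j) x i"
    by (simp add: mv_def sum_distrib_right)
qed

lemma ip_mv: "ip n x (mv n t y) = ip n (mv n (\<lambda>i j. t j i) x) y"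
proof -
  have "ip n x (mv n t y) = (\<Sum>i<n. \<Sum>j<n. x i * t i j * y j)"
    by (simp add: ip_def mv_def sum_distrib_left mult.assoc)
  also have "\<dots> = (\<Sum>j<n. \<Sum>i<n. x i * t i j * y j)" by (rule sum.swap)
  finally show ?thesis by (simp add: ip_def mv_def sum_distrib_right sum_distrib_left mult.commute)
qed

lemma sum_of_bool_mult:
  "finite A \<Longrightarrow> (\<Sum>j\<in>A. of_bool (i = j) * f j) = (if i \<in> A then f i else (0::real))"
  "finite A \<Longrightarrow> (\<Sum>j\<in>A. of_bool (j = i) * f j) = (if i \<in> A then f i else (0::real))"
  "finite A \<Longrightarrow> (\<Sum>j\<in>A. f j * of_bool (i = j)) = (if i \<in> A then f i else (0::real))"
  "finite A \<Longrightarrow> (\<Sum>j\<in>A. f j * of_bool (j = i)) = (if i \<in> A then f i else (0::real))"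
  by (simp_all add: of_bool_def if_distrib if_distribR sum.delta sum.delta' cong: if_cong)

lemma orthm_mv_transpose:
  assumes "orthm n t" "i < n"
  shows "mv n (\<lambda>i j. t j i) (mv n t x) i = x i"
  using assms by (simp add: mv_mv orthm_def) (simp add: mv_def sum_of_bool_mult)

lemma orthm_ip:
  assumes "orthm n t"
  shows "ip n (mv n t x) (mv n t y) = ip n x y"
  unfolding ip_mv using assms by (intro ip_cong) (simp_all add: orthm_mv_transpose)

lemma orthm_compose:
  assumes s: "orthm n s" and t: "orthm n t"
  shows "orthm n (\<lambda>i j. \<Sum>k<n. s i k * t k j)"
  unfolding orthm_def
proof (intro allI impI)
  fix i j assume ij: "i < n" "j < n"
  have "(\<Sum>k<n. (\<Sum>l<n. s k l * t l i) * (\<Sum>l<n. s k l * t l j)) =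
    ip n (mv n s (\<lambda>l. t l i)) (mv n s (\<lambda>l. t l j))"
    by (simp add: ip_def mv_def)
  also have "\<dots> = of_bool (i = j)"
    unfolding orthm_ip[OF s] using t ij by (simp add: orthm_def ip_def)
  finally show "(\<Sum>k<n. (\<Sum>l<n. s k l * t l i) * (\<Sum>l<n. s k l * t l j)) = of_bool (i = j)" .
qed

text \<open>A left inverse of a square matrix is also a right inverse; so the transpose of an
  orthogonal matrix is orthogonal and undoes it from either side.\<close>

lemma orthm_rows:
  assumes "orthm n t" "i < n" "j < n"
  shows "(\<Sum>k<n. t i k * t j k) = of_bool (i = j)"
proof -
  define A where "A = Matrix.mat n n (\<lambda>(i, j). t i j)"
  have A: "A \<in> carrier_mat n n" by (simp add: A_def)
  have "transpose_mat A * A = 1\<^sub>m n"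
    using assms(1) by (intro eq_matI) (auto simp: A_def scalar_prod_def orthm_def atLeast0LessThan)
  hence "A * transpose_mat A = 1\<^sub>m n"
    by (intro mat_mult_left_right_inverse[of "transpose_mat A"]) (use A in auto)
  hence "(A * transpose_mat A) $$ (i, j) = 1\<^sub>m n $$ (i, j)" by simp
  thus ?thesis using assms by (auto simp: A_def scalar_prod_def atLeast0LessThan)
qed

lemma orthm_transpose: "orthm n t \<Longrightarrow> orthm n (\<lambda>i j. t j i)"
  by (simp add: orthm_def orthm_rows[unfolded orthm_def])

lemma orthm_transpose_mv:
  assumes "orthm n t" "i < n"
  shows "mv n t (mv n (\<lambda>i j. t j i) x) i = x i"
  using orthm_mv_transpose[OF orthm_transpose[OF assms(1)] assms(2)] by simp

text \<open>Householder reflection in the hyperplane orthogonal to \<open>u\<close>. If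
  \<open>ip n u u = 0\<close>, division by zero yields 0 and the reflection is the identity, so this
  case needs no separate definition.\<close>

definition reflection :: "nat \<Rightarrow> (nat \<Rightarrow> real) \<Rightarrow> nat \<Rightarrow> nat \<Rightarrow> real" where
  "reflection n u = (\<lambda>i j. of_bool (i = j) - 2 / ip n u u * u i * u j)"

lemma mv_reflection:
  assumes "i < n"
  shows "mv n (reflection n u) x i = x i - 2 / ip n u u * ip n u x * u i"
proof -
  have "mv n (reflection n u) x i = x i - (\<Sum>j<n. 2 / ip n u u * (u i * (u j * x j)))"
    using assms
    by (simp add: mv_def reflection_def left_diff_distrib sum_subtractf sum_of_bool_mult mult.assoc)
  also have "\<dots> = x i - 2 / ip n u u * ip n u x * u i"
    unfolding sum_distrib_left[symmetric] by (simp add: ip_def)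
  finally show ?thesis .
qed

lemma orthm_reflection: "orthm n (reflection n u)"
  unfolding orthm_def
proof (intro allI impI)
  fix i j assume ij: "i < n" "j < n"
  define c where "c = 2 / ip n u u"
  have c: "c * c * ip n u u = 2 * c"
    by (cases "ip n u u = 0") (simp_all add: c_def field_simps)
  have "(\<Sum>k<n. reflection n u k i * reflection n u k j) =
    (\<Sum>k<n. of_bool (k = i) * of_bool (k = j)) - (\<Sum>k<n. of_bool (k = i) * (c * u k * u j))
    - (\<Sum>k<n. of_bool (k = j) * (c * u k * u i)) + c * c * ip n u u * u i * u j"
    unfolding reflection_def ip_def c_def[symmetric, unfolded ip_def]
      sum_distrib_left sum_distrib_right sum_subtractf[symmetric] sum.distrib[symmetric]
    by (intro sum.cong refl) (simp add: algebra_simps of_bool_def)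
  also have "\<dots> = of_bool (i = j)"
    using ij by (simp add: sum_of_bool_mult c)
  finally show "(\<Sum>k<n. reflection n u k i * reflection n u k j) = of_bool (i = j)" .
qed

text \<open>The reflecting vector is y - |y| e_k. It inherits the zeros of \<open>y\<close> before
  \<open>k\<close>, so the reflection leaves the first \<open>k\<close> coordinates of every vector
  alone; this is what lets successive reflections be composed.\<close>

lemma reflection_to_axis:
  assumes k: "k < n" and supp: "\<And>i. i < n \<Longrightarrow> i < k \<Longrightarrow> y i = 0"
  obtains u where "\<And>i. i < k \<Longrightarrow> u i = 0"
    "\<And>i. i < n \<Longrightarrow> mv n (reflection n u) y i = (if i = k then sqrt (ip n y y) else 0)"
proof -
  define r where "r = sqrt (ip n y y)"
  define u where "u = (\<lambda>i. if i < k then 0 else y i - r * of_bool (i = k))"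
  have uy: "u i = y i - r * of_bool (i = k)" if "i < n" for i
    using supp[OF that] by (auto simp: u_def)
  have r2: "r * r = ip n y y" by (simp add: r_def)
  have e: "ip n x (\<lambda>i. r * of_bool (i = k)) = r * x k" for x
    using k by (simp add: ip_def sum_of_bool_mult flip: mult.assoc)
  have e': "ip n (\<lambda>i. r * of_bool (i = k)) x = r * x k" for x
    by (subst ip_commute) (rule e)
  have uu: "ip n u u = 2 * (r * r - r * y k)"
  proof -
    have "ip n u u = ip n (\<lambda>i. y i - r * of_bool (i = k)) (\<lambda>i. y i - r * of_bool (i = k))"
      by (intro ip_cong) (auto simp: uy)
    also have "\<dots> = 2 * (r * r - r * y k)"
      by (simp add: ip_diff ip_diff_left e e' r2[symmetric])
    finally show ?thesis .
  qed
  have uyy: "ip n u y = r * r - r * y k"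
  proof -
    have "ip n u y = ip n (\<lambda>i. y i - r * of_bool (i = k)) y"
      by (intro ip_cong) (auto simp: uy)
    also have "\<dots> = r * r - r * y k"
      by (simp add: ip_diff ip_diff_left e e' r2[symmetric])
    finally show ?thesis .
  qed
  show thesis
  proof
    show "u i = 0" if "i < k" for i using that by (simp add: u_def)
    show "mv n (reflection n u) y i = (if i = k then sqrt (ip n y y) else 0)" if i: "i < n" for i
    proof (cases "ip n u u = 0")
      case True
      then have "u i = 0" using i by (simp add: ip_self_eq_0)
      with i show ?thesis by (auto simp: mv_reflection uy r_def)
    next
      case False
      \<comment> \<open>Since |y| = r, the squared norm of u = y - r e_k is twice its inner product
        with y.\<close>
      then have "2 / ip n u u * ip n u y = 1" unfolding uyy uu by (simp add: field_simps)
      with i show ?thesis by (auto simp: mv_reflection uy r_def)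
    qed
  qed
qed

text \<open>Householder's QR factorization. It takes the place of orthogonal projections: after the
  rotation \<open>t\<close> the span of the \<open>w l\<close>, dependent or not, lies in the first
  \<open>d\<close> coordinates, while a standard Gaussian vector keeps its law.\<close>

lemma triangularization:
  assumes "d \<le> n"
  obtains t where "orthm n t" "\<And>l i. l < d \<Longrightarrow> l < i \<Longrightarrow> i < n \<Longrightarrow> mv n t (w l) i = 0"
proof -
  have "\<exists>t. orthm n t \<and> (\<forall>l<d. \<forall>i<n. l < i \<longrightarrow> mv n t (w l) i = 0)"
    using assms
  proof (induction d)
    case 0
    have "orthm n (\<lambda>i j. of_bool (i = j))"
      by (simp add: orthm_def sum_of_bool_mult)
    thus ?case by auto
  next
    case (Suc d)
    then obtain t where t: "orthm n t" "\<And>l i. l < d \<Longrightarrow> l < i \<Longrightarrow> i < n \<Longrightarrow> mv n t (w l) i = 0"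
      by auto
    \<comment> \<open>Only the entries from \<open>d\<close> on may be rotated, or the zeros below
      the diagonal of the earlier vectors would be lost.\<close>
    define y where "y = (\<lambda>i. if i < d then 0 else mv n t (w d) i)"
    obtain u where u: "\<And>i. i < d \<Longrightarrow> u i = 0"
      "\<And>i. i < n \<Longrightarrow> mv n (reflection n u) y i = (if i = d then sqrt (ip n y y) else 0)"
      using reflection_to_axis[of d n y] Suc.prems by (auto simp: y_def)
    define s where "s = (\<lambda>i j. \<Sum>k<n. reflection n u i k * t k j)"
    have s: "mv n s x = mv n (reflection n u) (mv n t x)" for x
      by (simp add: s_def mv_mv)
    have "mv n s (w l) i = 0" if "l < Suc d" "i < n" "l < i" for l i
    proof (cases "l = d")
      case True
      have "ip n u (mv n t (w d)) = ip n u y"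
        unfolding ip_def by (intro sum.cong) (auto simp: y_def u(1))
      hence "mv n s (w l) i = mv n (reflection n u) y i"
        using that True by (simp add: s mv_reflection) (simp add: y_def)
      thus ?thesis using u(2)[of i] that True by simp
    next
      case False
      have "ip n u (mv n t (w l)) = 0"
        unfolding ip_def
      proof (intro sum.neutral ballI)
        fix j assume "j \<in> {..<n}"
        thus "u j * mv n t (w l) j = 0"
          using u(1)[of j] t(2)[of l j] that False by (cases "j < d") auto
      qed
      thus ?thesis using that False t(2)[of l i] by (simp add: s mv_reflection)
    qed
    moreover have "orthm n s" unfolding s_def by (intro orthm_compose orthm_reflection t)
    ultimately show ?case by blast
  qed
  with that show thesis by blast
qed

section \<open>Spectral theorem for real symmetric matrices\<close>

lemma symmetric_eigenvector:
  fixes a :: "nat \<Rightarrow> nat \<Rightarrow> real"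
  assumes sym: "\<And>i j. i < p \<Longrightarrow> j < p \<Longrightarrow> a i j = a j i" and p: "0 < p"
  obtains v \<mu> where "ip p v v = 1" "\<And>i. i < p \<Longrightarrow> mv p a v i = \<mu> * v i"
proof -
  define A where "A = Matrix.mat p p (\<lambda>(i, j). complex_of_real (a i j))"
  have A: "A \<in> carrier_mat p p" by (simp add: A_def)
  obtain \<mu> where "\<mu> \<in> spectrum A" using spectrum_non_empty[OF A p] by auto
  then obtain z where z: "z \<in> carrier_vec p" "z \<noteq> 0\<^sub>v p" "A *\<^sub>v z = \<mu> \<cdot>\<^sub>v z"
    using A by (auto simp: spectrum_def eigenvalue_def eigenvector_def)
  have ev: "(\<Sum>j<p. of_real (a i j) * z $ j) = \<mu> * z $ i" if "i < p" for i
  proof -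
    have "(A *\<^sub>v z) $ i = (\<mu> \<cdot>\<^sub>v z) $ i" by (simp add: z)
    thus ?thesis using that z(1) by (simp add: A_def scalar_prod_def atLeast0LessThan)
  qed
  \<comment> \<open>For a real symmetric matrix the Hermitian form \<open>q\<close> is its own
    conjugate; as it equals the eigenvalue times the positive number \<open>N\<close>, the
    eigenvalue is real. Then the real and imaginary parts of the eigenvector satisfy the same
    equation, and one of them is nonzero.\<close>
  define q where "q = (\<Sum>i<p. \<Sum>j<p. cnj (z $ i) * of_real (a i j) * z $ j)"
  define N where "N = (\<Sum>i<p. (cmod (z $ i))\<^sup>2)"
  have qN: "q = \<mu> * of_real N"
  proof -
    have "q = (\<Sum>i<p. cnj (z $ i) * (\<mu> * z $ i))"
      unfolding q_def by (simp add: ev[symmetric] sum_distrib_left mult.assoc)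
    thus ?thesis
      by (simp add: N_def sum_distrib_left complex_norm_square mult_ac del: of_real_power)
  qed
  have "cnj q = (\<Sum>i<p. \<Sum>j<p. z $ i * of_real (a i j) * cnj (z $ j))"
    by (simp add: q_def)
  also have "\<dots> = (\<Sum>j<p. \<Sum>i<p. z $ i * of_real (a i j) * cnj (z $ j))"
    by (rule sum.swap)
  also have "\<dots> = q"
    unfolding q_def using sym by (intro sum.cong) auto
  finally have "q \<in> \<real>" by (simp add: complex_is_Real_iff complex_eq_iff)
  moreover have "N > 0"
  proof -
    obtain i where "i < p" "z $ i \<noteq> 0" using z(1,2) by (metis carrier_vecD eq_vecI index_zero_vec)
    thus ?thesis unfolding N_def by (intro sum_pos2[of _ i]) auto
  qed
  ultimately have "\<mu> \<in> \<real>"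
    using qN Reals_divide[of q "of_real N"] by simp
  then obtain m where m: "\<mu> = of_real m" by (auto elim: Reals_cases)
  have re: "mv p a (\<lambda>j. Re (z $ j)) i = m * Re (z $ i)"
    and im: "mv p a (\<lambda>j. Im (z $ j)) i = m * Im (z $ i)" if "i < p" for i
    using arg_cong[OF ev[OF that], of Re] arg_cong[OF ev[OF that], of Im] by (simp_all add: mv_def m)
  obtain w where w: "ip p w w \<noteq> 0" "\<And>i. i < p \<Longrightarrow> mv p a w i = m * w i"
  proof (cases "ip p (\<lambda>j. Re (z $ j)) (\<lambda>j. Re (z $ j)) = 0")
    case False
    thus ?thesis using that re by blast
  next
    case True
    obtain i where "i < p" "z $ i \<noteq> 0" using z(1,2) by (metis carrier_vecD eq_vecI index_zero_vec)
    hence "ip p (\<lambda>j. Im (z $ j)) (\<lambda>j. Im (z $ j)) \<noteq> 0"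
      using True unfolding ip_self_eq_0 by (auto simp: complex_eq_iff)
    thus ?thesis using that im by blast
  qed
  define c where "c = 1 / sqrt (ip p w w)"
  have "ip p w w > 0" using w(1) ip_nonneg[of p w] by linarith
  show thesis
  proof
    show "ip p (\<lambda>i. c * w i) (\<lambda>i. c * w i) = 1"
      using \<open>ip p w w > 0\<close> unfolding ip_scale ip_scale_left by (simp add: c_def)
    show "mv p a (\<lambda>i. c * w i) i = m * (c * w i)" if "i < p" for i
      using w(2)[OF that] by (simp add: mv_scale)
  qed
qed

text \<open>Deflation: in an orthonormal basis that contains one eigenvector a symmetric matrix is
  block diagonal, and the induction hypothesis diagonalizes the block.\<close>

theorem spectral_theorem:
  fixes a :: "nat \<Rightarrow> nat \<Rightarrow> real"
  assumes "\<And>i j. i < p \<Longrightarrow> j < p \<Longrightarrow> a i j = a j i"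
  obtains q \<mu> where "orthm p q"
    "\<And>k i. k < p \<Longrightarrow> i < p \<Longrightarrow> mv p a (\<lambda>i. q i k) i = \<mu> k * q i k"
proof -
  have "\<exists>q \<mu>. orthm p q \<and> (\<forall>k<p. \<forall>i<p. mv p a (\<lambda>i. q i k) i = \<mu> k * q i k)"
    using assms
  proof (induction p arbitrary: a)
    case 0
    show ?case by (simp add: orthm_def)
  next
    case (Suc p)
    let ?n = "Suc p"
    obtain v m where v: "ip ?n v v = 1" "\<And>i. i < ?n \<Longrightarrow> mv ?n a v i = m * v i"
      using symmetric_eigenvector[of ?n a] Suc.prems by auto
    obtain t0 where t0: "orthm ?n t0" "\<And>i. 0 < i \<Longrightarrow> i < ?n \<Longrightarrow> mv ?n t0 v i = 0"
      using triangularization[of 1 ?n "\<lambda>_. v"] by (metis One_nat_def Suc_le_mono le0 lessI)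
    \<comment> \<open>\<open>triangularization\<close> turns the eigenvector onto axis 0. A cyclic
      renumbering makes this axis \<open>p\<close>, so that the remaining block is indexed by
      \<open>{..<p}\<close>; \<open>?s\<close> is the inverse of the renumbering.\<close>
    let ?s = "\<lambda>i. if i = 0 then p else i - 1"
    define t where "t = (\<lambda>i. t0 (if i = p then 0 else Suc i))"
    have bij: "bij_betw (\<lambda>i. if i = p then 0 else Suc i) {..<?n} {..<?n}"
      by (rule bij_betw_byWitness[where f' = ?s]) auto
    have t: "orthm ?n t"
      unfolding orthm_def
    proof (intro allI impI)
      fix i j assume ij: "i < ?n" "j < ?n"
      show "(\<Sum>k<?n. t k i * t k j) = of_bool (i = j)"
        using t0(1) ij sum.reindex_bij_betw[OF bij, of "\<lambda>k. t0 k i * t0 k j"]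
        by (simp add: orthm_def t_def)
    qed
    have tv: "mv ?n t v i = 0" if "i < p" for i
      using t0(2)[of "Suc i"] that by (simp add: t_def mv_def)
    define r where "r = mv ?n t v p"
    have r: "r\<^sup>2 = 1"
    proof -
      have "ip ?n (mv ?n t v) (mv ?n t v) = 1" by (simp add: orthm_ip[OF t] v)
      thus ?thesis by (simp add: ip_def tv r_def power2_eq_square)
    qed
    have vt: "v i = r * t p i" if "i < ?n" for i
    proof -
      have "v i = mv ?n (\<lambda>i j. t j i) (mv ?n t v) i" using orthm_mv_transpose[OF t that] by simp
      also have "\<dots> = r * t p i" by (simp add: mv_def[of _ "\<lambda>i j. t j i"] tv r_def)
      finally show ?thesis .
    qed
    have rtv: "t p i = r * v i" if "i < ?n" for i
      using vt[OF that] r by (simp add: power2_eq_square flip: mult.assoc)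
    have tp: "mv ?n a (t p) i = m * t p i" if "i < ?n" for i
    proof -
      have "mv ?n a (t p) i = mv ?n a (\<lambda>i. r * v i) i" by (rule fun_cong[OF mv_cong]) (simp add: rtv)
      thus ?thesis using v(2)[OF that] that by (simp add: mv_scale rtv)
    qed
    \<comment> \<open>The matrix in the rotated basis: row and column \<open>p\<close> vanish off
      the diagonal because \<open>t p\<close> is an eigenvector.\<close>
    define b where "b = (\<lambda>i j. ip ?n (t i) (mv ?n a (t j)))"
    have mva: "ip ?n x (mv ?n a y) = ip ?n (mv ?n a x) y" for x y
    proof -
      have "ip ?n x (mv ?n a y) = ip ?n (mv ?n (\<lambda>i j. a j i) x) y" by (rule ip_mv)
      also have "\<dots> = ip ?n (mv ?n a x) y" by (intro ip_cong refl) (simp only: mv_def, rule sum.cong, use Suc.prems in auto)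
      finally show ?thesis .
    qed
    have bsym: "b i j = b j i" for i j
      unfolding b_def by (subst mva) (rule ip_commute)
    have bp: "b p j = 0" if "j < p" for j
    proof -
      have "b p j = ip ?n (\<lambda>i. m * t p i) (t j)"
        unfolding b_def mva by (intro ip_cong) (auto simp: tp)
      also have "\<dots> = 0" unfolding ip_scale_left
        using orthm_rows[OF t, of p j] that by (simp add: ip_def)
      finally show ?thesis .
    qed
    obtain q0 \<mu>0 where q0: "orthm p q0"
      "\<And>k i. k < p \<Longrightarrow> i < p \<Longrightarrow> mv p b (\<lambda>i. q0 i k) i = \<mu>0 k * q0 i k"
      using Suc.IH[of b] bsym by blast
    \<comment> \<open>The diagonalizing matrix of the block, bordered by a 1 for the eigenvector
      already found.\<close>
    define e where "e = (\<lambda>i k. if i = p \<or> k = p then of_bool (i = k) else q0 i k)"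
    have e: "orthm ?n e"
      using q0(1) by (auto simp: orthm_def e_def less_Suc_eq cong: sum.cong_simp)
    have ort: "orthm ?n (\<lambda>i j. \<Sum>k<?n. t k i * e k j)"
      by (rule orthm_compose[OF orthm_transpose[OF t] e])
    have eq: "(\<lambda>i. \<Sum>k<?n. t k i * e k l) = mv ?n (\<lambda>i j. t j i) (\<lambda>k. e k l)" for l
      by (simp add: mv_def)
    define M where "M = (\<lambda>k. if k = p then m else \<mu>0 k)"
    have "mv ?n a (\<lambda>i. \<Sum>k<?n. t k i * e k l) i = M l * (\<Sum>k<?n. t k i * e k l)"
      if l: "l < ?n" and i: "i < ?n" for l i
    proof -
      let ?y = "\<lambda>i. \<Sum>k<?n. t k i * e k l"
      have "mv ?n t (mv ?n a ?y) k = M l * e k l" if k: "k < ?n" for k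
      proof -
        have "mv ?n t (mv ?n a ?y) k = ip ?n (mv ?n a (t k)) ?y"
          by (simp add: mv_def[of _ t] flip: ip_def mva)
        also have "\<dots> = (\<Sum>i<?n. \<Sum>c<?n. mv ?n a (t k) i * t c i * e c l)"
          by (simp only: ip_def sum_distrib_left mult.assoc)
        also have "\<dots> = (\<Sum>c<?n. \<Sum>i<?n. mv ?n a (t k) i * t c i * e c l)"
          by (rule sum.swap)
        also have "\<dots> = (\<Sum>c<?n. b k c * e c l)"
          by (simp only: b_def mva) (simp only: ip_def sum_distrib_right)
        also have "\<dots> = M l * e k l"
        proof (cases "k = p \<or> l = p")
          case True
          have "b p p = m"
          proof -
            have "b p p = ip ?n (t p) (\<lambda>i. m * t p i)"
              unfolding b_def by (intro ip_cong) (auto simp: tp)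
            also have "\<dots> = m" unfolding ip_scale using orthm_rows[OF t, of p p] by (simp add: ip_def)
            finally show ?thesis .
          qed
          thus ?thesis using True l k bp bsym by (auto simp: e_def M_def less_Suc_eq)
        next
          case False
          with l k have "l < p" "k < p" by auto
          thus ?thesis using q0(2)[of l k] False by (simp add: e_def M_def mv_def)
        qed
        finally show ?thesis .
      qed
      hence "mv ?n (\<lambda>i j. t j i) (mv ?n t (mv ?n a ?y)) i =
        mv ?n (\<lambda>i j. t j i) (\<lambda>k. M l * e k l) i"
        by (intro fun_cong[OF mv_cong]) auto
      thus ?thesis
        using orthm_mv_transpose[OF t i, of "mv ?n a ?y"] by (simp only: mv_scale) (simp only: mv_def)
    qed
    with ort show ?case by blast
  qed
  with that show thesis by blast
qed

section \<open>Positive definite quadratic forms, square root and inverse\<close>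

definition qf :: "nat \<Rightarrow> real mat \<Rightarrow> (nat \<Rightarrow> real) \<Rightarrow> (nat \<Rightarrow> real) \<Rightarrow> real" where
  "qf p C x y = ip p x (mv p (\<lambda>i j. C $$ (i, j)) y)"

lemma qf_sum: "qf p C x y = (\<Sum>i<p. \<Sum>j<p. x i * C $$ (i, j) * y j)"
  by (simp add: qf_def ip_def mv_def sum_distrib_left mult.assoc)

lemma qf_linear:
  "qf p C x (\<lambda>i. y i + z i) = qf p C x y + qf p C x z"
  "qf p C x (\<lambda>i. y i - z i) = qf p C x y - qf p C x z"
  "qf p C x (\<lambda>i. c * y i) = c * qf p C x y"
  "qf p C (\<lambda>i. y i + z i) x = qf p C y x + qf p C z x"
  "qf p C (\<lambda>i. y i - z i) x = qf p C y x - qf p C z x"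
  "qf p C (\<lambda>i. c * y i) x = c * qf p C y x"
  by (simp_all add: qf_sum algebra_simps sum.distrib sum_subtractf sum_distrib_left)

lemma qf_cong: "(\<And>i. i < p \<Longrightarrow> x i = x' i) \<Longrightarrow> (\<And>i. i < p \<Longrightarrow> y i = y' i) \<Longrightarrow> qf p C x y = qf p C x' y'"
  by (simp add: qf_sum)

lemma scalar_prod_self_ge_0: "0 \<le> scalar_prod v (v :: real Matrix.vec)"
  by (simp add: scalar_prod_def sum_nonneg)

lemma scalar_prod_mult_mat_vec:
  assumes "C \<in> carrier_mat p p" "v \<in> carrier_vec p" "w \<in> carrier_vec p"
  shows "scalar_prod v (C *\<^sub>v w) = qf p C (vec_index v) (vec_index w)"
  using assms by (simp add: scalar_prod_def qf_def ip_def mv_def atLeast0LessThan)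

context
  fixes p :: nat and C :: "real mat"
  assumes C: "pos_def p C"
begin

lemma pos_def_carrier: "C \<in> carrier_mat p p"
  using C by (simp add: pos_def_def)

lemma pos_def_sym: "i < p \<Longrightarrow> j < p \<Longrightarrow> C $$ (i, j) = C $$ (j, i)"
proof -
  assume ij: "i < p" "j < p"
  have "transpose_mat C $$ (i, j) = C $$ (i, j)" using C by (simp add: pos_def_def)
  thus ?thesis using ij pos_def_carrier by simp
qed

lemma qf_commute: "qf p C x y = qf p C y x"
  unfolding qf_sum by (subst sum.swap) (auto intro!: sum.cong simp: pos_def_sym)

lemma qf_pos: "(\<exists>i<p. x i \<noteq> 0) \<Longrightarrow> 0 < qf p C x x"
proof -
  assume "\<exists>i<p. x i \<noteq> 0"
  hence "Matrix.vec p x \<noteq> 0\<^sub>v p" by (metis index_vec index_zero_vec(1))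
  hence "0 < scalar_prod (Matrix.vec p x) (C *\<^sub>v Matrix.vec p x)"
    using C by (simp add: pos_def_def)
  also have "\<dots> = qf p C x x"
    by (subst scalar_prod_mult_mat_vec) (auto simp: pos_def_carrier intro!: qf_cong)
  finally show ?thesis .
qed

lemma qf_nonneg: "0 \<le> qf p C x x"
proof (cases "\<exists>i<p. x i \<noteq> 0")
  case False
  thus ?thesis by (simp add: qf_sum)
qed (use qf_pos in force)

lemma eigenvalue_in_spectrum:
  assumes "\<And>i. i < p \<Longrightarrow> mv p (\<lambda>i j. C $$ (i, j)) v i = \<mu> * v i" "\<exists>i<p. v i \<noteq> 0"
  shows "\<mu> \<in> spectrum C"
proof -
  have "C *\<^sub>v Matrix.vec p v = \<mu> \<cdot>\<^sub>v Matrix.vec p v"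
    using assms(1) pos_def_carrier by (intro eq_vecI) (auto simp: mv_def scalar_prod_def atLeast0LessThan)
  moreover have "Matrix.vec p v \<noteq> 0\<^sub>v p"
    using assms(2) by (metis index_vec index_zero_vec(1))
  ultimately show ?thesis
    using pos_def_carrier by (auto simp: spectrum_def eigenvalue_def eigenvector_def intro!: exI[of _ "Matrix.vec p v"])
qed

lemma pos_def_spectral:
  obtains q \<mu> where "orthm p q" "\<And>k. k < p \<Longrightarrow> 0 < \<mu> k" "\<And>k. k < p \<Longrightarrow> \<mu> k \<in> spectrum C"
    "\<And>i j. i < p \<Longrightarrow> j < p \<Longrightarrow> C $$ (i, j) = (\<Sum>k<p. \<mu> k * q i k * q j k)"
proof -
  obtain q \<mu> where q: "orthm p q"
    "\<And>k i. k < p \<Longrightarrow> i < p \<Longrightarrow> mv p (\<lambda>i j. C $$ (i, j)) (\<lambda>i. q i k) i = \<mu> k * q i k"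
    using spectral_theorem[of p "\<lambda>i j. C $$ (i, j)"] pos_def_sym by metis
  have qq: "ip p (\<lambda>i. q i k) (\<lambda>i. q i k) = 1" if "k < p" for k
    using q(1) that by (simp add: orthm_def ip_def)
  have nz: "\<exists>i<p. q i k \<noteq> 0" if "k < p" for k
    using qq[OF that] by (metis ip_self_eq_0 zero_neq_one)
  have pos: "0 < \<mu> k" if "k < p" for k
  proof -
    have "qf p C (\<lambda>i. q i k) (\<lambda>i. q i k) = ip p (\<lambda>i. q i k) (\<lambda>i. \<mu> k * q i k)"
      unfolding qf_def by (intro ip_cong) (auto simp: q(2)[OF that])
    also have "\<dots> = \<mu> k" by (simp add: ip_scale qq[OF that])
    finally show ?thesis using qf_pos[OF nz[OF that]] by simp
  qed
  have "C $$ (i, j) = (\<Sum>k<p. \<mu> k * q i k * q j k)" if ij: "i < p" "j < p" for i j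
  proof -
    have "(\<Sum>k<p. \<mu> k * q i k * q j k) = (\<Sum>k<p. \<Sum>l<p. C $$ (i, l) * q l k * q j k)"
      using q(2) ij by (auto simp: mv_def sum_distrib_right[symmetric] intro!: sum.cong)
    also have "\<dots> = (\<Sum>l<p. C $$ (i, l) * (\<Sum>k<p. q l k * q j k))"
      by (subst sum.swap) (simp add: sum_distrib_left mult.assoc)
    also have "\<dots> = C $$ (i, j)"
      using ij by (simp add: orthm_rows[OF q(1)] sum_of_bool_mult)
    finally show ?thesis ..
  qed
  thus thesis using that q(1) pos eigenvalue_in_spectrum[OF q(2) nz] by blast
qed

lemma finite_spectrum_pos_def: "finite (spectrum C)"
  using card_finite_spectrum[OF pos_def_carrier] by simp

text \<open>In coordinates with respect to an orthonormal eigenbasis the form is a sum of squares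
  weighted by eigenvalues. The constant of the residual bound depends on \<open>C\<close> only
  through these two extremes.\<close>

lemma qf_spectral_bounds:
  assumes "0 < p"
  shows "0 < Min (spectrum C)" "Min (spectrum C) * ip p x x \<le> qf p C x x"
    "qf p C x x \<le> Max (spectrum C) * ip p x x"
proof -
  obtain q \<mu> where q: "orthm p q" "\<And>k. k < p \<Longrightarrow> 0 < \<mu> k" "\<And>k. k < p \<Longrightarrow> \<mu> k \<in> spectrum C"
    "\<And>i j. i < p \<Longrightarrow> j < p \<Longrightarrow> C $$ (i, j) = (\<Sum>k<p. \<mu> k * q i k * q j k)"
    using pos_def_spectral by blast
  have fin: "finite (spectrum C)" by (rule finite_spectrum_pos_def)
  have ne: "spectrum C \<noteq> {}" using q(3)[OF assms] by blast
  have "0 < \<mu>'" if "\<mu>' \<in> spectrum C" for \<mu>'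
  proof -
    obtain v where v: "v \<in> carrier_vec p" "v \<noteq> 0\<^sub>v p" "C *\<^sub>v v = \<mu>' \<cdot>\<^sub>v v"
      using \<open>\<mu>' \<in> spectrum C\<close> pos_def_carrier by (auto simp: spectrum_def eigenvalue_def eigenvector_def)
    have "0 < scalar_prod v (C *\<^sub>v v)" using C v(1,2) by (simp add: pos_def_def)
    also have "\<dots> = \<mu>' * scalar_prod v v" using v by simp
    finally show ?thesis
      using scalar_prod_self_ge_0[of v] by (simp add: zero_less_mult_iff)
  qed
  thus "0 < Min (spectrum C)" using fin ne by simp
  define z where "z = mv p (\<lambda>i j. q j i) x"
  have qf: "qf p C x x = (\<Sum>k<p. \<mu> k * (z k)\<^sup>2)"
  proof -
    have "qf p C x x = (\<Sum>i<p. \<Sum>j<p. \<Sum>k<p. \<mu> k * (q i k * x i) * (q j k * x j))"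
      unfolding qf_sum using q(4)
      by (intro sum.cong refl) (simp add: sum_distrib_left sum_distrib_right mult_ac)
    also have "\<dots> = (\<Sum>i<p. \<Sum>k<p. \<Sum>j<p. \<mu> k * (q i k * x i) * (q j k * x j))"
      by (intro sum.cong refl sum.swap)
    also have "\<dots> = (\<Sum>k<p. \<Sum>i<p. \<Sum>j<p. \<mu> k * (q i k * x i) * (q j k * x j))"
      by (rule sum.swap)
    also have "\<dots> = (\<Sum>k<p. \<mu> k * (z k)\<^sup>2)"
      by (simp add: z_def mv_def power2_eq_square sum_distrib_left sum_distrib_right mult_ac)
    finally show ?thesis .
  qed
  have xx: "ip p x x = (\<Sum>k<p. (z k)\<^sup>2)"
    using orthm_ip[OF orthm_transpose[OF q(1)], of x x] by (simp add: z_def ip_self)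
  show "Min (spectrum C) * ip p x x \<le> qf p C x x"
    unfolding qf xx sum_distrib_left by (intro sum_mono mult_right_mono Min_le fin q) auto
  show "qf p C x x \<le> Max (spectrum C) * ip p x x"
    unfolding qf xx sum_distrib_left by (intro sum_mono mult_right_mono Max_ge fin q) auto
qed

end

lemma pos_def_sqrt_exists:
  assumes C: "pos_def p C"
  shows "\<exists>!B. pos_def p B \<and> B * B = C"
proof -
  obtain q \<mu> where q: "orthm p q" "\<And>k. k < p \<Longrightarrow> 0 < \<mu> k"
    "\<And>i j. i < p \<Longrightarrow> j < p \<Longrightarrow> C $$ (i, j) = (\<Sum>k<p. \<mu> k * q i k * q j k)"
    using pos_def_spectral[OF C] by metis
  define B where "B = Matrix.mat p p (\<lambda>(i, j). \<Sum>k<p. sqrt (\<mu> k) * q i k * q j k)"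
  have "B * B = C"
  proof (rule eq_matI)
    fix i j assume "i < dim_row C" "j < dim_col C"
    hence ij: "i < p" "j < p" using pos_def_carrier[OF C] by auto
    have "(B * B) $$ (i, j) =
      (\<Sum>m<p. \<Sum>k<p. \<Sum>l<p. sqrt (\<mu> k) * q i k * q m k * (sqrt (\<mu> l) * q m l * q j l))"
      using ij by (simp add: B_def scalar_prod_def atLeast0LessThan sum_product)
    also have "\<dots> = (\<Sum>k<p. \<Sum>m<p. \<Sum>l<p. sqrt (\<mu> k) * q i k * q m k * (sqrt (\<mu> l) * q m l * q j l))"
      by (rule sum.swap)
    also have "\<dots> = (\<Sum>k<p. \<Sum>l<p. \<Sum>m<p. sqrt (\<mu> k) * q i k * q m k * (sqrt (\<mu> l) * q m l * q j l))"
      by (intro sum.cong refl sum.swap)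
    also have "\<dots> = (\<Sum>k<p. \<Sum>l<p. sqrt (\<mu> k) * q i k * sqrt (\<mu> l) * q j l * (\<Sum>m<p. q m k * q m l))"
      by (simp add: sum_distrib_left mult_ac)
    also have "\<dots> = (\<Sum>k<p. sqrt (\<mu> k) * q i k * sqrt (\<mu> k) * q j k)"
      using q(1) by (simp add: orthm_def sum_of_bool_mult)
    also have "\<dots> = (\<Sum>k<p. \<mu> k * q i k * q j k)"
    proof (intro sum.cong refl)
      fix k assume "k \<in> {..<p}"
      hence "sqrt (\<mu> k) * sqrt (\<mu> k) = \<mu> k" using q(2)[of k] by simp
      thus "sqrt (\<mu> k) * q i k * sqrt (\<mu> k) * q j k = \<mu> k * q i k * q j k"
        by (metis (no_types, opaque_lifting) mult.assoc mult.commute)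
    qed
    finally show "(B * B) $$ (i, j) = C $$ (i, j)" using q(3) ij by simp
  qed (use pos_def_carrier[OF C] in \<open>auto simp: B_def\<close>)
  moreover have "pos_def p B"
    unfolding pos_def_def
  proof (intro conjI ballI impI)
    fix v :: "real Matrix.vec" assume v: "v \<in> carrier_vec p" "v \<noteq> 0\<^sub>v p"
    define z where "z = mv p (\<lambda>i j. q j i) (vec_index v)"
    have Bc: "B \<in> carrier_mat p p" by (simp add: B_def)
    have "scalar_prod v (B *\<^sub>v v) = (\<Sum>i<p. \<Sum>j<p. \<Sum>k<p. sqrt (\<mu> k) * (q i k * vec_index v i) * (q j k * vec_index v j))"
      unfolding scalar_prod_mult_mat_vec[OF Bc v(1) v(1)] qf_sum
      by (intro sum.cong refl) (simp add: B_def sum_distrib_left sum_distrib_right mult_ac)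
    also have "\<dots> = (\<Sum>i<p. \<Sum>k<p. \<Sum>j<p. sqrt (\<mu> k) * (q i k * vec_index v i) * (q j k * vec_index v j))"
      by (intro sum.cong refl sum.swap)
    also have "\<dots> = (\<Sum>k<p. \<Sum>i<p. \<Sum>j<p. sqrt (\<mu> k) * (q i k * vec_index v i) * (q j k * vec_index v j))"
      by (rule sum.swap)
    also have "\<dots> = (\<Sum>k<p. sqrt (\<mu> k) * (z k)\<^sup>2)"
      by (simp add: z_def mv_def power2_eq_square sum_distrib_left sum_distrib_right mult_ac)
    finally have eq: "scalar_prod v (B *\<^sub>v v) = (\<Sum>k<p. sqrt (\<mu> k) * (z k)\<^sup>2)" .
    have "ip p z z = ip p (vec_index v) (vec_index v)"
      unfolding z_def by (rule orthm_ip[OF orthm_transpose[OF q(1)]])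
    moreover obtain i where "i < p" "vec_index v i \<noteq> 0" using v by (metis carrier_vecD eq_vecI index_zero_vec)
    ultimately obtain k where "k < p" "z k \<noteq> 0" by (metis ip_self_eq_0)
    thus "0 < scalar_prod v (B *\<^sub>v v)" unfolding eq
      using q(2) by (intro sum_pos2[of _ k]) (auto simp: less_imp_le)
  qed (auto simp: B_def mult_ac intro!: eq_matI)
  \<comment> \<open>Uniqueness: if v is an eigenvector of the symmetric difference \<open>E\<close>
    with eigenvalue \<nu>, then 0 = |B1 v|^2 - |B2 v|^2 is \<nu> times the form of B1 + B2 at v, and
    positivity forces \<nu> = 0. A symmetric matrix all of whose eigenvalues are 0 vanishes.\<close>
  moreover have "B1 = B2" if B1: "pos_def p B1" "B1 * B1 = C" and B2: "pos_def p B2" "B2 * B2 = C" for B1 B2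
  proof -
    define E where "E = (\<lambda>i j. B1 $$ (i, j) - B2 $$ (i, j))"
    have sym: "E i j = E j i" if "i < p" "j < p" for i j
      using that by (simp add: E_def pos_def_sym[OF B1(1)] pos_def_sym[OF B2(1)])
    obtain t \<nu> where t: "orthm p t" "\<And>k i. k < p \<Longrightarrow> i < p \<Longrightarrow> mv p E (\<lambda>i. t i k) i = \<nu> k * t i k"
      using spectral_theorem[of p E] sym by metis
    have "\<nu> k = 0" if k: "k < p" for k
    proof -
      let ?v = "\<lambda>i. t i k"
      have nz: "\<exists>i<p. ?v i \<noteq> 0"
        using t(1) k ip_self_eq_0[of p ?v] by (auto simp: orthm_def ip_def)
      have Bsq: "(\<Sum>l<p. B $$ (i, l) * B $$ (l, j)) = C $$ (i, j)"
        if "pos_def p B" "B * B = C" "i < p" "j < p" for B i j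
        using that pos_def_carrier[OF that(1)]
        by (auto simp: scalar_prod_def atLeast0LessThan simp flip: that(2))
      have n: "qf p B1 y y' - qf p B2 y y' = ip p y (mv p E y')" for y y'
        unfolding qf_def E_def by (simp add: ip_def mv_def algebra_simps sum_subtractf)
      have EE: "ip p (mv p E x) y = ip p x (mv p E y)" for x y
        unfolding ip_mv by (intro ip_cong) (auto simp: mv_def sym intro!: sum.cong)
      have sq: "ip p (mv p (\<lambda>i j. B $$ (i, j)) x) (mv p (\<lambda>i j. B $$ (i, j)) y) = qf p C x y"
        if "pos_def p B" "B * B = C" for B x y
      proof -
        have "ip p (mv p (\<lambda>i j. B $$ (i, j)) x) (mv p (\<lambda>i j. B $$ (i, j)) y)
          = ip p (mv p (\<lambda>i j. B $$ (j, i)) (mv p (\<lambda>i j. B $$ (i, j)) x)) y"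
          by (rule ip_mv)
        also have "\<dots> = ip p (mv p (\<lambda>i j. C $$ (i, j)) x) y"
          unfolding mv_mv
        proof (intro ip_cong refl)
          fix i assume i: "i < p"
          have "(\<Sum>k<p. B $$ (k, i) * B $$ (k, j)) = C $$ (i, j)" if j: "j < p" for j
            unfolding Bsq[OF \<open>pos_def p B\<close> \<open>B * B = C\<close> i j, symmetric]
            using i by (intro sum.cong) (auto simp: pos_def_sym[OF \<open>pos_def p B\<close>, of _ i])
          thus "mv p (\<lambda>i j. \<Sum>k<p. B $$ (k, i) * B $$ (k, j)) x i = mv p (\<lambda>i j. C $$ (i, j)) x i"
            by (simp add: mv_def)
        qed
        also have "\<dots> = qf p C x y"
          using qf_commute[OF C] by (simp add: qf_def ip_commute)
        finally show ?thesis .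
      qed
      let ?b1 = "mv p (\<lambda>i j. B1 $$ (i, j)) ?v" and ?b2 = "mv p (\<lambda>i j. B2 $$ (i, j)) ?v"
      have Ev: "mv p E ?v = (\<lambda>i. ?b1 i - ?b2 i)"
        by (simp add: E_def mv_def algebra_simps sum_subtractf)
      have "ip p (mv p E ?v) (\<lambda>i. ?b1 i + ?b2 i) = ip p ?b1 ?b1 - ip p ?b2 ?b2"
        unfolding Ev by (simp add: ip_linear ip_commute)
      also have "\<dots> = 0" by (simp add: sq B1 B2)
      finally have 0: "ip p (mv p E ?v) (\<lambda>i. ?b1 i + ?b2 i) = 0" .
      have "ip p (mv p E ?v) (\<lambda>i. ?b1 i + ?b2 i) = ip p (\<lambda>i. \<nu> k * ?v i) (\<lambda>i. ?b1 i + ?b2 i)"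
        by (intro ip_cong) (auto simp: t(2)[OF k])
      also have "\<dots> = \<nu> k * (qf p B1 ?v ?v + qf p B2 ?v ?v)"
        by (simp add: ip_scale_left ip_add qf_def)
      finally show ?thesis using 0 qf_pos[OF B1(1) nz] qf_pos[OF B2(1) nz] by auto
    qed
    hence t0: "mv p E (\<lambda>i. t i k) i = 0" if "k < p" "i < p" for k i using t(2) that by simp
    have "E i j = 0" if ij: "i < p" "j < p" for i j
    proof -
      have "0 = (\<Sum>k<p. mv p E (\<lambda>i. t i k) i * t j k)" using t0 ij by simp
      also have "\<dots> = (\<Sum>l<p. E i l * (\<Sum>k<p. t l k * t j k))"
        unfolding mv_def sum_distrib_left sum_distrib_right
        by (subst sum.swap) (simp add: mult_ac)
      also have "\<dots> = E i j" using ij by (simp add: orthm_rows[OF t(1)] sum_of_bool_mult)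
      finally show ?thesis by simp
    qed
    thus ?thesis
      using pos_def_carrier[OF B1(1)] pos_def_carrier[OF B2(1)]
      by (intro eq_matI) (auto simp: E_def)
  qed
  ultimately show ?thesis by blast
qed

lemma sqrt_mat:
  assumes "pos_def p C"
  shows "pos_def p (sqrt_mat p C)" "sqrt_mat p C * sqrt_mat p C = C"
  using theI'[OF pos_def_sqrt_exists[OF assms]] by (simp_all add: sqrt_mat_def)

text \<open>By symmetry one square root moves across the scalar product. This is how norms involving
  the square root are turned into \<open>qf\<close>.\<close>

lemma vnorm_sqrt_mat:
  assumes C: "pos_def p C" and u: "u \<in> carrier_vec p"
  shows "(vnorm (sqrt_mat p C *\<^sub>v u))\<^sup>2 = qf p C (vec_index u) (vec_index u)"
proof -
  let ?B = "sqrt_mat p C"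
  have B: "?B \<in> carrier_mat p p" "transpose_mat ?B = ?B"
    using sqrt_mat[OF C] by (simp_all add: pos_def_def)
  have "(vnorm (?B *\<^sub>v u))\<^sup>2 = scalar_prod (?B *\<^sub>v u) (?B *\<^sub>v u)"
    using scalar_prod_self_ge_0[of "?B *\<^sub>v u"] by (simp add: vnorm_def)
  also have "\<dots> = scalar_prod u (transpose_mat ?B *\<^sub>v (?B *\<^sub>v u))"
    using B u by (metis mult_mat_vec_carrier transpose_vec_mult_scalar comm_scalar_prod)
  also have "\<dots> = scalar_prod u (C *\<^sub>v u)"
    using B u sqrt_mat(2)[OF C] by (simp flip: assoc_mult_mat_vec)
  finally show ?thesis using u by (simp add: scalar_prod_mult_mat_vec[OF pos_def_carrier[OF C]])
qed

lemma inv_mat: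
  assumes C: "pos_def p C"
  shows "inv_mat C \<in> carrier_mat p p" "C * inv_mat C = 1\<^sub>m p" "inv_mat C * C = 1\<^sub>m p"
proof -
  have "det C \<noteq> 0"
  proof
    assume "det C = 0"
    then obtain v where "v \<in> carrier_vec p" "v \<noteq> 0\<^sub>v p" "C *\<^sub>v v = 0\<^sub>v p"
      using det_0_iff_vec_prod_zero[OF pos_def_carrier[OF C]] by auto
    thus False using C by (force simp: pos_def_def)
  qed
  hence "C \<in> Units (ring_mat TYPE(real) p b)" for b
    using det_non_zero_imp_unit[OF pos_def_carrier[OF C], where b = b] by blast
  then obtain D where "mat_inverse C = Some D"
    using mat_inverse(1)[OF pos_def_carrier[OF C]] by (metis not_Some_eq)
  thus "inv_mat C \<in> carrier_mat p p" "C * inv_mat C = 1\<^sub>m p" "inv_mat C * C = 1\<^sub>m p"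
    using mat_inverse(2)[OF pos_def_carrier[OF C]] by (auto simp: inv_mat_def)
qed

section \<open>Gaussian measures\<close>

abbreviation lbn :: "nat \<Rightarrow> (nat \<Rightarrow> real) measure" where
  "lbn n \<equiv> \<Pi>\<^sub>M i\<in>{..<n}. lborel"

abbreviation gauss :: "nat \<Rightarrow> (nat \<Rightarrow> real) measure" where
  "gauss n \<equiv> \<Pi>\<^sub>M i\<in>{..<n}. std_normal_distribution"

lemma prob_space_std_normal: "prob_space std_normal_distribution"
  by (rule prob_space_normal_density) simp

lemma product_sigma_finite_lborel: "product_sigma_finite (\<lambda>_. lborel :: real measure)"
  by standard

lemma product_prob_space_normal: "product_prob_space (\<lambda>_. std_normal_distribution)"
  using prob_space_std_normal by (auto intro!: product_prob_spaceI)

lemma prob_space_gauss: "prob_space (gauss n)"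
  by (intro prob_space_PiM prob_space_std_normal)

lemma sets_lbn [measurable_cong]: "sets (lbn n) = sets (\<Pi>\<^sub>M i\<in>{..<n}. borel)"
  by (intro sets_PiM_cong) auto

lemma sets_gauss [measurable_cong]: "sets (gauss n) = sets (\<Pi>\<^sub>M i\<in>{..<n}. borel)"
  by (intro sets_PiM_cong) auto

lemma distr_PiM_componentwise:
  assumes I: "finite I" and M: "product_sigma_finite M"
    and N: "product_sigma_finite N"
    and f [measurable]: "\<And>i. i \<in> I \<Longrightarrow> f i \<in> measurable (M i) (N i)"
    and fN: "\<And>i. i \<in> I \<Longrightarrow> distr (M i) (N i) (f i) = N i"
  shows "distr (PiM I M) (PiM I N) (\<lambda>x. \<lambda>i\<in>I. f i (x i)) = PiM I N"
proof (rule product_sigma_finite.PiM_eqI[OF N I])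
  interpret M: product_sigma_finite M by fact
  have meas [measurable]: "(\<lambda>x. \<lambda>i\<in>I. f i (x i)) \<in> measurable (PiM I M) (PiM I N)"
    by measurable
  fix A assume A: "\<And>i. i \<in> I \<Longrightarrow> A i \<in> sets (N i)"
  have "(\<lambda>x. \<lambda>i\<in>I. f i (x i)) -` PiE I A \<inter> space (PiM I M) = PiE I (\<lambda>i. f i -` A i \<inter> space (M i))"
    by (auto simp: space_PiM PiE_iff)
  hence "emeasure (distr (PiM I M) (PiM I N) (\<lambda>x. \<lambda>i\<in>I. f i (x i))) (PiE I A) =
      emeasure (PiM I M) (PiE I (\<lambda>i. f i -` A i \<inter> space (M i)))"
    using A I by (subst emeasure_distr) (auto intro!: sets_PiM_I_finite)
  also have "\<dots> = (\<Prod>i\<in>I. emeasure (M i) (f i -` A i \<inter> space (M i)))"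
    using A I by (intro M.emeasure_PiM) auto
  also have "\<dots> = (\<Prod>i\<in>I. emeasure (N i) (A i))"
  proof (intro prod.cong refl)
    fix i assume i: "i \<in> I"
    show "emeasure (M i) (f i -` A i \<inter> space (M i)) = emeasure (N i) (A i)"
      using emeasure_distr[OF f[OF i] A[OF i]] by (simp add: fN[OF i])
  qed
  finally show "emeasure (distr (PiM I M) (PiM I N) (\<lambda>x. \<lambda>i\<in>I. f i (x i))) (PiE I A) =
    (\<Prod>i\<in>I. emeasure (N i) (A i))" .
qed simp

lemma nn_integral_lbn_translate:
  assumes f [measurable]: "f \<in> borel_measurable (lbn n)"
  shows "(\<integral>\<^sup>+x. f (\<lambda>i\<in>{..<n}. a i + x i) \<partial>lbn n) = (\<integral>\<^sup>+x. f x \<partial>lbn n)"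
proof -
  have "distr (lbn n) (lbn n) (\<lambda>x. \<lambda>i\<in>{..<n}. a i + x i) = lbn n"
    by (rule distr_PiM_componentwise)
      (auto simp: product_sigma_finite_lborel lborel_distr_plus cong: distr_cong)
  hence "(\<integral>\<^sup>+x. f x \<partial>lbn n) = (\<integral>\<^sup>+x. f x \<partial>distr (lbn n) (lbn n) (\<lambda>x. \<lambda>i\<in>{..<n}. a i + x i))"
    by simp
  also have "\<dots> = (\<integral>\<^sup>+x. f (\<lambda>i\<in>{..<n}. a i + x i) \<partial>lbn n)"
    by (rule nn_integral_distr) measurable
  finally show ?thesis ..
qed

lemma PiM_density:
  assumes I: "finite I" and N: "product_sigma_finite N"
    and D: "product_sigma_finite (\<lambda>i. density (N i) (d i))"
    and d [measurable]: "\<And>i. i \<in> I \<Longrightarrow> d i \<in> borel_measurable (N i)"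
  shows "PiM I (\<lambda>i. density (N i) (d i)) = density (PiM I N) (\<lambda>x. \<Prod>i\<in>I. d i (x i))"
proof (rule product_sigma_finite.PiM_eqI[OF D I, symmetric])
  show "sets (density (PiM I N) (\<lambda>x. \<Prod>i\<in>I. d i (x i))) = sets (PiM I (\<lambda>i. density (N i) (d i)))"
    unfolding sets_density by (intro sets_PiM_cong) auto
  fix A assume "\<And>i. i \<in> I \<Longrightarrow> A i \<in> sets (density (N i) (d i))"
  hence A: "\<And>i. i \<in> I \<Longrightarrow> A i \<in> sets (N i)" by simp
  have [measurable]: "(\<lambda>x. \<Prod>i\<in>I. d i (x i)) \<in> borel_measurable (PiM I N)"
    by measurable
  have "emeasure (density (PiM I N) (\<lambda>x. \<Prod>i\<in>I. d i (x i))) (PiE I A) =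
    (\<integral>\<^sup>+x. (\<Prod>i\<in>I. d i (x i)) * indicator (PiE I A) x \<partial>PiM I N)"
    using A I by (intro emeasure_density) auto
  also have "\<dots> = (\<integral>\<^sup>+x. (\<Prod>i\<in>I. d i (x i) * indicator (A i) (x i)) \<partial>PiM I N)"
  proof (intro nn_integral_cong)
    fix x assume "x \<in> space (PiM I N)"
    hence "indicator (PiE I A) x = (\<Prod>i\<in>I. indicator (A i) (x i) :: ennreal)"
      using I by (auto simp: indicator_def space_PiM PiE_iff prod_zero_iff)
    thus "(\<Prod>i\<in>I. d i (x i)) * indicator (PiE I A) x = (\<Prod>i\<in>I. d i (x i) * indicator (A i) (x i))"
      by (simp add: prod.distrib)
  qed
  also have "\<dots> = (\<Prod>i\<in>I. \<integral>\<^sup>+x. d i x * indicator (A i) x \<partial>N i)"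
    using A I by (intro product_sigma_finite.product_nn_integral_prod[OF N]) auto
  also have "\<dots> = (\<Prod>i\<in>I. emeasure (density (N i) (d i)) (A i))"
    using A by (intro prod.cong refl) (simp add: emeasure_density)
  finally show "emeasure (density (PiM I N) (\<lambda>x. \<Prod>i\<in>I. d i (x i))) (PiE I A) =
    (\<Prod>i\<in>I. emeasure (density (N i) (d i)) (A i))" .
qed

lemma gauss_density: "gauss n = density (lbn n) (\<lambda>x. ennreal (exp (- ip n x x / 2) / sqrt (2 * pi) ^ n))"
proof -
  have "gauss n = density (lbn n) (\<lambda>x. \<Prod>i<n. ennreal (std_normal_density (x i)))"
    using product_prob_space_normal
    by (intro PiM_density product_sigma_finite_lborel) (auto simp: product_prob_space_def)
  also have "\<dots> = density (lbn n) (\<lambda>x. ennreal (exp (- ip n x x / 2) / sqrt (2 * pi) ^ n))"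
  proof (rule arg_cong[of _ _ "density (lbn n)"], rule ext)
    fix x
    have "(\<Prod>i<n. ennreal (std_normal_density (x i))) = ennreal (\<Prod>i<n. std_normal_density (x i))"
      by (rule prod_ennreal) simp
    also have "(\<Prod>i<n. std_normal_density (x i)) = exp (- ip n x x / 2) / sqrt (2 * pi) ^ n"
      by (simp add: std_normal_density_def prod_dividef exp_sum ip_self sum_divide_distrib sum_negf[symmetric])
    finally show "(\<Prod>i<n. ennreal (std_normal_density (x i))) =
      ennreal (exp (- ip n x x / 2) / sqrt (2 * pi) ^ n)" .
  qed
  finally show ?thesis .
qed

lemma measurable_ip [measurable]:
  assumes [measurable]: "\<And>i. i < n \<Longrightarrow> (\<lambda>x. f x i) \<in> borel_measurable M"
    "\<And>i. i < n \<Longrightarrow> (\<lambda>x. g x i) \<in> borel_measurable M"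
  shows "(\<lambda>x. ip n (f x) (g x)) \<in> borel_measurable M"
  unfolding ip_def by measurable

lemma measurable_mv [measurable]:
  assumes [measurable]: "\<And>i. i < n \<Longrightarrow> (\<lambda>x. f x i) \<in> borel_measurable M"
  shows "(\<lambda>x. mv n t (f x) i) \<in> borel_measurable M"
  unfolding mv_def by measurable

text \<open>
  Uniqueness of Haar measure: if \<open>\<mu>\<close> and \<open>\<lambda>\<close> are translation invariant then two applications of
  Fubini to \<open>\<integral>\<integral> f(x) g(y - x)\<close> give \<open>\<mu>(f) \<lambda>(g) = \<lambda>(f) \<mu>(g \<circ> uminus)\<close>. Here \<open>\<mu>\<close> is the image of Lebesgue measure
  under the orthogonal map and \<open>g\<close> is a Gaussian, which that map leaves unchanged.
\<close>

lemma nn_integral_lbn_orthm: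
  assumes t: "orthm n t" and f [measurable]: "f \<in> borel_measurable (lbn n)"
  shows "(\<integral>\<^sup>+x. f (\<lambda>i\<in>{..<n}. mv n t x i) \<partial>lbn n) = (\<integral>\<^sup>+x. f x \<partial>lbn n)"
proof -
  interpret product_sigma_finite "\<lambda>_::nat. lborel :: real measure"
    by (rule product_sigma_finite_lborel)
  interpret L: sigma_finite_measure "lbn n" by (intro sigma_finite) simp
  interpret LL: pair_sigma_finite "lbn n" "lbn n" by standard
  define g :: "(nat \<Rightarrow> real) \<Rightarrow> ennreal" where "g x = ennreal (exp (- ip n x x / 2) / sqrt (2 * pi) ^ n)" for x
  have g [measurable]: "g \<in> borel_measurable (lbn n)"
    unfolding g_def by measurable
  have G: "(\<integral>\<^sup>+x. g x \<partial>lbn n) = 1"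
  proof -
    have "(\<integral>\<^sup>+x. g x \<partial>lbn n) = emeasure (gauss n) (space (gauss n))"
      unfolding gauss_density g_def by (subst emeasure_density) (auto intro!: nn_integral_cong)
    thus ?thesis using prob_space.emeasure_space_1[OF prob_space_gauss] by simp
  qed
  let ?T = "\<lambda>x. \<lambda>i\<in>{..<n}. mv n t x i"
  have "(\<integral>\<^sup>+x. f (?T x) \<partial>lbn n) = (\<integral>\<^sup>+x. f (?T x) * (\<integral>\<^sup>+y. g (\<lambda>i\<in>{..<n}. - mv n t x i + y i) \<partial>lbn n) \<partial>lbn n)"
    by (subst nn_integral_lbn_translate) (auto simp: G)
  also have "\<dots> = (\<integral>\<^sup>+x. \<integral>\<^sup>+y. f (?T x) * g (\<lambda>i\<in>{..<n}. - mv n t x i + y i) \<partial>lbn n \<partial>lbn n)"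
    by (subst nn_integral_cmult) auto
  also have "\<dots> = (\<integral>\<^sup>+y. \<integral>\<^sup>+x. f (?T x) * g (\<lambda>i\<in>{..<n}. - mv n t x i + y i) \<partial>lbn n \<partial>lbn n)"
    by (rule LL.Fubini') measurable
  also have "\<dots> = (\<integral>\<^sup>+y. \<integral>\<^sup>+x. f (\<lambda>i\<in>{..<n}. mv n t x i + y i) * g x \<partial>lbn n \<partial>lbn n)"
  proof (rule nn_integral_cong)
    fix y
    define b where "b = mv n (\<lambda>i j. t j i) y"
    have b: "mv n t b i = y i" if "i < n" for i
      using orthm_transpose_mv[OF t that] by (simp add: b_def)
    have "(\<integral>\<^sup>+x. f (?T x) * g (\<lambda>i\<in>{..<n}. - mv n t x i + y i) \<partial>lbn n) =
      (\<integral>\<^sup>+x. f (?T (\<lambda>i\<in>{..<n}. b i + x i)) *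
        g (\<lambda>i\<in>{..<n}. - mv n t (\<lambda>i\<in>{..<n}. b i + x i) i + y i) \<partial>lbn n)"
      by (rule nn_integral_lbn_translate[symmetric]) measurable
    also have "\<dots> = (\<integral>\<^sup>+x. f (\<lambda>i\<in>{..<n}. mv n t x i + y i) * g x \<partial>lbn n)"
    proof (rule nn_integral_cong)
      fix x
      have eq: "mv n t (\<lambda>i\<in>{..<n}. b i + x i) i = mv n t x i + y i" if "i < n" for i
      proof -
        have "mv n t (\<lambda>i\<in>{..<n}. b i + x i) i = mv n t (\<lambda>i. b i + x i) i"
          by (rule fun_cong[OF mv_cong]) simp
        thus ?thesis by (simp add: mv_add b[OF that])
      qed
      have "f (?T (\<lambda>i\<in>{..<n}. b i + x i)) = f (\<lambda>i\<in>{..<n}. mv n t x i + y i)"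
        by (intro arg_cong[of _ _ f] restrict_ext) (simp add: eq)
      moreover have "ip n (\<lambda>i\<in>{..<n}. - mv n t (\<lambda>i\<in>{..<n}. b i + x i) i + y i)
          (\<lambda>i\<in>{..<n}. - mv n t (\<lambda>i\<in>{..<n}. b i + x i) i + y i)
        = ip n (\<lambda>i. - 1 * mv n t x i) (\<lambda>i. - 1 * mv n t x i)"
        by (intro ip_cong) (auto simp: eq)
      hence "g (\<lambda>i\<in>{..<n}. - mv n t (\<lambda>i\<in>{..<n}. b i + x i) i + y i) = g x"
        unfolding g_def by (simp only: ip_scale ip_scale_left orthm_ip[OF t]) simp
      ultimately show "f (?T (\<lambda>i\<in>{..<n}. b i + x i)) *
        g (\<lambda>i\<in>{..<n}. - mv n t (\<lambda>i\<in>{..<n}. b i + x i) i + y i) =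
        f (\<lambda>i\<in>{..<n}. mv n t x i + y i) * g x" by simp
    qed
    finally show "(\<integral>\<^sup>+x. f (?T x) * g (\<lambda>i\<in>{..<n}. - mv n t x i + y i) \<partial>lbn n) =
      (\<integral>\<^sup>+x. f (\<lambda>i\<in>{..<n}. mv n t x i + y i) * g x \<partial>lbn n)" .
  qed
  also have "\<dots> = (\<integral>\<^sup>+x. \<integral>\<^sup>+y. f (\<lambda>i\<in>{..<n}. mv n t x i + y i) * g x \<partial>lbn n \<partial>lbn n)"
    by (rule LL.Fubini') measurable
  also have "\<dots> = (\<integral>\<^sup>+x. (\<integral>\<^sup>+y. f y \<partial>lbn n) * g x \<partial>lbn n)"
    by (intro nn_integral_cong) (simp add: nn_integral_multc nn_integral_lbn_translate)
  also have "\<dots> = (\<integral>\<^sup>+y. f y \<partial>lbn n)"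
    by (simp add: nn_integral_cmult G)
  finally show ?thesis .
qed

lemma nn_integral_gauss:
  assumes [measurable]: "f \<in> borel_measurable (\<Pi>\<^sub>M i\<in>{..<n}. borel)"
  shows "(\<integral>\<^sup>+x. f x \<partial>gauss n) = (\<integral>\<^sup>+x. ennreal (exp (- ip n x x / 2) / sqrt (2 * pi) ^ n) * f x \<partial>lbn n)"
  unfolding gauss_density by (subst nn_integral_density) auto

lemma nn_integral_gauss_orthm:
  assumes t: "orthm n t" and f [measurable]: "f \<in> borel_measurable (\<Pi>\<^sub>M i\<in>{..<n}. borel)"
  shows "(\<integral>\<^sup>+x. f (\<lambda>i\<in>{..<n}. mv n t x i) \<partial>gauss n) = (\<integral>\<^sup>+x. f x \<partial>gauss n)"
proof -
  let ?g = "\<lambda>x. ennreal (exp (- ip n x x / 2) / sqrt (2 * pi) ^ n)"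
  let ?T = "\<lambda>x. \<lambda>i\<in>{..<n}. mv n t x i"
  have "ip n (?T x) (?T x) = ip n x x" for x
    by (subst (2) orthm_ip[OF t, symmetric]) (auto intro!: ip_cong)
  hence "(\<integral>\<^sup>+x. f (?T x) \<partial>gauss n) = (\<integral>\<^sup>+x. ?g (?T x) * f (?T x) \<partial>lbn n)"
    by (subst nn_integral_gauss) auto
  also have "\<dots> = (\<integral>\<^sup>+x. ?g x * f x \<partial>lbn n)"
    by (rule nn_integral_lbn_orthm[OF t]) measurable
  finally show ?thesis by (simp add: nn_integral_gauss)
qed

lemma distr_gauss_component:
  assumes "i < n"
  shows "distr (gauss n) std_normal_distribution (\<lambda>x. x i) = std_normal_distribution"
  using assms by (intro distr_PiM_component) (auto intro: prob_space_std_normal)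

lemma nn_integral_gauss_component:
  assumes "i < n" and f [measurable]: "f \<in> borel_measurable borel"
  shows "(\<integral>\<^sup>+x. f (x i) \<partial>gauss n) = (\<integral>\<^sup>+z. f z \<partial>std_normal_distribution)"
proof -
  have "(\<integral>\<^sup>+z. f z \<partial>std_normal_distribution) =
    (\<integral>\<^sup>+z. f z \<partial>distr (gauss n) std_normal_distribution (\<lambda>x. x i))"
    by (simp add: distr_gauss_component[OF assms(1)])
  also have "\<dots> = (\<integral>\<^sup>+x. f (x i) \<partial>gauss n)"
    using assms(1) by (intro nn_integral_distr) auto
  finally show ?thesis ..
qed

text \<open>A rotation brings \<open>w\<close> onto axis 0, where it has an entry \<open>c\<close>
  with c^2 = |w|^2. Testing the square makes the sign of \<open>c\<close> immaterial.\<close>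

lemma nn_integral_gauss_linear:
  assumes f [measurable]: "f \<in> borel_measurable borel"
  shows "(\<integral>\<^sup>+x. f ((ip n w x)\<^sup>2) \<partial>gauss n) = (\<integral>\<^sup>+z. f (ip n w w * z\<^sup>2) \<partial>std_normal_distribution)"
proof (cases "n = 0")
  case True
  have "prob_space (gauss n)" "prob_space std_normal_distribution"
    by (rule prob_space_gauss prob_space_std_normal)+
  hence "emeasure (gauss n) (space (gauss n)) = 1"
    "emeasure std_normal_distribution (space std_normal_distribution) = 1"
    by (blast intro: prob_space.emeasure_space_1)+
  thus ?thesis using True by (simp add: ip_def)
next
  case False
  obtain t where t: "orthm n t" "\<And>i. 0 < i \<Longrightarrow> i < n \<Longrightarrow> mv n t w i = 0"
    using triangularization[of 1 n "\<lambda>_. w"] False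
    by (metis One_nat_def Suc_leI lessI neq0_conv)
  define c where "c = mv n t w 0"
  have red: "ip n (mv n t w) y = c * y 0" for y
  proof -
    have "ip n (mv n t w) y = (\<Sum>i<n. if i = 0 then c * y 0 else 0)"
      unfolding ip_def by (intro sum.cong) (auto simp: c_def t(2))
    thus ?thesis using False by simp
  qed
  have c: "ip n w w = c\<^sup>2"
    using red[of "mv n t w"] by (simp add: orthm_ip[OF t(1)] c_def power2_eq_square)
  have "ip n w x = c * mv n t x 0" for x
    using red[of "mv n t x"] by (simp add: orthm_ip[OF t(1)])
  hence "(\<integral>\<^sup>+x. f ((ip n w x)\<^sup>2) \<partial>gauss n) = (\<integral>\<^sup>+x. f ((c * (\<lambda>i\<in>{..<n}. mv n t x i) 0)\<^sup>2) \<partial>gauss n)"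
    using False by simp
  also have "\<dots> = (\<integral>\<^sup>+x. f ((c * x 0)\<^sup>2) \<partial>gauss n)"
    using False by (intro nn_integral_gauss_orthm[OF t(1)]) simp
  also have "\<dots> = (\<integral>\<^sup>+z. f ((c * z)\<^sup>2) \<partial>std_normal_distribution)"
    using False by (intro nn_integral_gauss_component) auto
  finally show ?thesis by (simp add: c power_mult_distrib)
qed

lemma det_gram:
  assumes q: "orthm p q" and s: "\<And>k. k < p \<Longrightarrow> 0 \<le> \<mu> k" and C: "C \<in> carrier_mat p p"
    "\<And>i j. i < p \<Longrightarrow> j < p \<Longrightarrow> C $$ (i, j) = (\<Sum>k<p. \<mu> k * q i k * q j k)"
  shows "Determinant.det C = (\<Prod>k<p. \<mu> k)"
proof -
  define Q where "Q = Matrix.mat p p (\<lambda>(i, j). q i j)"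
  define D where "D = Matrix.mat p p (\<lambda>(i, j). if i = j then \<mu> i else 0)"
  have Q [simp]: "Q \<in> carrier_mat p p" and D [simp]: "D \<in> carrier_mat p p"
    by (simp_all add: Q_def D_def)
  have Q1: "Q * transpose_mat Q = 1\<^sub>m p"
    by (rule eq_matI) (auto simp: Q_def scalar_prod_def atLeast0LessThan orthm_rows[OF q])
  have CD: "C = Q * D * transpose_mat Q"
  proof (rule eq_matI)
    fix i j assume "i < dim_row (Q * D * transpose_mat Q)" "j < dim_col (Q * D * transpose_mat Q)"
    hence ij: "i < p" "j < p" by (auto simp: Q_def)
    have "(\<Sum>l<p. q i l * (if l = k then \<mu> l else 0)) = \<mu> k * q i k" if "k < p" for k
      using that by (simp add: if_distrib[of "\<lambda>x. _ * x"] cong: if_cong)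
    thus "C $$ (i, j) = (Q * D * transpose_mat Q) $$ (i, j)"
      using ij by (simp add: C Q_def D_def scalar_prod_def atLeast0LessThan)
  qed (use C in \<open>auto simp: Q_def D_def\<close>)
  have "Determinant.det C = Determinant.det Q * Determinant.det D * Determinant.det (transpose_mat Q)"
    unfolding CD using det_mult[of "Q * D" p "transpose_mat Q"] det_mult[OF Q D] mult_carrier_mat[OF Q D] Q
    by simp
  also have "\<dots> = Determinant.det (Q * transpose_mat Q) * Determinant.det D"
    using det_mult[OF Q, of "transpose_mat Q"] Q by simp
  also have "\<dots> = Determinant.det D" by (simp add: Q1)
  also have "\<dots> = prod_list (diag_mat D)"
    by (rule det_upper_triangular[OF _ D]) (auto simp: D_def)
  also have "\<dots> = (\<Prod>k<p. \<mu> k)"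
    by (subst prod_list_diag_prod) (auto simp: D_def atLeast0LessThan intro!: prod.cong)
  finally show ?thesis .
qed

lemma nn_integral_lbn_scale:
  assumes s: "\<And>i. i < n \<Longrightarrow> 0 < s i" and f [measurable]: "f \<in> borel_measurable (lbn n)"
  shows "(\<integral>\<^sup>+x. f x \<partial>lbn n) = ennreal (\<Prod>i<n. s i) * (\<integral>\<^sup>+x. f (\<lambda>i\<in>{..<n}. s i * x i) \<partial>lbn n)"
proof -
  \<comment> \<open>Extended by 1, the scale is positive at every index and not only on the
    coordinates of the product.\<close>
  define r where "r = (\<lambda>i. if i < n then s i else 1)"
  have r: "0 < r i" for i using s by (simp add: r_def)
  have dens: "distr lborel (density lborel (\<lambda>_. ennreal (inverse (r i)))) ((*) (r i))
      = density lborel (\<lambda>_. ennreal (inverse (r i)))" for i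
    using lborel_distr_mult[of "r i"] r[of i] by (simp cong: distr_cong)
  have sf: "product_sigma_finite (\<lambda>i. density lborel (\<lambda>_. ennreal (inverse (r i))))"
    unfolding product_sigma_finite_def
    by (intro allI sigma_finite_measure.sigma_finite_iff_density_finite[THEN iffD2] sigma_finite_lborel) auto
  have "distr (lbn n) (\<Pi>\<^sub>M i\<in>{..<n}. density lborel (\<lambda>_. ennreal (inverse (r i)))) (\<lambda>x. \<lambda>i\<in>{..<n}. r i * x i)
     = (\<Pi>\<^sub>M i\<in>{..<n}. density lborel (\<lambda>_. ennreal (inverse (r i))))"
    by (rule distr_PiM_componentwise) (auto simp: product_sigma_finite_lborel dens sf)
  also have "\<dots> = density (lbn n) (\<lambda>_. \<Prod>i<n. ennreal (inverse (r i)))"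
    by (rule PiM_density) (auto simp: product_sigma_finite_lborel sf)
  finally have eq: "distr (lbn n) (\<Pi>\<^sub>M i\<in>{..<n}. density lborel (\<lambda>_. ennreal (inverse (r i)))) (\<lambda>x. \<lambda>i\<in>{..<n}. r i * x i)
     = density (lbn n) (\<lambda>_. \<Prod>i<n. ennreal (inverse (r i)))" .
  have [measurable]: "f \<in> borel_measurable (\<Pi>\<^sub>M i\<in>{..<n}. density lborel (\<lambda>_. ennreal (inverse (r i))))"
  proof -
    have "sets (\<Pi>\<^sub>M i\<in>{..<n}. density lborel (\<lambda>_. ennreal (inverse (r i)))) = sets (lbn n)"
      by (intro sets_PiM_cong) auto
    thus ?thesis using f measurable_cong_sets by blast
  qed
  have "(\<integral>\<^sup>+x. f (\<lambda>i\<in>{..<n}. r i * x i) \<partial>lbn n) =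
    (\<integral>\<^sup>+x. f x \<partial>distr (lbn n) (\<Pi>\<^sub>M i\<in>{..<n}. density lborel (\<lambda>_. ennreal (inverse (r i)))) (\<lambda>x. \<lambda>i\<in>{..<n}. r i * x i))"
    by (rule nn_integral_distr[symmetric]) measurable
  also have "\<dots> = (\<Prod>i<n. ennreal (inverse (r i))) * (\<integral>\<^sup>+x. f x \<partial>lbn n)"
    unfolding eq by (subst nn_integral_density) (auto simp: nn_integral_cmult)
  finally have "ennreal (\<Prod>i<n. r i) * (\<integral>\<^sup>+x. f (\<lambda>i\<in>{..<n}. r i * x i) \<partial>lbn n) =
    (ennreal (\<Prod>i<n. r i) * (\<Prod>i<n. ennreal (inverse (r i)))) * (\<integral>\<^sup>+x. f x \<partial>lbn n)"
    by (simp add: mult.assoc)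
  also have "ennreal (\<Prod>i<n. r i) * (\<Prod>i<n. ennreal (inverse (r i))) = 1"
    using r by (simp add: prod_ennreal less_imp_le prod_nonneg less_imp_neq[symmetric]
        flip: ennreal_mult prod.distrib)
  finally have "ennreal (\<Prod>i<n. r i) * (\<integral>\<^sup>+x. f (\<lambda>i\<in>{..<n}. r i * x i) \<partial>lbn n) = (\<integral>\<^sup>+x. f x \<partial>lbn n)"
    by (simp only: mult_1)
  moreover have "(\<Prod>i<n. r i) = (\<Prod>i<n. s i)" by (simp add: r_def)
  moreover have "(\<lambda>i\<in>{..<n}. r i * x i) = (\<lambda>i\<in>{..<n}. s i * x i)" for x
    by (auto simp: r_def restrict_def)
  ultimately show ?thesis by (simp only:)
qed

section \<open>The normal law as a linear image of the standard Gaussian\<close>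

lemma normal_dist_density:
  assumes C: "pos_def p C"
  shows "normal_dist p C = density (lbn p)
    (\<lambda>x. ennreal (exp (- qf p (inv_mat C) x x / 2) / sqrt ((2 * pi) ^ p * Determinant.det C)))"
  unfolding normal_dist_def
  by (subst scalar_prod_mult_mat_vec[OF inv_mat(1)[OF C]])
    (auto intro!: arg_cong[of _ _ "density (lbn p)"] ext qf_cong simp: qf_sum)

lemma sets_normal_dist [measurable_cong]: "sets (normal_dist p C) = sets (\<Pi>\<^sub>M i\<in>{..<p}. borel)"
  unfolding normal_dist_def sets_density by (rule sets_lbn)

lemma measurable_qf [measurable]:
  assumes [measurable]: "\<And>i. i < n \<Longrightarrow> (\<lambda>x. f x i) \<in> borel_measurable M"
    "\<And>i. i < n \<Longrightarrow> (\<lambda>x. g x i) \<in> borel_measurable M"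
  shows "(\<lambda>x. qf n C (f x) (g x)) \<in> borel_measurable M"
  unfolding qf_def by measurable

lemma inv_mat_mv:
  assumes C: "pos_def p C" and i: "i < p"
  shows "mv p (\<lambda>i j. inv_mat C $$ (i, j)) (mv p (\<lambda>i j. C $$ (i, j)) w) i = w i"
proof -
  have "(\<Sum>k<p. inv_mat C $$ (i, k) * C $$ (k, j)) = of_bool (i = j)" if "j < p" for j
    using arg_cong[OF inv_mat(3)[OF C], of "\<lambda>M. M $$ (i, j)"] i that inv_mat(1)[OF C] pos_def_carrier[OF C]
    by (auto simp: scalar_prod_def atLeast0LessThan)
  thus ?thesis using i unfolding mv_mv by (simp add: mv_def sum_of_bool_mult)
qed

lemma sqrt_prod: "sqrt (\<Prod>k\<in>A. f k) = (\<Prod>k\<in>A. sqrt (f k))"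
  by (induction A rule: infinite_finite_induct) (auto simp: real_sqrt_mult)

text \<open>Turning to the principal axes of \<open>C\<close> and rescaling each by the root of its
  eigenvalue transforms the density into the standard one; the Jacobian cancels the determinant. The
  witness has columns \<open>sqrt (\<mu> k)\<close> times the eigenvectors, and afterwards only its
  Gram identity with \<open>C\<close> matters.\<close>

theorem normal_dist_linear_image:
  assumes C: "pos_def p C"
  shows "\<exists>a. (\<forall>i<p. \<forall>j<p. C $$ (i, j) = (\<Sum>k<p. a i k * a j k)) \<and>
    (\<forall>f\<in>borel_measurable (\<Pi>\<^sub>M i\<in>{..<p}. borel).
      (\<integral>\<^sup>+x. f x \<partial>normal_dist p C) = (\<integral>\<^sup>+z. f (\<lambda>i\<in>{..<p}. mv p a z i) \<partial>gauss p))"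
proof -
  obtain q \<mu> where q: "orthm p q" "\<And>k. k < p \<Longrightarrow> 0 < \<mu> k"
    "\<And>i j. i < p \<Longrightarrow> j < p \<Longrightarrow> C $$ (i, j) = (\<Sum>k<p. \<mu> k * q i k * q j k)"
    using pos_def_spectral[OF C] by metis
  define a where "a = (\<lambda>i k. q i k * sqrt (\<mu> k))"
  have Ca: "C $$ (i, j) = (\<Sum>k<p. a i k * a j k)" if "i < p" "j < p" for i j
    unfolding q(3)[OF that]
  proof (intro sum.cong refl)
    fix k assume "k \<in> {..<p}"
    hence "sqrt (\<mu> k) * sqrt (\<mu> k) = \<mu> k" using q(2)[of k] by simp
    thus "\<mu> k * q i k * q j k = a i k * a j k"
      unfolding a_def by (metis (no_types, opaque_lifting) mult.assoc mult.commute)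
  qed
  have det: "Determinant.det C = (\<Prod>k<p. \<mu> k)"
    using q by (intro det_gram) (auto simp: less_imp_le pos_def_carrier[OF C])
  \<comment> \<open>The inverse is not diagonalized: \<open>mv p q y\<close> equals \<open>C\<close>
    applied to \<open>w\<close>, so \<open>inv_mat C\<close> returns \<open>w\<close>, and the form
    becomes an inner product.\<close>
  have quad: "qf p (inv_mat C) (\<lambda>i\<in>{..<p}. mv p q y i) (\<lambda>i\<in>{..<p}. mv p q y i) = (\<Sum>k<p. (y k)\<^sup>2 / \<mu> k)" for y
  proof -
    let ?x = "mv p q y"
    define w where "w = mv p q (\<lambda>k. y k / \<mu> k)"
    have Cw: "mv p (\<lambda>i j. C $$ (i, j)) w i = ?x i" if i: "i < p" for i
    proof -
      have "mv p (\<lambda>i j. C $$ (i, j)) w i = (\<Sum>j<p. \<Sum>k<p. \<mu> k * q i k * (q j k * w j))"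
        using i by (simp add: mv_def q(3) sum_distrib_right mult.assoc)
      also have "\<dots> = (\<Sum>k<p. \<mu> k * q i k * mv p (\<lambda>i j. q j i) w k)"
        by (subst sum.swap) (simp add: mv_def sum_distrib_left)
      also have "\<dots> = ?x i"
        unfolding mv_def[of p q y]
      proof (intro sum.cong refl)
        fix k assume "k \<in> {..<p}"
        hence k: "k < p" by simp
        have "mv p (\<lambda>i j. q j i) w k = y k / \<mu> k"
          unfolding w_def by (rule orthm_mv_transpose[OF q(1) k])
        thus "\<mu> k * q i k * mv p (\<lambda>i j. q j i) w k = q i k * y k" using q(2)[OF k] by simp
      qed
      finally show ?thesis .
    qed
    have "qf p (inv_mat C) (\<lambda>i\<in>{..<p}. ?x i) (\<lambda>i\<in>{..<p}. ?x i)
        = qf p (inv_mat C) ?x (mv p (\<lambda>i j. C $$ (i, j)) w)"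
      by (intro qf_cong) (auto simp: Cw)
    also have "\<dots> = ip p ?x w"
      unfolding qf_def by (intro ip_cong) (auto simp: inv_mat_mv[OF C])
    also have "\<dots> = (\<Sum>k<p. (y k)\<^sup>2 / \<mu> k)"
      unfolding w_def orthm_ip[OF q(1)] by (simp add: ip_def power2_eq_square)
    finally show ?thesis .
  qed
  have "(\<integral>\<^sup>+x. f x \<partial>normal_dist p C) = (\<integral>\<^sup>+z. f (\<lambda>i\<in>{..<p}. mv p a z i) \<partial>gauss p)"
    if f [measurable]: "f \<in> borel_measurable (\<Pi>\<^sub>M i\<in>{..<p}. borel)" for f
  proof -
    let ?c = "sqrt ((2 * pi) ^ p * Determinant.det C)"
    let ?d = "\<lambda>x. ennreal (exp (- qf p (inv_mat C) x x / 2) / ?c)"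
    define F where "F = (\<lambda>y. ennreal (exp (- (\<Sum>k<p. (y k)\<^sup>2 / \<mu> k) / 2) / ?c) * f (\<lambda>i\<in>{..<p}. mv p q y i))"
    have F: "F \<in> borel_measurable (lbn p)" unfolding F_def by measurable
    have S: "(\<lambda>x. \<lambda>i\<in>{..<p}. sqrt (\<mu> i) * x i) \<in> measurable (lbn p) (lbn p)" by measurable
    have "(\<integral>\<^sup>+x. f x \<partial>normal_dist p C) = (\<integral>\<^sup>+x. ?d x * f x \<partial>lbn p)"
      unfolding normal_dist_density[OF C] by (subst nn_integral_density) auto
    also have "\<dots> = (\<integral>\<^sup>+y. ?d (\<lambda>i\<in>{..<p}. mv p q y i) * f (\<lambda>i\<in>{..<p}. mv p q y i) \<partial>lbn p)"
      by (rule nn_integral_lbn_orthm[OF q(1), symmetric]) measurable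
    also have "\<dots> = (\<integral>\<^sup>+y. ennreal (exp (- (\<Sum>k<p. (y k)\<^sup>2 / \<mu> k) / 2) / ?c) * f (\<lambda>i\<in>{..<p}. mv p q y i) \<partial>lbn p)"
      by (simp add: quad)
    also have "\<dots> = ennreal (\<Prod>k<p. sqrt (\<mu> k)) *
      (\<integral>\<^sup>+z. ennreal (exp (- (\<Sum>k<p. ((\<lambda>i\<in>{..<p}. sqrt (\<mu> i) * z i) k)\<^sup>2 / \<mu> k) / 2) / ?c) *
         f (\<lambda>i\<in>{..<p}. mv p q (\<lambda>i\<in>{..<p}. sqrt (\<mu> i) * z i) i) \<partial>lbn p)"
      by (rule nn_integral_lbn_scale) (use q(2) in \<open>simp, measurable\<close>)
    also have "\<dots> = (\<integral>\<^sup>+z. ennreal (\<Prod>k<p. sqrt (\<mu> k)) * (ennreal (exp (- (\<Sum>k<p. ((\<lambda>i\<in>{..<p}. sqrt (\<mu> i) * z i) k)\<^sup>2 / \<mu> k) / 2) / ?c) *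
         f (\<lambda>i\<in>{..<p}. mv p q (\<lambda>i\<in>{..<p}. sqrt (\<mu> i) * z i) i)) \<partial>lbn p)"
      by (rule nn_integral_cmult[symmetric, OF measurable_compose[OF S F[unfolded F_def]]])
    also have "\<dots> = (\<integral>\<^sup>+z. ennreal (exp (- ip p z z / 2) / sqrt (2 * pi) ^ p) * f (\<lambda>i\<in>{..<p}. mv p a z i) \<partial>lbn p)"
    proof (rule nn_integral_cong)
      fix z
      have 1: "(\<Sum>k<p. ((\<lambda>i\<in>{..<p}. sqrt (\<mu> i) * z i) k)\<^sup>2 / \<mu> k) = ip p z z"
        unfolding ip_self
        by (intro sum.cong refl) (use q(2) in \<open>force simp: power_mult_distrib less_imp_le\<close>)
      have 2: "(\<lambda>i\<in>{..<p}. mv p q (\<lambda>i\<in>{..<p}. sqrt (\<mu> i) * z i) i) = (\<lambda>i\<in>{..<p}. mv p a z i)"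
        by (intro restrict_ext) (simp add: mv_def a_def mult.assoc)
      have pos: "0 < (\<Prod>k<p. \<mu> k)" using q(2) by (intro prod_pos) auto
      have 3: "(\<Prod>k<p. sqrt (\<mu> k)) = sqrt (\<Prod>k<p. \<mu> k)"
        by (rule sqrt_prod[symmetric])
      have 4: "(\<Prod>k<p. sqrt (\<mu> k)) / ?c = 1 / sqrt (2 * pi) ^ p"
        unfolding det 3 using pos
        by (simp add: real_sqrt_mult real_sqrt_power power_mult_distrib less_imp_neq[symmetric] del: prod_zero_iff)
      have "ennreal (\<Prod>k<p. sqrt (\<mu> k)) * ennreal (exp (- ip p z z / 2) / ?c)
          = ennreal (exp (- ip p z z / 2) * ((\<Prod>k<p. sqrt (\<mu> k)) / ?c))"
        using q(2) by (subst ennreal_mult'[symmetric]) (auto intro!: prod_nonneg simp: less_imp_le mult_ac)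
      thus "ennreal (\<Prod>k<p. sqrt (\<mu> k)) * (ennreal (exp (- (\<Sum>k<p. ((\<lambda>i\<in>{..<p}. sqrt (\<mu> i) * z i) k)\<^sup>2 / \<mu> k) / 2) / ?c) *
         f (\<lambda>i\<in>{..<p}. mv p q (\<lambda>i\<in>{..<p}. sqrt (\<mu> i) * z i) i)) =
         ennreal (exp (- ip p z z / 2) / sqrt (2 * pi) ^ p) * f (\<lambda>i\<in>{..<p}. mv p a z i)"
        unfolding 1 2 4 by (simp add: mult.assoc[symmetric])
    qed
    also have "\<dots> = (\<integral>\<^sup>+z. f (\<lambda>i\<in>{..<p}. mv p a z i) \<partial>gauss p)"
      by (rule nn_integral_gauss[symmetric]) measurable
    finally show ?thesis .
  qed
  thus ?thesis using Ca by (intro exI[of _ a] conjI ballI allI impI)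
qed

lemma prob_space_normal_dist:
  assumes C: "pos_def p C"
  shows "prob_space (normal_dist p C)"
proof
  obtain a where a: "\<forall>f\<in>borel_measurable (\<Pi>\<^sub>M i\<in>{..<p}. borel).
      (\<integral>\<^sup>+x. f x \<partial>normal_dist p C) = (\<integral>\<^sup>+z. f (\<lambda>i\<in>{..<p}. mv p a z i) \<partial>gauss p)"
    using normal_dist_linear_image[OF C] by (elim exE conjE)
  show "emeasure (normal_dist p C) (space (normal_dist p C)) = 1"
    using bspec[OF a, of "\<lambda>_. 1"] prob_space.emeasure_space_1[OF prob_space_gauss[of p]] by simp
qed

lemma nn_integral_normal_dist_linear:
  assumes C: "pos_def p C" and f [measurable]: "f \<in> borel_measurable borel"
  shows "(\<integral>\<^sup>+x. f ((ip p v x)\<^sup>2) \<partial>normal_dist p C) = (\<integral>\<^sup>+z. f (qf p C v v * z\<^sup>2) \<partial>std_normal_distribution)"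
proof -
  obtain a where Ca: "\<forall>i<p. \<forall>j<p. C $$ (i, j) = (\<Sum>k<p. a i k * a j k)"
    and a: "\<forall>f\<in>borel_measurable (\<Pi>\<^sub>M i\<in>{..<p}. borel).
      (\<integral>\<^sup>+x. f x \<partial>normal_dist p C) = (\<integral>\<^sup>+z. f (\<lambda>i\<in>{..<p}. mv p a z i) \<partial>gauss p)"
    using normal_dist_linear_image[OF C] by (elim exE conjE)
  let ?w = "mv p (\<lambda>i j. a j i) v"
  have "ip p v (\<lambda>i\<in>{..<p}. mv p a z i) = ip p ?w z" for z
    unfolding ip_mv[of p v a z, symmetric] by (intro ip_cong) auto
  hence "(\<integral>\<^sup>+x. f ((ip p v x)\<^sup>2) \<partial>normal_dist p C) = (\<integral>\<^sup>+z. f ((ip p ?w z)\<^sup>2) \<partial>gauss p)"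
    by (subst bspec[OF a]) auto
  also have "\<dots> = (\<integral>\<^sup>+z. f (ip p ?w ?w * z\<^sup>2) \<partial>std_normal_distribution)"
    by (rule nn_integral_gauss_linear) measurable
  also have "ip p ?w ?w = qf p C v v"
    unfolding ip_mv mv_mv
    by (subst ip_commute) (simp add: qf_def ip_def mv_def Ca cong: sum.cong_simp)
  finally show ?thesis .
qed

section \<open>The noise of one coordinate and its redrawing\<close>

lemma ip_fun_upd:
  assumes "j < p"
  shows "ip p v (x(j := t)) = ip p v x + (t - x j) * v j"
proof -
  have "ip p v (x(j := t)) = ip p v (\<lambda>i. x i + (t - x j) * of_bool (i = j))"
    by (intro ip_cong) auto
  also have "\<dots> = ip p v x + (t - x j) * v j"
    using assms by (simp add: ip_add ip_scale) (simp add: ip_def sum_of_bool_mult)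
  finally show ?thesis .
qed

context
  fixes p j :: nat and C :: "real mat" and v :: "nat \<Rightarrow> real" and s :: real
  assumes C: "pos_def p C" and j: "j < p" and s: "0 < s" and vj: "v j = 1"
    and Cv: "\<And>i. i < p \<Longrightarrow> mv p (\<lambda>i k. C $$ (i, k)) v i = s * of_bool (i = j)"
begin

text \<open>In this context \<open>ip p v x\<close> is the residual of the regression of coordinate
  \<open>j\<close> on the others, and \<open>s\<close> is its variance. Being uncorrelated with all
  other coordinates, it must have coefficients proportional to a column of the inverse.\<close>

lemma inv_mat_column: "i < p \<Longrightarrow> inv_mat C $$ (i, j) = v i / s"
proof -
  assume i: "i < p"
  have "v i = mv p (\<lambda>i j. inv_mat C $$ (i, j)) (mv p (\<lambda>i j. C $$ (i, j)) v) i"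
    using inv_mat_mv[OF C i] by simp
  also have "\<dots> = mv p (\<lambda>i j. inv_mat C $$ (i, j)) (\<lambda>i. s * of_bool (i = j)) i"
    by (rule fun_cong[OF mv_cong]) (simp add: Cv)
  also have "\<dots> = s * inv_mat C $$ (i, j)"
    using j by (simp add: mv_scale) (simp add: mv_def sum_of_bool_mult)
  finally show ?thesis using s by simp
qed

lemma inv_mat_sym: "i < p \<Longrightarrow> k < p \<Longrightarrow> inv_mat C $$ (i, k) = inv_mat C $$ (k, i)"
proof -
  assume ik: "i < p" "k < p"
  let ?I = "inv_mat C"
  have I: "?I \<in> carrier_mat p p" by (rule inv_mat(1)[OF C])
  have Ct: "transpose_mat C = C" using C by (simp add: pos_def_def)
  have "transpose_mat (?I * C) = 1\<^sub>m p" by (simp add: inv_mat[OF C])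
  hence "C * transpose_mat ?I = 1\<^sub>m p"
    using transpose_mult[OF I pos_def_carrier[OF C]] Ct by simp
  hence "?I * (C * transpose_mat ?I) = ?I * 1\<^sub>m p" by simp
  hence "transpose_mat ?I = ?I"
    using I pos_def_carrier[OF C] inv_mat(3)[OF C] by (simp flip: assoc_mult_mat)
  hence "transpose_mat ?I $$ (i, k) = ?I $$ (i, k)" by simp
  thus ?thesis using I ik by simp
qed

text \<open>Completing the square in coordinate \<open>j\<close>: what is left of the exponent once
  the residual \<open>ip p v x\<close> has been split off does not involve x_j. This is the
  independence of the residual from the other coordinates, at the level of densities.\<close>

lemma qf_inv_mat_split:
  "qf p (inv_mat C) (x(j := t)) (x(j := t)) - (ip p v (x(j := t)))\<^sup>2 / s =
   qf p (inv_mat C) x x - (ip p v x)\<^sup>2 / s"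
proof -
  let ?e = "\<lambda>i. of_bool (i = j) :: real" and ?c = "t - x j"
  have e: "qf p (inv_mat C) y ?e = ip p v y / s" for y
  proof -
    have "mv p (\<lambda>i j. inv_mat C $$ (i, j)) ?e i = v i / s" if "i < p" for i
      using inv_mat_column[OF that] j by (simp add: mv_def sum_of_bool_mult)
    hence "qf p (inv_mat C) y ?e = ip p y (\<lambda>i. v i / s)"
      unfolding qf_def by (intro ip_cong) auto
    thus ?thesis by (simp add: ip_def sum_divide_distrib mult.commute)
  qed
  have e': "qf p (inv_mat C) ?e y = ip p v y / s" for y
  proof -
    have "qf p (inv_mat C) ?e y = qf p (inv_mat C) y ?e"
      unfolding qf_sum
    proof (subst sum.swap, intro sum.cong refl)
      fix a b assume "a \<in> {..<p}" "b \<in> {..<p}"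
      thus "?e b * inv_mat C $$ (b, a) * y a = y a * inv_mat C $$ (a, b) * ?e b"
        using inv_mat_sym[of a b] by simp
    qed
    thus ?thesis by (simp add: e)
  qed
  have "qf p (inv_mat C) (x(j := t)) (x(j := t)) =
    qf p (inv_mat C) (\<lambda>i. x i + ?c * ?e i) (\<lambda>i. x i + ?c * ?e i)"
    by (intro qf_cong) auto
  also have "\<dots> = qf p (inv_mat C) x x + 2 * ?c * ip p v x / s + ?c\<^sup>2 * ip p v ?e / s"
    by (simp add: qf_linear e e') (simp add: power2_eq_square add_divide_distrib algebra_simps)
  also have "ip p v ?e = 1" using j vj by (simp add: ip_def sum_of_bool_mult)
  finally have 1: "qf p (inv_mat C) (x(j := t)) (x(j := t)) =
    qf p (inv_mat C) x x + 2 * ?c * ip p v x / s + ?c\<^sup>2 / s" by (simp only: mult_1_right)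
  have 2: "ip p v (x(j := t)) = ip p v x + ?c" using ip_fun_upd[OF j] vj by simp
  show ?thesis unfolding 1 2 using s by (simp add: field_simps power2_eq_square)
qed

text \<open>Integrating coordinate \<open>j\<close> innermost, with the residual as the new
  variable, turns the inner integral into a standard normal one. What matters about the outer weight
  is that it depends neither on \<open>f\<close> nor on coordinate \<open>j\<close>.\<close>

lemma nn_integral_normal_dist_split:
  assumes f [measurable]: "f \<in> borel_measurable (\<Pi>\<^sub>M i\<in>{..<p}. borel)"
  shows "(\<integral>\<^sup>+x. f x \<partial>normal_dist p C) =
    (\<integral>\<^sup>+x. ennreal (exp (- (qf p (inv_mat C) (x(j := 0)) (x(j := 0)) - (ip p v (x(j := 0)))\<^sup>2 / s) / 2) *
        sqrt (2 * pi * s) / sqrt ((2 * pi) ^ p * Determinant.det C)) *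
      (\<integral>\<^sup>+z. f (x(j := - ip p v (x(j := 0)) + sqrt s * z)) \<partial>std_normal_distribution)
      \<partial>(\<Pi>\<^sub>M i\<in>{..<p} - {j}. lborel))"
proof -
  interpret product_sigma_finite "\<lambda>_::nat. lborel :: real measure"
    by (rule product_sigma_finite_lborel)
  let ?c = "sqrt ((2 * pi) ^ p * Determinant.det C)"
  let ?d = "\<lambda>x. ennreal (exp (- qf p (inv_mat C) x x / 2) / ?c)"
  let ?J = "{..<p} - {j}"
  have ins: "insert j ?J = {..<p}" using j by auto
  have setsJ: "sets (Pi\<^sub>M ?J (\<lambda>_. lborel)) = sets (\<Pi>\<^sub>M i\<in>?J. borel)" by (intro sets_PiM_cong) auto
  have meas: "(\<lambda>x. ?d x * f x) \<in> borel_measurable (lbn p)" by measurable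
  have "(\<integral>\<^sup>+x. f x \<partial>normal_dist p C) = (\<integral>\<^sup>+x. ?d x * f x \<partial>lbn p)"
    unfolding normal_dist_density[OF C] by (subst nn_integral_density) auto
  also have "\<dots> = (\<integral>\<^sup>+x. \<integral>\<^sup>+t. ?d (x(j := t)) * f (x(j := t)) \<partial>lborel \<partial>Pi\<^sub>M ?J (\<lambda>_. lborel))"
    using product_nn_integral_insert[of ?J j "\<lambda>x. ?d x * f x"] meas unfolding ins by simp
  also have "\<dots> = (\<integral>\<^sup>+x. ennreal (exp (- (qf p (inv_mat C) (x(j := 0)) (x(j := 0)) - (ip p v (x(j := 0)))\<^sup>2 / s) / 2) *
        sqrt (2 * pi * s) / ?c) *
      (\<integral>\<^sup>+z. f (x(j := - ip p v (x(j := 0)) + sqrt s * z)) \<partial>std_normal_distribution)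
      \<partial>Pi\<^sub>M ?J (\<lambda>_. lborel))"
  proof (rule nn_integral_cong)
    fix x assume x: "x \<in> space (Pi\<^sub>M ?J (\<lambda>_. lborel :: real measure))"
    define q where "q = qf p (inv_mat C) (x(j := 0)) (x(j := 0)) - (ip p v (x(j := 0)))\<^sup>2 / s"
    define r where "r = ip p v (x(j := 0))"
    have "x \<in> space (\<Pi>\<^sub>M i\<in>?J. borel :: real measure)"
      using x by (simp add: space_PiM)
    from measurable_component_update[OF this, of j]
    have upd [measurable]: "(\<lambda>t. x(j := t)) \<in> measurable borel (\<Pi>\<^sub>M i\<in>{..<p}. borel)"
      unfolding ins by simp
    have fm [measurable]: "(\<lambda>t. f (x(j := t))) \<in> borel_measurable borel"
      by (rule measurable_compose[OF upd f])
    have q: "qf p (inv_mat C) (x(j := t)) (x(j := t)) = q + (r + t)\<^sup>2 / s" for t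
      using qf_inv_mat_split[of "x(j := 0)" t] ip_fun_upd[OF j, of v "x(j := 0)" t] vj
      by (simp add: q_def r_def)
    have d: "?d (x(j := t)) = ennreal (exp (- q / 2) / ?c * exp (- (r + t)\<^sup>2 / (2 * s)))" for t
    proof -
      have "- (q + (r + t)\<^sup>2 / s) / 2 = - q / 2 + - (r + t)\<^sup>2 / (2 * s)"
        using s by (simp add: field_simps)
      thus ?thesis unfolding q by (simp only: exp_add times_divide_eq_left)
    qed
    have "(\<integral>\<^sup>+t. ?d (x(j := t)) * f (x(j := t)) \<partial>lborel) =
      ennreal \<bar>sqrt s\<bar> * (\<integral>\<^sup>+z. ennreal (exp (- q / 2) / ?c * exp (- (r + (- r + sqrt s * z))\<^sup>2 / (2 * s))) * f (x(j := - r + sqrt s * z)) \<partial>lborel)"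
      unfolding d by (rule nn_integral_real_affine) (use s in \<open>simp_all\<close>)
    also have "\<dots> = ennreal (sqrt s) * (\<integral>\<^sup>+z. ennreal (exp (- q / 2) * sqrt (2 * pi) / ?c) * (ennreal (std_normal_density z) * f (x(j := - r + sqrt s * z))) \<partial>lborel)"
    proof -
      have "exp (- q / 2) / ?c * exp (- (r + (- r + sqrt s * z))\<^sup>2 / (2 * s)) =
          exp (- q / 2) * sqrt (2 * pi) / ?c * std_normal_density z" for z
        using s by (simp add: std_normal_density_def power_mult_distrib)
      hence "ennreal (exp (- q / 2) / ?c * exp (- (r + (- r + sqrt s * z))\<^sup>2 / (2 * s))) =
          ennreal (exp (- q / 2) * sqrt (2 * pi) / ?c) * ennreal (std_normal_density z)" for z
        by (simp only: ennreal_mult''[OF normal_density_nonneg])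
      thus ?thesis using s by (simp add: mult.assoc)
    qed
    also have "\<dots> = ennreal (exp (- q / 2) * sqrt (2 * pi * s) / ?c) * (\<integral>\<^sup>+z. ennreal (std_normal_density z) * f (x(j := - r + sqrt s * z)) \<partial>lborel)"
    proof -
      have h: "sqrt s * (exp (- q / 2) * sqrt (2 * pi) / ?c) = exp (- q / 2) * sqrt (2 * pi * s) / ?c"
        using s by (simp add: real_sqrt_mult)
      have "ennreal (sqrt s) * ennreal (exp (- q / 2) * sqrt (2 * pi) / ?c) =
          ennreal (exp (- q / 2) * sqrt (2 * pi * s) / ?c)"
        unfolding h[symmetric] by (rule ennreal_mult'[symmetric]) (use s in simp)
      thus ?thesis by (subst nn_integral_cmult) (auto simp flip: mult.assoc)
    qed
    also have "(\<integral>\<^sup>+z. ennreal (std_normal_density z) * f (x(j := - r + sqrt s * z)) \<partial>lborel) =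
      (\<integral>\<^sup>+z. f (x(j := - r + sqrt s * z)) \<partial>std_normal_distribution)"
      by (subst nn_integral_density) auto
    finally show "(\<integral>\<^sup>+t. ?d (x(j := t)) * f (x(j := t)) \<partial>lborel) =
      ennreal (exp (- (qf p (inv_mat C) (x(j := 0)) (x(j := 0)) - (ip p v (x(j := 0)))\<^sup>2 / s) / 2) *
        sqrt (2 * pi * s) / ?c) *
      (\<integral>\<^sup>+z. f (x(j := - ip p v (x(j := 0)) + sqrt s * z)) \<partial>std_normal_distribution)"
      by (simp only: q_def r_def)
  qed
  finally show ?thesis .
qed

lemma measurable_resample [measurable]:
  "(\<lambda>(x, z). x(j := x j - ip p v x + sqrt s * z)) \<in>
    measurable ((\<Pi>\<^sub>M i\<in>{..<p}. borel) \<Otimes>\<^sub>M borel) (\<Pi>\<^sub>M i\<in>{..<p}. borel)"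
proof -
  have ins: "insert j {..<p} = {..<p}" and j' [simp]: "j \<in> {..<p}" using j by auto
  have "(\<lambda>(x, z). x(j := x j - ip p v x + sqrt s * z)) = (\<lambda>w. (fst w)(j := fst w j - ip p v (fst w) + sqrt s * snd w))"
    by auto
  also have "\<dots> \<in> measurable ((\<Pi>\<^sub>M i\<in>{..<p}. borel) \<Otimes>\<^sub>M borel) (\<Pi>\<^sub>M i\<in>{..<p}. borel)"
  proof (rule measurable_fun_upd[where J = "{..<p}"])
    show "(\<lambda>w. fst w j - ip p v (fst w) + sqrt s * snd w) \<in> borel_measurable ((\<Pi>\<^sub>M i\<in>{..<p}. borel) \<Otimes>\<^sub>M borel)"
      by (intro borel_measurable_add borel_measurable_diff borel_measurable_times measurable_ip
          measurable_compose[OF measurable_fst measurable_component_singleton] measurable_snd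
          borel_measurable_const) (simp_all add: j)
  qed (use ins in auto)
  finally show ?thesis .
qed

text \<open>The redrawn mean \<open>F\<close> does not depend on coordinate \<open>j\<close>, so
  averaging it over that coordinate changes nothing; both sides then have the same inner integral
  against the same weight.\<close>

lemma nn_integral_normal_dist_resample:
  assumes f [measurable]: "f \<in> borel_measurable (\<Pi>\<^sub>M i\<in>{..<p}. borel)"
  shows "(\<integral>\<^sup>+x. f x \<partial>normal_dist p C) =
    (\<integral>\<^sup>+x. \<integral>\<^sup>+z. f (x(j := x j - ip p v x + sqrt s * z)) \<partial>std_normal_distribution \<partial>normal_dist p C)"
proof -
  interpret z: prob_space std_normal_distribution by (rule prob_space_std_normal)
  define F where "F = (\<lambda>x. \<integral>\<^sup>+z. f (x(j := x j - ip p v x + sqrt s * z)) \<partial>std_normal_distribution)"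
  have "(\<lambda>w. f (case w of (x, z) \<Rightarrow> x(j := x j - ip p v x + sqrt s * z))) \<in>
      borel_measurable ((\<Pi>\<^sub>M i\<in>{..<p}. borel) \<Otimes>\<^sub>M std_normal_distribution)"
    by measurable
  hence F [measurable]: "F \<in> borel_measurable (\<Pi>\<^sub>M i\<in>{..<p}. borel)"
    unfolding F_def using z.borel_measurable_nn_integral_fst by fastforce
  have inner: "F (x(j := t)) = F x" for x t
    using ip_fun_upd[OF j, of v x t] vj by (simp add: F_def)
  have eq: "F x = (\<integral>\<^sup>+z. f (x(j := - ip p v (x(j := 0)) + sqrt s * z)) \<partial>std_normal_distribution)" for x
    using ip_fun_upd[OF j, of v x 0] vj by (simp add: F_def)
  have "(\<integral>\<^sup>+x. F x \<partial>normal_dist p C) = (\<integral>\<^sup>+x. f x \<partial>normal_dist p C)"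
    unfolding nn_integral_normal_dist_split[OF F] nn_integral_normal_dist_split[OF f]
    unfolding inner eq[symmetric] using z.emeasure_space_1 by simp
  thus ?thesis by (simp add: F_def)
qed

text \<open>Redrawing the noise of the regression of coordinate \<open>j\<close> on the others, independently in every
  observation, does not change the law of the sample.\<close>

lemma sample_law_resample:
  assumes f [measurable]: "f \<in> borel_measurable (\<Pi>\<^sub>M k\<in>{..<n}. \<Pi>\<^sub>M i\<in>{..<p}. borel)"
  shows "(\<integral>\<^sup>+x. f x \<partial>sample_law n p C) =
    (\<integral>\<^sup>+x. \<integral>\<^sup>+z. f (\<lambda>k\<in>{..<n}. (x k)(j := x k j - ip p v (x k) + sqrt s * z k)) \<partial>gauss n \<partial>sample_law n p C)"
proof -
  interpret z: prob_space std_normal_distribution by (rule prob_space_std_normal)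
  interpret N: prob_space "normal_dist p C" by (rule prob_space_normal_dist[OF C])
  interpret NN: product_prob_space "\<lambda>_::nat. normal_dist p C" by unfold_locales
  interpret ZZ: product_prob_space "\<lambda>_::nat. std_normal_distribution" by unfold_locales
  interpret S: prob_space "sample_law n p C"
    unfolding sample_law_def by (intro prob_space_PiM prob_space_normal_dist[OF C])
  interpret G: prob_space "gauss n" by (rule prob_space_gauss)
  interpret SG: pair_prob_space "sample_law n p C" "gauss n" by unfold_locales
  have setsS [measurable_cong]: "sets (sample_law n p C) = sets (\<Pi>\<^sub>M k\<in>{..<n}. \<Pi>\<^sub>M i\<in>{..<p}. borel)"
    unfolding sample_law_def by (intro sets_PiM_cong refl sets_normal_dist)
  let ?T = "\<lambda>(x, z) k. (x k)(j := x k j - ip p v (x k) + sqrt s * z k)"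
  let ?R = "\<lambda>w. \<lambda>k\<in>{..<n}. (\<lambda>(x, z). x(j := x j - ip p v x + sqrt s * z)) (fst w k, snd w k)"
  have R [measurable]: "?R \<in> measurable (sample_law n p C \<Otimes>\<^sub>M gauss n) (\<Pi>\<^sub>M k\<in>{..<n}. \<Pi>\<^sub>M i\<in>{..<p}. borel)"
    by measurable
  have dR: "distr (sample_law n p C \<Otimes>\<^sub>M gauss n) (sample_law n p C) ?R = sample_law n p C"
  proof -
    have "distr (sample_law n p C \<Otimes>\<^sub>M gauss n) (sample_law n p C) ?R = (\<Pi>\<^sub>M k\<in>{..<n}. normal_dist p C)"
    proof (rule NN.PiM_eqI)
      show "sets (distr (sample_law n p C \<Otimes>\<^sub>M gauss n) (sample_law n p C) ?R) = sets (\<Pi>\<^sub>M k\<in>{..<n}. normal_dist p C)"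
        by (simp add: sample_law_def)
      fix A assume A: "\<And>k. k \<in> {..<n} \<Longrightarrow> A k \<in> sets (normal_dist p C)"
      hence A' [measurable]: "\<And>k. k \<in> {..<n} \<Longrightarrow> A k \<in> sets (\<Pi>\<^sub>M i\<in>{..<p}. borel)"
        by (simp add: sets_normal_dist)
      let ?h = "\<lambda>k x. \<integral>\<^sup>+z. indicator (A k) (x(j := x j - ip p v x + sqrt s * z)) \<partial>std_normal_distribution"
      have box: "Pi\<^sub>E {..<n} A \<in> sets (sample_law n p C)"
        unfolding sample_law_def using A by (intro sets_PiM_I_finite) auto
      have ind: "indicator (Pi\<^sub>E {..<n} A) (?R w) = (\<Prod>k<n. indicator (A k) ((fst w k)(j := fst w k j - ip p v (fst w k) + sqrt s * snd w k)) :: ennreal)" for w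
        by (auto simp: indicator_def PiE_iff prod_zero_iff extensional_def)
      have m: "(\<lambda>w. indicator (A k) (case w of (x, z) \<Rightarrow> x(j := x j - ip p v x + sqrt s * z)) :: ennreal) \<in>
         borel_measurable ((\<Pi>\<^sub>M i\<in>{..<p}. borel) \<Otimes>\<^sub>M std_normal_distribution)" if "k < n" for k
      proof -
        have [measurable]: "A k \<in> sets (\<Pi>\<^sub>M i\<in>{..<p}. borel)" using A' that by simp
        show ?thesis by measurable
      qed
      have hm: "?h k \<in> borel_measurable (normal_dist p C)" if "k < n" for k
        using z.borel_measurable_nn_integral_fst[OF m[OF that]]
        by (simp cong: measurable_cong_sets add: sets_normal_dist)
      have "emeasure (distr (sample_law n p C \<Otimes>\<^sub>M gauss n) (sample_law n p C) ?R) (Pi\<^sub>E {..<n} A) =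
        (\<integral>\<^sup>+w. indicator (Pi\<^sub>E {..<n} A) w \<partial>distr (sample_law n p C \<Otimes>\<^sub>M gauss n) (sample_law n p C) ?R)"
        using box by simp
      also have "\<dots> = (\<integral>\<^sup>+w. indicator (Pi\<^sub>E {..<n} A) (?R w) \<partial>(sample_law n p C \<Otimes>\<^sub>M gauss n))"
        using box by (intro nn_integral_distr) auto
      also have "\<dots> = (\<integral>\<^sup>+x. \<integral>\<^sup>+z. indicator (Pi\<^sub>E {..<n} A) (?R (x, z)) \<partial>gauss n \<partial>sample_law n p C)"
        using box by (intro G.nn_integral_fst[symmetric]) auto
      also have "\<dots> = (\<integral>\<^sup>+x. \<integral>\<^sup>+z. (\<Prod>k<n. indicator (A k) ((x k)(j := x k j - ip p v (x k) + sqrt s * z k))) \<partial>gauss n \<partial>sample_law n p C)"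
        unfolding ind by simp
      also have "\<dots> = (\<integral>\<^sup>+x. (\<Prod>k<n. ?h k (x k)) \<partial>sample_law n p C)"
      proof (rule nn_integral_cong)
        fix x assume x: "x \<in> space (sample_law n p C)"
        show "(\<integral>\<^sup>+z. (\<Prod>k<n. indicator (A k) ((x k)(j := x k j - ip p v (x k) + sqrt s * z k))) \<partial>gauss n) = (\<Prod>k<n. ?h k (x k))"
        proof (rule ZZ.product_nn_integral_prod)
          fix k assume k: "k \<in> {..<n}"
          hence "x k \<in> space (\<Pi>\<^sub>M i\<in>{..<p}. borel :: real measure)"
            using x sets_eq_imp_space_eq[OF sets_normal_dist[of p C]] by (auto simp: sample_law_def space_PiM)
          thus "(\<lambda>z. indicator (A k) ((x k)(j := x k j - ip p v (x k) + sqrt s * z)) :: ennreal) \<in> borel_measurable std_normal_distribution"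
            using measurable_compose[OF measurable_Pair1' m[of k]] k by simp
        qed simp
      qed
      also have "\<dots> = (\<Prod>k<n. \<integral>\<^sup>+x. ?h k x \<partial>normal_dist p C)"
        unfolding sample_law_def by (rule NN.product_nn_integral_prod) (use hm in auto)
      also have "\<dots> = (\<Prod>k<n. emeasure (normal_dist p C) (A k))"
      proof (intro prod.cong refl)
        fix k assume k: "k \<in> {..<n}"
        have "(\<integral>\<^sup>+x. ?h k x \<partial>normal_dist p C) = (\<integral>\<^sup>+x. indicator (A k) x \<partial>normal_dist p C)"
          using A'[OF k] by (intro nn_integral_normal_dist_resample[symmetric]) auto
        thus "(\<integral>\<^sup>+x. ?h k x \<partial>normal_dist p C) = emeasure (normal_dist p C) (A k)"
          using A[OF k] by simp
      qed
      finally show "emeasure (distr (sample_law n p C \<Otimes>\<^sub>M gauss n) (sample_law n p C) ?R) (Pi\<^sub>E {..<n} A) =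
        (\<Prod>k<n. emeasure (normal_dist p C) (A k))" .
    qed simp
    thus "distr (sample_law n p C \<Otimes>\<^sub>M gauss n) (sample_law n p C) ?R = sample_law n p C"
      by (simp add: sample_law_def)
  qed
  have "(\<integral>\<^sup>+x. f x \<partial>sample_law n p C) = (\<integral>\<^sup>+x. f x \<partial>distr (sample_law n p C \<Otimes>\<^sub>M gauss n) (sample_law n p C) ?R)"
    by (simp only: dR)
  also have "\<dots> = (\<integral>\<^sup>+w. f (?R w) \<partial>(sample_law n p C \<Otimes>\<^sub>M gauss n))"
    by (rule nn_integral_distr) measurable
  also have "\<dots> = (\<integral>\<^sup>+x. \<integral>\<^sup>+z. f (?R (x, z)) \<partial>gauss n \<partial>sample_law n p C)"
    by (rule G.nn_integral_fst[symmetric]) measurable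
  finally show ?thesis by simp
qed

end

section \<open>Chi-squared laws and the penalty\<close>

lemma nn_integral_gauss_Suc:
  assumes f [measurable]: "f \<in> borel_measurable (\<Pi>\<^sub>M i\<in>{..<Suc n}. borel)"
  shows "(\<integral>\<^sup>+x. f x \<partial>gauss (Suc n)) = (\<integral>\<^sup>+x. \<integral>\<^sup>+z. f (x(n := z)) \<partial>std_normal_distribution \<partial>gauss n)"
proof -
  interpret ZZ: product_prob_space "\<lambda>_::nat. std_normal_distribution"
    by (rule product_prob_space_normal)
  have ins: "insert n {..<n} = {..<Suc n}" by auto
  have "f \<in> borel_measurable (gauss (Suc n))" by measurable
  thus ?thesis
    using ZZ.product_nn_integral_insert[of "{..<n}" n f] unfolding ins by simp
qed

lemma gauss_0: "(\<integral>\<^sup>+x. f (ip 0 x x) \<partial>gauss 0) = f 0"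
  using prob_space.emeasure_space_1[OF prob_space_gauss[of 0]] by (simp add: ip_def)

lemma nn_integral_chi2_Suc:
  assumes h [measurable]: "h \<in> borel_measurable borel"
  shows "(\<integral>\<^sup>+x. h (ip (Suc d) x x) \<partial>gauss (Suc d)) =
    (\<integral>\<^sup>+x. \<integral>\<^sup>+z. h (ip d x x + z\<^sup>2) \<partial>std_normal_distribution \<partial>gauss d)"
proof -
  have "ip (Suc d) (x(d := z)) (x(d := z)) = ip d x x + z\<^sup>2" for x z
    by (simp add: ip_def power2_eq_square cong: sum.cong_simp)
  thus ?thesis by (subst nn_integral_gauss_Suc) auto
qed

lemma std_normal_second_moment: "(\<integral>\<^sup>+z. ennreal (z\<^sup>2) \<partial>std_normal_distribution) = 1"
proof -
  have 1: "has_bochner_integral lborel (\<lambda>x. std_normal_density x * x\<^sup>2) 1"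
    using std_normal_moment_even[of 1] by (simp add: fact_numeral)
  have "(\<integral>\<^sup>+z. ennreal (z\<^sup>2) \<partial>std_normal_distribution) = (\<integral>\<^sup>+z. ennreal (std_normal_density z * z\<^sup>2) \<partial>lborel)"
    by (subst nn_integral_density) (auto simp: ennreal_mult)
  also have "\<dots> = ennreal 1"
    using 1 by (subst nn_integral_eq_integral)
      (auto simp: has_bochner_integral_iff)
  finally show ?thesis by simp
qed

text \<open>The coordinates \<open>b = a s\<close>, \<open>c = a w\<close>, \<open>a = r / sqrt (1 + s\<^sup>2 + w\<^sup>2)\<close> replace spherical coordinates.\<close>

lemma nn_integral_radial_3:
  assumes F [measurable]: "F \<in> borel_measurable borel"
  shows "(\<integral>\<^sup>+a. \<integral>\<^sup>+b. \<integral>\<^sup>+c. F (a\<^sup>2 + b\<^sup>2 + c\<^sup>2) \<partial>lborel \<partial>lborel \<partial>(lborel :: real measure)) =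
    (\<integral>\<^sup>+s. \<integral>\<^sup>+w. ennreal (1 / sqrt (1 + s\<^sup>2 + w\<^sup>2) ^ 3) \<partial>lborel \<partial>(lborel :: real measure)) *
    (\<integral>\<^sup>+r. ennreal (r\<^sup>2) * F (r\<^sup>2) \<partial>(lborel :: real measure))" (is "_ = ?K * ?I")
proof -
  have "(\<integral>\<^sup>+a. \<integral>\<^sup>+b. \<integral>\<^sup>+c. F (a\<^sup>2 + b\<^sup>2 + c\<^sup>2) \<partial>lborel \<partial>lborel \<partial>(lborel :: real measure)) =
    (\<integral>\<^sup>+a. \<integral>\<^sup>+s. \<integral>\<^sup>+w. ennreal (a\<^sup>2) * F (a\<^sup>2 * (1 + s\<^sup>2 + w\<^sup>2)) \<partial>lborel \<partial>lborel \<partial>(lborel :: real measure))"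
  proof (rule nn_integral_cong_AE)
    have "AE a in lborel. a \<noteq> (0::real)" by (rule AE_lborel_singleton)
    thus "AE a in lborel. (\<integral>\<^sup>+b. \<integral>\<^sup>+c. F (a\<^sup>2 + b\<^sup>2 + c\<^sup>2) \<partial>lborel \<partial>lborel) =
      (\<integral>\<^sup>+s. \<integral>\<^sup>+w. ennreal (a\<^sup>2) * F (a\<^sup>2 * (1 + s\<^sup>2 + w\<^sup>2)) \<partial>lborel \<partial>lborel)"
    proof eventually_elim
      fix a :: real assume a: "a \<noteq> 0"
      have "(\<integral>\<^sup>+b. \<integral>\<^sup>+c. F (a\<^sup>2 + b\<^sup>2 + c\<^sup>2) \<partial>lborel \<partial>lborel) =
        ennreal \<bar>a\<bar> * (\<integral>\<^sup>+s. \<integral>\<^sup>+c. F (a\<^sup>2 + (0 + a * s)\<^sup>2 + c\<^sup>2) \<partial>lborel \<partial>lborel)"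
        using a by (intro nn_integral_real_affine) auto
      also have "\<dots> = ennreal \<bar>a\<bar> * (\<integral>\<^sup>+s. ennreal \<bar>a\<bar> * (\<integral>\<^sup>+w. F (a\<^sup>2 + (0 + a * s)\<^sup>2 + (0 + a * w)\<^sup>2) \<partial>lborel) \<partial>lborel)"
      proof (intro arg_cong2[of _ _ _ _ "(*)"] refl nn_integral_cong)
        fix s
        show "(\<integral>\<^sup>+c. F (a\<^sup>2 + (0 + a * s)\<^sup>2 + c\<^sup>2) \<partial>lborel) =
          ennreal \<bar>a\<bar> * (\<integral>\<^sup>+w. F (a\<^sup>2 + (0 + a * s)\<^sup>2 + (0 + a * w)\<^sup>2) \<partial>lborel)"
          using a by (intro nn_integral_real_affine) auto
      qed
      also have "\<dots> = (\<integral>\<^sup>+s. \<integral>\<^sup>+w. ennreal \<bar>a\<bar> * (ennreal \<bar>a\<bar> * F (a\<^sup>2 + (0 + a * s)\<^sup>2 + (0 + a * w)\<^sup>2)) \<partial>lborel \<partial>lborel)"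
        by (simp add: nn_integral_cmult)
      also have "\<dots> = (\<integral>\<^sup>+s. \<integral>\<^sup>+w. ennreal (a\<^sup>2) * F (a\<^sup>2 * (1 + s\<^sup>2 + w\<^sup>2)) \<partial>lborel \<partial>lborel)"
      proof (intro nn_integral_cong)
        fix s w
        have "ennreal \<bar>a\<bar> * ennreal \<bar>a\<bar> = ennreal (a\<^sup>2)"
          by (subst ennreal_mult[symmetric]) (auto simp: power2_eq_square)
        moreover have "a\<^sup>2 + (0 + a * s)\<^sup>2 + (0 + a * w)\<^sup>2 = a\<^sup>2 * (1 + s\<^sup>2 + w\<^sup>2)"
          by (simp add: power_mult_distrib algebra_simps)
        ultimately show "ennreal \<bar>a\<bar> * (ennreal \<bar>a\<bar> * F (a\<^sup>2 + (0 + a * s)\<^sup>2 + (0 + a * w)\<^sup>2)) =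
          ennreal (a\<^sup>2) * F (a\<^sup>2 * (1 + s\<^sup>2 + w\<^sup>2))" by (simp add: mult.assoc[symmetric])
      qed
      finally show "(\<integral>\<^sup>+b. \<integral>\<^sup>+c. F (a\<^sup>2 + b\<^sup>2 + c\<^sup>2) \<partial>lborel \<partial>lborel) =
        (\<integral>\<^sup>+s. \<integral>\<^sup>+w. ennreal (a\<^sup>2) * F (a\<^sup>2 * (1 + s\<^sup>2 + w\<^sup>2)) \<partial>lborel \<partial>lborel)" .
    qed
  qed
  also have "\<dots> = (\<integral>\<^sup>+s. \<integral>\<^sup>+a. \<integral>\<^sup>+w. ennreal (a\<^sup>2) * F (a\<^sup>2 * (1 + s\<^sup>2 + w\<^sup>2)) \<partial>lborel \<partial>lborel \<partial>(lborel :: real measure))"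
    by (rule lborel_pair.Fubini') measurable
  also have "\<dots> = (\<integral>\<^sup>+s. \<integral>\<^sup>+w. \<integral>\<^sup>+a. ennreal (a\<^sup>2) * F (a\<^sup>2 * (1 + s\<^sup>2 + w\<^sup>2)) \<partial>lborel \<partial>lborel \<partial>(lborel :: real measure))"
    by (intro nn_integral_cong lborel_pair.Fubini') measurable
  also have "\<dots> = (\<integral>\<^sup>+s. \<integral>\<^sup>+w. ennreal (1 / sqrt (1 + s\<^sup>2 + w\<^sup>2) ^ 3) * ?I \<partial>lborel \<partial>(lborel :: real measure))"
  proof (intro nn_integral_cong)
    fix s w :: real
    define q where "q = sqrt (1 + s\<^sup>2 + w\<^sup>2)"
    have q: "0 < q" "q\<^sup>2 = 1 + s\<^sup>2 + w\<^sup>2"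
      unfolding q_def by (auto intro!: add_pos_nonneg)
    have "(\<integral>\<^sup>+a. ennreal (a\<^sup>2) * F (a\<^sup>2 * (1 + s\<^sup>2 + w\<^sup>2)) \<partial>lborel) =
      ennreal \<bar>1 / q\<bar> * (\<integral>\<^sup>+r. ennreal ((0 + 1 / q * r)\<^sup>2) * F ((0 + 1 / q * r)\<^sup>2 * (1 + s\<^sup>2 + w\<^sup>2)) \<partial>lborel)"
      using q by (intro nn_integral_real_affine) auto
    also have "\<dots> = (\<integral>\<^sup>+r. ennreal (1 / q ^ 3) * (ennreal (r\<^sup>2) * F (r\<^sup>2)) \<partial>lborel)"
    proof (subst nn_integral_cmult[symmetric], measurable, intro nn_integral_cong)
      fix r
      have 1: "(0 + 1 / q * r)\<^sup>2 * (1 + s\<^sup>2 + w\<^sup>2) = r\<^sup>2"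
        unfolding q(2)[symmetric] using q(1) by (simp add: power_mult_distrib power_divide)
      have "ennreal \<bar>1 / q\<bar> * ennreal ((0 + 1 / q * r)\<^sup>2) = ennreal (\<bar>1 / q\<bar> * (0 + 1 / q * r)\<^sup>2)"
        by (rule ennreal_mult[symmetric]) auto
      also have "\<bar>1 / q\<bar> * (0 + 1 / q * r)\<^sup>2 = 1 / q ^ 3 * r\<^sup>2"
        using q(1) by (simp add: power2_eq_square power3_eq_cube)
      also have "ennreal \<dots> = ennreal (1 / q ^ 3) * ennreal (r\<^sup>2)"
        by (rule ennreal_mult) (use q(1) in auto)
      finally show "ennreal \<bar>1 / q\<bar> * (ennreal ((0 + 1 / q * r)\<^sup>2) * F ((0 + 1 / q * r)\<^sup>2 * (1 + s\<^sup>2 + w\<^sup>2))) =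
        ennreal (1 / q ^ 3) * (ennreal (r\<^sup>2) * F (r\<^sup>2))"
        unfolding 1 by (simp add: mult.assoc[symmetric])
    qed
    also have "\<dots> = ennreal (1 / q ^ 3) * ?I" by (rule nn_integral_cmult) measurable
    finally show "(\<integral>\<^sup>+a. ennreal (a\<^sup>2) * F (a\<^sup>2 * (1 + s\<^sup>2 + w\<^sup>2)) \<partial>lborel) =
      ennreal (1 / sqrt (1 + s\<^sup>2 + w\<^sup>2) ^ 3) * ?I" by (simp only: q_def)
  qed
  also have "\<dots> = ?K * ?I"
    by (simp add: nn_integral_multc)
  finally show ?thesis .
qed

text \<open>Both sides are radial integrals of \<open>h\<close> against the same one-dimensional
  weight, up to a constant. The constant contains the integral \<open>K\<close>, which is not
  evaluated: taking \<open>h = 1\<close> shows that the constant is 1, because the second moment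
  is.\<close>

lemma std_normal_size_bias:
  assumes h [measurable]: "h \<in> borel_measurable borel"
  shows "(\<integral>\<^sup>+a. \<integral>\<^sup>+b. \<integral>\<^sup>+c. h (a\<^sup>2 + b\<^sup>2 + c\<^sup>2) \<partial>std_normal_distribution \<partial>std_normal_distribution \<partial>std_normal_distribution) =
    (\<integral>\<^sup>+z. ennreal (z\<^sup>2) * h (z\<^sup>2) \<partial>std_normal_distribution)"
proof -
  define K where "K = (\<integral>\<^sup>+s. \<integral>\<^sup>+w. ennreal (1 / sqrt (1 + s\<^sup>2 + w\<^sup>2) ^ 3) \<partial>lborel \<partial>(lborel :: real measure))"
  let ?k = "1 / sqrt (2 * pi)"
  let ?e = "\<lambda>u. ennreal (exp (- u / 2))"
  have dens: "ennreal (std_normal_density z) = ennreal ?k * ?e (z\<^sup>2)" for z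
    unfolding std_normal_density_def by (rule ennreal_mult) auto
  have "\<exists>c. \<forall>h\<in>borel_measurable borel.
    (\<integral>\<^sup>+a. \<integral>\<^sup>+b. \<integral>\<^sup>+c. h (a\<^sup>2 + b\<^sup>2 + c\<^sup>2) \<partial>std_normal_distribution \<partial>std_normal_distribution \<partial>std_normal_distribution) =
    c * (\<integral>\<^sup>+z. ennreal (z\<^sup>2) * h (z\<^sup>2) \<partial>std_normal_distribution)"
  proof (intro exI ballI)
    fix h :: "real \<Rightarrow> ennreal" assume h [measurable]: "h \<in> borel_measurable borel"
    have "(\<integral>\<^sup>+a. \<integral>\<^sup>+b. \<integral>\<^sup>+c. h (a\<^sup>2 + b\<^sup>2 + c\<^sup>2) \<partial>std_normal_distribution \<partial>std_normal_distribution \<partial>std_normal_distribution) =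
      (\<integral>\<^sup>+a. \<integral>\<^sup>+b. \<integral>\<^sup>+c. ennreal (std_normal_density a) * (ennreal (std_normal_density b) * (ennreal (std_normal_density c) * h (a\<^sup>2 + b\<^sup>2 + c\<^sup>2))) \<partial>lborel \<partial>lborel \<partial>lborel)"
      by (simp add: nn_integral_density nn_integral_cmult)
    also have "\<dots> = (\<integral>\<^sup>+a. \<integral>\<^sup>+b. \<integral>\<^sup>+c. ennreal (?k ^ 3) * (?e (a\<^sup>2 + b\<^sup>2 + c\<^sup>2) * h (a\<^sup>2 + b\<^sup>2 + c\<^sup>2)) \<partial>lborel \<partial>lborel \<partial>lborel)"
    proof (intro nn_integral_cong)
      fix a b c :: real
      have "?e (a\<^sup>2 + b\<^sup>2 + c\<^sup>2) = ?e (a\<^sup>2) * (?e (b\<^sup>2) * ?e (c\<^sup>2))"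
        by (simp add: ennreal_mult[symmetric] exp_add[symmetric] add_divide_distrib)
      moreover have "ennreal (?k ^ 3) = ennreal ?k * (ennreal ?k * ennreal ?k)"
        by (simp add: ennreal_mult[symmetric] power3_eq_cube)
      ultimately show "ennreal (std_normal_density a) * (ennreal (std_normal_density b) * (ennreal (std_normal_density c) * h (a\<^sup>2 + b\<^sup>2 + c\<^sup>2))) =
        ennreal (?k ^ 3) * (?e (a\<^sup>2 + b\<^sup>2 + c\<^sup>2) * h (a\<^sup>2 + b\<^sup>2 + c\<^sup>2))"
        unfolding dens by (simp only: mult_ac)
    qed
    also have "\<dots> = ennreal (?k ^ 3) * (\<integral>\<^sup>+a. \<integral>\<^sup>+b. \<integral>\<^sup>+c. ?e (a\<^sup>2 + b\<^sup>2 + c\<^sup>2) * h (a\<^sup>2 + b\<^sup>2 + c\<^sup>2) \<partial>lborel \<partial>lborel \<partial>lborel)"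
      by (simp add: nn_integral_cmult)
    also have "\<dots> = ennreal (?k ^ 3) * (K * (\<integral>\<^sup>+r. ennreal (r\<^sup>2) * (?e (r\<^sup>2) * h (r\<^sup>2)) \<partial>lborel))"
      unfolding K_def by (subst nn_integral_radial_3[of "\<lambda>u. ?e u * h u"]) auto
    also have "ennreal (?k ^ 3) = ennreal (?k ^ 2) * ennreal ?k"
      by (simp add: ennreal_mult[symmetric] power3_eq_cube power2_eq_square)
    also have "ennreal (?k ^ 2) * ennreal ?k * (K * (\<integral>\<^sup>+r. ennreal (r\<^sup>2) * (?e (r\<^sup>2) * h (r\<^sup>2)) \<partial>lborel)) =
      ennreal (?k ^ 2) * K * (\<integral>\<^sup>+r. ennreal ?k * (ennreal (r\<^sup>2) * (?e (r\<^sup>2) * h (r\<^sup>2))) \<partial>lborel)"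
      by (subst nn_integral_cmult) (auto simp only: mult_ac, measurable)
    also have "(\<integral>\<^sup>+r. ennreal ?k * (ennreal (r\<^sup>2) * (?e (r\<^sup>2) * h (r\<^sup>2))) \<partial>lborel) =
      (\<integral>\<^sup>+z. ennreal (z\<^sup>2) * h (z\<^sup>2) \<partial>std_normal_distribution)"
      by (subst nn_integral_density) (auto simp only: dens mult_ac, measurable)
    finally show "(\<integral>\<^sup>+a. \<integral>\<^sup>+b. \<integral>\<^sup>+c. h (a\<^sup>2 + b\<^sup>2 + c\<^sup>2) \<partial>std_normal_distribution \<partial>std_normal_distribution \<partial>std_normal_distribution) =
      ennreal (?k ^ 2) * K * (\<integral>\<^sup>+z. ennreal (z\<^sup>2) * h (z\<^sup>2) \<partial>std_normal_distribution)" .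
  qed
  then obtain c where c: "\<forall>h\<in>borel_measurable borel.
    (\<integral>\<^sup>+a. \<integral>\<^sup>+b. \<integral>\<^sup>+c. h (a\<^sup>2 + b\<^sup>2 + c\<^sup>2) \<partial>std_normal_distribution \<partial>std_normal_distribution \<partial>std_normal_distribution) =
    c * (\<integral>\<^sup>+z. ennreal (z\<^sup>2) * h (z\<^sup>2) \<partial>std_normal_distribution)" ..
  have "c = 1"
    using bspec[OF c, of "\<lambda>_. 1"] prob_space.emeasure_space_1[OF prob_space_std_normal]
    by (simp add: std_normal_second_moment)
  thus ?thesis using bspec[OF c h] by simp
qed

lemma nn_integral_chi2_add_3:
  assumes h [measurable]: "h \<in> borel_measurable borel"
  shows "(\<integral>\<^sup>+x. h (ip (d + 3) x x) \<partial>gauss (d + 3)) =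
    (\<integral>\<^sup>+x. \<integral>\<^sup>+z. ennreal (z\<^sup>2) * h (ip d x x + z\<^sup>2) \<partial>std_normal_distribution \<partial>gauss d)"
proof -
  interpret z: prob_space std_normal_distribution by (rule prob_space_std_normal)
  define h1 where "h1 = (\<lambda>u. \<integral>\<^sup>+z. h (u + z\<^sup>2) \<partial>std_normal_distribution)"
  define h2 where "h2 = (\<lambda>u. \<integral>\<^sup>+z. h1 (u + z\<^sup>2) \<partial>std_normal_distribution)"
  have [measurable]: "h1 \<in> borel_measurable borel" unfolding h1_def by measurable
  have [measurable]: "h2 \<in> borel_measurable borel" unfolding h2_def by measurable
  have "(\<integral>\<^sup>+x. h (ip (d + 3) x x) \<partial>gauss (d + 3)) = (\<integral>\<^sup>+x. h (ip (Suc (Suc (Suc d))) x x) \<partial>gauss (Suc (Suc (Suc d))))"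
    by (simp add: numeral_3_eq_3)
  also have "\<dots> = (\<integral>\<^sup>+x. h1 (ip (Suc (Suc d)) x x) \<partial>gauss (Suc (Suc d)))"
    unfolding h1_def by (rule nn_integral_chi2_Suc) measurable
  also have "\<dots> = (\<integral>\<^sup>+x. h2 (ip (Suc d) x x) \<partial>gauss (Suc d))"
    unfolding h2_def by (rule nn_integral_chi2_Suc) measurable
  also have "\<dots> = (\<integral>\<^sup>+x. \<integral>\<^sup>+a. h2 (ip d x x + a\<^sup>2) \<partial>std_normal_distribution \<partial>gauss d)"
    by (rule nn_integral_chi2_Suc) measurable
  also have "\<dots> = (\<integral>\<^sup>+x. \<integral>\<^sup>+a. \<integral>\<^sup>+b. \<integral>\<^sup>+c. h (ip d x x + a\<^sup>2 + b\<^sup>2 + c\<^sup>2)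
      \<partial>std_normal_distribution \<partial>std_normal_distribution \<partial>std_normal_distribution \<partial>gauss d)"
    by (simp only: h2_def h1_def)
  also have "\<dots> = (\<integral>\<^sup>+x. \<integral>\<^sup>+z. ennreal (z\<^sup>2) * h (ip d x x + z\<^sup>2) \<partial>std_normal_distribution \<partial>gauss d)"
    using std_normal_size_bias[of "\<lambda>u. h (ip d x x + u)" for x] by (simp add: add.assoc)
  finally show ?thesis .
qed

text \<open>Weighting by one square replaces this square by three, that is, adds two degrees of
  freedom; each of the \<open>d\<close> squares contributes equally. The induction splits off the
  last square and applies the hypothesis to \<open>h\<close> averaged over it.\<close>

lemma chi2_size_bias:
  assumes "h \<in> borel_measurable borel"
  shows "(\<integral>\<^sup>+x. ennreal (ip d x x) * h (ip d x x) \<partial>gauss d) =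
    of_nat d * (\<integral>\<^sup>+x. h (ip (d + 2) x x) \<partial>gauss (d + 2))"
  using assms
proof (induction d arbitrary: h)
  case 0
  show ?case using gauss_0[of "\<lambda>u. ennreal u * h u"] by simp
next
  case (Suc d)
  note [measurable] = Suc.prems
  interpret z: prob_space std_normal_distribution by (rule prob_space_std_normal)
  interpret G: prob_space "gauss d" by (rule prob_space_gauss)
  interpret zG: pair_prob_space std_normal_distribution "gauss d" by unfold_locales
  have "(\<integral>\<^sup>+x. ennreal (ip (Suc d) x x) * h (ip (Suc d) x x) \<partial>gauss (Suc d)) =
    (\<integral>\<^sup>+x. \<integral>\<^sup>+z. ennreal (ip d x x + z\<^sup>2) * h (ip d x x + z\<^sup>2) \<partial>std_normal_distribution \<partial>gauss d)"
    by (rule nn_integral_chi2_Suc) measurable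
  also have "\<dots> = (\<integral>\<^sup>+x. \<integral>\<^sup>+z. ennreal (ip d x x) * h (ip d x x + z\<^sup>2) \<partial>std_normal_distribution \<partial>gauss d) +
      (\<integral>\<^sup>+x. \<integral>\<^sup>+z. ennreal (z\<^sup>2) * h (ip d x x + z\<^sup>2) \<partial>std_normal_distribution \<partial>gauss d)"
    by (simp add: ennreal_plus distrib_right nn_integral_add)
  also have "(\<integral>\<^sup>+x. \<integral>\<^sup>+z. ennreal (ip d x x) * h (ip d x x + z\<^sup>2) \<partial>std_normal_distribution \<partial>gauss d) =
    (\<integral>\<^sup>+x. ennreal (ip d x x) * (\<integral>\<^sup>+z. h (ip d x x + z\<^sup>2) \<partial>std_normal_distribution) \<partial>gauss d)"
    by (simp add: nn_integral_cmult)
  also have "\<dots> = of_nat d * (\<integral>\<^sup>+x. \<integral>\<^sup>+z. h (ip (d + 2) x x + z\<^sup>2) \<partial>std_normal_distribution \<partial>gauss (d + 2))"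
    by (rule Suc.IH[of "\<lambda>u. \<integral>\<^sup>+z. h (u + z\<^sup>2) \<partial>std_normal_distribution"]) measurable
  also have "(\<integral>\<^sup>+x. \<integral>\<^sup>+z. h (ip (d + 2) x x + z\<^sup>2) \<partial>std_normal_distribution \<partial>gauss (d + 2)) =
    (\<integral>\<^sup>+x. h (ip (d + 3) x x) \<partial>gauss (d + 3))"
    using nn_integral_chi2_Suc[OF Suc.prems, of "d + 2"] by (simp add: numeral_3_eq_3)
  also have "(\<integral>\<^sup>+x. \<integral>\<^sup>+z. ennreal (z\<^sup>2) * h (ip d x x + z\<^sup>2) \<partial>std_normal_distribution \<partial>gauss d) =
    (\<integral>\<^sup>+x. h (ip (d + 3) x x) \<partial>gauss (d + 3))"
    by (rule nn_integral_chi2_add_3[symmetric]) (rule Suc.prems)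
  finally show ?case by (simp add: distrib_right numeral_3_eq_3 add.commute)
qed

lemma nn_integral_gauss_split:
  assumes "case_prod h \<in> borel_measurable (borel \<Otimes>\<^sub>M borel)"
  shows "(\<integral>\<^sup>+z. h (\<Sum>i<d. (z i)\<^sup>2) (\<Sum>i=d..<d+N. (z i)\<^sup>2) \<partial>gauss (d + N)) =
    (\<integral>\<^sup>+x. \<integral>\<^sup>+y. h (ip d x x) (ip N y y) \<partial>gauss N \<partial>gauss d)"
  using assms
proof (induction N arbitrary: h)
  case 0
  have "(\<integral>\<^sup>+y. h u (ip 0 y y) \<partial>gauss 0) = h u 0" for u by (rule gauss_0)
  thus ?case by (simp add: ip_self)
next
  case (Suc N)
  have [measurable]: "(\<lambda>w. h (f w) (g w)) \<in> borel_measurable M"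
    if [measurable]: "f \<in> borel_measurable M" "g \<in> borel_measurable M" for f g and M :: "'b measure"
    using measurable_compose[OF measurable_Pair[OF that] Suc.prems] by simp
  interpret z: prob_space std_normal_distribution by (rule prob_space_std_normal)
  define h1 where "h1 = (\<lambda>u v. \<integral>\<^sup>+t. h u (v + t\<^sup>2) \<partial>std_normal_distribution)"
  have m: "case_prod h1 \<in> borel_measurable (borel \<Otimes>\<^sub>M borel)"
    unfolding h1_def split_def by measurable
  have "(\<integral>\<^sup>+z. h (\<Sum>i<d. (z i)\<^sup>2) (\<Sum>i=d..<d+Suc N. (z i)\<^sup>2) \<partial>gauss (d + Suc N)) =
    (\<integral>\<^sup>+x. \<integral>\<^sup>+t. h (\<Sum>i<d. ((x(d+N := t)) i)\<^sup>2) (\<Sum>i=d..<d+Suc N. ((x(d+N := t)) i)\<^sup>2) \<partial>std_normal_distribution \<partial>gauss (d + N))"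
    unfolding add_Suc_right by (rule nn_integral_gauss_Suc) measurable
  also have "\<dots> = (\<integral>\<^sup>+x. h1 (\<Sum>i<d. (x i)\<^sup>2) (\<Sum>i=d..<d+N. (x i)\<^sup>2) \<partial>gauss (d + N))"
    by (simp add: h1_def cong: sum.cong_simp)
  also have "\<dots> = (\<integral>\<^sup>+x. \<integral>\<^sup>+y. h1 (ip d x x) (ip N y y) \<partial>gauss N \<partial>gauss d)"
    by (rule Suc.IH[OF m])
  also have "\<dots> = (\<integral>\<^sup>+x. \<integral>\<^sup>+y. h (ip d x x) (ip (Suc N) y y) \<partial>gauss (Suc N) \<partial>gauss d)"
    unfolding h1_def by (intro nn_integral_cong nn_integral_chi2_Suc[symmetric]) measurable
  finally show ?case .
qed

section \<open>Mean positive part of a difference of chi-squared variables\<close>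

lemma chi2_mean: "(\<integral>\<^sup>+x. ennreal (ip d x x) \<partial>gauss d) = of_nat d"
  using chi2_size_bias[of "\<lambda>_. 1" d] prob_space.emeasure_space_1[OF prob_space_gauss[of "d + 2"]] by simp

lemma AE_chi2_pos:
  assumes "0 < N"
  shows "AE y in gauss N. 0 < ip N y y"
proof -
  have "AE z in std_normal_distribution. z \<noteq> (0::real)"
    using AE_lborel_singleton[of "0::real"] by (subst AE_density) auto
  hence "AE z in distr (gauss N) std_normal_distribution (\<lambda>x. x 0). z \<noteq> 0"
    unfolding distr_gauss_component[OF assms] .
  hence "AE y in gauss N. y (0::nat) \<noteq> 0"
    by (rule AE_distrD[rotated]) (use assms in simp)
  thus ?thesis
  proof eventually_elim
    fix y :: "nat \<Rightarrow> real" assume "y 0 \<noteq> 0"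
    hence "ip N y y \<noteq> 0" using assms by (auto simp: ip_self_eq_0)
    thus "0 < ip N y y" using ip_nonneg[of N y] by linarith
  qed
qed

text \<open>\<open>ennreal\<close> sends negative numbers to 0, so this is the mean of the positive
  part of U - y V for independent chi-squared U and V.\<close>

definition chi2_excess :: "nat \<Rightarrow> nat \<Rightarrow> real \<Rightarrow> ennreal" where
  "chi2_excess d N y = (\<integral>\<^sup>+z. ennreal ((\<Sum>i<d. (z i)\<^sup>2) - y * (\<Sum>i=d..<d+N. (z i)\<^sup>2)) \<partial>gauss (d + N))"

lemma chi2_excess_split:
  "chi2_excess d N y = (\<integral>\<^sup>+x. \<integral>\<^sup>+w. ennreal (ip d x x - y * ip N w w) \<partial>gauss N \<partial>gauss d)"
  unfolding chi2_excess_def by (rule nn_integral_gauss_split) measurable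

lemma chi2_excess_antimono:
  assumes "y \<le> y'" shows "chi2_excess d N y' \<le> chi2_excess d N y"
  unfolding chi2_excess_def using assms
  by (intro nn_integral_mono ennreal_leI diff_left_mono mult_right_mono sum_nonneg) auto

lemma chi2_excess_0: "chi2_excess d N 0 = of_nat d"
  unfolding chi2_excess_split
  using prob_space.emeasure_space_1[OF prob_space_gauss[of N]] by (simp add: chi2_mean)

lemma chi2_excess_finite:
  assumes "0 \<le> y" shows "chi2_excess d N y \<noteq> \<infinity>"
proof -
  have "chi2_excess d N y \<le> of_nat d" using chi2_excess_antimono[OF assms, of d N] by (simp add: chi2_excess_0)
  also have "\<dots> < \<infinity>" by (simp add: of_nat_less_top)
  finally show ?thesis by simp
qed

text \<open>The positive part changes by at most (y' - y) V, and V has mean \<open>N\<close>.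
  Continuity in \<open>y\<close> is wanted for the intermediate value theorem.\<close>

lemma chi2_excess_lipschitz:
  assumes "0 \<le> y" "y \<le> y'"
  shows "chi2_excess d N y \<le> chi2_excess d N y' + ennreal (y' - y) * of_nat N"
proof -
  interpret G: prob_space "gauss N" by (rule prob_space_gauss)
  have "chi2_excess d N y \<le> (\<integral>\<^sup>+x. \<integral>\<^sup>+w. ennreal (ip d x x - y' * ip N w w) + ennreal (y' - y) * ennreal (ip N w w) \<partial>gauss N \<partial>gauss d)"
    unfolding chi2_excess_split
  proof (intro nn_integral_mono)
    fix x w
    have "ennreal (ip d x x - y * ip N w w) \<le> ennreal (max 0 (ip d x x - y' * ip N w w) + (y' - y) * ip N w w)"
      using assms by (intro ennreal_leI) (auto simp: algebra_simps max_def)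
    also have "\<dots> = ennreal (ip d x x - y' * ip N w w) + ennreal (y' - y) * ennreal (ip N w w)"
      using assms by (simp add: ennreal_plus ennreal_mult ennreal_max_0)
    finally show "ennreal (ip d x x - y * ip N w w) \<le> ennreal (ip d x x - y' * ip N w w) + ennreal (y' - y) * ennreal (ip N w w)" .
  qed
  also have "\<dots> = chi2_excess d N y' + ennreal (y' - y) * of_nat N"
    unfolding chi2_excess_split
    using prob_space.emeasure_space_1[OF prob_space_gauss[of d]]
    by (simp add: nn_integral_add nn_integral_cmult chi2_mean)
  finally show ?thesis .
qed

text \<open>V is positive almost surely, so the positive part is eventually 0 as \<open>k\<close>
  grows; U dominates, first in the inner and then in the outer integral.\<close>

lemma chi2_excess_tendsto_0:
  assumes "0 < N"
  shows "(\<lambda>k. chi2_excess d N (real k)) \<longlonglongrightarrow> 0"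
proof -
  interpret G: prob_space "gauss N" by (rule prob_space_gauss)
  interpret D: prob_space "gauss d" by (rule prob_space_gauss)
  let ?f = "\<lambda>k x. \<integral>\<^sup>+w. ennreal (ip d x x - real k * ip N w w) \<partial>gauss N"
  have inner: "(\<lambda>k. ?f k x) \<longlonglongrightarrow> 0" for x
  proof -
    have "(\<lambda>k. \<integral>\<^sup>+w. ennreal (ip d x x - real k * ip N w w) \<partial>gauss N) \<longlonglongrightarrow> (\<integral>\<^sup>+w. 0 \<partial>gauss N)"
    proof (rule nn_integral_dominated_convergence[where w = "\<lambda>_. ennreal (ip d x x)"])
      show "AE w in gauss N. (\<lambda>k. ennreal (ip d x x - real k * ip N w w)) \<longlonglongrightarrow> 0"
        using AE_chi2_pos[OF assms]
      proof eventually_elim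
        fix w assume w: "0 < ip N w w"
        have "\<forall>\<^sub>F k in sequentially. ip d x x / ip N w w \<le> real k"
          using filterlim_real_sequentially by (auto simp: filterlim_at_top)
        hence "\<forall>\<^sub>F k in sequentially. ennreal (ip d x x - real k * ip N w w) = 0"
          by eventually_elim (use w in \<open>simp add: field_simps ennreal_eq_0_iff\<close>)
        thus "(\<lambda>k. ennreal (ip d x x - real k * ip N w w)) \<longlonglongrightarrow> 0"
          by (rule tendsto_eventually)
      qed
    qed (auto intro!: ennreal_leI simp: G.emeasure_space_1)
    thus ?thesis by simp
  qed
  have "(\<lambda>k. \<integral>\<^sup>+x. ?f k x \<partial>gauss d) \<longlonglongrightarrow> (\<integral>\<^sup>+x. 0 \<partial>gauss d)"
  proof (rule nn_integral_dominated_convergence[where w = "\<lambda>x. ennreal (ip d x x)"])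
    show "AE x in gauss d. ?f k x \<le> ennreal (ip d x x)" for k
    proof (rule AE_I2)
      fix x
      have "?f k x \<le> (\<integral>\<^sup>+w. ennreal (ip d x x) \<partial>gauss N)"
        by (intro nn_integral_mono ennreal_leI) simp
      thus "?f k x \<le> ennreal (ip d x x)" by (simp add: G.emeasure_space_1)
    qed
  qed (auto simp: chi2_mean inner of_nat_less_top)
  thus ?thesis by (simp add: chi2_excess_split)
qed

text \<open>The excess runs continuously from \<open>d\<close> at 0 down to arbitrarily small
  values.\<close>

lemma chi2_excess_onto:
  assumes N: "0 < N" and t: "0 < t" "t \<le> real d"
  obtains y where "0 \<le> y" "chi2_excess d N y = ennreal t"
proof -
  define g where "g = (\<lambda>y. enn2real (chi2_excess d N y))"
  have eg: "chi2_excess d N y = ennreal (g y)" if "0 \<le> y" for y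
    using chi2_excess_finite[OF that, of d N] by (simp add: g_def less_top)
  have g0: "0 \<le> g y" for y by (simp add: g_def)
  have "\<forall>\<^sub>F k in sequentially. chi2_excess d N (real k) < ennreal t"
    using chi2_excess_tendsto_0[OF N, of d] t by (intro order_tendstoD) auto
  then obtain k where k: "chi2_excess d N (real k) < ennreal t"
    by (auto simp: eventually_sequentially)
  have lip: "\<bar>g y - g y'\<bar> \<le> real N * \<bar>y - y'\<bar>" if "0 \<le> y" "0 \<le> y'" for y y'
  proof -
    have *: "\<bar>g y - g y'\<bar> \<le> real N * (y' - y)" if y: "0 \<le> y" "y \<le> y'" for y y'
    proof -
      have "ennreal (g y) \<le> ennreal (g y') + ennreal (y' - y) * of_nat N"
        using chi2_excess_lipschitz[OF y, of d N] y by (simp add: eg)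
      also have "\<dots> = ennreal (g y' + (y' - y) * real N)"
        using y g0 by (simp add: ennreal_plus ennreal_mult ennreal_of_nat_eq_real_of_nat)
      finally have "g y \<le> g y' + (y' - y) * real N"
        using y g0[of y'] by (subst (asm) ennreal_le_iff) auto
      moreover have "g y' \<le> g y"
        using chi2_excess_antimono[OF y(2), of d N] y g0 by (simp add: eg)
      ultimately show ?thesis by (simp add: mult.commute)
    qed
    show ?thesis
      using *[of y y'] *[of y' y] that by (cases "y \<le> y'") (auto simp: abs_minus_commute)
  qed
  have "continuous_on {0..real k} g"
  proof (rule lipschitz_on_continuous_on[of "real N"], rule lipschitz_onI)
    fix x y :: real assume "x \<in> {0..real k}" "y \<in> {0..real k}"
    thus "dist (g x) (g y) \<le> real N * dist x y"
      using lip[of x y] by (simp add: dist_real_def)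
  qed simp
  moreover have "g (real k) \<le> t" using k by (simp add: eg ennreal_less_iff g0)
  moreover have "t \<le> g 0" using t by (simp add: g_def chi2_excess_0)
  ultimately obtain y where "0 \<le> y" "g y = t"
    using IVT2'[of g "real k" t 0] by auto
  with that eg show thesis by auto
qed

text \<open>The threshold of the Fisher variable enters through its translation into
  \<open>y * v \<le> u\<close>, asked for positive v only: V = 0, where the quotient degenerates, is
  a null event.\<close>

lemma nn_integral_indicator_fisher:
  assumes N: "0 < N" and c: "\<And>u v. 0 \<le> u \<Longrightarrow> 0 < v \<Longrightarrow> c \<le> (u / real d) / (v / real N) \<longleftrightarrow> y * v \<le> u"
  shows "ennreal (measure (fisher_dist d N) {c..}) =
    (\<integral>\<^sup>+x. \<integral>\<^sup>+w. indicator {w. y * ip N w w \<le> ip d x x} w \<partial>gauss N \<partial>gauss d)"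
proof -
  interpret G: prob_space "gauss (d + N)" by (rule prob_space_gauss)
  let ?q = "\<lambda>z. ((\<Sum>i<d. (z i)\<^sup>2) / d) / ((\<Sum>i=d..<d + N. (z i)\<^sup>2) / N)"
  have m: "?q \<in> borel_measurable (gauss (d + N))" by measurable
  interpret F: prob_space "fisher_dist d N"
    unfolding fisher_dist_def by (rule G.prob_space_distr[OF m])
  have "sets (fisher_dist d N) = sets borel" by (simp add: fisher_dist_def)
  hence "ennreal (measure (fisher_dist d N) {c..}) = (\<integral>\<^sup>+q. indicator {c..} q \<partial>fisher_dist d N)"
    by (subst nn_integral_indicator) (auto simp: F.emeasure_eq_measure)
  also have "\<dots> = (\<integral>\<^sup>+z. indicator {c..} (?q z) \<partial>gauss (d + N))"
    unfolding fisher_dist_def by (rule nn_integral_distr[OF m]) simp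
  also have "\<dots> = (\<integral>\<^sup>+x. \<integral>\<^sup>+w. indicator {c..} ((ip d x x / d) / (ip N w w / N)) \<partial>gauss N \<partial>gauss d)"
    by (rule nn_integral_gauss_split[of "\<lambda>u v. indicator {c..} ((u / d) / (v / N))"]) measurable
  also have "\<dots> = (\<integral>\<^sup>+x. \<integral>\<^sup>+w. indicator {w. y * ip N w w \<le> ip d x x} w \<partial>gauss N \<partial>gauss d)"
  proof (rule nn_integral_cong, rule nn_integral_cong_AE)
    fix x
    show "AE w in gauss N. indicator {c..} ((ip d x x / d) / (ip N w w / N)) =
      (indicator {w. y * ip N w w \<le> ip d x x} w :: ennreal)"
      using AE_chi2_pos[OF N]
    proof eventually_elim
      fix w assume "0 < ip N w w"
      from c[OF ip_nonneg this, of d x]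
      show "indicator {c..} ((ip d x x / d) / (ip N w w / N)) =
        (indicator {w. y * ip N w w \<le> ip d x x} w :: ennreal)"
        by (simp only: indicator_def atLeast_iff mem_Collect_eq)
    qed
  qed
  finally show ?thesis .
qed

text \<open>On the event y V \<le> U the positive part is U - y V. Size-biasing turns the weights U
  and V into two additional degrees of freedom each, which explains the parameters
  \<open>d + 2\<close> and \<open>N + 2\<close> of the two Fisher laws, with x = y N.\<close>

lemma Dkhi_chi2_excess:
  assumes d: "0 < d" and N: "0 < N" and x: "0 \<le> x"
  shows "ennreal (real d * Dkhi d N x) = chi2_excess d N (x / real N)" "0 \<le> Dkhi d N x"
proof -
  define y where "y = x / real N"
  have y: "0 \<le> y" using x by (simp add: y_def)
  interpret D: prob_space "gauss d" by (rule prob_space_gauss)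
  interpret G: prob_space "gauss N" by (rule prob_space_gauss)
  interpret G2: prob_space "gauss (N + 2)" by (rule prob_space_gauss)
  let ?I = "\<lambda>u v. indicator {(u, v). y * v \<le> u} (u, v) :: ennreal"
  define A where "A = (\<integral>\<^sup>+x. \<integral>\<^sup>+w. ennreal (ip d x x) * ?I (ip d x x) (ip N w w) \<partial>gauss N \<partial>gauss d)"
  define B where "B = (\<integral>\<^sup>+x. \<integral>\<^sup>+w. ennreal (ip N w w) * ?I (ip d x x) (ip N w w) \<partial>gauss N \<partial>gauss d)"
  have Im [measurable]: "(\<lambda>w. ?I (f w) (g w)) \<in> borel_measurable M"
    if [measurable]: "f \<in> borel_measurable M" "g \<in> borel_measurable M" for f g and M :: "'b measure"
    by measurable
  have "ennreal (real d * measure (fisher_dist (d + 2) N) {x / (real d + 2)..}) =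
    of_nat d * (\<integral>\<^sup>+x. \<integral>\<^sup>+w. indicator {w. y * ip N w w \<le> ip (d + 2) x x} w \<partial>gauss N \<partial>gauss (d + 2))"
  proof (subst nn_integral_indicator_fisher[symmetric, OF N, of "x / (real d + 2)"])
    show "x / (real d + 2) \<le> u / real (d + 2) / (v / real N) \<longleftrightarrow> y * v \<le> u" if "0 \<le> u" "0 < v" for u v
    proof -
      have "u / real (d + 2) / (v / real N) = 1 / (real d + 2) * (u * real N / v)"
        "x / (real d + 2) = 1 / (real d + 2) * x"
        by simp_all
      moreover have "0 < 1 / (real d + 2)" by simp
      ultimately have "x / (real d + 2) \<le> u / real (d + 2) / (v / real N) \<longleftrightarrow> x \<le> u * real N / v"
        by (simp only: mult_le_cancel_left_pos)
      also have "\<dots> \<longleftrightarrow> y * v \<le> u" using that N by (simp add: y_def field_simps)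
      finally show ?thesis .
    qed
  qed (simp add: ennreal_mult ennreal_of_nat_eq_real_of_nat)
  also have "(\<integral>\<^sup>+x. \<integral>\<^sup>+w. indicator {w. y * ip N w w \<le> ip (d + 2) x x} w \<partial>gauss N \<partial>gauss (d + 2)) =
    (\<integral>\<^sup>+x. (\<lambda>u. \<integral>\<^sup>+w. ?I u (ip N w w) \<partial>gauss N) (ip (d + 2) x x) \<partial>gauss (d + 2))"
    by (simp add: indicator_def)
  also have "of_nat d * \<dots> = (\<integral>\<^sup>+x. ennreal (ip d x x) * (\<lambda>u. \<integral>\<^sup>+w. ?I u (ip N w w) \<partial>gauss N) (ip d x x) \<partial>gauss d)"
    by (rule chi2_size_bias[symmetric]) measurable
  also have "\<dots> = A"
    unfolding A_def by (intro nn_integral_cong nn_integral_cmult[symmetric]) measurable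
  finally have A: "ennreal (real d * measure (fisher_dist (d + 2) N) {x / (real d + 2)..}) = A" .
  have "ennreal (x * measure (fisher_dist d (N + 2)) {(real N + 2) / (real N * real d) * x..}) =
    ennreal x * (\<integral>\<^sup>+x. \<integral>\<^sup>+w. indicator {w. y * ip (N + 2) w w \<le> ip d x x} w \<partial>gauss (N + 2) \<partial>gauss d)"
  proof (subst nn_integral_indicator_fisher[symmetric, of _ "(real N + 2) / (real N * real d) * x"])
    show "(real N + 2) / (real N * real d) * x \<le> u / real d / (v / real (N + 2)) \<longleftrightarrow> y * v \<le> u" if "0 \<le> u" "0 < v" for u v
    proof -
      have "u / real d / (v / real (N + 2)) = (real N + 2) / (real N * real d) * (u * real N / v)"
        using that N d by (simp add: field_simps)
      moreover have "0 < (real N + 2) / (real N * real d)" using N d by simp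
      ultimately have "(real N + 2) / (real N * real d) * x \<le> u / real d / (v / real (N + 2)) \<longleftrightarrow> x \<le> u * real N / v"
        by (simp only: mult_le_cancel_left_pos)
      also have "\<dots> \<longleftrightarrow> y * v \<le> u" using that N by (simp add: y_def field_simps)
      finally show ?thesis .
    qed
  qed (use x in \<open>simp_all add: ennreal_mult\<close>)
  also have "\<dots> = ennreal x * (\<integral>\<^sup>+x. \<integral>\<^sup>+w. ?I (ip d x x) (ip (N + 2) w w) \<partial>gauss (N + 2) \<partial>gauss d)"
    by (simp add: indicator_def)
  also have "\<dots> = ennreal y * (\<integral>\<^sup>+x. of_nat N * (\<integral>\<^sup>+w. ?I (ip d x x) (ip (N + 2) w w) \<partial>gauss (N + 2)) \<partial>gauss d)"
  proof -
    have "ennreal x = ennreal y * of_nat N"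
      using N x by (simp add: y_def ennreal_of_nat_eq_real_of_nat flip: ennreal_mult)
    moreover have "(\<lambda>x. \<integral>\<^sup>+w. ?I (ip d x x) (ip (N + 2) w w) \<partial>gauss (N + 2)) \<in> borel_measurable (gauss d)"
      by measurable
    ultimately show ?thesis by (simp only: nn_integral_cmult mult.assoc)
  qed
  also have "\<dots> = ennreal y * B"
    unfolding B_def
    by (intro arg_cong2[of _ _ _ _ "(*)"] refl nn_integral_cong chi2_size_bias[symmetric]) measurable
  finally have B: "ennreal (x * measure (fisher_dist d (N + 2)) {(real N + 2) / (real N * real d) * x..}) = ennreal y * B" .
  \<comment> \<open>Written as a sum, because subtraction in \<open>ennreal\<close> is
    truncated.\<close>
  have "chi2_excess d N y + ennreal y * B =
    (\<integral>\<^sup>+x. \<integral>\<^sup>+w. ennreal (ip d x x - y * ip N w w) + ennreal y * (ennreal (ip N w w) * ?I (ip d x x) (ip N w w)) \<partial>gauss N \<partial>gauss d)"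
    unfolding chi2_excess_split B_def by (simp add: nn_integral_add nn_integral_cmult)
  also have "\<dots> = A"
    unfolding A_def
  proof (intro nn_integral_cong)
    fix x w
    have e: "ennreal y * ennreal (ip N w w) = ennreal (y * ip N w w)" using y by (simp add: ennreal_mult)
    show "ennreal (ip d x x - y * ip N w w) + ennreal y * (ennreal (ip N w w) * ?I (ip d x x) (ip N w w)) =
      ennreal (ip d x x) * ?I (ip d x x) (ip N w w)"
      using y by (cases "y * ip N w w \<le> ip d x x")
        (auto simp: mult.assoc[symmetric] e ennreal_eq_0_iff simp flip: ennreal_plus)
  qed
  finally have AB: "chi2_excess d N y + ennreal y * B = A" .
  let ?a = "real d * measure (fisher_dist (d + 2) N) {x / (real d + 2)..}"
  let ?b = "x * measure (fisher_dist d (N + 2)) {(real N + 2) / (real N * real d) * x..}"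
  have dD: "real d * Dkhi d N x = ?a - ?b"
    using d by (simp add: Dkhi_def algebra_simps)
  have b0: "0 \<le> ?b" and a0: "0 \<le> ?a" using x by simp_all
  obtain g where g: "0 \<le> g" "chi2_excess d N y = ennreal g"
    using chi2_excess_finite[OF y, of d N] by (cases "chi2_excess d N y") auto
  have "ennreal (g + ?b) = ennreal ?a"
    using AB unfolding A[symmetric] B[symmetric] g(2) using g(1) b0 by (simp add: ennreal_plus)
  hence "g + ?b = ?a" using g(1) b0 a0 by (subst (asm) ennreal_inj) auto
  hence "real d * Dkhi d N x = g" by (simp add: dD)
  thus "ennreal (real d * Dkhi d N x) = chi2_excess d N (x / real N)" "0 \<le> Dkhi d N x"
    using g d by (auto simp: y_def zero_le_mult_iff)
qed

text \<open>\<open>inv_into\<close> returns a preimage once \<open>q\<close> is known to lie in the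
  range, and the intermediate value theorem provides a point where the excess is
  \<open>d * q\<close>.\<close>

lemma EDkhi_chi2_excess:
  assumes d: "0 < d" and N: "0 < N" and q: "0 < q" "q \<le> 1"
  shows "0 \<le> EDkhi d N q" "chi2_excess d N (EDkhi d N q / real N) = ennreal (real d * q)"
proof -
  obtain y where y: "0 \<le> y" "chi2_excess d N y = ennreal (real d * q)"
    using chi2_excess_onto[of N "real d * q" d] assms by auto
  have "ennreal (real d * Dkhi d N (y * real N)) = ennreal (real d * q)"
    using Dkhi_chi2_excess(1)[OF d N, of "y * real N"] y N by simp
  hence "real d * Dkhi d N (y * real N) = real d * q"
    using Dkhi_chi2_excess(2)[OF d N, of "y * real N"] y q by (subst (asm) ennreal_inj) auto
  hence "Dkhi d N (y * real N) = q" using d by simp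
  hence im: "q \<in> Dkhi d N ` {0..}" using y by (intro image_eqI[of _ _ "y * real N"]) auto
  show 1: "0 \<le> EDkhi d N q" using inv_into_into[OF im] by (simp add: EDkhi_def)
  have "Dkhi d N (EDkhi d N q) = q" using f_inv_into_f[OF im] by (simp add: EDkhi_def)
  thus "chi2_excess d N (EDkhi d N q / real N) = ennreal (real d * q)"
    using Dkhi_chi2_excess(1)[OF d N 1] by simp
qed

section \<open>Distances to random subspaces\<close>

abbreviation nsq :: "nat \<Rightarrow> (nat \<Rightarrow> real) \<Rightarrow> real" where
  "nsq n x \<equiv> ip n x x"

text \<open>An infimum over coefficients instead of a projection: it makes sense for dependent
  \<open>w\<close>, and upper bounds follow by exhibiting one \<open>c\<close>.\<close>

definition dist2 :: "nat \<Rightarrow> nat \<Rightarrow> (nat \<Rightarrow> nat \<Rightarrow> real) \<Rightarrow> (nat \<Rightarrow> real) \<Rightarrow> real" where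
  "dist2 n d w z = (INF c. nsq n (\<lambda>k. z k - (\<Sum>l<d. c l * w l k)))"

lemma bdd_below_dist2: "bdd_below (range (\<lambda>c. nsq n (\<lambda>k. z k - (\<Sum>l<d. c l * w l k))))"
  by (rule bdd_belowI2[of _ 0]) simp

lemma dist2_le: "dist2 n d w z \<le> nsq n (\<lambda>k. z k - (\<Sum>l<d. c l * w l k))"
  unfolding dist2_def by (rule cINF_lower[OF bdd_below_dist2]) simp

lemma dist2_greatest:
  "(\<And>c. b \<le> nsq n (\<lambda>k. z k - (\<Sum>l<d. c l * w l k))) \<Longrightarrow> b \<le> dist2 n d w z"
  unfolding dist2_def by (rule cINF_greatest) auto

lemma dist2_cong:
  assumes "\<And>k. k < n \<Longrightarrow> z k = z' k" "\<And>l k. l < d \<Longrightarrow> k < n \<Longrightarrow> w l k = w' l k"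
  shows "dist2 n d w z = dist2 n d w' z'"
proof -
  have "nsq n (\<lambda>k. z k - (\<Sum>l<d. c l * w l k)) = nsq n (\<lambda>k. z' k - (\<Sum>l<d. c l * w' l k))" for c
    by (intro ip_cong) (simp_all add: assms)
  thus ?thesis by (simp add: dist2_def)
qed

lemma mv_diff_sum: "mv n t (\<lambda>k. z k - (\<Sum>l<(d::nat). c l * w l k)) i = mv n t z i - (\<Sum>l<d. c l * mv n t (w l) i)"
proof (induction d)
  case 0
  show ?case by simp
next
  case (Suc d)
  have "mv n t (\<lambda>k. z k - (\<Sum>l<Suc d. c l * w l k)) i =
    mv n t (\<lambda>k. (z k - (\<Sum>l<d. c l * w l k)) - c d * w d k) i"
    by (simp add: algebra_simps)
  also have "\<dots> = mv n t (\<lambda>k. z k - (\<Sum>l<d. c l * w l k)) i - c d * mv n t (w d) i"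
    unfolding mv_diff mv_scale ..
  finally show ?case using Suc.IH by simp
qed

lemma sum_split_at: "e \<le> (n::nat) \<Longrightarrow> (\<Sum>i<n. f i) = (\<Sum>i<e. f i) + (\<Sum>i=e..<n. f i :: real)"
  using sum.atLeastLessThan_concat[of 0 e n f] by (simp add: atLeast0LessThan)

text \<open>No combination of the \<open>w l\<close> reaches the coordinates from \<open>e\<close>
  on, so that part of \<open>z\<close> survives in every residual.\<close>

lemma dist2_ge_tail:
  assumes t: "orthm n t" and e: "e \<le> n"
    and w: "\<And>l i. l < d \<Longrightarrow> e \<le> i \<Longrightarrow> i < n \<Longrightarrow> mv n t (w l) i = 0"
  shows "(\<Sum>i=e..<n. (mv n t z i)\<^sup>2) \<le> dist2 n d w z"
proof (rule dist2_greatest)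
  fix c
  let ?r = "\<lambda>k. z k - (\<Sum>l<d. c l * w l k)"
  have "(\<Sum>i=e..<n. (mv n t z i)\<^sup>2) = (\<Sum>i=e..<n. (mv n t ?r i)\<^sup>2)"
    by (intro sum.cong refl) (simp add: mv_diff_sum w)
  also have "\<dots> \<le> nsq n (mv n t ?r)"
    unfolding ip_self sum_split_at[OF e] by (simp add: sum_nonneg)
  also have "\<dots> = nsq n ?r" by (rule orthm_ip[OF t])
  finally show "(\<Sum>i=e..<n. (mv n t z i)\<^sup>2) \<le> nsq n ?r" .
qed

lemma triangular_solve:
  assumes "\<And>l. l < d \<Longrightarrow> mv n t (w l) l \<noteq> 0" "\<And>l i. l < d \<Longrightarrow> l < i \<Longrightarrow> i < n \<Longrightarrow> mv n t (w l) i = 0"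
    and "d \<le> n"
  shows "\<exists>c. \<forall>i<d. mv n t (\<lambda>k. z k - (\<Sum>l<d. c l * w l k)) i = 0"
  using assms
proof (induction d arbitrary: z)
  case 0
  show ?case by simp
next
  case (Suc d)
  define a where "a = mv n t z d / mv n t (w d) d"
  obtain c where c: "\<And>i. i < d \<Longrightarrow> mv n t (\<lambda>k. (z k - a * w d k) - (\<Sum>l<d. c l * w l k)) i = 0"
    using Suc.IH[of "\<lambda>k. z k - a * w d k"] Suc.prems by auto
  define c' where "c' = c(d := a)"
  have "(\<lambda>k. z k - (\<Sum>l<Suc d. c' l * w l k)) = (\<lambda>k. (z k - a * w d k) - (\<Sum>l<d. c l * w l k))"
    by (auto simp: c'_def algebra_simps intro!: sum.cong)
  moreover have "mv n t (\<lambda>k. (z k - a * w d k) - (\<Sum>l<d. c l * w l k)) d = 0"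
    unfolding mv_diff_sum mv_diff mv_scale using Suc.prems by (simp add: a_def)
  ultimately show ?case using c by (metis less_Suc_eq)
qed

text \<open>A triangular system with nonzero diagonal is solvable, so the first \<open>d\<close>
  coordinates of \<open>z\<close> can be removed entirely. Unlike the lower bound, this is a
  statement about linearly independent \<open>w\<close>.\<close>

lemma dist2_le_tail:
  assumes t: "orthm n t" and d: "d \<le> n"
    and w: "\<And>l i. l < d \<Longrightarrow> l < i \<Longrightarrow> i < n \<Longrightarrow> mv n t (w l) i = 0"
    and nz: "\<And>l. l < d \<Longrightarrow> mv n t (w l) l \<noteq> 0"
  shows "dist2 n d w z \<le> (\<Sum>i=d..<n. (mv n t z i)\<^sup>2)"
proof -
  obtain c where c: "\<forall>i<d. mv n t (\<lambda>k. z k - (\<Sum>l<d. c l * w l k)) i = 0"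
    using triangular_solve[OF nz w d] by blast
  let ?r = "\<lambda>k. z k - (\<Sum>l<d. c l * w l k)"
  have "dist2 n d w z \<le> nsq n (mv n t ?r)"
    using dist2_le[of n d w z c] by (simp add: orthm_ip[OF t])
  also have "\<dots> = (\<Sum>i=d..<n. (mv n t z i)\<^sup>2)"
    unfolding ip_self sum_split_at[OF d] using c by (simp add: mv_diff_sum w)
  finally show ?thesis .
qed

text \<open>Once the earlier diagonal entries are nonzero, the squared distance of
  \<open>w l\<close> to its predecessors is at most the square of its entry \<open>l\<close>.
  Positive distances express linear independence in a form that can be checked almost
  surely.\<close>

lemma triangular_diagonal_nonzero:
  assumes t: "orthm n t" and d: "d \<le> n"
    and w: "\<And>l i. l < d \<Longrightarrow> l < i \<Longrightarrow> i < n \<Longrightarrow> mv n t (w l) i = 0"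
    and pos: "\<And>l. l < d \<Longrightarrow> 0 < dist2 n l w (w l)"
  shows "l < d \<Longrightarrow> mv n t (w l) l \<noteq> 0"
proof (induction l rule: less_induct)
  case (less l)
  have "0 < dist2 n l w (w l)" using less.prems by (rule pos)
  also have "\<dots> \<le> (\<Sum>i=l..<n. (mv n t (w l) i)\<^sup>2)"
    using less d by (intro dist2_le_tail[OF t] w) auto
  also have "\<dots> = (mv n t (w l) l)\<^sup>2"
    using less.prems d by (subst sum.atLeast_Suc_lessThan) (auto simp: w)
  finally show ?case by auto
qed

lemma nsq_scale: "nsq n (\<lambda>k. a * z k) = a\<^sup>2 * nsq n z"
  by (simp add: ip_scale ip_scale_left power2_eq_square)

lemma rational_approximation: "\<exists>r. (\<forall>m. r m \<in> \<rat>) \<and> r \<longlonglongrightarrow> (x :: real)"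
proof -
  have "\<exists>q\<in>\<rat>. x < q \<and> q < x + 1 / real (Suc m)" for m
    by (rule Rats_dense_in_real) simp
  then obtain r where r: "\<And>m. r m \<in> \<rat>" "\<And>m. x < r m" "\<And>m. r m < x + 1 / real (Suc m)"
    by metis
  have "r \<longlonglongrightarrow> x"
  proof (rule tendsto_sandwich[of "\<lambda>_. x" _ _ "\<lambda>m. x + 1 / real (Suc m)"])
    show "(\<lambda>m. x + 1 / real (Suc m)) \<longlonglongrightarrow> x"
      using tendsto_add[OF tendsto_const[of x] LIMSEQ_inverse_real_of_nat] by (simp add: inverse_eq_divide)
  qed (use r in \<open>auto intro!: always_eventually less_imp_le\<close>)
  with r show ?thesis by blast
qed

text \<open>The rationals are dense and the norm is continuous in the coefficients. A countable
  infimum is measurable, and extensional functions on \<open>{..<d}\<close> make the index set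
  countable.\<close>

lemma dist2_rational:
  "dist2 n d w z = (INF c\<in>{..<d} \<rightarrow>\<^sub>E \<rat>. nsq n (\<lambda>k. z k - (\<Sum>l<d. c l * w l k)))"
proof (rule antisym)
  have ne: "({..<d} \<rightarrow>\<^sub>E (\<rat> :: real set)) \<noteq> {}" by (auto simp: PiE_eq_empty_iff)
  show "dist2 n d w z \<le> (INF c\<in>{..<d} \<rightarrow>\<^sub>E \<rat>. nsq n (\<lambda>k. z k - (\<Sum>l<d. c l * w l k)))"
    using ne by (intro cINF_greatest dist2_le)
  show "(INF c\<in>{..<d} \<rightarrow>\<^sub>E \<rat>. nsq n (\<lambda>k. z k - (\<Sum>l<d. c l * w l k))) \<le> dist2 n d w z"
  proof (rule dist2_greatest)
    fix c :: "nat \<Rightarrow> real"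
    obtain r where r: "\<And>l m. r l m \<in> \<rat>" "\<And>l. r l \<longlonglongrightarrow> c l"
      using rational_approximation[of "c l" for l] by metis
    define q where "q m = (\<lambda>l\<in>{..<d}. r l m)" for m
    have "(\<lambda>m. nsq n (\<lambda>k. z k - (\<Sum>l<d. q m l * w l k))) \<longlonglongrightarrow> nsq n (\<lambda>k. z k - (\<Sum>l<d. c l * w l k))"
      unfolding ip_def q_def by (auto intro!: tendsto_intros r)
    moreover have "(INF c\<in>{..<d} \<rightarrow>\<^sub>E \<rat>. nsq n (\<lambda>k. z k - (\<Sum>l<d. c l * w l k))) \<le>
        nsq n (\<lambda>k. z k - (\<Sum>l<d. q m l * w l k))" for m
    proof (intro cINF_lower bdd_belowI2[of _ 0])
      show "q m \<in> {..<d} \<rightarrow>\<^sub>E \<rat>"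
        unfolding q_def by (rule restrict_PiE_iff[THEN iffD2]) (simp add: r(1))
    qed simp
    ultimately show "(INF c\<in>{..<d} \<rightarrow>\<^sub>E \<rat>. nsq n (\<lambda>k. z k - (\<Sum>l<d. c l * w l k))) \<le>
        nsq n (\<lambda>k. z k - (\<Sum>l<d. c l * w l k))"
      by (intro LIMSEQ_le_const) auto
  qed
qed

lemma measurable_dist2 [measurable]:
  assumes [measurable]: "\<And>k. k < n \<Longrightarrow> (\<lambda>x. z x k) \<in> borel_measurable M"
    "\<And>l k. l < d \<Longrightarrow> k < n \<Longrightarrow> (\<lambda>x. w x l k) \<in> borel_measurable M"
  shows "(\<lambda>x. dist2 n d (w x) (z x)) \<in> borel_measurable M"
  unfolding dist2_rational
proof (rule borel_measurable_cINF_real)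
  show "countable ({..<d} \<rightarrow>\<^sub>E (\<rat> :: real set))"
    by (intro countable_PiE countable_rat) auto
  fix c
  show "(\<lambda>x. nsq n (\<lambda>k. z x k - (\<Sum>l<d. c l * w x l k))) \<in> borel_measurable M"
    unfolding ip_def by measurable
qed

text \<open>After the rotation |z|^2 = A + B with B the tail, and the squared distance is at least
  B; hence |z|^2 minus 1 + y times that distance is at most A - y B. Dependent \<open>w\<close> can
  only decrease the left-hand side.\<close>

lemma chi2_excess_projection:
  assumes d: "d \<le> n" and y: "0 \<le> y"
  shows "(\<integral>\<^sup>+z. ennreal (nsq n (\<lambda>k. a * z k) - (1 + y) * dist2 n d w (\<lambda>k. a * z k)) \<partial>gauss n)
    \<le> ennreal (a\<^sup>2) * chi2_excess d (n - d) y"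
proof -
  obtain t where t: "orthm n t" "\<And>l i. l < d \<Longrightarrow> l < i \<Longrightarrow> i < n \<Longrightarrow> mv n t (w l) i = 0"
    using triangularization[OF d, of w] by blast
  let ?h = "\<lambda>z. ennreal ((\<Sum>i<d. (z i)\<^sup>2) - y * (\<Sum>i=d..<n. (z i)\<^sup>2))"
  have "(\<integral>\<^sup>+z. ennreal (nsq n (\<lambda>k. a * z k) - (1 + y) * dist2 n d w (\<lambda>k. a * z k)) \<partial>gauss n) \<le>
    (\<integral>\<^sup>+z. ennreal (a\<^sup>2) * ?h (\<lambda>i\<in>{..<n}. mv n t z i) \<partial>gauss n)"
  proof (rule nn_integral_mono)
    fix z
    let ?B = "\<Sum>i=d..<n. (mv n t z i)\<^sup>2"
    have "(\<Sum>i=d..<n. (mv n t (\<lambda>k. a * z k) i)\<^sup>2) \<le> dist2 n d w (\<lambda>k. a * z k)"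
      using t d by (intro dist2_ge_tail) auto
    hence "a\<^sup>2 * ?B \<le> dist2 n d w (\<lambda>k. a * z k)"
      by (simp add: mv_scale power_mult_distrib sum_distrib_left)
    hence "(1 + y) * (a\<^sup>2 * ?B) \<le> (1 + y) * dist2 n d w (\<lambda>k. a * z k)"
      using y by (intro mult_left_mono) auto
    moreover have "nsq n (\<lambda>k. a * z k) = a\<^sup>2 * ((\<Sum>i<d. (mv n t z i)\<^sup>2) + ?B)"
      unfolding nsq_scale orthm_ip[OF t(1), of z z, symmetric]
      unfolding ip_self sum_split_at[OF d] ..
    ultimately have "nsq n (\<lambda>k. a * z k) - (1 + y) * dist2 n d w (\<lambda>k. a * z k) \<le>
      a\<^sup>2 * ((\<Sum>i<d. (mv n t z i)\<^sup>2) - y * ?B)"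
      by (simp add: algebra_simps)
    hence "ennreal (nsq n (\<lambda>k. a * z k) - (1 + y) * dist2 n d w (\<lambda>k. a * z k)) \<le>
      ennreal (a\<^sup>2) * ennreal ((\<Sum>i<d. (mv n t z i)\<^sup>2) - y * ?B)"
      by (subst ennreal_mult'[symmetric]) (auto intro: ennreal_leI)
    thus "ennreal (nsq n (\<lambda>k. a * z k) - (1 + y) * dist2 n d w (\<lambda>k. a * z k)) \<le>
      ennreal (a\<^sup>2) * ?h (\<lambda>i\<in>{..<n}. mv n t z i)"
      using d by simp
  qed
  also have "\<dots> = ennreal (a\<^sup>2) * (\<integral>\<^sup>+z. ?h (\<lambda>i\<in>{..<n}. mv n t z i) \<partial>gauss n)"
  proof (rule nn_integral_cmult)
    have "?h \<in> borel_measurable (\<Pi>\<^sub>M i\<in>{..<n}. borel)"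
      by (intro measurable_compose[OF _ measurable_ennreal] borel_measurable_diff borel_measurable_times
          borel_measurable_sum borel_measurable_power measurable_component_singleton borel_measurable_const)
        (use d in auto)
    moreover have "(\<lambda>z. \<lambda>i\<in>{..<n}. mv n t z i) \<in> measurable (gauss n) (\<Pi>\<^sub>M i\<in>{..<n}. borel)" by measurable
    ultimately show "(\<lambda>z. ?h (\<lambda>i\<in>{..<n}. mv n t z i)) \<in> borel_measurable (gauss n)"
      by (rule measurable_compose[rotated])
  qed
  also have "(\<integral>\<^sup>+z. ?h (\<lambda>i\<in>{..<n}. mv n t z i) \<partial>gauss n) = (\<integral>\<^sup>+z. ?h z \<partial>gauss n)"
    using d by (intro nn_integral_gauss_orthm[OF t(1)]) measurable
  also have "\<dots> = chi2_excess d (n - d) y" using d by (simp add: chi2_excess_def)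
  finally show ?thesis .
qed

lemma std_normal_affine_second_moment:
  "(\<integral>\<^sup>+z. ennreal ((b + a * z)\<^sup>2) \<partial>std_normal_distribution) = ennreal (b\<^sup>2 + a\<^sup>2)"
proof -
  have 0: "has_bochner_integral lborel (\<lambda>x. std_normal_density x) 1"
    by (simp add: has_bochner_integral_iff)
  have 1: "has_bochner_integral lborel (\<lambda>x. std_normal_density x * x) 0"
    using std_normal_moment_odd[of 0] by simp
  have 2: "has_bochner_integral lborel (\<lambda>x. std_normal_density x * x\<^sup>2) 1"
    using std_normal_moment_even[of 1] by (simp add: fact_numeral)
  have "has_bochner_integral lborel (\<lambda>x. b\<^sup>2 * std_normal_density x + (2 * a * b * (std_normal_density x * x) + a\<^sup>2 * (std_normal_density x * x\<^sup>2)))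
    (b\<^sup>2 * 1 + (2 * a * b * 0 + a\<^sup>2 * 1))"
    by (intro has_bochner_integral_add has_bochner_integral_mult_right 0 1 2)
  hence i: "has_bochner_integral lborel (\<lambda>x. std_normal_density x * (b + a * x)\<^sup>2) (b\<^sup>2 + a\<^sup>2)"
    by (simp add: power2_eq_square algebra_simps)
  have "(\<integral>\<^sup>+z. ennreal ((b + a * z)\<^sup>2) \<partial>std_normal_distribution) =
    (\<integral>\<^sup>+z. ennreal (std_normal_density z * (b + a * z)\<^sup>2) \<partial>lborel)"
    by (subst nn_integral_density) (auto simp: ennreal_mult)
  also have "\<dots> = ennreal (b\<^sup>2 + a\<^sup>2)"
    using i by (subst nn_integral_eq_integral) (auto simp: has_bochner_integral_iff)
  finally show ?thesis .
qed

text \<open>Only the \<open>n - d\<close> tail coordinates count, each contributing its squared mean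
  and the variance a^2. That all \<open>d\<close> dimensions are gained comes from the independence
  of the \<open>w l\<close>, given as positive distances to the predecessors.\<close>

lemma dist2_gauss_mean_le:
  assumes d: "d \<le> n" and pos: "\<And>l. l < d \<Longrightarrow> 0 < dist2 n l w (w l)"
  shows "(\<integral>\<^sup>+z. ennreal (dist2 n d w (\<lambda>k. g k + a * z k)) \<partial>gauss n) \<le> ennreal (nsq n g + a\<^sup>2 * (real n - real d))"
proof -
  obtain t where t: "orthm n t" "\<And>l i. l < d \<Longrightarrow> l < i \<Longrightarrow> i < n \<Longrightarrow> mv n t (w l) i = 0"
    using triangularization[OF d, of w] by blast
  note nz = triangular_diagonal_nonzero[OF t(1) d t(2) pos]
  let ?h = "\<lambda>z. ennreal (\<Sum>i=d..<n. (mv n t g i + a * z i)\<^sup>2)"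
  have "(\<integral>\<^sup>+z. ennreal (dist2 n d w (\<lambda>k. g k + a * z k)) \<partial>gauss n) \<le>
    (\<integral>\<^sup>+z. ?h (\<lambda>i\<in>{..<n}. mv n t z i) \<partial>gauss n)"
  proof (intro nn_integral_mono ennreal_leI)
    fix z
    have "dist2 n d w (\<lambda>k. g k + a * z k) \<le> (\<Sum>i=d..<n. (mv n t (\<lambda>k. g k + a * z k) i)\<^sup>2)"
      by (rule dist2_le_tail[OF t(1) d t(2) nz])
    thus "dist2 n d w (\<lambda>k. g k + a * z k) \<le> (\<Sum>i=d..<n. (mv n t g i + a * (\<lambda>i\<in>{..<n}. mv n t z i) i)\<^sup>2)"
      by (simp add: mv_add mv_scale cong: sum.cong_simp)
  qed
  also have "\<dots> = (\<integral>\<^sup>+z. ?h z \<partial>gauss n)"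
    by (intro nn_integral_gauss_orthm[OF t(1)]) measurable
  also have "\<dots> = (\<Sum>i=d..<n. \<integral>\<^sup>+z. ennreal ((mv n t g i + a * z i)\<^sup>2) \<partial>gauss n)"
    by (subst nn_integral_sum[symmetric]) (auto simp: sum_ennreal)
  also have "\<dots> = (\<Sum>i=d..<n. ennreal ((mv n t g i)\<^sup>2 + a\<^sup>2))"
  proof (intro sum.cong refl)
    fix i assume "i \<in> {d..<n}"
    hence "(\<integral>\<^sup>+z. ennreal ((mv n t g i + a * z i)\<^sup>2) \<partial>gauss n) =
      (\<integral>\<^sup>+z. ennreal ((mv n t g i + a * z)\<^sup>2) \<partial>std_normal_distribution)"
      by (intro nn_integral_gauss_component) auto
    thus "(\<integral>\<^sup>+z. ennreal ((mv n t g i + a * z i)\<^sup>2) \<partial>gauss n) = ennreal ((mv n t g i)\<^sup>2 + a\<^sup>2)"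
      by (simp add: std_normal_affine_second_moment)
  qed
  also have "\<dots> = ennreal ((\<Sum>i=d..<n. (mv n t g i)\<^sup>2) + a\<^sup>2 * (real n - real d))"
    using d by (subst sum_ennreal) (auto simp: sum.distrib of_nat_diff mult.commute)
  also have "\<dots> \<le> ennreal (nsq n g + a\<^sup>2 * (real n - real d))"
    unfolding orthm_ip[OF t(1), of g g, symmetric]
    unfolding ip_self sum_split_at[OF d]
    by (intro ennreal_leI add_right_mono) (simp add: sum_nonneg)
  finally show ?thesis .
qed

text \<open>Coordinate \<open>d\<close> of the rotated vector is not reached by the
  \<open>w l\<close> and has no atoms, so almost surely it is not 0.\<close>

lemma dist2_gauss_pos:
  assumes d: "d < n" and a: "a \<noteq> 0"
  shows "AE z in gauss n. 0 < dist2 n d w (\<lambda>k. g k + a * z k)"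
proof -
  obtain t where t: "orthm n t" "\<And>l i. l < d \<Longrightarrow> l < i \<Longrightarrow> i < n \<Longrightarrow> mv n t (w l) i = 0"
    using triangularization[of d n w] d by auto
  define b where "b = - mv n t g d / a"
  have "(\<integral>\<^sup>+z. indicator {b} (mv n t z d) \<partial>gauss n) =
    (\<integral>\<^sup>+z. (\<lambda>z. indicator {b} (z d)) (\<lambda>i\<in>{..<n}. mv n t z i) \<partial>gauss n)"
    using d by simp
  also have "\<dots> = (\<integral>\<^sup>+z. indicator {b} (z d) \<partial>gauss n)"
    using d by (intro nn_integral_gauss_orthm[OF t(1)]) measurable
  also have "\<dots> = (\<integral>\<^sup>+z. indicator {b} z \<partial>std_normal_distribution)"
    by (rule nn_integral_gauss_component[OF d]) measurable
  also have "\<dots> = 0"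
  proof -
    have "AE z in std_normal_distribution. z \<noteq> b"
      using AE_lborel_singleton[of b] by (subst AE_density) auto
    thus ?thesis by (subst nn_integral_0_iff_AE) auto
  qed
  finally have "AE z in gauss n. indicator {b} (mv n t z d) = (0 :: ennreal)"
    by (subst (asm) nn_integral_0_iff_AE) auto
  thus ?thesis
  proof eventually_elim
    fix z assume "indicator {b} (mv n t z d) = (0 :: ennreal)"
    hence "mv n t g d + a * mv n t z d \<noteq> 0"
      using a by (auto simp: b_def indicator_def field_simps split: if_splits)
    hence "0 < (mv n t (\<lambda>k. g k + a * z k) d)\<^sup>2" by (simp add: mv_add mv_scale)
    also have "\<dots> \<le> (\<Sum>i=d..<n. (mv n t (\<lambda>k. g k + a * z k) i)\<^sup>2)"
      using d by (intro member_le_sum) auto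
    also have "\<dots> \<le> dist2 n d w (\<lambda>k. g k + a * z k)"
      using t d by (intro dist2_ge_tail) auto
    finally show "0 < dist2 n d w (\<lambda>k. g k + a * z k)" .
  qed
qed

section \<open>Regression coefficients as solutions of the normal equations\<close>

lemma nn_integral_normal_dist_square:
  assumes C: "pos_def p C"
  shows "(\<integral>\<^sup>+x. ennreal ((ip p u x)\<^sup>2) \<partial>normal_dist p C) = ennreal (qf p C u u)"
proof -
  have "(\<integral>\<^sup>+x. ennreal ((ip p u x)\<^sup>2) \<partial>normal_dist p C) =
    (\<integral>\<^sup>+z. ennreal (qf p C u u * z\<^sup>2) \<partial>std_normal_distribution)"
    by (rule nn_integral_normal_dist_linear[OF C]) measurable
  also have "\<dots> = (\<integral>\<^sup>+z. ennreal (qf p C u u) * ennreal (z\<^sup>2) \<partial>std_normal_distribution)"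
    using qf_nonneg[OF C] by (simp add: ennreal_mult)
  also have "\<dots> = ennreal (qf p C u u)"
    by (subst nn_integral_cmult) (auto simp: std_normal_second_moment)
  finally show ?thesis .
qed

text \<open>Polarization of the second moments.\<close>

lemma normal_dist_covariance:
  assumes C: "pos_def p C"
  shows "has_bochner_integral (normal_dist p C) (\<lambda>x. ip p u x * ip p w x) (qf p C u w)"
proof -
  have sq: "has_bochner_integral (normal_dist p C) (\<lambda>x. (ip p u x)\<^sup>2) (qf p C u u)" for u
    by (rule has_bochner_integral_nn_integral)
      (auto simp: nn_integral_normal_dist_square[OF C] qf_nonneg[OF C])
  have "has_bochner_integral (normal_dist p C)
    (\<lambda>x. ((ip p (\<lambda>i. u i + w i) x)\<^sup>2 - (ip p (\<lambda>i. u i - w i) x)\<^sup>2) / 4)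
    ((qf p C (\<lambda>i. u i + w i) (\<lambda>i. u i + w i) - qf p C (\<lambda>i. u i - w i) (\<lambda>i. u i - w i)) / 4)"
    by (intro has_bochner_integral_divide_zero has_bochner_integral_diff sq)
  moreover have "((ip p (\<lambda>i. u i + w i) x)\<^sup>2 - (ip p (\<lambda>i. u i - w i) x)\<^sup>2) / 4 = ip p u x * ip p w x" for x
    by (simp add: ip_add_left ip_diff_left power2_eq_square algebra_simps)
  moreover have "(qf p C (\<lambda>i. u i + w i) (\<lambda>i. u i + w i) - qf p C (\<lambda>i. u i - w i) (\<lambda>i. u i - w i)) / 4 = qf p C u w"
    by (simp add: qf_linear qf_commute[OF C, of w u])
  ultimately show ?thesis by simp
qed

lemma ip_unit: "i < p \<Longrightarrow> ip p (\<lambda>k. of_bool (k = i)) x = x i"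
  by (simp add: ip_def sum_of_bool_mult)

definition noise_coeff :: "real mat \<Rightarrow> nat \<Rightarrow> nat \<Rightarrow> real" where
  "noise_coeff \<theta> j = (\<lambda>i. of_bool (i = j) - \<theta> $$ (i, j))"

text \<open>Testing the conditional expectation with x_i for i \<noteq> j shows that the residual is
  uncorrelated with the other coordinates, so \<open>C\<close> maps its coefficients to a multiple
  of e_j. Applying the inverse identifies the multiple as \<open>sigma2 C j\<close>.\<close>

lemma regression_mat_normal_equations:
  assumes C: "pos_def p C" and r: "regression_mat p C \<theta>" and j: "j < p"
  shows "\<theta> $$ (j, j) = 0" "noise_coeff \<theta> j j = 1" "0 < sigma2 C j"
    "\<And>i. i < p \<Longrightarrow> mv p (\<lambda>i k. C $$ (i, k)) (noise_coeff \<theta> j) i = sigma2 C j * of_bool (i = j)"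
proof -
  let ?N = "normal_dist p C" and ?F = "others_sigma p j" and ?J = "{..<p} - {j}"
  let ?v = "noise_coeff \<theta> j" and ?C = "\<lambda>i k. C $$ (i, k)"
  interpret N: prob_space ?N by (rule prob_space_normal_dist[OF C])
  have spaceN: "space ?N = space (\<Pi>\<^sub>M k\<in>{..<p}. (borel :: real measure))"
    by (rule sets_eq_imp_space_eq[OF sets_normal_dist])
  have res: "(\<lambda>x. restrict x ?J) \<in> measurable ?N (\<Pi>\<^sub>M k\<in>?J. borel)"
    unfolding measurable_cong_sets[OF sets_normal_dist refl]
    by (rule measurable_restrict_subset) auto
  have sub: "subalgebra ?N ?F"
    unfolding subalgebra_def others_sigma_def
  proof
    show "sets (vimage_algebra (space (\<Pi>\<^sub>M k\<in>{..<p}. borel)) (\<lambda>x. restrict x ?J) (\<Pi>\<^sub>M k\<in>?J. borel)) \<subseteq> sets ?N"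
      using measurable_sets[OF res] measurable_space[OF res]
      by (subst sets_vimage_algebra2) (auto simp: spaceN)
  qed (simp add: spaceN)
  have ipm: "(\<lambda>x. ip p u x) \<in> borel_measurable ?N" for u by measurable
  interpret F: finite_measure_subalgebra ?N ?F by unfold_locales (rule sub)
  show d: "\<theta> $$ (j, j) = 0" using r j by (simp add: regression_mat_def)
  thus vj: "?v j = 1" by (simp add: noise_coeff_def)
  have ce: "AE x in ?N. real_cond_exp ?N ?F (\<lambda>x. x j) x = ip p (\<lambda>k. \<theta> $$ (k, j)) x"
  proof -
    have "(\<Sum>k\<in>?J. \<theta> $$ (k, j) * x k) = ip p (\<lambda>k. \<theta> $$ (k, j)) x" for x
      unfolding ip_def using j d by (subst (2) sum.remove[of _ j]) auto
    moreover have "AE x in ?N. real_cond_exp ?N ?F (\<lambda>x. x j) x = (\<Sum>k\<in>?J. \<theta> $$ (k, j) * x k)"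
      using r j unfolding regression_mat_def by blast
    ultimately show ?thesis by (simp only:)
  qed
  have off: "mv p ?C ?v i = 0" if i: "i < p" "i \<noteq> j" for i
  proof -
    let ?ei = "\<lambda>k. of_bool (k = i) :: real" and ?ej = "\<lambda>k. of_bool (k = j) :: real"
    have cov: "has_bochner_integral ?N (\<lambda>x. x i * ip p w x) (qf p C ?ei w)" for w
      using normal_dist_covariance[OF C, of ?ei w] i by (simp add: ip_unit)
    have xij: "has_bochner_integral ?N (\<lambda>x. x i * x j) (qf p C ?ei ?ej)"
      using cov[of ?ej] j by (simp add: ip_unit)
    \<comment> \<open>x_i factors through the restriction to the other coordinates, whose preimages
      make up \<open>others_sigma\<close>.\<close>
    have mi: "(\<lambda>x. x i) \<in> borel_measurable ?F"
    proof -
      have "(\<lambda>x. (restrict x ?J) i) \<in> borel_measurable ?F"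
        unfolding others_sigma_def
        by (rule measurable_compose[OF measurable_vimage_algebra1 measurable_component_singleton])
          (use i in \<open>auto simp: space_PiM\<close>)
      thus ?thesis using i by simp
    qed
    have mj: "(\<lambda>x. x j) \<in> borel_measurable ?N"
      unfolding measurable_cong_sets[OF sets_normal_dist refl]
      using j by (intro measurable_component_singleton) simp
    have "(\<integral>x. x i * real_cond_exp ?N ?F (\<lambda>x. x j) x \<partial>?N) = (\<integral>x. x i * x j \<partial>?N)"
      using xij mi mj by (intro F.real_cond_exp_intg(2)) (auto simp: has_bochner_integral_iff)
    also have "\<dots> = qf p C ?ei ?ej" using xij by (simp add: has_bochner_integral_iff)
    finally have 1: "(\<integral>x. x i * real_cond_exp ?N ?F (\<lambda>x. x j) x \<partial>?N) = qf p C ?ei ?ej" .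
    have "(\<integral>x. x i * real_cond_exp ?N ?F (\<lambda>x. x j) x \<partial>?N) = (\<integral>x. x i * ip p (\<lambda>k. \<theta> $$ (k, j)) x \<partial>?N)"
    proof (rule integral_cong_AE)
      show "AE x in ?N. x i * real_cond_exp ?N ?F (\<lambda>x. x j) x = x i * ip p (\<lambda>k. \<theta> $$ (k, j)) x"
        using ce by eventually_elim simp
      have [measurable]: "(\<lambda>x. x i) \<in> borel_measurable ?N"
        unfolding measurable_cong_sets[OF sets_normal_dist refl]
        using i by (intro measurable_component_singleton) simp
      show "(\<lambda>x. x i * real_cond_exp ?N ?F (\<lambda>x. x j) x) \<in> borel_measurable ?N" by measurable
      show "(\<lambda>x. x i * ip p (\<lambda>k. \<theta> $$ (k, j)) x) \<in> borel_measurable ?N"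
        by (intro borel_measurable_times ipm) fact
    qed
    also have "\<dots> = qf p C ?ei (\<lambda>k. \<theta> $$ (k, j))"
      using cov by (simp add: has_bochner_integral_iff)
    finally have "qf p C ?ei ?v = 0"
      using 1 unfolding noise_coeff_def by (simp add: qf_linear)
    thus ?thesis using i by (simp add: qf_def ip_unit)
  qed
  define s where "s = mv p ?C ?v j"
  have Cv: "mv p ?C ?v i = s * of_bool (i = j)" if "i < p" for i
    using off[OF that] by (simp add: s_def)
  have "1 = mv p (\<lambda>i j. inv_mat C $$ (i, j)) (mv p ?C ?v) j"
    using inv_mat_mv[OF C j] vj by simp
  also have "\<dots> = mv p (\<lambda>i j. inv_mat C $$ (i, j)) (\<lambda>i. s * of_bool (i = j)) j"
    by (rule fun_cong[OF mv_cong]) (simp add: Cv)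
  also have "\<dots> = s * inv_mat C $$ (j, j)"
    using j by (simp add: mv_scale) (simp add: mv_def sum_of_bool_mult)
  finally have s: "s = sigma2 C j" unfolding sigma2_def
    by (metis mult_eq_0_iff nonzero_eq_divide_eq one_neq_zero)
  have "0 < qf p C ?v ?v" using vj j by (intro qf_pos[OF C]) force
  also have "qf p C ?v ?v = ip p ?v (\<lambda>i. s * of_bool (i = j))"
    unfolding qf_def by (intro ip_cong) (simp_all add: Cv)
  also have "\<dots> = s" unfolding ip_scale using j vj by (subst ip_commute) (simp add: ip_unit)
  finally show "0 < sigma2 C j" by (simp add: s)
  show "mv p ?C ?v i = sigma2 C j * of_bool (i = j)" if "i < p" for i
    using Cv[OF that] by (simp add: s)
qed

section \<open>Distances between the columns of the sample\<close>

lemma sets_sample_law [measurable_cong]: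
  "sets (sample_law n p C) = sets (\<Pi>\<^sub>M k\<in>{..<n}. \<Pi>\<^sub>M i\<in>{..<p}. borel)"
  unfolding sample_law_def by (intro sets_PiM_cong refl sets_normal_dist)

lemma prob_space_sample_law: "pos_def p C \<Longrightarrow> prob_space (sample_law n p C)"
  unfolding sample_law_def by (intro prob_space_PiM prob_space_normal_dist)

lemma measurable_sample_entry [measurable]:
  assumes "k < n" "i < p"
  shows "(\<lambda>x. x k i) \<in> borel_measurable (\<Pi>\<^sub>M k\<in>{..<n}. \<Pi>\<^sub>M i\<in>{..<p}. (borel :: real measure))"
proof -
  have 1: "(\<lambda>x. x k) \<in> measurable (\<Pi>\<^sub>M k\<in>{..<n}. \<Pi>\<^sub>M i\<in>{..<p}. borel :: real measure) (\<Pi>\<^sub>M i\<in>{..<p}. borel)"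
    using assms by (intro measurable_component_singleton) auto
  have 2: "(\<lambda>y. y i) \<in> borel_measurable (\<Pi>\<^sub>M i\<in>{..<p}. borel :: real measure)"
    using assms by (intro measurable_component_singleton) auto
  from measurable_compose[OF 1 2] show ?thesis .
qed

lemma measurable_sample_row [measurable]:
  assumes "k < n"
  shows "(\<lambda>x. ip p u (x k)) \<in> borel_measurable (\<Pi>\<^sub>M k\<in>{..<n}. \<Pi>\<^sub>M i\<in>{..<p}. borel)"
  unfolding ip_def using assms
  by (intro borel_measurable_sum borel_measurable_times borel_measurable_const measurable_sample_entry) auto

lemma nn_integral_sample_row:
  assumes C: "pos_def p C" and k: "k < n" and f [measurable]: "f \<in> borel_measurable (\<Pi>\<^sub>M i\<in>{..<p}. borel)"
  shows "(\<integral>\<^sup>+x. f (x k) \<partial>sample_law n p C) = (\<integral>\<^sup>+x. f x \<partial>normal_dist p C)"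
proof -
  have "distr (sample_law n p C) (normal_dist p C) (\<lambda>x. x k) = normal_dist p C"
    unfolding sample_law_def
    using k by (intro distr_PiM_component prob_space_normal_dist[OF C]) auto
  hence "(\<integral>\<^sup>+x. f x \<partial>normal_dist p C) = (\<integral>\<^sup>+x. f x \<partial>distr (sample_law n p C) (normal_dist p C) (\<lambda>x. x k))"
    by simp
  also have "\<dots> = (\<integral>\<^sup>+x. f (x k) \<partial>sample_law n p C)"
    unfolding sample_law_def using k by (intro nn_integral_distr) auto
  finally show ?thesis ..
qed

lemma sample_second_moment:
  assumes C: "pos_def p C"
  shows "(\<integral>\<^sup>+x. ennreal (nsq n (\<lambda>k. ip p u (x k))) \<partial>sample_law n p C) = ennreal (real n * qf p C u u)"
proof -
  have "(\<integral>\<^sup>+x. ennreal (nsq n (\<lambda>k. ip p u (x k))) \<partial>sample_law n p C) =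
    (\<integral>\<^sup>+x. (\<Sum>k<n. ennreal ((ip p u (x k))\<^sup>2)) \<partial>sample_law n p C)"
    by (simp add: ip_self[of n] sum_ennreal)
  also have "\<dots> = (\<Sum>k<n. \<integral>\<^sup>+x. ennreal ((ip p u (x k))\<^sup>2) \<partial>sample_law n p C)"
    by (rule nn_integral_sum) measurable
  also have "\<dots> = (\<Sum>k<n. ennreal (qf p C u u))"
    using nn_integral_sample_row[OF C, of _ n "\<lambda>y. ennreal ((ip p u y)\<^sup>2)"]
    by (simp add: nn_integral_normal_dist_square[OF C])
  also have "\<dots> = ennreal (real n * qf p C u u)"
    using qf_nonneg[OF C] by (simp add: ennreal_mult ennreal_of_nat_eq_real_of_nat)
  finally show ?thesis .
qed

context
  fixes n p j :: nat and C :: "real mat" and v :: "nat \<Rightarrow> real" and s :: real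
  assumes C: "pos_def p C" and j: "j < p" and s: "0 < s" and vj: "v j = 1"
    and Cv: "\<And>i. i < p \<Longrightarrow> mv p (\<lambda>i k. C $$ (i, k)) v i = s * of_bool (i = j)"
begin

definition redraw :: "(nat \<Rightarrow> nat \<Rightarrow> real) \<Rightarrow> (nat \<Rightarrow> real) \<Rightarrow> nat \<Rightarrow> nat \<Rightarrow> real" where
  "redraw x z = (\<lambda>k\<in>{..<n}. (x k)(j := x k j - ip p v (x k) + sqrt s * z k))"

lemmas sample_law_redraw = sample_law_resample[OF C j s vj Cv, of _ n, folded redraw_def]

lemma ip_redraw: "k < n \<Longrightarrow> ip p u (redraw x z k) = ip p u (x k) + (sqrt s * z k - ip p v (x k)) * u j"
  using ip_fun_upd[OF j, of u "x k"] by (simp add: redraw_def)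

lemma ip_redraw_noise: "k < n \<Longrightarrow> ip p v (redraw x z k) = sqrt s * z k"
  by (simp add: ip_redraw vj)

lemma ip_redraw_other: "k < n \<Longrightarrow> u j = 0 \<Longrightarrow> ip p u (redraw x z k) = ip p u (x k)"
  by (simp add: ip_redraw)

text \<open>Redraw the noise: the vectors \<open>W l\<close> have no entry at \<open>j\<close>, so
  the spanning columns stay fixed while the noise becomes a fresh Gaussian vector, and the bound for
  deterministic subspaces applies for every \<open>x\<close>.\<close>

lemma sample_chi2_excess:
  fixes W :: "nat \<Rightarrow> nat \<Rightarrow> real"
  assumes d: "d \<le> n" and y: "0 \<le> y" and W: "\<And>l. l < d \<Longrightarrow> W l j = 0"
  shows "(\<integral>\<^sup>+x. ennreal (nsq n (\<lambda>k. ip p v (x k)) -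
      (1 + y) * dist2 n d (\<lambda>l k. ip p (W l) (x k)) (\<lambda>k. ip p v (x k))) \<partial>sample_law n p C)
    \<le> ennreal s * chi2_excess d (n - d) y"
proof -
  interpret S: prob_space "sample_law n p C" by (rule prob_space_sample_law[OF C])
  let ?f = "\<lambda>x. ennreal (nsq n (\<lambda>k. ip p v (x k)) -
      (1 + y) * dist2 n d (\<lambda>l k. ip p (W l) (x k)) (\<lambda>k. ip p v (x k)))"
  have "(\<integral>\<^sup>+x. ?f x \<partial>sample_law n p C) = (\<integral>\<^sup>+x. \<integral>\<^sup>+z. ?f (redraw x z) \<partial>gauss n \<partial>sample_law n p C)"
    by (rule sample_law_redraw) measurable
  also have "\<dots> \<le> (\<integral>\<^sup>+x. ennreal s * chi2_excess d (n - d) y \<partial>sample_law n p C)"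
  proof (rule nn_integral_mono)
    fix x :: "nat \<Rightarrow> nat \<Rightarrow> real"
    have "?f (redraw x z) = ennreal (nsq n (\<lambda>k. sqrt s * z k) -
      (1 + y) * dist2 n d (\<lambda>l k. ip p (W l) (x k)) (\<lambda>k. sqrt s * z k))" for z
    proof -
      have "nsq n (\<lambda>k. ip p v (redraw x z k)) = nsq n (\<lambda>k. sqrt s * z k)"
        by (intro ip_cong ip_redraw_noise)
      moreover have "dist2 n d (\<lambda>l k. ip p (W l) (redraw x z k)) (\<lambda>k. ip p v (redraw x z k)) =
          dist2 n d (\<lambda>l k. ip p (W l) (x k)) (\<lambda>k. sqrt s * z k)"
        by (intro dist2_cong) (simp_all add: ip_redraw_noise ip_redraw_other W)
      ultimately show ?thesis by (simp only:)
    qed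
    thus "(\<integral>\<^sup>+z. ?f (redraw x z) \<partial>gauss n) \<le> ennreal s * chi2_excess d (n - d) y"
      using chi2_excess_projection[OF d y, of "sqrt s" "\<lambda>l k. ip p (W l) (x k)"] s by simp
  qed
  also have "\<dots> = ennreal s * chi2_excess d (n - d) y"
    by (simp add: S.emeasure_space_1)
  finally show ?thesis .
qed

text \<open>Given the other columns, a combination with coefficient 1 at \<open>j\<close> still
  contains the independent noise of variable \<open>j\<close>, which almost surely avoids a fixed
  affine subspace of dimension below \<open>n\<close>.\<close>

lemma sample_dist2_pos:
  fixes W :: "nat \<Rightarrow> nat \<Rightarrow> real"
  assumes d: "d < n" and W: "\<And>l. l < d \<Longrightarrow> W l j = 0" and u: "u j = 1"
  shows "AE x in sample_law n p C. 0 < dist2 n d (\<lambda>l k. ip p (W l) (x k)) (\<lambda>k. ip p u (x k))"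
proof -
  let ?f = "\<lambda>x. indicator {..0} (dist2 n d (\<lambda>l k. ip p (W l) (x k)) (\<lambda>k. ip p u (x k))) :: ennreal"
  have "(\<integral>\<^sup>+x. ?f x \<partial>sample_law n p C) = (\<integral>\<^sup>+x. \<integral>\<^sup>+z. ?f (redraw x z) \<partial>gauss n \<partial>sample_law n p C)"
    by (rule sample_law_redraw) measurable
  also have "\<dots> = (\<integral>\<^sup>+x. 0 \<partial>sample_law n p C)"
  proof (rule nn_integral_cong)
    fix x :: "nat \<Rightarrow> nat \<Rightarrow> real"
    let ?g = "\<lambda>k. ip p u (x k) - ip p v (x k)"
    have "?f (redraw x z) = indicator {..0} (dist2 n d (\<lambda>l k. ip p (W l) (x k)) (\<lambda>k. ?g k + sqrt s * z k))" for z
    proof -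
      have "dist2 n d (\<lambda>l k. ip p (W l) (redraw x z k)) (\<lambda>k. ip p u (redraw x z k)) =
          dist2 n d (\<lambda>l k. ip p (W l) (x k)) (\<lambda>k. ?g k + sqrt s * z k)"
        by (intro dist2_cong) (simp_all add: ip_redraw u W)
      thus ?thesis by (simp only:)
    qed
    moreover have "AE z in gauss n. indicator {..0} (dist2 n d (\<lambda>l k. ip p (W l) (x k)) (\<lambda>k. ?g k + sqrt s * z k)) = (0 :: ennreal)"
      using dist2_gauss_pos[OF d, of "sqrt s" "\<lambda>l k. ip p (W l) (x k)" ?g] s by (auto simp: indicator_def)
    ultimately show "(\<integral>\<^sup>+z. ?f (redraw x z) \<partial>gauss n) = 0"
      by (simp only:) (rule nn_integral_zero')
  qed
  finally have "(\<integral>\<^sup>+x. ?f x \<partial>sample_law n p C) = 0" by simp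
  hence "AE x in sample_law n p C. ?f x = 0"
    by (subst (asm) nn_integral_0_iff_AE) auto
  thus ?thesis by eventually_elim (simp add: indicator_def split: if_splits)
qed

text \<open>Given the other columns, the response is a fixed vector, the bias with coefficients
  \<delta>, plus fresh noise. The positive distances make the columns independent, so that all
  \<open>d\<close> degrees of freedom are gained.\<close>

lemma sample_dist2_mean_le:
  fixes W :: "nat \<Rightarrow> nat \<Rightarrow> real"
  assumes d: "d \<le> n" and W: "\<And>l. l < d \<Longrightarrow> W l j = 0" and \<delta>: "\<delta> j = 0"
    and pos: "\<And>l. l < d \<Longrightarrow> AE x in sample_law n p C. 0 < dist2 n l (\<lambda>l k. ip p (W l) (x k)) (\<lambda>k. ip p (W l) (x k))"
  shows "(\<integral>\<^sup>+x. ennreal (dist2 n d (\<lambda>l k. ip p (W l) (x k)) (\<lambda>k. ip p (\<lambda>i. \<delta> i + v i) (x k))) \<partial>sample_law n p C)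
    \<le> ennreal (real n * qf p C \<delta> \<delta> + s * (real n - real d))"
proof -
  interpret S: prob_space "sample_law n p C" by (rule prob_space_sample_law[OF C])
  let ?u = "\<lambda>i. \<delta> i + v i"
  let ?f = "\<lambda>x. ennreal (dist2 n d (\<lambda>l k. ip p (W l) (x k)) (\<lambda>k. ip p ?u (x k)))"
  have all: "AE x in sample_law n p C. \<forall>l<d. 0 < dist2 n l (\<lambda>l k. ip p (W l) (x k)) (\<lambda>k. ip p (W l) (x k))"
    using pos by (subst AE_all_countable) (auto simp: AE_impI)
  have "(\<integral>\<^sup>+x. ?f x \<partial>sample_law n p C) = (\<integral>\<^sup>+x. \<integral>\<^sup>+z. ?f (redraw x z) \<partial>gauss n \<partial>sample_law n p C)"
    by (rule sample_law_redraw) measurable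
  also have "\<dots> \<le> (\<integral>\<^sup>+x. ennreal (nsq n (\<lambda>k. ip p \<delta> (x k))) + ennreal (s * (real n - real d)) \<partial>sample_law n p C)"
  proof (rule nn_integral_mono_AE)
    show "AE x in sample_law n p C. (\<integral>\<^sup>+z. ?f (redraw x z) \<partial>gauss n) \<le>
      ennreal (nsq n (\<lambda>k. ip p \<delta> (x k))) + ennreal (s * (real n - real d))"
      using all
    proof eventually_elim
      fix x :: "nat \<Rightarrow> nat \<Rightarrow> real" assume x: "\<forall>l<d. 0 < dist2 n l (\<lambda>l k. ip p (W l) (x k)) (\<lambda>k. ip p (W l) (x k))"
      have "?f (redraw x z) = ennreal (dist2 n d (\<lambda>l k. ip p (W l) (x k)) (\<lambda>k. ip p \<delta> (x k) + sqrt s * z k))" for z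
        by (intro arg_cong[of _ _ ennreal] dist2_cong) (simp_all add: ip_redraw \<delta> vj ip_add_left W)
      hence "(\<integral>\<^sup>+z. ?f (redraw x z) \<partial>gauss n) \<le> ennreal (nsq n (\<lambda>k. ip p \<delta> (x k)) + (sqrt s)\<^sup>2 * (real n - real d))"
        using dist2_gauss_mean_le[OF d, of "\<lambda>l k. ip p (W l) (x k)" "\<lambda>k. ip p \<delta> (x k)" "sqrt s"] x
        by (simp only:)
      also have "\<dots> = ennreal (nsq n (\<lambda>k. ip p \<delta> (x k))) + ennreal (s * (real n - real d))"
        using s d by (simp add: ennreal_plus)
      finally show "(\<integral>\<^sup>+z. ?f (redraw x z) \<partial>gauss n) \<le>
        ennreal (nsq n (\<lambda>k. ip p \<delta> (x k))) + ennreal (s * (real n - real d))" .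
    qed
  qed
  also have "\<dots> = ennreal (real n * qf p C \<delta> \<delta>) + ennreal (s * (real n - real d))"
    by (subst nn_integral_add) (auto simp: sample_second_moment[OF C] S.emeasure_space_1)
  also have "\<dots> = ennreal (real n * qf p C \<delta> \<delta> + s * (real n - real d))"
    using s d qf_nonneg[OF C] by (simp add: ennreal_plus)
  finally show ?thesis .
qed

end

section \<open>The normalized penalty and its monotonicity\<close>

definition pen_rate :: "nat \<Rightarrow> nat \<Rightarrow> nat \<Rightarrow> real" where
  "pen_rate n p d = EDkhi (d + 1) (n - d - 1) (1 / (real ((p - 1) choose d) * (real d + 1)\<^sup>2)) / real (n - d - 1)"

lemma pen_eq_pen_rate:
  assumes "d + 1 < n"
  shows "pen K n p d = K * (pen_rate n p d * (real n - real d))"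
proof -
  have "real (n - d - 1) = real n - real d - 1" using assms by (simp add: of_nat_diff)
  thus ?thesis by (simp only: pen_def pen_rate_def) simp
qed

text \<open>One of the two factors \<open>d + 1\<close> in the argument of \<open>EDkhi\<close>
  cancels the normalization of \<open>Dkhi\<close>. What remains, summed over the binomially many
  supports of size \<open>d\<close>, is 1 / (d + 1), whence a harmonic sum.\<close>

lemma pen_rate_chi2_excess:
  assumes d: "d + 1 < n" and p: "d \<le> p - 1"
  shows "0 \<le> pen_rate n p d"
    "chi2_excess (Suc d) (n - Suc d) (pen_rate n p d) = ennreal (1 / (real ((p - 1) choose d) * (real d + 1)))"
proof -
  define q where "q = 1 / (real ((p - 1) choose d) * (real d + 1)\<^sup>2)"
  have b: "1 \<le> real ((p - 1) choose d)" using p by (simp add: Suc_leI)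
  hence "1 * 1 \<le> real ((p - 1) choose d) * (real d + 1)\<^sup>2"
    by (intro mult_mono) (auto simp: one_le_power)
  hence q: "0 < q" "q \<le> 1" by (auto simp: q_def)
  have N: "0 < n - d - 1" using d by simp
  note E = EDkhi_chi2_excess[of "d + 1" "n - d - 1" q, OF _ N q]
  show "0 \<le> pen_rate n p d" using E(1) by (simp add: pen_rate_def q_def)
  have "real (d + 1) * q = 1 / (real ((p - 1) choose d) * (real d + 1))"
    by (simp add: q_def power2_eq_square add.commute)
  thus "chi2_excess (Suc d) (n - Suc d) (pen_rate n p d) = ennreal (1 / (real ((p - 1) choose d) * (real d + 1)))"
    using E(2) by (simp add: pen_rate_def q_def)
qed

lemma chi2_excess_Suc_mono:
  assumes "d < n" "0 \<le> y"
  shows "chi2_excess d (n - d) y \<le> chi2_excess (Suc d) (n - Suc d) y"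
proof -
  have "(\<Sum>i=d..<n. (z i)\<^sup>2) = (z d)\<^sup>2 + (\<Sum>i=Suc d..<n. (z i)\<^sup>2)" for z :: "nat \<Rightarrow> real"
    using assms by (rule_tac sum.atLeast_Suc_lessThan) auto
  hence "(\<Sum>i<d. (z i)\<^sup>2) - y * (\<Sum>i=d..<n. (z i)\<^sup>2) \<le> (\<Sum>i<Suc d. (z i)\<^sup>2) - y * (\<Sum>i=Suc d..<n. (z i)\<^sup>2)"
    for z :: "nat \<Rightarrow> real"
    using assms by (simp add: algebra_simps mult_nonneg_nonneg add_increasing)
  thus ?thesis
    using assms by (simp add: chi2_excess_def) (intro nn_integral_mono ennreal_leI, simp)
qed

text \<open>The ratio of successive binomial coefficients is (p - 1 - d) / (d + 1), at least 1 up to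
  the middle; the growing second factor makes the inequality strict.\<close>

lemma binomial_weight_strict_mono:
  assumes p: "2 * d + 2 \<le> p"
  shows "real ((p - 1) choose d) * (real d + 1) < real ((p - 1) choose Suc d) * (real (Suc d) + 1)"
proof -
  have "Suc d * ((p - 1) choose Suc d) = (p - 1) * ((p - 1 - 1) choose d)"
    by (metis Suc_times_binomial_eq binomial_absorption mult.commute)
  also have "\<dots> = (p - 1 - d) * ((p - 1) choose d)"
    by (rule binomial_absorb_comp[symmetric])
  finally have eq: "Suc d * ((p - 1) choose Suc d) = (p - 1 - d) * ((p - 1) choose d)" .
  have "Suc d * ((p - 1) choose d) \<le> Suc d * ((p - 1) choose Suc d)"
    unfolding eq using p by (intro mult_right_mono) auto
  hence le: "(p - 1) choose d \<le> (p - 1) choose Suc d"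
    by (simp only: mult_le_cancel1 zero_less_Suc simp_thms)
  have pos: "0 < (p - 1) choose d" using p by simp
  hence pos': "0 < (p - 1) choose Suc d" using le by linarith
  have "((p - 1) choose d) * (d + 1) \<le> ((p - 1) choose Suc d) * (d + 1)"
    using le by (rule mult_right_mono) simp
  also have "\<dots> < ((p - 1) choose Suc d) * (d + 2)"
    using pos' by (intro mult_strict_left_mono) auto
  finally have "real (((p - 1) choose d) * (d + 1)) < real (((p - 1) choose Suc d) * (d + 2))"
    by (simp only: of_nat_less_iff)
  thus ?thesis by (simp add: algebra_simps)
qed

text \<open>Monotonicity allows the penalty of a column in the bias term to be replaced by that of
  the degree. Were the rate to drop, moving one square from V to U and lowering the factor of V
  would both raise the mean excess, whereas its prescribed value strictly decreases.\<close>

lemma pen_rate_Suc_mono: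
  assumes d: "d + 2 < n" and p: "2 * d + 2 \<le> p"
  shows "pen_rate n p d \<le> pen_rate n p (Suc d)"
proof (rule ccontr)
  assume "\<not> ?thesis"
  hence less: "pen_rate n p (Suc d) \<le> pen_rate n p d" by simp
  note A = pen_rate_chi2_excess[of d n p] and B = pen_rate_chi2_excess[of "Suc d" n p]
  have d1: "d + 1 < n" "d \<le> p - 1" "Suc d + 1 < n" "Suc d \<le> p - 1" using d p by auto
  have "ennreal (1 / (real ((p - 1) choose d) * (real d + 1))) = chi2_excess (Suc d) (n - Suc d) (pen_rate n p d)"
    using A(2) d1 by simp
  also have "\<dots> \<le> chi2_excess (Suc (Suc d)) (n - Suc (Suc d)) (pen_rate n p d)"
    using A(1) d1 by (intro chi2_excess_Suc_mono) auto
  also have "\<dots> \<le> chi2_excess (Suc (Suc d)) (n - Suc (Suc d)) (pen_rate n p (Suc d))"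
    by (rule chi2_excess_antimono[OF less])
  also have "\<dots> = ennreal (1 / (real ((p - 1) choose Suc d) * (real (Suc d) + 1)))"
    using B(2) d1 by simp
  finally have "1 / (real ((p - 1) choose d) * (real d + 1)) \<le> 1 / (real ((p - 1) choose Suc d) * (real (Suc d) + 1))"
    by (subst (asm) ennreal_le_iff) auto
  moreover have "0 < real ((p - 1) choose d) * (real d + 1)" using p by simp
  ultimately have "real ((p - 1) choose Suc d) * (real (Suc d) + 1) \<le> real ((p - 1) choose d) * (real d + 1)"
    using binomial_weight_strict_mono[OF p] by (simp add: field_simps)
  thus False using binomial_weight_strict_mono[OF p] by simp
qed

lemma pen_rate_mono:
  assumes "d \<le> e" "e + 1 < n" "2 * e \<le> p"
  shows "pen_rate n p d \<le> pen_rate n p e"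
  using assms
proof (induction e rule: dec_induct)
  case (step e)
  have "pen_rate n p d \<le> pen_rate n p e" using step by simp
  also have "\<dots> \<le> pen_rate n p (Suc e)" using step by (intro pen_rate_Suc_mono) auto
  finally show ?case .
qed simp

lemma harmonic_sum_le: "(\<Sum>d\<le>D. 1 / (real d + 1)) \<le> 1 + ln (real D + 1)"
proof (induction D)
  case (Suc D)
  have "ln ((real D + 1) / (real D + 2)) \<le> (real D + 1) / (real D + 2) - 1"
    by (rule ln_le_minus_one) simp
  hence "1 / (real D + 2) \<le> ln (real D + 2) - ln (real D + 1)"
    by (simp add: ln_div field_simps)
  thus ?case using Suc by (simp add: algebra_simps)
qed simp

text \<open>The constant 1.1 of the degree condition matters only here.\<close>

lemma degree_bounds:
  assumes n: "3 \<le> n" and np: "n < p" and \<eta>: "0 < \<eta>" "\<eta> < 1" and D1: "1 \<le> D"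
    and D: "real D \<le> \<eta> * (real n / (2 * (1.1 + sqrt (ln (real p)))\<^sup>2))"
  shows "8 * D \<le> n" "(\<Sum>d\<le>D. 1 / (real d + 1)) \<le> ln (real n)"
proof -
  have "exp 1 \<le> real p" using exp_le n np by simp
  hence "1 \<le> ln (real p)" using n np by (subst ln_ge_iff) auto
  hence "2.1 \<le> 1.1 + sqrt (ln (real p))" by simp
  hence "2.1\<^sup>2 \<le> (1.1 + sqrt (ln (real p)))\<^sup>2" by (rule power_mono) simp
  hence c: "8.82 \<le> 2 * (1.1 + sqrt (ln (real p)))\<^sup>2" by (simp add: power2_eq_square)
  have "real D \<le> 1 * (real n / (2 * (1.1 + sqrt (ln (real p)))\<^sup>2))"
    using \<eta> c by (intro order.trans[OF D] mult_right_mono) auto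
  also have "\<dots> \<le> real n / 8.82"
    unfolding mult_1 using c by (intro divide_left_mono) auto
  finally have Dn: "8.82 * real D \<le> real n" by simp
  hence "real (8 * D) \<le> real n" by simp
  thus "8 * D \<le> n" by linarith
  \<comment> \<open>As 1 \<le> D, 3 (D + 1) \<le> 6 D \<le> 8.82 D \<le> n, where 8.82 is twice the
    square of 2.1.\<close>
  have "exp 1 * (real D + 1) \<le> 3 * (real D + 1)" using exp_le by (intro mult_right_mono) auto
  also have "\<dots> \<le> real n" using Dn D1 by simp
  finally have "ln (exp 1 * (real D + 1)) \<le> ln (real n)" using n by (subst ln_le_cancel_iff) auto
  hence "1 + ln (real D + 1) \<le> ln (real n)" by (simp add: ln_mult)
  with harmonic_sum_le[of D] show "(\<Sum>d\<le>D. 1 / (real d + 1)) \<le> ln (real n)" by simp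
qed

section \<open>Prediction risk of the selected estimator\<close>

text \<open>Coefficients of a residual: for \<open>j < p\<close>,
  \<open>ip p (res_coeff j a) (x k)\<close> is entry \<open>k\<close> of X_j - X a.\<close>

definition res_coeff :: "nat \<Rightarrow> (nat \<Rightarrow> real) \<Rightarrow> nat \<Rightarrow> real" where
  "res_coeff j a = (\<lambda>i. of_bool (i = j) - a i)"

lemma noise_coeff_eq: "noise_coeff \<theta> j = res_coeff j (\<lambda>i. \<theta> $$ (i, j))"
  by (simp add: noise_coeff_def res_coeff_def)

text \<open>\<open>dist2\<close> takes families indexed by numbers, so the elements of
  \<open>S\<close> are listed in increasing order. In \<open>span_family\<close> index 0 is the
  additional direction \<open>a\<close>, which is why its dimension is
  \<open>Suc (card S)\<close>.\<close>

definition unit_family :: "nat set \<Rightarrow> nat \<Rightarrow> nat \<Rightarrow> real" where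
  "unit_family S l = (\<lambda>i. of_bool (i = sorted_list_of_set S ! l))"

definition span_family :: "(nat \<Rightarrow> real) \<Rightarrow> nat set \<Rightarrow> nat \<Rightarrow> nat \<Rightarrow> real" where
  "span_family a S l = (case l of 0 \<Rightarrow> a | Suc l \<Rightarrow> unit_family S l)"

lemma sorted_list_nth_mem: "finite S \<Longrightarrow> l < card S \<Longrightarrow> sorted_list_of_set S ! l \<in> S"
  using nth_mem[of l "sorted_list_of_set S"] by simp

lemma unit_family_outside: "finite S \<Longrightarrow> l < card S \<Longrightarrow> j \<notin> S \<Longrightarrow> unit_family S l j = 0"
  using sorted_list_nth_mem[of S l] by (auto simp: unit_family_def)

lemma unit_family_nth_self: "unit_family S l (sorted_list_of_set S ! l) = 1"
  by (simp add: unit_family_def)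

lemma ip_supported:
  assumes S: "S \<subseteq> {..<p}" and b: "\<And>i. i < p \<Longrightarrow> i \<notin> S \<Longrightarrow> b i = 0"
  shows "ip p b y = (\<Sum>l<card S. b (sorted_list_of_set S ! l) * ip p (unit_family S l) y)"
proof -
  have fin: "finite S" using S finite_subset by blast
  have bij: "bij_betw (\<lambda>l. sorted_list_of_set S ! l) {..<card S} S"
    using bij_betw_nth[of "sorted_list_of_set S" "{..<card S}" S] fin by simp
  have "ip p b y = (\<Sum>i\<in>S. b i * y i)"
    unfolding ip_def using S b by (intro sum.mono_neutral_right) auto
  also have "\<dots> = (\<Sum>l<card S. b (sorted_list_of_set S ! l) * y (sorted_list_of_set S ! l))"
    by (rule sum.reindex_bij_betw[OF bij, symmetric])
  also have "\<dots> = (\<Sum>l<card S. b (sorted_list_of_set S ! l) * ip p (unit_family S l) y)"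
    using sorted_list_nth_mem[OF fin] S
    by (intro sum.cong refl) (auto simp: unit_family_def ip_unit subset_iff)
  finally show ?thesis .
qed

text \<open>With \<open>r\<close> the squared distance of the noise \<open>\<epsilon>\<close> to the span of \<open>h\<close> and the selected columns,
  \<open>r \<le> \<parallel>\<epsilon> + h / K\<parallel>\<^sup>2\<close> controls the cross term \<open>2 \<langle>\<epsilon>, h\<rangle>\<close> and \<open>r \<le> \<parallel>\<epsilon> + h\<parallel>\<^sup>2\<close> uses up the penalty.\<close>

lemma pointwise_risk_bound:
  fixes x :: "nat \<Rightarrow> nat \<Rightarrow> real" and a b :: "nat \<Rightarrow> real" and j :: nat
  assumes K: "1 < K" and y: "0 \<le> y" and S: "S \<subseteq> {..<p}" and b: "\<And>i. i < p \<Longrightarrow> i \<notin> S \<Longrightarrow> b i = 0"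
  defines "\<epsilon> \<equiv> \<lambda>k. ip p (res_coeff j a) (x k)"
  defines "h \<equiv> \<lambda>k. ip p (\<lambda>i. a i - b i) (x k)"
  shows "nsq n \<epsilon> + (1 - 1 / K) * nsq n h \<le>
    nsq n (\<lambda>k. ip p (res_coeff j b) (x k)) * (1 + K * y) +
    K * (nsq n \<epsilon> - (1 + y) * dist2 n (Suc (card S)) (\<lambda>l k. ip p (span_family a S l) (x k)) \<epsilon>)"
proof -
  define r where "r = dist2 n (Suc (card S)) (\<lambda>l k. ip p (span_family a S l) (x k)) \<epsilon>"
  have line: "r \<le> nsq n \<epsilon> + 2 * t * ip n \<epsilon> h + t\<^sup>2 * nsq n h" for t
  proof -
    define c where "c = (\<lambda>l. case l of 0 \<Rightarrow> - t | Suc l \<Rightarrow> t * b (sorted_list_of_set S ! l))"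
    have eq: "\<epsilon> k - (\<Sum>l<Suc (card S). c l * ip p (span_family a S l) (x k)) = \<epsilon> k + t * h k" for k
      using ip_supported[OF S b, where y = "x k"]
      by (simp add: sum.lessThan_Suc_shift h_def ip_diff_left c_def span_family_def sum_distrib_left algebra_simps
          del: sum.lessThan_Suc)
    have "r \<le> nsq n (\<lambda>k. \<epsilon> k + t * h k)"
      using dist2_le[of n "Suc (card S)" "\<lambda>l k. ip p (span_family a S l) (x k)" \<epsilon> c] unfolding r_def eq .
    thus ?thesis
      by (simp add: ip_add ip_add_left ip_scale ip_scale_left ip_commute[of n h \<epsilon>] power2_eq_square algebra_simps)
  qed
  let ?E = "nsq n \<epsilon>" and ?H = "nsq n h" and ?P = "ip n \<epsilon> h"
  have rss: "nsq n (\<lambda>k. ip p (res_coeff j b) (x k)) = ?E + 2 * ?P + ?H"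
  proof -
    have "ip p (res_coeff j b) (x k) = \<epsilon> k + h k" for k
      by (simp add: \<epsilon>_def h_def res_coeff_def ip_diff_left)
    thus ?thesis by (simp add: ip_add ip_add_left ip_commute[of n h \<epsilon>])
  qed
  have 1: "K * r \<le> K * ?E + 2 * ?P + ?H / K"
  proof -
    have "K * r \<le> K * (?E + 2 * (1 / K) * ?P + (1 / K)\<^sup>2 * ?H)"
      using K line[of "1 / K"] by (intro mult_left_mono) auto
    also have "\<dots> = K * ?E + 2 * ?P + ?H / K"
      using K by (simp add: power2_eq_square field_simps)
    finally show ?thesis .
  qed
  have "r \<le> ?E + 2 * ?P + ?H" using line[of 1] by simp
  hence "K * y * r \<le> K * y * (?E + 2 * ?P + ?H)"
    using K y by (intro mult_left_mono) auto
  with 1 show ?thesis unfolding rss r_def[symmetric] by (simp add: algebra_simps)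
qed

lemma measurable_sample_law_entry:
  "k < n \<Longrightarrow> i < p \<Longrightarrow> (\<lambda>x. x k i) \<in> borel_measurable (sample_law n p C)"
  unfolding measurable_cong_sets[OF sets_sample_law refl] by (rule measurable_sample_entry)

lemma sum_over_supports:
  fixes f :: "nat \<Rightarrow> real"
  assumes j: "j < p"
  shows "(\<Sum>S | S \<subseteq> {..<p} - {j} \<and> card S \<le> D. f (card S)) = (\<Sum>d\<le>D. real ((p - 1) choose d) * f d)"
proof -
  let ?J = "{..<p} - {j}"
  have cJ: "card ?J = p - 1" using j by simp
  have U: "{S. S \<subseteq> ?J \<and> card S \<le> D} = (\<Union>d\<in>{..D}. {S. S \<subseteq> ?J \<and> card S = d})" by auto
  have "(\<Sum>S | S \<subseteq> ?J \<and> card S \<le> D. f (card S)) = (\<Sum>d\<le>D. \<Sum>S | S \<subseteq> ?J \<and> card S = d. f (card S))"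
    unfolding U by (subst sum.UNION_disjoint) (auto intro: finite_subset[of _ "Pow ?J"])
  also have "\<dots> = (\<Sum>d\<le>D. real ((p - 1) choose d) * f d)"
    by (intro sum.cong refl) (simp add: n_subsets[of ?J] cJ)
  finally show ?thesis .
qed

text \<open>Column \<open>j\<close> of the estimator of model \<open>m\<close> on the data \<open>x\<close> is the function \<open>A m x j\<close>, and
  \<open>K * pen_rate n p d\<close> is \<open>pen(d) / (n - d)\<close>.\<close>

locale model_selection =
  fixes n p D :: nat and C \<theta> :: "real mat" and K :: real and M :: "(nat \<times> nat) set set"
    and A :: "(nat \<times> nat) set \<Rightarrow> (nat \<Rightarrow> nat \<Rightarrow> real) \<Rightarrow> nat \<Rightarrow> nat \<Rightarrow> real"
    and mh :: "(nat \<Rightarrow> nat \<Rightarrow> real) \<Rightarrow> (nat \<times> nat) set"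
  assumes C: "pos_def p C" and reg: "regression_mat p C \<theta>" and K: "1 < K"
    and n3: "3 \<le> n" and np: "n < p" and M: "M \<subseteq> digraphs p"
    and deg: "\<And>m j. m \<in> M \<Longrightarrow> j < p \<Longrightarrow> card (nbrs m j) \<le> D"
    and D: "8 * D \<le> n" and harm: "(\<Sum>d\<le>D. 1 / (real d + 1)) \<le> ln (real n)"
    and A_meas: "\<And>m i j. m \<in> M \<Longrightarrow> i < p \<Longrightarrow> j < p \<Longrightarrow> (\<lambda>x. A m x j i) \<in> borel_measurable (sample_law n p C)"
    and A_ls: "AE x in sample_law n p C. \<forall>m\<in>M. \<forall>j<p. (\<forall>i<p. i \<notin> nbrs m j \<longrightarrow> A m x j i = 0) \<and>
      (\<forall>b. (\<forall>i<p. i \<notin> nbrs m j \<longrightarrow> b i = 0) \<longrightarrow>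
        nsq n (\<lambda>k. ip p (res_coeff j (A m x j)) (x k)) \<le> nsq n (\<lambda>k. ip p (res_coeff j b) (x k)))"
    and mh_meas: "mh \<in> measurable (sample_law n p C) (count_space UNIV)"
    and mh_min: "AE x in sample_law n p C. mh x \<in> M \<and> (\<forall>m\<in>M.
      (\<Sum>j<p. nsq n (\<lambda>k. ip p (res_coeff j (A (mh x) x j)) (x k)) * (1 + K * pen_rate n p (card (nbrs (mh x) j)))) \<le>
      (\<Sum>j<p. nsq n (\<lambda>k. ip p (res_coeff j (A m x j)) (x k)) * (1 + K * pen_rate n p (card (nbrs m j)))))"
begin

lemma finite_M: "finite M"
  by (rule finite_subset[OF M]) (auto simp: digraphs_def intro: finite_subset[of _ "Pow ({..<p} \<times> {..<p})"])

lemma nbrs_subset: "m \<in> M \<Longrightarrow> nbrs m j \<subseteq> {..<p} - {j}"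
  using M by (auto simp: digraphs_def nbrs_def)

text \<open>A version of the selected estimator that is measurable also off the almost sure event \<open>mh x \<in> M\<close>.\<close>

definition asel :: "(nat \<Rightarrow> nat \<Rightarrow> real) \<Rightarrow> nat \<Rightarrow> nat \<Rightarrow> real" where
  "asel x j i = (\<Sum>m\<in>M. of_bool (mh x = m) * A m x j i)"

lemma asel_eq: "mh x \<in> M \<Longrightarrow> asel x j i = A (mh x) x j i"
  by (simp add: asel_def sum_of_bool_mult finite_M)

lemma measurable_asel:
  assumes "i < p" "j < p"
  shows "(\<lambda>x. asel x j i) \<in> borel_measurable (sample_law n p C)"
  unfolding asel_def
proof (intro borel_measurable_sum borel_measurable_times)
  fix m assume m: "m \<in> M"
  show "(\<lambda>x. A m x j i) \<in> borel_measurable (sample_law n p C)" using A_meas m assms by simp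
  have "(\<lambda>m'. of_bool (m' = m) :: real) \<in> measurable (count_space UNIV) borel" by simp
  from measurable_compose[OF mh_meas this]
  show "(\<lambda>x. of_bool (mh x = m) :: real) \<in> borel_measurable (sample_law n p C)" .
qed

lemma theta_facts:
  assumes "j < p"
  shows "\<theta> $$ (j, j) = 0" "res_coeff j (\<lambda>i. \<theta> $$ (i, j)) j = 1" "0 < sigma2 C j"
    "\<And>i. i < p \<Longrightarrow> mv p (\<lambda>i k. C $$ (i, k)) (res_coeff j (\<lambda>i. \<theta> $$ (i, j))) i = sigma2 C j * of_bool (i = j)"
  using regression_mat_normal_equations[OF C reg assms] by (simp_all add: noise_coeff_eq)

text \<open>Pythagoras: by the normal equations the noise is orthogonal, for \<open>C\<close>, to
  every vector without entry at \<open>j\<close>.\<close>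

lemma qf_noise:
  assumes j: "j < p" and u: "u j = 0"
  shows "qf p C (\<lambda>i. u i + res_coeff j (\<lambda>i. \<theta> $$ (i, j)) i) (\<lambda>i. u i + res_coeff j (\<lambda>i. \<theta> $$ (i, j)) i)
    = qf p C u u + sigma2 C j"
proof -
  let ?v = "res_coeff j (\<lambda>i. \<theta> $$ (i, j))"
  have uv: "qf p C w ?v = sigma2 C j * w j" for w
  proof -
    have "qf p C w ?v = ip p w (\<lambda>i. sigma2 C j * of_bool (i = j))"
      unfolding qf_def using theta_facts(4)[OF j] by (intro ip_cong) auto
    also have "\<dots> = sigma2 C j * w j"
      unfolding ip_scale using j by (subst ip_commute) (simp add: ip_unit)
    finally show ?thesis .
  qed
  show ?thesis
    using u theta_facts(2)[OF j] by (simp add: qf_linear qf_commute[OF C, of ?v u] uv)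
qed

lemma measurable_asel_error:
  assumes "j < p"
  shows "(\<lambda>x. nsq n (\<lambda>k. ip p (\<lambda>i. \<theta> $$ (i, j) - asel x j i) (x k))) \<in> borel_measurable (sample_law n p C)"
  by (intro measurable_ip borel_measurable_diff borel_measurable_const measurable_asel
      measurable_sample_law_entry assms)

lemma pen_rate_model:
  assumes "d \<le> D"
  shows "0 \<le> pen_rate n p d"
    "chi2_excess (Suc d) (n - Suc d) (pen_rate n p d) = ennreal (1 / (real ((p - 1) choose d) * (real d + 1)))"
proof -
  have "d + 1 < n" "d \<le> p - 1" using assms D np n3 by auto
  thus "0 \<le> pen_rate n p d"
    "chi2_excess (Suc d) (n - Suc d) (pen_rate n p d) = ennreal (1 / (real ((p - 1) choose d) * (real d + 1)))"
    by (rule pen_rate_chi2_excess)+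
qed

definition excess :: "nat \<Rightarrow> nat set \<Rightarrow> (nat \<Rightarrow> nat \<Rightarrow> real) \<Rightarrow> real" where
  "excess j S x = nsq n (\<lambda>k. ip p (res_coeff j (\<lambda>i. \<theta> $$ (i, j))) (x k)) -
    (1 + pen_rate n p (card S)) * dist2 n (Suc (card S)) (\<lambda>l k. ip p (span_family (\<lambda>i. \<theta> $$ (i, j)) S l) (x k))
      (\<lambda>k. ip p (res_coeff j (\<lambda>i. \<theta> $$ (i, j))) (x k))"

lemma measurable_excess: "excess j S \<in> borel_measurable (sample_law n p C)"
  unfolding excess_def[abs_def] measurable_cong_sets[OF sets_sample_law refl]
  by (intro borel_measurable_diff borel_measurable_times borel_measurable_const
      measurable_ip measurable_dist2 measurable_sample_row)

text \<open>The zero diagonal of \<theta> and j \<notin> S keep variable \<open>j\<close> out of the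
  subspace, so the noise is independent of it.\<close>

lemma excess_mean:
  assumes j: "j < p" and S: "S \<subseteq> {..<p} - {j}" "card S \<le> D"
  shows "(\<integral>\<^sup>+x. ennreal (excess j S x) \<partial>sample_law n p C) \<le>
    ennreal (sigma2 C j / (real ((p - 1) choose card S) * (real (card S) + 1)))"
proof -
  have fin: "finite S" using S(1) finite_subset by blast
  have W: "span_family (\<lambda>i. \<theta> $$ (i, j)) S l j = 0" if "l < Suc (card S)" for l
    using that theta_facts(1)[OF j] unit_family_outside[OF fin, of _ j] S(1)
    by (cases l) (auto simp: span_family_def)
  have "(\<integral>\<^sup>+x. ennreal (excess j S x) \<partial>sample_law n p C) \<le>
    ennreal (sigma2 C j) * chi2_excess (Suc (card S)) (n - Suc (card S)) (pen_rate n p (card S))"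
    unfolding excess_def
    using theta_facts[OF j] S(2) D n3 pen_rate_model(1)[OF S(2)] W
    by (intro sample_chi2_excess[OF C j]) auto
  also have "\<dots> = ennreal (sigma2 C j / (real ((p - 1) choose card S) * (real (card S) + 1)))"
    using theta_facts(3)[OF j] by (simp add: pen_rate_model(2)[OF S(2)] flip: ennreal_mult)
  finally show ?thesis .
qed

text \<open>The residual sum of squares is at most the squared distance of X_j to the span of the
  columns of the model, whose mean loses one variance for every column. Owing to this loss the
  product with \<open>K * pen_rate\<close> contributes exactly \<open>pen\<close> times the
  variance.\<close>

lemma least_squares_mean:
  assumes m: "m \<in> M" and j: "j < p" and b: "\<And>i. i < p \<Longrightarrow> i \<notin> nbrs m j \<Longrightarrow> b i = 0"
  shows "(\<integral>\<^sup>+x. ennreal (nsq n (\<lambda>k. ip p (res_coeff j (A m x j)) (x k))) \<partial>sample_law n p C) \<le>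
    ennreal (real n * qf p C (\<lambda>i. \<theta> $$ (i, j) - b i) (\<lambda>i. \<theta> $$ (i, j) - b i)
      + sigma2 C j * (real n - real (card (nbrs m j))))"
proof -
  let ?S = "nbrs m j" and ?v = "res_coeff j (\<lambda>i. \<theta> $$ (i, j))" and ?\<delta> = "\<lambda>i. \<theta> $$ (i, j) - b i"
  have S: "?S \<subseteq> {..<p} - {j}" by (rule nbrs_subset[OF m])
  hence Sp: "?S \<subseteq> {..<p}" by auto
  have fin: "finite ?S" using Sp finite_subset by blast
  have card: "card ?S \<le> n" "card ?S < n" using deg[OF m j] D n3 by auto
  have "(\<integral>\<^sup>+x. ennreal (nsq n (\<lambda>k. ip p (res_coeff j (A m x j)) (x k))) \<partial>sample_law n p C) \<le>
    (\<integral>\<^sup>+x. ennreal (dist2 n (card ?S) (\<lambda>l k. ip p (unit_family ?S l) (x k)) (\<lambda>k. ip p (\<lambda>i. ?\<delta> i + ?v i) (x k))) \<partial>sample_law n p C)"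
  proof (rule nn_integral_mono_AE)
    show "AE x in sample_law n p C. ennreal (nsq n (\<lambda>k. ip p (res_coeff j (A m x j)) (x k))) \<le>
      ennreal (dist2 n (card ?S) (\<lambda>l k. ip p (unit_family ?S l) (x k)) (\<lambda>k. ip p (\<lambda>i. ?\<delta> i + ?v i) (x k)))"
      using A_ls
    proof eventually_elim
      fix x assume x: "\<forall>m\<in>M. \<forall>j<p. (\<forall>i<p. i \<notin> nbrs m j \<longrightarrow> A m x j i = 0) \<and>
        (\<forall>b. (\<forall>i<p. i \<notin> nbrs m j \<longrightarrow> b i = 0) \<longrightarrow>
          nsq n (\<lambda>k. ip p (res_coeff j (A m x j)) (x k)) \<le> nsq n (\<lambda>k. ip p (res_coeff j b) (x k)))"
      show "ennreal (nsq n (\<lambda>k. ip p (res_coeff j (A m x j)) (x k))) \<le>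
        ennreal (dist2 n (card ?S) (\<lambda>l k. ip p (unit_family ?S l) (x k)) (\<lambda>k. ip p (\<lambda>i. ?\<delta> i + ?v i) (x k)))"
      proof (intro ennreal_leI dist2_greatest)
        fix c :: "nat \<Rightarrow> real"
        \<comment> \<open>The combination is added to \<open>b\<close>; the result is still
          supported in the neighbourhood, so it competes in the least squares problem.\<close>
        define b' where "b' = (\<lambda>i. b i + (\<Sum>l<card ?S. c l * unit_family ?S l i))"
        have "b' i = 0" if "i < p" "i \<notin> ?S" for i
          using b[OF that] unit_family_outside[OF fin _ that(2)] by (simp add: b'_def)
        hence "nsq n (\<lambda>k. ip p (res_coeff j (A m x j)) (x k)) \<le> nsq n (\<lambda>k. ip p (res_coeff j b') (x k))"
          using x m j by blast
        also have "\<dots> = nsq n (\<lambda>k. ip p (\<lambda>i. ?\<delta> i + ?v i) (x k) - (\<Sum>l<card ?S. c l * ip p (unit_family ?S l) (x k)))"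
        proof (intro ip_cong)
          fix k
          have "ip p (\<lambda>i. \<Sum>l<card ?S. c l * unit_family ?S l i) (x k) = (\<Sum>l<card ?S. c l * ip p (unit_family ?S l) (x k))"
            unfolding ip_def sum_distrib_left sum_distrib_right by (subst sum.swap) (simp add: mult.assoc)
          moreover have "res_coeff j b' = (\<lambda>i. (?\<delta> i + ?v i) - (\<Sum>l<card ?S. c l * unit_family ?S l i))"
            by (simp add: b'_def res_coeff_def fun_eq_iff)
          ultimately show "ip p (res_coeff j b') (x k) =
            ip p (\<lambda>i. ?\<delta> i + ?v i) (x k) - (\<Sum>l<card ?S. c l * ip p (unit_family ?S l) (x k))"
            by (simp only: ip_diff_left)
          thus "ip p (res_coeff j b') (x k) =
            ip p (\<lambda>i. ?\<delta> i + ?v i) (x k) - (\<Sum>l<card ?S. c l * ip p (unit_family ?S l) (x k))" .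
        qed
        finally show "nsq n (\<lambda>k. ip p (res_coeff j (A m x j)) (x k)) \<le>
          nsq n (\<lambda>k. ip p (\<lambda>i. ?\<delta> i + ?v i) (x k) - (\<Sum>l<card ?S. c l * ip p (unit_family ?S l) (x k)))" .
      qed
    qed
  qed
  also have "\<dots> \<le> ennreal (real n * qf p C ?\<delta> ?\<delta> + sigma2 C j * (real n - real (card ?S)))"
  proof (rule sample_dist2_mean_le[where v = ?v and \<delta> = ?\<delta> and W = "unit_family ?S", OF C j theta_facts(3)[OF j] theta_facts(2)[OF j]])
    show "unit_family ?S l j = 0" if "l < card ?S" for l
      using unit_family_outside[OF fin that] S by auto
    show "\<theta> $$ (j, j) - b j = 0" using theta_facts(1)[OF j] b[OF j] S by auto
    fix l assume l: "l < card ?S"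
    let ?i = "sorted_list_of_set ?S ! l"
    have i: "?i < p" using sorted_list_nth_mem[OF fin l] Sp by auto
    show "AE x in sample_law n p C. 0 < dist2 n l (\<lambda>l k. ip p (unit_family ?S l) (x k)) (\<lambda>k. ip p (unit_family ?S l) (x k))"
    \<comment> \<open>A column of the model is kept away from the preceding ones by its own noise:
      here variable \<open>?i\<close> plays the part of \<open>j\<close>.\<close>
    proof (rule sample_dist2_pos[where W = "unit_family ?S" and u = "unit_family ?S l" and d = l
          and v = "res_coeff ?i (\<lambda>i. \<theta> $$ (i, ?i))", OF C i theta_facts(3)[OF i] theta_facts(2)[OF i]])
      show "unit_family ?S l' ?i = 0" if "l' < l" for l'
        using that l fin nth_eq_iff_index_eq[of "sorted_list_of_set ?S" l l'] by (auto simp: unit_family_def)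
    qed (use l card theta_facts(4)[OF i] in \<open>auto simp: unit_family_nth_self\<close>)
  qed (use card theta_facts(4)[OF j] in auto)
  finally show ?thesis .
qed

theorem selected_prediction_risk:
  assumes m: "m \<in> M" and b: "\<And>i j. i < p \<Longrightarrow> j < p \<Longrightarrow> i \<notin> nbrs m j \<Longrightarrow> b j i = 0"
  shows "(\<integral>\<^sup>+x. ennreal (\<Sum>j<p. nsq n (\<lambda>k. ip p (\<lambda>i. \<theta> $$ (i, j) - asel x j i) (x k))) \<partial>sample_law n p C) \<le>
    ennreal (K / (K - 1) * (\<Sum>j<p.
      real n * qf p C (\<lambda>i. \<theta> $$ (i, j) - b j i) (\<lambda>i. \<theta> $$ (i, j) - b j i) * (1 + K * pen_rate n p (card (nbrs m j)))
      + sigma2 C j * (K * pen_rate n p (card (nbrs m j)) * (real n - real (card (nbrs m j))) + K * ln (real n))))"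
proof -
  let ?L = "sample_law n p C"
  let ?v = "\<lambda>j. res_coeff j (\<lambda>i. \<theta> $$ (i, j))"
  let ?\<delta> = "\<lambda>j i. \<theta> $$ (i, j) - b j i"
  let ?y = "\<lambda>S. pen_rate n p (card S)"
  let ?E = "\<lambda>j x. nsq n (\<lambda>k. ip p (?v j) (x k))"
  let ?H = "\<lambda>x. \<Sum>j<p. nsq n (\<lambda>k. ip p (\<lambda>i. \<theta> $$ (i, j) - asel x j i) (x k))"
  let ?R = "\<lambda>m j x. nsq n (\<lambda>k. ip p (res_coeff j (A m x j)) (x k))"
  let ?B = "\<lambda>j x. nsq n (\<lambda>k. ip p (res_coeff j (b j)) (x k))"
  let ?Sub = "\<lambda>j. {S. S \<subseteq> {..<p} - {j} \<and> card S \<le> D}"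
  have finSub: "finite (?Sub j)" for j by (auto intro: finite_subset[of _ "Pow ({..<p} - {j})"])
  have yn: "0 \<le> ?y (nbrs m' j)" if "m' \<in> M" "j < p" for m' j
    using pen_rate_model(1)[OF deg[OF that]] .
  have ptw: "AE x in ?L. (\<Sum>j<p. ?E j x) + (1 - 1 / K) * ?H x \<le>
      (\<Sum>j<p. ?B j x + K * ?y (nbrs m j) * ?R m j x) + (\<Sum>j<p. \<Sum>S\<in>?Sub j. K * max 0 (excess j S x))"
    using A_ls mh_min
  proof eventually_elim
    fix x assume x: "\<forall>m\<in>M. \<forall>j<p. (\<forall>i<p. i \<notin> nbrs m j \<longrightarrow> A m x j i = 0) \<and>
        (\<forall>b. (\<forall>i<p. i \<notin> nbrs m j \<longrightarrow> b i = 0) \<longrightarrow> ?R m j x \<le> nsq n (\<lambda>k. ip p (res_coeff j b) (x k)))"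
      and sel: "mh x \<in> M \<and> (\<forall>m\<in>M. (\<Sum>j<p. ?R (mh x) j x * (1 + K * ?y (nbrs (mh x) j))) \<le>
        (\<Sum>j<p. ?R m j x * (1 + K * ?y (nbrs m j))))"
    let ?m = "mh x"
    have mM: "?m \<in> M" using sel by blast
    have "?E j x + (1 - 1 / K) * nsq n (\<lambda>k. ip p (\<lambda>i. \<theta> $$ (i, j) - asel x j i) (x k)) \<le>
      ?R ?m j x * (1 + K * ?y (nbrs ?m j)) + (\<Sum>S\<in>?Sub j. K * max 0 (excess j S x))" if j: "j < p" for j
    proof -
      have Sp: "nbrs ?m j \<subseteq> {..<p}" using nbrs_subset[OF mM] by auto
      have supp: "\<And>i. i < p \<Longrightarrow> i \<notin> nbrs ?m j \<Longrightarrow> A ?m x j i = 0" using x mM j by blast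
      have "?E j x + (1 - 1 / K) * nsq n (\<lambda>k. ip p (\<lambda>i. \<theta> $$ (i, j) - A ?m x j i) (x k)) \<le>
        ?R ?m j x * (1 + K * ?y (nbrs ?m j)) + K * excess j (nbrs ?m j) x"
        unfolding excess_def by (rule pointwise_risk_bound[OF K yn[OF mM j] Sp supp])
      also have "K * excess j (nbrs ?m j) x \<le> K * max 0 (excess j (nbrs ?m j) x)"
        using K by (intro mult_left_mono) auto
      \<comment> \<open>The selected neighbourhood depends on the data. Summing the positive parts
        over all supports removes this dependence, and the penalty is calibrated to pay for the
        sum.\<close>
      also have "\<dots> \<le> (\<Sum>S\<in>?Sub j. K * max 0 (excess j S x))"
        using nbrs_subset[OF mM] deg[OF mM j] finSub K
        by (intro member_le_sum[of "nbrs ?m j"]) auto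
      finally show ?thesis using mM by (simp add: asel_eq)
    qed
    hence "(\<Sum>j<p. ?E j x + (1 - 1 / K) * nsq n (\<lambda>k. ip p (\<lambda>i. \<theta> $$ (i, j) - asel x j i) (x k))) \<le>
      (\<Sum>j<p. ?R ?m j x * (1 + K * ?y (nbrs ?m j)) + (\<Sum>S\<in>?Sub j. K * max 0 (excess j S x)))"
      by (intro sum_mono) auto
    hence "(\<Sum>j<p. ?E j x) + (1 - 1 / K) * ?H x \<le>
      (\<Sum>j<p. ?R ?m j x * (1 + K * ?y (nbrs ?m j))) + (\<Sum>j<p. \<Sum>S\<in>?Sub j. K * max 0 (excess j S x))"
      by (simp only: sum.distrib sum_distrib_left[symmetric])
    also have "(\<Sum>j<p. ?R ?m j x * (1 + K * ?y (nbrs ?m j))) \<le> (\<Sum>j<p. ?R m j x * (1 + K * ?y (nbrs m j)))"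
      using sel m by blast
    \<comment> \<open>In the unpenalized part the estimator is compared with the fixed column
      \<open>b j\<close>, whose mean residual contains exactly the noise level
      \<open>n * sigma2 C j\<close> to be cancelled; the penalized part keeps the smaller residual
      of the estimator.\<close>
    also have "\<dots> \<le> (\<Sum>j<p. ?B j x + K * ?y (nbrs m j) * ?R m j x)"
    proof (intro sum_mono)
      fix j assume "j \<in> {..<p}"
      hence "?R m j x \<le> ?B j x" using x m b by auto
      thus "?R m j x * (1 + K * ?y (nbrs m j)) \<le> ?B j x + K * ?y (nbrs m j) * ?R m j x"
        by (simp add: algebra_simps)
    qed
    finally show "(\<Sum>j<p. ?E j x) + (1 - 1 / K) * ?H x \<le>
      (\<Sum>j<p. ?B j x + K * ?y (nbrs m j) * ?R m j x) + (\<Sum>j<p. \<Sum>S\<in>?Sub j. K * max 0 (excess j S x))"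
      by simp
  qed
  have Kp: "0 < K" "0 \<le> 1 - 1 / K" using K by auto
  have Em [measurable]: "(\<lambda>x. nsq n (\<lambda>k. ip p u (x k))) \<in> borel_measurable ?L" for u
    unfolding measurable_cong_sets[OF sets_sample_law refl] by (intro measurable_ip measurable_sample_row)
  have Hm [measurable]: "?H \<in> borel_measurable ?L"
    by (intro borel_measurable_sum measurable_asel_error) auto
  have Rm: "?R m j \<in> borel_measurable ?L" if "j < p" for j
    unfolding res_coeff_def
    by (intro measurable_ip borel_measurable_diff borel_measurable_const A_meas measurable_sample_law_entry m that)
  note [measurable] = measurable_excess
  have pack: "(\<Sum>j<p. ennreal (f j)) + (\<Sum>j<p. \<Sum>S\<in>?Sub j. ennreal (g j S)) =
      ennreal ((\<Sum>j<p. f j) + (\<Sum>j<p. \<Sum>S\<in>?Sub j. g j S))"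
    if f: "\<And>j. j < p \<Longrightarrow> 0 \<le> f j" and g: "\<And>j S. j < p \<Longrightarrow> 0 \<le> g j S" for f g
  proof -
    have "(\<Sum>j<p. ennreal (f j)) = ennreal (\<Sum>j<p. f j)"
      using f by (intro sum_ennreal) auto
    moreover have "(\<Sum>j<p. \<Sum>S\<in>?Sub j. ennreal (g j S)) = (\<Sum>j<p. ennreal (\<Sum>S\<in>?Sub j. g j S))"
      using g by (intro sum.cong refl sum_ennreal) auto
    moreover have "\<dots> = ennreal (\<Sum>j<p. \<Sum>S\<in>?Sub j. g j S)"
      using g by (intro sum_ennreal sum_nonneg) auto
    moreover have "0 \<le> (\<Sum>j<p. f j)" "0 \<le> (\<Sum>j<p. \<Sum>S\<in>?Sub j. g j S)"
      using f g by (auto intro!: sum_nonneg)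
    ultimately show ?thesis by (simp only: ennreal_plus)
  qed
  have sig: "0 \<le> sigma2 C j" if "j < p" for j using theta_facts(3)[OF that] by simp
  have bj: "b j j = 0" if "j < p" for j using b[OF that that] nbrs_subset[OF m, of j] by auto
  let ?\<Sigma> = "\<Sum>j<p. sigma2 C j"
  let ?q = "\<lambda>j. qf p C (?\<delta> j) (?\<delta> j)"
  let ?rhs = "\<Sum>j<p. real n * ?q j * (1 + K * ?y (nbrs m j)) +
    sigma2 C j * (K * ?y (nbrs m j) * (real n - real (card (nbrs m j))) + K * ln (real n))"
  have dn: "real (card (nbrs m j)) \<le> real n" if "j < p" for j
    using deg[OF m that] D by simp
  have "(\<integral>\<^sup>+x. ennreal (\<Sum>j<p. ?E j x) \<partial>?L) = (\<Sum>j<p. \<integral>\<^sup>+x. ennreal (?E j x) \<partial>?L)"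
    by (subst nn_integral_sum[symmetric]) (auto simp: sum_ennreal)
  also have "\<dots> = (\<Sum>j<p. ennreal (real n * sigma2 C j))"
    using qf_noise[of _ "\<lambda>_. 0"] by (intro sum.cong refl) (simp add: sample_second_moment[OF C] qf_sum)
  also have "\<dots> = ennreal (real n * ?\<Sigma>)"
    using sig by (subst sum_ennreal) (auto simp: sum_distrib_left)
  finally have intE: "(\<integral>\<^sup>+x. ennreal (\<Sum>j<p. ?E j x) \<partial>?L) = ennreal (real n * ?\<Sigma>)" .
  have "ennreal (real n * ?\<Sigma>) + ennreal (1 - 1 / K) * (\<integral>\<^sup>+x. ennreal (?H x) \<partial>?L) =
    (\<integral>\<^sup>+x. ennreal ((\<Sum>j<p. ?E j x) + (1 - 1 / K) * ?H x) \<partial>?L)"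
  proof -
    have Fm: "(\<lambda>x. ennreal (\<Sum>j<p. ?E j x)) \<in> borel_measurable ?L"
      by (rule measurable_compose[OF borel_measurable_sum[OF Em] measurable_ennreal])
    have Hm': "(\<lambda>x. ennreal (?H x)) \<in> borel_measurable ?L"
      by (rule measurable_compose[OF Hm measurable_ennreal])
    have HKm: "(\<lambda>x. ennreal (1 - 1 / K) * ennreal (?H x)) \<in> borel_measurable ?L"
      by (rule borel_measurable_times_ennreal[OF borel_measurable_const Hm'])
    have "(\<integral>\<^sup>+x. ennreal ((\<Sum>j<p. ?E j x) + (1 - 1 / K) * ?H x) \<partial>?L) =
      (\<integral>\<^sup>+x. ennreal (\<Sum>j<p. ?E j x) + ennreal (1 - 1 / K) * ennreal (?H x) \<partial>?L)"
    proof (rule nn_integral_cong)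
      fix x
      have "0 \<le> ?H x" "0 \<le> (\<Sum>j<p. ?E j x)" by (simp_all add: sum_nonneg)
      thus "ennreal ((\<Sum>j<p. ?E j x) + (1 - 1 / K) * ?H x) = ennreal (\<Sum>j<p. ?E j x) + ennreal (1 - 1 / K) * ennreal (?H x)"
        by (subst ennreal_plus) (auto simp only: ennreal_mult Kp intro!: mult_nonneg_nonneg)
    qed
    also have "\<dots> = (\<integral>\<^sup>+x. ennreal (\<Sum>j<p. ?E j x) \<partial>?L) + (\<integral>\<^sup>+x. ennreal (1 - 1 / K) * ennreal (?H x) \<partial>?L)"
      by (rule nn_integral_add[OF Fm HKm])
    also have "(\<integral>\<^sup>+x. ennreal (1 - 1 / K) * ennreal (?H x) \<partial>?L) = ennreal (1 - 1 / K) * (\<integral>\<^sup>+x. ennreal (?H x) \<partial>?L)"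
      by (rule nn_integral_cmult[OF Hm'])
    finally show ?thesis unfolding intE ..
  qed
  also have "\<dots> \<le> (\<integral>\<^sup>+x. (\<Sum>j<p. ennreal (?B j x) + ennreal (K * ?y (nbrs m j)) * ennreal (?R m j x)) +
      (\<Sum>j<p. \<Sum>S\<in>?Sub j. ennreal K * ennreal (excess j S x)) \<partial>?L)"
  proof (rule nn_integral_mono_AE)
    show "AE x in ?L. ennreal ((\<Sum>j<p. ?E j x) + (1 - 1 / K) * ?H x) \<le>
      (\<Sum>j<p. ennreal (?B j x) + ennreal (K * ?y (nbrs m j)) * ennreal (?R m j x)) +
      (\<Sum>j<p. \<Sum>S\<in>?Sub j. ennreal K * ennreal (excess j S x))"
      using ptw
    proof eventually_elim
      fix x assume "(\<Sum>j<p. ?E j x) + (1 - 1 / K) * ?H x \<le>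
        (\<Sum>j<p. ?B j x + K * ?y (nbrs m j) * ?R m j x) + (\<Sum>j<p. \<Sum>S\<in>?Sub j. K * max 0 (excess j S x))"
      hence "ennreal ((\<Sum>j<p. ?E j x) + (1 - 1 / K) * ?H x) \<le>
        ennreal ((\<Sum>j<p. ?B j x + K * ?y (nbrs m j) * ?R m j x) + (\<Sum>j<p. \<Sum>S\<in>?Sub j. K * max 0 (excess j S x)))"
        by (rule ennreal_leI)
      also have "\<dots> = (\<Sum>j<p. ennreal (?B j x) + ennreal (K * ?y (nbrs m j)) * ennreal (?R m j x)) +
        (\<Sum>j<p. \<Sum>S\<in>?Sub j. ennreal K * ennreal (excess j S x))"
      proof -
        have Ky: "0 \<le> K * ?y (nbrs m j)" if "j < p" for j using Kp yn[OF m that] by simp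
        have "(\<Sum>j<p. ennreal (?B j x) + ennreal (K * ?y (nbrs m j)) * ennreal (?R m j x)) =
          (\<Sum>j<p. ennreal (?B j x + K * ?y (nbrs m j) * ?R m j x))"
          using Ky by (intro sum.cong refl)
            (simp only: ennreal_plus[OF ip_nonneg mult_nonneg_nonneg[OF Ky ip_nonneg]] ennreal_mult[OF Ky ip_nonneg] lessThan_iff)
        moreover have "(\<Sum>j<p. \<Sum>S\<in>?Sub j. ennreal K * ennreal (excess j S x)) =
          (\<Sum>j<p. \<Sum>S\<in>?Sub j. ennreal (K * max 0 (excess j S x)))"
          using Kp by (intro sum.cong refl) (simp add: ennreal_mult ennreal_max_0)
        moreover have "(\<Sum>j<p. ennreal (?B j x + K * ?y (nbrs m j) * ?R m j x)) +
            (\<Sum>j<p. \<Sum>S\<in>?Sub j. ennreal (K * max 0 (excess j S x))) =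
          ennreal ((\<Sum>j<p. ?B j x + K * ?y (nbrs m j) * ?R m j x) + (\<Sum>j<p. \<Sum>S\<in>?Sub j. K * max 0 (excess j S x)))"
          by (rule pack) (use Kp Ky in \<open>auto intro!: add_nonneg_nonneg mult_nonneg_nonneg\<close>)
        ultimately show ?thesis by (simp only:)
      qed
      finally show "ennreal ((\<Sum>j<p. ?E j x) + (1 - 1 / K) * ?H x) \<le>
        (\<Sum>j<p. ennreal (?B j x) + ennreal (K * ?y (nbrs m j)) * ennreal (?R m j x)) +
        (\<Sum>j<p. \<Sum>S\<in>?Sub j. ennreal K * ennreal (excess j S x))" .
    qed
  qed
  also have "\<dots> = (\<Sum>j<p. (\<integral>\<^sup>+x. ennreal (?B j x) \<partial>?L) + ennreal (K * ?y (nbrs m j)) * (\<integral>\<^sup>+x. ennreal (?R m j x) \<partial>?L)) +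
      (\<Sum>j<p. \<Sum>S\<in>?Sub j. ennreal K * (\<integral>\<^sup>+x. ennreal (excess j S x) \<partial>?L))"
  proof -
    have Rj: "(\<lambda>x. ennreal (?R m j x)) \<in> borel_measurable ?L" if "j < p" for j
      using Rm[OF that] by (rule measurable_compose) simp
    have Bj: "(\<lambda>x. ennreal (?B j x)) \<in> borel_measurable ?L" for j
      using Em by (rule measurable_compose) simp
    have ex: "(\<lambda>x. ennreal (excess j S x)) \<in> borel_measurable ?L" for j S
      using measurable_excess by (rule measurable_compose) simp
    have kR: "(\<lambda>x. ennreal (K * ?y (nbrs m j)) * ennreal (?R m j x)) \<in> borel_measurable ?L" if "j < p" for j
      using Rj[OF that] by (intro borel_measurable_times_ennreal borel_measurable_const)
    have Kex: "(\<lambda>x. ennreal K * ennreal (excess j S x)) \<in> borel_measurable ?L" for j S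
      using ex by (intro borel_measurable_times_ennreal borel_measurable_const)
    have BR: "(\<lambda>x. ennreal (?B j x) + ennreal (K * ?y (nbrs m j)) * ennreal (?R m j x)) \<in> borel_measurable ?L" if "j < p" for j
      by (rule borel_measurable_add[OF Bj kR[OF that]])
    have F: "(\<lambda>x. \<Sum>j<p. ennreal (?B j x) + ennreal (K * ?y (nbrs m j)) * ennreal (?R m j x)) \<in> borel_measurable ?L"
      by (rule borel_measurable_sum, rule BR, simp)
    have GS: "(\<lambda>x. \<Sum>S\<in>?Sub j. ennreal K * ennreal (excess j S x)) \<in> borel_measurable ?L" for j
      by (rule borel_measurable_sum, rule Kex)
    have G: "(\<lambda>x. \<Sum>j<p. \<Sum>S\<in>?Sub j. ennreal K * ennreal (excess j S x)) \<in> borel_measurable ?L"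
      by (rule borel_measurable_sum, rule GS)
    have "(\<integral>\<^sup>+x. (\<Sum>j<p. ennreal (?B j x) + ennreal (K * ?y (nbrs m j)) * ennreal (?R m j x)) +
        (\<Sum>j<p. \<Sum>S\<in>?Sub j. ennreal K * ennreal (excess j S x)) \<partial>?L) =
      (\<integral>\<^sup>+x. (\<Sum>j<p. ennreal (?B j x) + ennreal (K * ?y (nbrs m j)) * ennreal (?R m j x)) \<partial>?L) +
      (\<integral>\<^sup>+x. (\<Sum>j<p. \<Sum>S\<in>?Sub j. ennreal K * ennreal (excess j S x)) \<partial>?L)"
      by (rule nn_integral_add[OF F G])
    also have "(\<integral>\<^sup>+x. (\<Sum>j<p. ennreal (?B j x) + ennreal (K * ?y (nbrs m j)) * ennreal (?R m j x)) \<partial>?L) =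
      (\<Sum>j<p. \<integral>\<^sup>+x. ennreal (?B j x) + ennreal (K * ?y (nbrs m j)) * ennreal (?R m j x) \<partial>?L)"
      by (rule nn_integral_sum, rule BR, simp)
    also have "\<dots> = (\<Sum>j<p. (\<integral>\<^sup>+x. ennreal (?B j x) \<partial>?L) + ennreal (K * ?y (nbrs m j)) * (\<integral>\<^sup>+x. ennreal (?R m j x) \<partial>?L))"
    proof (intro sum.cong refl)
      fix j assume "j \<in> {..<p}"
      hence j: "j < p" by simp
      show "(\<integral>\<^sup>+x. ennreal (?B j x) + ennreal (K * ?y (nbrs m j)) * ennreal (?R m j x) \<partial>?L) =
        (\<integral>\<^sup>+x. ennreal (?B j x) \<partial>?L) + ennreal (K * ?y (nbrs m j)) * (\<integral>\<^sup>+x. ennreal (?R m j x) \<partial>?L)"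
        unfolding nn_integral_add[OF Bj kR[OF j]] nn_integral_cmult[OF Rj[OF j]] ..
    qed
    also have "(\<integral>\<^sup>+x. (\<Sum>j<p. \<Sum>S\<in>?Sub j. ennreal K * ennreal (excess j S x)) \<partial>?L) =
      (\<Sum>j<p. \<integral>\<^sup>+x. (\<Sum>S\<in>?Sub j. ennreal K * ennreal (excess j S x)) \<partial>?L)"
      by (rule nn_integral_sum, rule GS)
    also have "\<dots> = (\<Sum>j<p. \<Sum>S\<in>?Sub j. \<integral>\<^sup>+x. ennreal K * ennreal (excess j S x) \<partial>?L)"
      by (rule sum.cong[OF refl], rule nn_integral_sum, rule Kex)
    also have "\<dots> = (\<Sum>j<p. \<Sum>S\<in>?Sub j. ennreal K * (\<integral>\<^sup>+x. ennreal (excess j S x) \<partial>?L))"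
      unfolding nn_integral_cmult[OF ex] ..
    finally show ?thesis .
  qed
  also have "\<dots> \<le> (\<Sum>j<p. ennreal (real n * (?q j + sigma2 C j)) +
      ennreal (K * ?y (nbrs m j)) * ennreal (real n * ?q j + sigma2 C j * (real n - real (card (nbrs m j))))) +
      (\<Sum>j<p. \<Sum>S\<in>?Sub j. ennreal K * ennreal (sigma2 C j / (real ((p - 1) choose card S) * (real (card S) + 1))))"
  proof (intro add_mono sum_mono mult_left_mono)
    fix j assume "j \<in> {..<p}"
    hence j: "j < p" by simp
    show "(\<integral>\<^sup>+x. ennreal (?R m j x) \<partial>?L) \<le> ennreal (real n * ?q j + sigma2 C j * (real n - real (card (nbrs m j))))"
      using b j by (intro least_squares_mean[OF m j]) auto
    have "res_coeff j (b j) = (\<lambda>i. ?\<delta> j i + ?v j i)" by (auto simp: res_coeff_def)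
    moreover have "?\<delta> j j = 0" using bj[OF j] theta_facts(1)[OF j] by simp
    ultimately show "(\<integral>\<^sup>+x. ennreal (?B j x) \<partial>?L) \<le> ennreal (real n * (?q j + sigma2 C j))"
      using qf_noise[OF j, of "?\<delta> j"] by (simp add: sample_second_moment[OF C])
  next
    fix j S assume "j \<in> {..<p}" "S \<in> ?Sub j"
    thus "(\<integral>\<^sup>+x. ennreal (excess j S x) \<partial>?L) \<le> ennreal (sigma2 C j / (real ((p - 1) choose card S) * (real (card S) + 1)))"
      by (intro excess_mean) auto
  qed auto
  also have "\<dots> = ennreal ((\<Sum>j<p. real n * (?q j + sigma2 C j) +
      K * ?y (nbrs m j) * (real n * ?q j + sigma2 C j * (real n - real (card (nbrs m j))))) +
      (\<Sum>j<p. \<Sum>S\<in>?Sub j. K * (sigma2 C j / (real ((p - 1) choose card S) * (real (card S) + 1)))))"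
  proof -
    have 1: "0 \<le> real n * ?q j + sigma2 C j * (real n - real (card (nbrs m j)))" if "j < p" for j
      using qf_nonneg[OF C] sig[OF that] dn[OF that] by (intro add_nonneg_nonneg mult_nonneg_nonneg) auto
    have 2: "0 \<le> real n * (?q j + sigma2 C j)" if "j < p" for j
      using qf_nonneg[OF C] sig[OF that] by simp
    have 3: "0 \<le> K * ?y (nbrs m j)" if "j < p" for j using Kp yn[OF m that] by simp
    have 4: "0 \<le> sigma2 C j / (real ((p - 1) choose card S) * (real (card S) + 1))" if "j < p" for j S
      using sig[OF that] by simp
    have "(\<Sum>j<p. ennreal (real n * (?q j + sigma2 C j)) +
        ennreal (K * ?y (nbrs m j)) * ennreal (real n * ?q j + sigma2 C j * (real n - real (card (nbrs m j))))) =
      (\<Sum>j<p. ennreal (real n * (?q j + sigma2 C j) +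
        K * ?y (nbrs m j) * (real n * ?q j + sigma2 C j * (real n - real (card (nbrs m j))))))"
      using 1 2 3 by (intro sum.cong refl) (simp only: ennreal_plus[OF 2 mult_nonneg_nonneg[OF 3 1]] ennreal_mult lessThan_iff)
    moreover have "(\<Sum>j<p. \<Sum>S\<in>?Sub j. ennreal K * ennreal (sigma2 C j / (real ((p - 1) choose card S) * (real (card S) + 1)))) =
      (\<Sum>j<p. \<Sum>S\<in>?Sub j. ennreal (K * (sigma2 C j / (real ((p - 1) choose card S) * (real (card S) + 1)))))"
      using Kp 4 by (intro sum.cong refl ennreal_mult[symmetric]) auto
    ultimately show ?thesis
      using pack[OF add_nonneg_nonneg[OF 2 mult_nonneg_nonneg[OF 3 1]] mult_nonneg_nonneg[OF less_imp_le[OF Kp(1)] 4]]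
      by (simp only:)
  qed
  also have "\<dots> \<le> ennreal (real n * ?\<Sigma> + ?rhs)"
  proof (rule ennreal_leI)
    have "(\<Sum>S\<in>?Sub j. K * (sigma2 C j / (real ((p - 1) choose card S) * (real (card S) + 1)))) \<le> sigma2 C j * (K * ln (real n))"
      if j: "j < p" for j
    proof -
      have "(\<Sum>S\<in>?Sub j. K * (sigma2 C j / (real ((p - 1) choose card S) * (real (card S) + 1)))) =
        (\<Sum>d\<le>D. real ((p - 1) choose d) * (K * (sigma2 C j / (real ((p - 1) choose d) * (real d + 1)))))"
        by (rule sum_over_supports[OF j])
      also have "\<dots> = K * sigma2 C j * (\<Sum>d\<le>D. 1 / (real d + 1))"
        unfolding sum_distrib_left
      proof (intro sum.cong refl)
        fix d assume "d \<in> {..D}"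
        hence "(p - 1) choose d \<noteq> 0" using D np by (simp add: binomial_eq_0_iff)
        thus "real ((p - 1) choose d) * (K * (sigma2 C j / (real ((p - 1) choose d) * (real d + 1)))) =
          K * sigma2 C j * (1 / (real d + 1))" by simp
      qed
      also have "\<dots> \<le> K * sigma2 C j * ln (real n)"
        using harm Kp sig[OF j] by (intro mult_left_mono) auto
      finally show ?thesis by (simp add: mult_ac)
    qed
    hence "(\<Sum>j<p. \<Sum>S\<in>?Sub j. K * (sigma2 C j / (real ((p - 1) choose card S) * (real (card S) + 1)))) \<le>
      (\<Sum>j<p. sigma2 C j * (K * ln (real n)))" by (intro sum_mono) auto
    moreover have "real n * ?\<Sigma> + ?rhs = (\<Sum>j<p. real n * (?q j + sigma2 C j) +
      K * ?y (nbrs m j) * (real n * ?q j + sigma2 C j * (real n - real (card (nbrs m j))))) + (\<Sum>j<p. sigma2 C j * (K * ln (real n)))"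
      unfolding sum_distrib_left sum.distrib[symmetric] by (intro sum.cong refl) (simp add: algebra_simps)
    ultimately show "(\<Sum>j<p. real n * (?q j + sigma2 C j) +
      K * ?y (nbrs m j) * (real n * ?q j + sigma2 C j * (real n - real (card (nbrs m j))))) +
      (\<Sum>j<p. \<Sum>S\<in>?Sub j. K * (sigma2 C j / (real ((p - 1) choose card S) * (real (card S) + 1)))) \<le> real n * ?\<Sigma> + ?rhs"
      by simp
  qed
  finally have main: "ennreal (real n * ?\<Sigma>) + ennreal (1 - 1 / K) * (\<integral>\<^sup>+x. ennreal (?H x) \<partial>?L) \<le> ennreal (real n * ?\<Sigma> + ?rhs)" .
  have S0: "0 \<le> real n * ?\<Sigma>" using sig by (intro mult_nonneg_nonneg sum_nonneg) auto
  have K1: "0 < 1 - 1 / K" using K by simp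
  \<comment> \<open>A strictly positive left-hand side allows passing from \<open>ennreal\<close>
    back to the reals without knowing the sign of the right-hand side.\<close>
  have le: "u \<le> w" if "ennreal u \<le> ennreal w" "0 < u" for u w :: real
    using that by (auto simp: ennreal_le_iff2)
  \<comment> \<open>The noise level can be cancelled because the risk is finite, which
    \<open>main\<close> itself shows.\<close>
  obtain h where h: "0 \<le> h" "(\<integral>\<^sup>+x. ennreal (?H x) \<partial>?L) = ennreal h"
  proof (cases "\<integral>\<^sup>+x. ennreal (?H x) \<partial>?L")
    case top
    have "ennreal (1 - 1 / K) * (\<integral>\<^sup>+x. ennreal (?H x) \<partial>?L) = \<infinity>"
      unfolding top using K by (simp add: ennreal_mult_top)
    with main show ?thesis by (simp add: top_unique)
  qed (use that in auto)
  have "ennreal (real n * ?\<Sigma> + (1 - 1 / K) * h) \<le> ennreal (real n * ?\<Sigma> + ?rhs)"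
    using main S0 h(1) K1 unfolding h(2) by (simp add: ennreal_plus ennreal_mult)
  moreover have "0 < real n * ?\<Sigma> + (1 - 1 / K) * h"
  proof -
    have "0 < ?\<Sigma>" using theta_facts(3) np by (intro sum_pos) auto
    thus ?thesis using n3 K1 h(1) by (intro add_pos_nonneg) auto
  qed
  ultimately have "real n * ?\<Sigma> + (1 - 1 / K) * h \<le> real n * ?\<Sigma> + ?rhs"
    by (rule le)
  hence "(1 - 1 / K) * h \<le> ?rhs" by simp
  hence "h \<le> K / (K - 1) * ?rhs" using K by (simp add: field_simps)
  thus ?thesis unfolding h(2) by (rule ennreal_leI)
qed

end

section \<open>Small ball estimates\<close>

lemma std_normal_laplace:
  assumes "-1 < a"
  shows "(\<integral>\<^sup>+z. ennreal (exp (- a / 2 * z\<^sup>2)) \<partial>std_normal_distribution) = ennreal (1 / sqrt (1 + a))"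
proof -
  define \<sigma> where "\<sigma> = 1 / sqrt (1 + a)"
  have \<sigma>: "0 < \<sigma>" "\<sigma>\<^sup>2 = 1 / (1 + a)" using assms by (simp_all add: \<sigma>_def power_divide)
  have eq: "std_normal_density z * exp (- a / 2 * z\<^sup>2) = \<sigma> * normal_density 0 \<sigma> z" for z
  proof -
    have "\<sigma> * normal_density 0 \<sigma> z = \<sigma> / sqrt (2 * pi * \<sigma>\<^sup>2) * exp (- z\<^sup>2 / (2 * \<sigma>\<^sup>2))"
      by (simp add: normal_density_def)
    also have "\<sigma> / sqrt (2 * pi * \<sigma>\<^sup>2) = 1 / sqrt (2 * pi)" using \<sigma>(1) by (simp add: real_sqrt_mult)
    also have "- z\<^sup>2 / (2 * \<sigma>\<^sup>2) = - z\<^sup>2 / 2 + - a / 2 * z\<^sup>2"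
      using assms unfolding \<sigma>(2) by (simp add: field_simps)
    finally show ?thesis unfolding exp_add by (simp add: std_normal_density_def)
  qed
  have "(\<integral>\<^sup>+z. ennreal (exp (- a / 2 * z\<^sup>2)) \<partial>std_normal_distribution) =
    (\<integral>\<^sup>+z. ennreal (std_normal_density z * exp (- a / 2 * z\<^sup>2)) \<partial>lborel)"
    by (subst nn_integral_density) (auto simp: ennreal_mult)
  also have "\<dots> = (\<integral>\<^sup>+z. ennreal \<sigma> * ennreal (normal_density 0 \<sigma> z) \<partial>lborel)"
    unfolding eq using \<sigma>(1) by (simp add: ennreal_mult)
  also have "\<dots> = ennreal \<sigma> * emeasure (density lborel (normal_density 0 \<sigma>)) UNIV"
    by (subst nn_integral_cmult) (auto simp: emeasure_density)
  also have "emeasure (density lborel (normal_density 0 \<sigma>)) UNIV = 1"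
    using prob_space.emeasure_space_1[OF prob_space_normal_density[OF \<sigma>(1), of 0]] by simp
  finally show ?thesis by (simp add: \<sigma>_def)
qed

lemma sample_laplace:
  assumes C: "pos_def p C" and a: "-1 < a" and u: "qf p C u u = 1"
  shows "(\<integral>\<^sup>+x. ennreal (exp (- a / 2 * nsq n (\<lambda>k. ip p u (x k)))) \<partial>sample_law n p C) = ennreal ((1 / sqrt (1 + a)) ^ n)"
proof -
  interpret N: prob_space "normal_dist p C" by (rule prob_space_normal_dist[OF C])
  interpret NN: product_prob_space "\<lambda>_::nat. normal_dist p C" by unfold_locales
  let ?g = "\<lambda>y. ennreal (exp (- a / 2 * (ip p u y)\<^sup>2))"
  have ipm: "(\<lambda>y. ip p u y) \<in> borel_measurable (normal_dist p C)"
    unfolding measurable_cong_sets[OF sets_normal_dist refl] ip_def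
    by (intro borel_measurable_sum borel_measurable_times borel_measurable_const measurable_component_singleton)
  have gm: "?g \<in> borel_measurable (normal_dist p C)"
    using ipm by (rule measurable_compose) measurable
  have "ennreal (exp (- a / 2 * nsq n (\<lambda>k. ip p u (x k)))) = (\<Prod>k<n. ?g (x k))" for x
    by (simp add: ip_self[of n] sum_distrib_left exp_sum sum_negf[symmetric] prod_ennreal)
  hence "(\<integral>\<^sup>+x. ennreal (exp (- a / 2 * nsq n (\<lambda>k. ip p u (x k)))) \<partial>sample_law n p C) =
    (\<integral>\<^sup>+x. (\<Prod>k<n. ?g (x k)) \<partial>sample_law n p C)" by simp
  also have "\<dots> = (\<Prod>k<n. \<integral>\<^sup>+y. ?g y \<partial>normal_dist p C)"
    unfolding sample_law_def by (rule NN.product_nn_integral_prod) (simp, rule gm)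
  also have "(\<integral>\<^sup>+y. ?g y \<partial>normal_dist p C) = ennreal (1 / sqrt (1 + a))"
    using nn_integral_normal_dist_linear[OF C, of "\<lambda>t. ennreal (exp (- a / 2 * t))" u] std_normal_laplace[OF a]
    by (simp add: u)
  finally show ?thesis using a by (simp add: ennreal_power)
qed

text \<open>Chernoff's bound, with the exponent already included in \<open>f\<close>.\<close>

lemma emeasure_le_exp_moment:
  assumes f: "f \<in> borel_measurable M" and s: "\<And>x. x \<in> A \<Longrightarrow> c \<le> f x" and A: "A \<in> sets M"
  shows "emeasure M A \<le> ennreal (exp (- c)) * (\<integral>\<^sup>+x. ennreal (exp (f x)) \<partial>M)"
proof -
  have "emeasure M A = (\<integral>\<^sup>+x. indicator A x \<partial>M)" using A by simp
  also have "\<dots> \<le> (\<integral>\<^sup>+x. ennreal (exp (- c)) * ennreal (exp (f x)) \<partial>M)"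
  proof (rule nn_integral_mono)
    fix x
    have "ennreal (exp (- c)) * ennreal (exp (f x)) = ennreal (exp (f x - c))"
      by (simp add: ennreal_mult[symmetric] exp_add[symmetric] algebra_simps)
    moreover have "1 \<le> exp (f x - c)" if "x \<in> A" using s[OF that] by simp
    ultimately show "indicator A x \<le> ennreal (exp (- c)) * ennreal (exp (f x))"
      by (auto simp: indicator_def)
  qed
  also have "\<dots> = ennreal (exp (- c)) * (\<integral>\<^sup>+x. ennreal (exp (f x)) \<partial>M)"
    using f by (intro nn_integral_cmult) simp
  finally show ?thesis .
qed

text \<open>The difference of the two sides is \<open>g \<epsilon>\<close>; its derivative is (1 -
  t)^2 / t and \<open>g 1 = 0\<close>. For \<epsilon> = 1 - sqrt \<eta> the resulting tail is exp (-
  n \<eta>).\<close>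

lemma chi2_lower_tail_exponent:
  fixes \<epsilon> :: real
  assumes "0 < \<epsilon>" "\<epsilon> \<le> 1"
  shows "(1 - \<epsilon>\<^sup>2) / 2 + ln \<epsilon> \<le> - (1 - \<epsilon>)\<^sup>2"
proof -
  define g where "g = (\<lambda>t::real. ln t + (3 - 4 * t + t\<^sup>2) / 2)"
  have "g \<epsilon> \<le> g 1"
  proof (rule DERIV_nonneg_imp_nondecreasing[OF assms(2)])
    fix t assume t: "\<epsilon> \<le> t" "t \<le> 1"
    hence t0: "0 < t" using assms by simp
    have "(g has_real_derivative 1 / t + (- 4 + 2 * t) / 2) (at t)"
      unfolding g_def using t0 by (auto intro!: derivative_eq_intros)
    moreover have "1 / t + (- 4 + 2 * t) / 2 = (1 - t)\<^sup>2 / t"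
      using t0 by (simp add: field_simps power2_eq_square)
    ultimately show "\<exists>y. (g has_real_derivative y) (at t) \<and> 0 \<le> y" using t0 by auto
  qed
  thus ?thesis by (simp add: g_def power2_eq_square field_simps)
qed

lemma measurable_sample_law_nsq [measurable]:
  "(\<lambda>x. nsq n (\<lambda>k. ip p u (x k))) \<in> borel_measurable (sample_law n p C)"
  unfolding measurable_cong_sets[OF sets_sample_law refl] by (intro measurable_ip measurable_sample_row)

lemma sample_lower_tail:
  assumes C: "pos_def p C" and u: "0 < qf p C u u" and \<epsilon>: "0 < \<epsilon>" "\<epsilon> \<le> 1"
  shows "emeasure (sample_law n p C) {x \<in> space (sample_law n p C). nsq n (\<lambda>k. ip p u (x k)) < \<epsilon>\<^sup>2 * real n * qf p C u u}
    \<le> ennreal (exp (- real n * (1 - \<epsilon>)\<^sup>2))"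
proof -
  define q where "q = sqrt (qf p C u u)"
  define w where "w = (\<lambda>i. 1 / q * u i)"
  have q: "0 < q" "q\<^sup>2 = qf p C u u" using u by (simp_all add: q_def)
  have w: "qf p C w w = 1" unfolding w_def qf_linear(3,6) q(2)[symmetric] using q(1) by (simp add: power2_eq_square)
  have nw: "nsq n (\<lambda>k. ip p w (x k)) = nsq n (\<lambda>k. ip p u (x k)) / qf p C u u" for x
    unfolding w_def ip_scale_left ip_scale using q by (simp add: power2_eq_square flip: q(2))
  \<comment> \<open>The optimal exponent in Chernoff's bound; with it 1 / sqrt (1 + a) =
    \<epsilon>.\<close>
  define a where "a = 1 / \<epsilon>\<^sup>2 - 1"
  have a: "0 \<le> a" "1 + a = (1 / \<epsilon>)\<^sup>2" using \<epsilon> by (auto simp: a_def power_divide power_le_one)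
  let ?A = "{x \<in> space (sample_law n p C). nsq n (\<lambda>k. ip p u (x k)) < \<epsilon>\<^sup>2 * real n * qf p C u u}"
  have "emeasure (sample_law n p C) ?A \<le> ennreal (exp (- (- a / 2 * (\<epsilon>\<^sup>2 * real n)))) *
    (\<integral>\<^sup>+x. ennreal (exp (- a / 2 * nsq n (\<lambda>k. ip p w (x k)))) \<partial>sample_law n p C)"
  proof (rule emeasure_le_exp_moment)
    fix x assume "x \<in> ?A"
    hence "nsq n (\<lambda>k. ip p w (x k)) \<le> \<epsilon>\<^sup>2 * real n" unfolding nw using u by (simp add: field_simps)
    thus "- a / 2 * (\<epsilon>\<^sup>2 * real n) \<le> - a / 2 * nsq n (\<lambda>k. ip p w (x k))"
      using a by (intro mult_left_mono_neg) auto
  qed measurable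
  also have "(\<integral>\<^sup>+x. ennreal (exp (- a / 2 * nsq n (\<lambda>k. ip p w (x k)))) \<partial>sample_law n p C) = ennreal (\<epsilon> ^ n)"
    using sample_laplace[OF C _ w, of a n] a \<epsilon> by simp
  also have "ennreal (exp (- (- a / 2 * (\<epsilon>\<^sup>2 * real n)))) * ennreal (\<epsilon> ^ n) = ennreal (exp (real n * ((1 - \<epsilon>\<^sup>2) / 2 + ln \<epsilon>)))"
  proof -
    have "\<epsilon> ^ n = exp (real n * ln \<epsilon>)" using \<epsilon> by (simp add: exp_of_nat_mult)
    moreover have "- (- a / 2 * (\<epsilon>\<^sup>2 * real n)) = real n * ((1 - \<epsilon>\<^sup>2) / 2)"
      using \<epsilon> by (simp add: a_def field_simps)
    ultimately show ?thesis by (simp add: ennreal_mult[symmetric] exp_add[symmetric] distrib_left)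
  qed
  also have "\<dots> \<le> ennreal (exp (- real n * (1 - \<epsilon>)\<^sup>2))"
    using mult_left_mono[OF chi2_lower_tail_exponent[OF \<epsilon>], of "real n"] by (intro ennreal_leI) simp
  finally show ?thesis .
qed

text \<open>A crude Chernoff bound with exponent 1/4: each observation contributes exp (-2) sqrt 2
  \<le> exp (-1). The generous constant 8 only affects the mesh of the lattice.\<close>

lemma sample_upper_tail:
  assumes C: "pos_def p C" and u: "qf p C u u = 1"
  shows "emeasure (sample_law n p C) {x \<in> space (sample_law n p C). 8 * real n < nsq n (\<lambda>k. ip p u (x k))}
    \<le> ennreal (exp (- real n))"
proof -
  let ?A = "{x \<in> space (sample_law n p C). 8 * real n < nsq n (\<lambda>k. ip p u (x k))}"
  have "emeasure (sample_law n p C) ?A \<le> ennreal (exp (- (2 * real n))) *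
    (\<integral>\<^sup>+x. ennreal (exp (- (-1 / 2) / 2 * nsq n (\<lambda>k. ip p u (x k)))) \<partial>sample_law n p C)"
    by (rule emeasure_le_exp_moment) auto
  also have "(\<integral>\<^sup>+x. ennreal (exp (- (-1 / 2) / 2 * nsq n (\<lambda>k. ip p u (x k)))) \<partial>sample_law n p C) = ennreal (sqrt 2 ^ n)"
    by (subst sample_laplace[OF C _ u]) (auto simp: real_sqrt_divide)
  also have "ennreal (exp (- (2 * real n))) * ennreal (sqrt 2 ^ n) \<le> ennreal (exp (- real n))"
  proof -
    have "sqrt 2 \<le> exp (1::real)"
      using exp_ge_add_one_self[of "1::real"] real_sqrt_le_mono[of 2 4] by simp
    hence "sqrt 2 ^ n \<le> exp 1 ^ n" by (intro power_mono) auto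
    also have "\<dots> = exp (real n)" by (simp flip: exp_of_nat_mult)
    finally have "exp (- (2 * real n)) * sqrt 2 ^ n \<le> exp (- (2 * real n)) * exp (real n)"
      by (intro mult_left_mono) auto
    also have "\<dots> = exp (- real n)" by (simp flip: exp_add)
    finally show ?thesis by (simp add: ennreal_leI flip: ennreal_mult)
  qed
  finally show ?thesis .
qed

section \<open>Rounding to a lattice\<close>

lemma qf_sum_orthonormal:
  fixes e :: nat
  assumes "\<And>i k. i < e \<Longrightarrow> k < e \<Longrightarrow> qf p C (Q i) (Q k) = of_bool (i = k)"
  shows "qf p C (\<lambda>i. \<Sum>k<e. r k * Q k i) (\<lambda>i. \<Sum>k<e. s k * Q k i) = (\<Sum>k<e. r k * s k)"
proof -
  have left: "qf p C (\<lambda>i. \<Sum>k<d. r k * Q k i) y = (\<Sum>k<d. r k * qf p C (Q k) y)" for d :: nat and r y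
    by (induction d) (simp_all add: qf_linear, simp add: qf_sum)
  have right: "qf p C y (\<lambda>i. \<Sum>k<d. s k * Q k i) = (\<Sum>k<d. s k * qf p C y (Q k))" for d :: nat and s y
    by (induction d) (simp_all add: qf_linear, simp add: qf_sum)
  show ?thesis unfolding left right by (simp add: assms sum_of_bool_mult mult.commute cong: sum.cong_simp)
qed

text \<open>Gram-Schmidt for the inner product \<open>qf p C\<close>. The number \<open>e\<close> of
  basis vectors may be smaller than \<open>d\<close>, since the \<open>W l\<close> may be dependent,
  for instance when the column of \<theta> is supported in \<open>S\<close>.\<close>

lemma gram_schmidt_qf:
  fixes d :: nat
  assumes C: "pos_def p C"
  shows "\<exists>e\<le>d. \<exists>Q. (\<forall>i<e. \<forall>k<e. qf p C (Q i) (Q k) = of_bool (i = k)) \<and>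
    (\<forall>l<d. \<exists>r. \<forall>i<p. W l i = (\<Sum>k<e. r k * Q k i))"
proof (induction d)
  case 0
  show ?case by auto
next
  case (Suc d)
  then obtain e Q where e: "e \<le> d" and Q: "\<And>i k. i < e \<Longrightarrow> k < e \<Longrightarrow> qf p C (Q i) (Q k) = of_bool (i = k)"
    and W: "\<And>l. l < d \<Longrightarrow> \<exists>r. \<forall>i<p. W l i = (\<Sum>k<e. r k * Q k i)" by blast
  define r where "r k = qf p C (W d) (Q k)" for k
  define w where "w = (\<lambda>i. W d i - (\<Sum>k<e. r k * Q k i))"
  have orth: "qf p C w (Q k) = 0" if k: "k < e" for k
  proof -
    have "qf p C (\<lambda>i. \<Sum>k<e. r k * Q k i) (Q k) = qf p C (\<lambda>i. \<Sum>k<e. r k * Q k i) (\<lambda>i. \<Sum>k'<e. of_bool (k' = k) * Q k' i)"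
      using k by (intro arg_cong2[of _ _ _ _ "qf p C"] refl ext) (simp add: sum_of_bool_mult)
    also have "\<dots> = r k" using k by (subst qf_sum_orthonormal[OF Q]) (simp_all add: sum_of_bool_mult)
    finally show ?thesis by (simp add: w_def qf_linear r_def)
  qed
  show ?case
  proof (cases "qf p C w w = 0")
    case True
    hence "w i = 0" if "i < p" for i using qf_pos[OF C, of w] that by force
    hence "\<forall>i<p. W d i = (\<Sum>k<e. r k * Q k i)" by (simp add: w_def)
    hence "\<forall>l<Suc d. \<exists>r. \<forall>i<p. W l i = (\<Sum>k<e. r k * Q k i)" using W by (metis less_Suc_eq)
    thus ?thesis using e Q by (intro exI[of _ e] conjI exI[of _ Q]) auto
  next
    case False
    define c where "c = sqrt (qf p C w w)"
    have c: "0 < c" "c * c = qf p C w w" using False qf_nonneg[OF C, of w] by (auto simp: c_def)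
    define Q' where "Q' = Q(e := (\<lambda>i. 1 / c * w i))"
    have "qf p C (Q' i) (Q' k) = of_bool (i = k)" if "i < Suc e" "k < Suc e" for i k
    proof -
      have "qf p C (\<lambda>i. 1 / c * w i) (\<lambda>i. 1 / c * w i) = 1"
        unfolding qf_linear(3,6) c(2)[symmetric] using c(1) by simp
      moreover have "qf p C (\<lambda>i. 1 / c * w i) (Q k) = 0" "qf p C (Q k) (\<lambda>i. 1 / c * w i) = 0" if "k < e" for k
        unfolding qf_linear(3,6) using orth[OF that] qf_commute[OF C, of "Q k" w] by simp_all
      ultimately show ?thesis using that Q by (auto simp: Q'_def less_Suc_eq)
    qed
    moreover have "\<exists>r. \<forall>i<p. W l i = (\<Sum>k<Suc e. r k * Q' k i)" if l: "l < Suc d" for l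
    proof (cases "l = d")
      case True
      have "W d i = (\<Sum>k<Suc e. (r(e := c)) k * Q' k i)" for i
        using c(1) by (simp add: Q'_def w_def)
      thus ?thesis using True by blast
    next
      case False
      then obtain r' where "\<forall>i<p. W l i = (\<Sum>k<e. r' k * Q k i)" using W[of l] l by auto
      hence "\<forall>i<p. W l i = (\<Sum>k<Suc e. (r'(e := 0)) k * Q' k i)" by (simp add: Q'_def)
      thus ?thesis by blast
    qed
    ultimately show ?thesis using e by (intro exI[of _ "Suc e"] conjI exI[of _ Q']) auto
  qed
qed

text \<open>
  Rounding one coordinate at a time: along a coordinate the quadratic function has leading coefficient
  at most \<open>\<parallel>Y\<^sub>i\<parallel>\<^sup>2\<close>, so one of the two neighbouring grid points increases it by at most \<open>h\<^sup>2 \<parallel>Y\<^sub>i\<parallel>\<^sup>2 / 4\<close>.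
\<close>

lemma quadratic_rounding:
  fixes A B c h t :: real
  assumes h: "0 < h" and A: "A \<le> A'" "0 \<le> A'"
  shows "\<exists>m::int. \<bar>h * of_int m - t\<bar> \<le> h \<and>
    A * (h * of_int m)\<^sup>2 + B * (h * of_int m) \<le> A * t\<^sup>2 + B * t + h\<^sup>2 / 4 * A'"
proof -
  define m where "m = \<lfloor>t / h\<rfloor>"
  define \<alpha> where "\<alpha> = t / h - of_int m"
  have \<alpha>: "0 \<le> \<alpha>" "\<alpha> \<le> 1" unfolding \<alpha>_def m_def by linarith+
  have t: "t = h * of_int m + h * \<alpha>" using h by (simp add: \<alpha>_def field_simps)
  let ?f = "\<lambda>z. A * z\<^sup>2 + B * z"
  let ?l = "h * of_int m" and ?r = "h * of_int (m + 1)"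
  have "(1 - \<alpha>) * ?f ?l + \<alpha> * ?f ?r = ?f t + A * (\<alpha> * (1 - \<alpha>)) * h\<^sup>2"
    unfolding t by (simp add: power2_eq_square algebra_simps)
  also have "\<dots> \<le> ?f t + h\<^sup>2 / 4 * A'"
  proof -
    have "0 \<le> \<alpha> * (1 - \<alpha>)" using \<alpha> by simp
    moreover have "\<alpha> * (1 - \<alpha>) \<le> 1 / 4"
      using zero_le_power2[of "\<alpha> - 1 / 2"] by (simp add: power2_eq_square algebra_simps)
    ultimately have "A * (\<alpha> * (1 - \<alpha>)) \<le> A' * (1 / 4)"
      using A by (intro order.trans[OF mult_right_mono[OF A(1)] mult_left_mono]) auto
    hence "A * (\<alpha> * (1 - \<alpha>)) * h\<^sup>2 \<le> A' * (1 / 4) * h\<^sup>2" by (rule mult_right_mono) simp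
    thus ?thesis by (simp add: mult_ac)
  qed
  finally have avg: "(1 - \<alpha>) * ?f ?l + \<alpha> * ?f ?r \<le> ?f t + h\<^sup>2 / 4 * A'" .
  have "?f ?l \<le> ?f t + h\<^sup>2 / 4 * A' \<or> ?f ?r \<le> ?f t + h\<^sup>2 / 4 * A'"
  proof (rule ccontr)
    assume "\<not> ?thesis"
    hence gt: "?f t + h\<^sup>2 / 4 * A' < ?f ?l" "?f t + h\<^sup>2 / 4 * A' < ?f ?r" by auto
    have "(1 - \<alpha>) * (?f t + h\<^sup>2 / 4 * A') + \<alpha> * (?f t + h\<^sup>2 / 4 * A') < (1 - \<alpha>) * ?f ?l + \<alpha> * ?f ?r"
    proof (cases "\<alpha> = 0")
      case False
      have 1: "(1 - \<alpha>) * (?f t + h\<^sup>2 / 4 * A') \<le> (1 - \<alpha>) * ?f ?l"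
        by (rule mult_left_mono) (use gt \<alpha> in auto)
      have 2: "\<alpha> * (?f t + h\<^sup>2 / 4 * A') < \<alpha> * ?f ?r"
        by (rule mult_strict_left_mono) (use gt \<alpha> False in auto)
      show ?thesis by (rule add_le_less_mono[OF 1 2])
    qed (use gt in simp)
    moreover have "(1 - \<alpha>) * (?f t + h\<^sup>2 / 4 * A') + \<alpha> * (?f t + h\<^sup>2 / 4 * A') = ?f t + h\<^sup>2 / 4 * A'"
      unfolding distrib_right[symmetric] by simp
    ultimately have "?f t + h\<^sup>2 / 4 * A' < (1 - \<alpha>) * ?f ?l + \<alpha> * ?f ?r" by (simp only:)
    with avg show False by (rule leD[THEN notE])
  qed
  moreover have "\<bar>?l - t\<bar> \<le> h" "\<bar>?r - t\<bar> \<le> h"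
    unfolding t using \<alpha> h by (auto simp: abs_le_iff algebra_simps mult_left_le)
  ultimately show ?thesis by blast
qed

lemma nsq_add_scale: "nsq n (\<lambda>i. v i + t * y i) = nsq n v + 2 * ip n v y * t + nsq n y * t\<^sup>2"
  by (simp add: ip_add ip_add_left ip_scale ip_scale_left ip_commute[of n y v] power2_eq_square algebra_simps)

lemma int_abs_le_square: "\<bar>m\<bar> \<le> (m::int)\<^sup>2"
proof (cases "m = 0")
  case False
  hence "\<bar>m\<bar> * 1 \<le> \<bar>m\<bar> * \<bar>m\<bar>" by (intro mult_left_mono) auto
  thus ?thesis by (simp add: power2_eq_square)
qed simp

text \<open>The quantity to be kept negative is the difference |Y s|^2 - \<rho> |s|^2, so it is
  rounded as a whole; subtracting \<rho> only lowers the leading coefficients. The offset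
  \<open>v\<close> in the induction holds the coordinates not yet rounded.\<close>

lemma lattice_rounding:
  assumes h: "0 < h" and \<rho>: "0 \<le> \<rho>"
  shows "\<exists>m::nat \<Rightarrow> int. (\<forall>k<e. \<bar>h * of_int (m k) - s k\<bar> \<le> h) \<and>
    nsq n (\<lambda>i. \<Sum>k<e. h * of_int (m k) * Y k i) - \<rho> * (\<Sum>k<e. (h * of_int (m k))\<^sup>2) \<le>
    nsq n (\<lambda>i. \<Sum>k<e. s k * Y k i) - \<rho> * (\<Sum>k<e. (s k)\<^sup>2) + h\<^sup>2 / 4 * (\<Sum>k<e. nsq n (Y k))"
proof -
  let ?f = "\<lambda>v z. nsq n v - \<rho> * z"
  have "\<exists>m::nat \<Rightarrow> int. (\<forall>k<e. \<bar>h * of_int (m k) - s k\<bar> \<le> h) \<and>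
    ?f (\<lambda>i. v i + (\<Sum>k<e. h * of_int (m k) * Y k i)) (\<Sum>k<e. (h * of_int (m k))\<^sup>2) \<le>
    ?f (\<lambda>i. v i + (\<Sum>k<e. s k * Y k i)) (\<Sum>k<e. (s k)\<^sup>2) + h\<^sup>2 / 4 * (\<Sum>k<e. nsq n (Y k))" for v
  proof (induction e arbitrary: v)
    case 0
    show ?case by simp
  next
    case (Suc e)
    obtain m where m: "\<forall>k<e. \<bar>h * of_int (m k) - s k\<bar> \<le> h"
      "?f (\<lambda>i. (v i + s e * Y e i) + (\<Sum>k<e. h * of_int (m k) * Y k i)) (\<Sum>k<e. (h * of_int (m k))\<^sup>2) \<le>
       ?f (\<lambda>i. (v i + s e * Y e i) + (\<Sum>k<e. s k * Y k i)) (\<Sum>k<e. (s k)\<^sup>2) + h\<^sup>2 / 4 * (\<Sum>k<e. nsq n (Y k))"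
      using Suc.IH[of "\<lambda>i. v i + s e * Y e i"] by blast
    let ?v = "\<lambda>i. v i + (\<Sum>k<e. h * of_int (m k) * Y k i)"
    let ?A = "nsq n (Y e) - \<rho>" and ?B = "2 * ip n ?v (Y e)"
    have expand: "nsq n (\<lambda>i. ?v i + t * Y e i) = nsq n ?v + 2 * ip n ?v (Y e) * t + nsq n (Y e) * t\<^sup>2" for t
      by (rule nsq_add_scale)
    obtain m0 :: int where m0: "\<bar>h * of_int m0 - s e\<bar> \<le> h"
      "?A * (h * of_int m0)\<^sup>2 + ?B * (h * of_int m0) \<le> ?A * (s e)\<^sup>2 + ?B * s e + h\<^sup>2 / 4 * nsq n (Y e)"
      using quadratic_rounding[OF h, of ?A "nsq n (Y e)" "s e" ?B] \<rho> by auto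
    define m' where "m' = m(e := m0)"
    have 1: "(\<lambda>i. v i + (\<Sum>k<Suc e. h * of_int (m' k) * Y k i)) = (\<lambda>i. ?v i + (h * of_int m0) * Y e i)"
      by (simp add: m'_def add.assoc)
    have 2: "(\<Sum>k<Suc e. (h * of_int (m' k))\<^sup>2) = (\<Sum>k<e. (h * of_int (m k))\<^sup>2) + (h * of_int m0)\<^sup>2"
      by (simp add: m'_def)
    have 3: "(\<lambda>i. (v i + s e * Y e i) + (\<Sum>k<e. h * of_int (m k) * Y k i)) = (\<lambda>i. ?v i + s e * Y e i)"
      by (simp add: algebra_simps)
    have 4: "(\<lambda>i. (v i + s e * Y e i) + (\<Sum>k<e. s k * Y k i)) = (\<lambda>i. v i + (\<Sum>k<Suc e. s k * Y k i))"
      by (simp add: algebra_simps)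
    have "?f (\<lambda>i. v i + (\<Sum>k<Suc e. h * of_int (m' k) * Y k i)) (\<Sum>k<Suc e. (h * of_int (m' k))\<^sup>2) \<le>
       ?f (\<lambda>i. v i + (\<Sum>k<Suc e. s k * Y k i)) (\<Sum>k<Suc e. (s k)\<^sup>2) + h\<^sup>2 / 4 * (\<Sum>k<Suc e. nsq n (Y k))"
      unfolding 1 2 using m(2) m0(2) unfolding 3 4 expand by (simp add: algebra_simps)
    moreover have "\<forall>k<Suc e. \<bar>h * of_int (m' k) - s k\<bar> \<le> h"
      using m(1) m0(1) by (simp add: m'_def less_Suc_eq)
    ultimately show ?case by blast
  qed
  from this[of "\<lambda>_. 0"] show ?thesis by simp
qed

lemma sum_exp_squares_le: "(\<Sum>m\<in>{- int B..int B}. exp (- (real_of_int m)\<^sup>2)) \<le> 3"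
proof -
  have half: "exp (- (real_of_int m)\<^sup>2) \<le> (1 / 2) ^ nat \<bar>m\<bar>" for m
  proof -
    have "exp (- 1) \<le> (1 / 2 :: real)"
      using exp_ge_add_one_self[of "1::real"] by (simp add: exp_minus field_simps)
    hence "exp (- 1) ^ nat \<bar>m\<bar> \<le> (1 / 2 :: real) ^ nat \<bar>m\<bar>" by (intro power_mono) auto
    moreover have "exp (- 1 :: real) ^ nat \<bar>m\<bar> = exp (- \<bar>real_of_int m\<bar>)"
      by (simp flip: exp_of_nat_mult)
    moreover have "\<bar>real_of_int m\<bar> \<le> (real_of_int m)\<^sup>2"
      using int_abs_le_square[of m] by (metis of_int_abs of_int_le_iff of_int_power)
    ultimately have "exp (- (real_of_int m)\<^sup>2) \<le> exp (- 1) ^ nat \<bar>m\<bar>" by simp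
    also have "\<dots> \<le> (1 / 2) ^ nat \<bar>m\<bar>" by fact
    finally show ?thesis .
  qed
  have "(\<Sum>m\<in>{- int B..int B}. (1 / 2 :: real) ^ nat \<bar>m\<bar>) = 3 - 2 * (1 / 2) ^ B"
  proof (induction B)
    case (Suc B)
    have "{- int (Suc B)..int (Suc B)} = insert (- int (Suc B)) (insert (int (Suc B)) {- int B..int B})"
      by auto
    thus ?case using Suc by (simp add: nat_add_distrib)
  qed simp
  moreover have "(\<Sum>m\<in>{- int B..int B}. exp (- (real_of_int m)\<^sup>2)) \<le> (\<Sum>m\<in>{- int B..int B}. (1 / 2) ^ nat \<bar>m\<bar>)"
    by (intro sum_mono half)
  moreover have "0 \<le> (1 / 2 :: real) ^ B" by simp
  ultimately show ?thesis by linarith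
qed

text \<open>Each point of \<open>G\<close> satisfies 1 \<le> exp R times the product of the exp (-
  m_k^2); summed over a box containing \<open>G\<close> the product factorizes, and each factor is
  at most 3.\<close>

lemma card_lattice_points_le:
  fixes R :: real and e :: nat
  defines "G \<equiv> {m \<in> {..<e} \<rightarrow>\<^sub>E UNIV. (\<Sum>k<e. (real_of_int (m k))\<^sup>2) \<le> R}"
  shows "finite G" "real (card G) \<le> exp R * 3 ^ e"
proof -
  define B where "B = nat \<lceil>R\<rceil>"
  have sub: "G \<subseteq> {..<e} \<rightarrow>\<^sub>E {- int B..int B}"
  proof
    fix m assume m: "m \<in> G"
    have "m k \<in> {- int B..int B}" if k: "k < e" for k
    proof -
      have "(real_of_int (m k))\<^sup>2 \<le> (\<Sum>k<e. (real_of_int (m k))\<^sup>2)"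
        using k by (intro member_le_sum) auto
      also have "\<dots> \<le> R" using m by (simp add: G_def)
      finally have "real_of_int ((m k)\<^sup>2) \<le> R" by simp
      hence "(m k)\<^sup>2 \<le> \<lceil>R\<rceil>" by linarith
      moreover have "\<bar>m k\<bar> \<le> (m k)\<^sup>2" by (rule int_abs_le_square)
      moreover have "0 \<le> (m k)\<^sup>2" by simp
      ultimately have "\<bar>m k\<bar> \<le> int B" unfolding B_def by linarith
      thus ?thesis by (simp add: abs_le_iff)
    qed
    thus "m \<in> {..<e} \<rightarrow>\<^sub>E {- int B..int B}" using m by (auto simp: G_def PiE_iff)
  qed
  have finP: "finite ({..<e} \<rightarrow>\<^sub>E {- int B..int B})" by (intro finite_PiE) auto
  show fin: "finite G" by (rule finite_subset[OF sub finP])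
  have "real (card G) * exp (- R) = (\<Sum>m\<in>G. exp (- R))" by simp
  also have "\<dots> \<le> (\<Sum>m\<in>G. \<Prod>k<e. exp (- (real_of_int (m k))\<^sup>2))"
  proof (intro sum_mono)
    fix m assume "m \<in> G"
    hence "exp (- R) \<le> exp (- (\<Sum>k<e. (real_of_int (m k))\<^sup>2))" by (simp add: G_def)
    thus "exp (- R) \<le> (\<Prod>k<e. exp (- (real_of_int (m k))\<^sup>2))" by (simp add: exp_sum flip: sum_negf)
  qed
  also have "\<dots> \<le> (\<Sum>m\<in>{..<e} \<rightarrow>\<^sub>E {- int B..int B}. \<Prod>k<e. exp (- (real_of_int (m k))\<^sup>2))"
    by (rule sum_mono2[OF finP sub]) (simp add: prod_nonneg)
  also have "\<dots> = (\<Prod>k<e. \<Sum>m\<in>{- int B..int B}. exp (- (real_of_int m)\<^sup>2))"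
    by (rule prod_sum_PiE[symmetric]) simp_all
  also have "\<dots> \<le> (\<Prod>k<e. 3)"
    by (rule prod_mono) (simp add: sum_exp_squares_le sum_nonneg)
  finally show "real (card G) \<le> exp R * 3 ^ e" by (simp add: exp_minus field_simps)
qed

lemma ip_sum_coeff: "ip p (\<lambda>i. \<Sum>k<e. r k * Q k i) y = (\<Sum>k<(e::nat). r k * ip p (Q k) y)"
  by (induction e) (simp_all add: ip_linear, simp add: ip_def)

text \<open>A vector of small ratio is normalized and rounded. If no basis vector is exceptionally
  long, the rounded vector has a ratio below \<epsilon>, and only finitely many lattice points come
  into question. A measurable superset \<open>B\<close> is asserted since the event itself is an
  uncountable union over \<open>c\<close>.\<close>

lemma subspace_small_ball:
  fixes W :: "nat \<Rightarrow> nat \<Rightarrow> real"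
  assumes C: "pos_def p C" and \<epsilon>: "0 < \<epsilon>" "\<epsilon> < 1" and d: "0 < d" and n: "0 < n"
  shows "\<exists>B\<in>sets (sample_law n p C).
    {x \<in> space (sample_law n p C). \<exists>c. nsq n (\<lambda>k. ip p (\<lambda>i. \<Sum>l<d. c l * W l i) (x k)) <
      (\<epsilon>\<^sup>2)\<^sup>2 * real n * qf p C (\<lambda>i. \<Sum>l<d. c l * W l i) (\<lambda>i. \<Sum>l<d. c l * W l i)} \<subseteq> B \<and>
    emeasure (sample_law n p C) B \<le> ennreal (real d * exp (- real n) +
      exp (8 / (\<epsilon>\<^sup>2 * (1 - \<epsilon>\<^sup>2)) * real d) * 3 ^ d * exp (- real n * (1 - \<epsilon>)\<^sup>2))"
proof -
  let ?L = "sample_law n p C"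
  obtain e Q where e: "e \<le> d" and Q: "\<And>i k. i < e \<Longrightarrow> k < e \<Longrightarrow> qf p C (Q i) (Q k) = of_bool (i = k)"
    and W: "\<And>l. l < d \<Longrightarrow> \<exists>r. \<forall>i<p. W l i = (\<Sum>k<e. r k * Q k i)"
    using gram_schmidt_qf[OF C, of d W] by blast
  \<comment> \<open>\<open>g\<close> is the gap between \<epsilon>^2 and \<epsilon>^4 that the
    rounding may use up. With |Y_k|^2 \<le> 8 n and e \<le> d, a mesh with h^2 = g / (2 d) costs at
    most h^2 / 4 times 8 d n, which is g n, exactly the gap.\<close>
  define g where "g = \<epsilon>\<^sup>2 * (1 - \<epsilon>\<^sup>2)"
  have \<epsilon>2: "0 < \<epsilon>\<^sup>2" "\<epsilon>\<^sup>2 < 1" using \<epsilon> by (auto simp: power_less_one_iff abs_square_less_1)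
  have g: "0 < g" "g \<le> 1" using \<epsilon>2 by (auto simp: g_def mult_le_one)
  define h where "h = sqrt (g / (2 * real d))"
  have h: "0 < h" "h\<^sup>2 = g / (2 * real d)" using g d by (simp_all add: h_def)
  \<comment> \<open>Rounding moves a unit vector to squared norm at most 2 + 2 d h^2 \<le> 4, so its
    integer coordinates have sum of squares at most 4 / h^2.\<close>
  define R where "R = 4 / h\<^sup>2"
  have R: "R = 8 / g * real d" using d by (simp add: R_def h)
  define z where "z = (\<lambda>m::nat \<Rightarrow> int. \<lambda>i. \<Sum>k<e. h * of_int (m k) * Q k i)"
  define G where "G = {m \<in> {..<e} \<rightarrow>\<^sub>E UNIV. (\<Sum>k<e. (real_of_int (m k))\<^sup>2) \<le> R}"
  \<comment> \<open>The lower tail is available for vectors of positive norm; the lattice points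
    that occur have it because their strict inequality excludes 0.\<close>
  define G' where "G' = {m \<in> G. 0 < qf p C (z m) (z m)}"
  have finG: "finite G" and cardG: "real (card G) \<le> exp R * 3 ^ e"
    unfolding G_def by (rule card_lattice_points_le)+
  have finG': "finite G'" and cardG': "real (card G') \<le> exp R * 3 ^ d"
  proof -
    show "finite G'" using finG by (simp add: G'_def)
    have "card G' \<le> card G" using finG by (intro card_mono) (auto simp: G'_def)
    hence "real (card G') \<le> exp R * 3 ^ e" using cardG by linarith
    also have "\<dots> \<le> exp R * 3 ^ d" using e by (intro mult_left_mono power_increasing) auto
    finally show "real (card G') \<le> exp R * 3 ^ d" .
  qed
  let ?U = "\<lambda>k. {x \<in> space ?L. 8 * real n < nsq n (\<lambda>i. ip p (Q k) (x i))}"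
  let ?V = "\<lambda>m. {x \<in> space ?L. nsq n (\<lambda>i. ip p (z m) (x i)) < \<epsilon>\<^sup>2 * real n * qf p C (z m) (z m)}"
  define B where "B = (\<Union>k\<in>{..<e}. ?U k) \<union> (\<Union>m\<in>G'. ?V m)"
  have U: "?U k \<in> sets ?L" for k by measurable
  have V: "?V m \<in> sets ?L" for m by measurable
  have B: "B \<in> sets ?L"
    unfolding B_def using U V finG' by (intro sets.Un sets.finite_UN) auto
  have zz: "qf p C (z m) (z m) = (\<Sum>k<e. (h * of_int (m k))\<^sup>2)" for m
    unfolding z_def using qf_sum_orthonormal[OF Q, of e "\<lambda>k. h * of_int (m k)" "\<lambda>k. h * of_int (m k)"]
    by (simp add: power2_eq_square)
  have zx: "ip p (z m) y = (\<Sum>k<e. h * of_int (m k) * ip p (Q k) y)" for m y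
    unfolding z_def by (rule ip_sum_coeff)
  have "x \<in> B" if x: "x \<in> space ?L" and bad: "nsq n (\<lambda>k. ip p u (x k)) < (\<epsilon>\<^sup>2)\<^sup>2 * real n * qf p C u u"
    and u: "u = (\<lambda>i. \<Sum>l<d. c l * W l i)" for x u c
  proof (rule ccontr)
    assume nB: "x \<notin> B"
    obtain r where r: "\<And>l i. l < d \<Longrightarrow> i < p \<Longrightarrow> W l i = (\<Sum>k<e. r l k * Q k i)"
      using W by metis
    define s where "s k = (\<Sum>l<d. c l * r l k)" for k
    have us: "u i = (\<Sum>k<e. s k * Q k i)" if "i < p" for i
    proof -
      have "u i = (\<Sum>l<d. \<Sum>k<e. c l * r l k * Q k i)"
        unfolding u using r that by (simp add: sum_distrib_left mult.assoc)
      also have "\<dots> = (\<Sum>k<e. s k * Q k i)"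
        unfolding s_def sum_distrib_right by (rule sum.swap)
      finally show ?thesis .
    qed
    define \<tau> where "\<tau> = (\<Sum>k<e. (s k)\<^sup>2)"
    have \<tau>: "qf p C u u = \<tau>"
    proof -
      have "qf p C u u = qf p C (\<lambda>i. \<Sum>k<e. s k * Q k i) (\<lambda>i. \<Sum>k<e. s k * Q k i)"
        by (intro qf_cong us)
      also have "\<dots> = \<tau>" unfolding \<tau>_def using qf_sum_orthonormal[OF Q, of e s s] by (simp add: power2_eq_square)
      finally show ?thesis .
    qed
    let ?Y = "\<lambda>k i. ip p (Q k) (x i)"
    have ux: "ip p u (x i) = (\<Sum>k<e. s k * ?Y k i)" for i
      unfolding ip_sum_coeff[symmetric] by (intro ip_cong us refl)
    have "0 < \<tau>"
    proof (rule ccontr)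
      assume "\<not> 0 < \<tau>"
      hence "\<tau> = 0" using sum_nonneg[of "{..<e}" "\<lambda>k. (s k)\<^sup>2"] by (simp add: \<tau>_def)
      thus False using bad \<tau> ip_nonneg[of n "\<lambda>k. ip p u (x k)"] by simp
    qed
    define q where "q = 1 / sqrt \<tau>"
    have q: "q\<^sup>2 = 1 / \<tau>" using \<open>0 < \<tau>\<close> by (simp add: q_def power_divide)
    have small: "nsq n (\<lambda>i. \<Sum>k<e. (q * s k) * ?Y k i) < (\<epsilon>\<^sup>2)\<^sup>2 * real n"
    proof -
      have "(\<Sum>k<e. (q * s k) * ?Y k i) = q * ip p u (x i)" for i
        unfolding ux by (simp add: sum_distrib_left mult.assoc)
      hence "nsq n (\<lambda>i. \<Sum>k<e. (q * s k) * ?Y k i) = nsq n (\<lambda>k. ip p u (x k)) / \<tau>"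
        by (simp add: nsq_scale q)
      thus ?thesis using bad[unfolded \<tau>] \<open>0 < \<tau>\<close> by (simp add: pos_divide_less_eq)
    qed
    have unit: "(\<Sum>k<e. (q * s k)\<^sup>2) = 1"
      using \<open>0 < \<tau>\<close> by (simp add: power_mult_distrib q \<tau>_def sum_divide_distrib[symmetric])
    obtain m where m: "\<And>k. k < e \<Longrightarrow> \<bar>h * of_int (m k) - q * s k\<bar> \<le> h"
      "nsq n (\<lambda>i. \<Sum>k<e. h * of_int (m k) * ?Y k i) - \<epsilon>\<^sup>2 * real n * (\<Sum>k<e. (h * of_int (m k))\<^sup>2) \<le>
       nsq n (\<lambda>i. \<Sum>k<e. (q * s k) * ?Y k i) - \<epsilon>\<^sup>2 * real n * (\<Sum>k<e. (q * s k)\<^sup>2) + h\<^sup>2 / 4 * (\<Sum>k<e. nsq n (?Y k))"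
      using lattice_rounding[OF h(1), of "\<epsilon>\<^sup>2 * real n" e "\<lambda>k. q * s k" n ?Y] by auto
    \<comment> \<open>Restricted to \<open>{..<e}\<close> to become an element of the finite set
      \<open>G\<close> of extensional functions.\<close>
    define m' where "m' = restrict m {..<e}"
    have m'm: "m' k = m k" if "k < e" for k using that by (simp add: m'_def)
    have "nsq n (?Y k) \<le> 8 * real n" if "k < e" for k
      using nB x that by (auto simp: B_def not_less)
    hence "(\<Sum>k<e. nsq n (?Y k)) \<le> (\<Sum>k<e. 8 * real n)" by (intro sum_mono) auto
    also have "\<dots> \<le> real d * (8 * real n)" using e by (simp add: mult_right_mono)
    finally have "h\<^sup>2 / 4 * (\<Sum>k<e. nsq n (?Y k)) \<le> h\<^sup>2 / 4 * (real d * (8 * real n))"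
      by (rule mult_left_mono) simp
    also have "\<dots> = g * real n" using d by (simp add: h)
    finally have "nsq n (\<lambda>i. \<Sum>k<e. h * of_int (m k) * ?Y k i) - \<epsilon>\<^sup>2 * real n * (\<Sum>k<e. (h * of_int (m k))\<^sup>2) <
      (\<epsilon>\<^sup>2)\<^sup>2 * real n - \<epsilon>\<^sup>2 * real n + g * real n"
      using m(2) small unfolding unit by linarith
    also have "\<dots> = 0" by (simp add: g_def power2_eq_square algebra_simps)
    finally have neg: "nsq n (\<lambda>i. ip p (z m') (x i)) < \<epsilon>\<^sup>2 * real n * qf p C (z m') (z m')"
      unfolding zx zz by (simp add: m'm cong: sum.cong_simp)
    have "(\<Sum>k<e. (h * of_int (m k))\<^sup>2) \<le> (\<Sum>k<e. 2 * (q * s k)\<^sup>2 + 2 * h\<^sup>2)"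
    proof (intro sum_mono)
      fix k assume "k \<in> {..<e}"
      define a where "a = h * of_int (m k) - q * s k"
      have "a\<^sup>2 \<le> h\<^sup>2" using m(1)[of k] \<open>k \<in> {..<e}\<close> h(1) by (simp add: a_def abs_le_square_iff[symmetric])
      moreover have "(h * of_int (m k))\<^sup>2 \<le> 2 * (q * s k)\<^sup>2 + 2 * a\<^sup>2"
      proof -
        have eq: "h * of_int (m k) = q * s k + a" by (simp add: a_def)
        have "(q * s k + a)\<^sup>2 + (q * s k - a)\<^sup>2 = 2 * (q * s k)\<^sup>2 + 2 * a\<^sup>2"
          by (simp add: power2_eq_square algebra_simps)
        moreover have "0 \<le> (q * s k - a)\<^sup>2" by simp
        ultimately show ?thesis unfolding eq by linarith
      qed
      ultimately show "(h * of_int (m k))\<^sup>2 \<le> 2 * (q * s k)\<^sup>2 + 2 * h\<^sup>2" by linarith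
    qed
    also have "\<dots> = 2 + 2 * (real e * h\<^sup>2)"
      using unit by (simp add: sum.distrib flip: sum_distrib_left)
    also have "real e * h\<^sup>2 \<le> real d * h\<^sup>2" using e by (intro mult_right_mono) auto
    also have "real d * h\<^sup>2 \<le> 1" using d g by (simp add: h)
    finally have "h\<^sup>2 * (\<Sum>k<e. (real_of_int (m k))\<^sup>2) \<le> 4"
      by (simp add: power_mult_distrib flip: sum_distrib_left)
    hence "(\<Sum>k<e. (real_of_int (m' k))\<^sup>2) \<le> R"
      using h(1) by (simp add: R_def field_simps m'm cong: sum.cong_simp)
    hence "m' \<in> G" by (auto simp: G_def m'_def)
    moreover have "0 < qf p C (z m') (z m')"
    proof -
      have "0 \<le> nsq n (\<lambda>i. ip p (z m') (x i))" by simp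
      hence "0 < \<epsilon>\<^sup>2 * real n * qf p C (z m') (z m')" using neg by linarith
      moreover have "0 < \<epsilon>\<^sup>2 * real n" using \<epsilon>2 n by simp
        ultimately show ?thesis using zero_less_mult_pos by blast
    qed
    ultimately have "x \<in> (\<Union>m\<in>G'. ?V m)" using neg x by (auto simp: G'_def)
    thus False using nB by (simp add: B_def)
  qed
  hence sub: "{x \<in> space ?L. \<exists>c. nsq n (\<lambda>k. ip p (\<lambda>i. \<Sum>l<d. c l * W l i) (x k)) <
      (\<epsilon>\<^sup>2)\<^sup>2 * real n * qf p C (\<lambda>i. \<Sum>l<d. c l * W l i) (\<lambda>i. \<Sum>l<d. c l * W l i)} \<subseteq> B" by blast
  have "emeasure ?L B \<le> emeasure ?L (\<Union>k\<in>{..<e}. ?U k) + emeasure ?L (\<Union>m\<in>G'. ?V m)"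
    unfolding B_def using U V finG' by (intro emeasure_subadditive sets.finite_UN) auto
  also have "\<dots> \<le> (\<Sum>k<e. emeasure ?L (?U k)) + (\<Sum>m\<in>G'. emeasure ?L (?V m))"
    using U V finG' by (intro add_mono emeasure_subadditive_finite) auto
  also have "\<dots> \<le> (\<Sum>k<e. ennreal (exp (- real n))) + (\<Sum>m\<in>G'. ennreal (exp (- real n * (1 - \<epsilon>)\<^sup>2)))"
  proof (intro add_mono sum_mono)
    show "emeasure ?L (?U k) \<le> ennreal (exp (- real n))" if "k \<in> {..<e}" for k
      using Q[of k k] that by (intro sample_upper_tail[OF C]) simp
    show "emeasure ?L (?V m) \<le> ennreal (exp (- real n * (1 - \<epsilon>)\<^sup>2))" if "m \<in> G'" for m
      using that \<epsilon> by (intro sample_lower_tail[OF C]) (auto simp: G'_def)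
  qed
  also have "\<dots> = ennreal (real e * exp (- real n) + real (card G') * exp (- real n * (1 - \<epsilon>)\<^sup>2))"
    by (simp add: ennreal_plus ennreal_mult ennreal_of_nat_eq_real_of_nat)
  also have "\<dots> \<le> ennreal (real d * exp (- real n) + exp R * 3 ^ d * exp (- real n * (1 - \<epsilon>)\<^sup>2))"
    using e cardG' by (intro ennreal_leI add_mono mult_right_mono) auto
  finally show ?thesis using B sub unfolding R g_def by blast
qed

text \<open>The number of supports is a binomial coefficient, bounded here by \<open>p ^ D\<close>,
  the quantity that the degree condition controls.\<close>

lemma small_ball_union:
  assumes C: "pos_def p C" and \<epsilon>: "0 < \<epsilon>" "\<epsilon> < 1" and n: "0 < n" and j: "j < p"
  shows "\<exists>B\<in>sets (sample_law n p C).
    {x \<in> space (sample_law n p C). \<exists>S c. S \<subseteq> {..<p} - {j} \<and> card S = D \<and>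
      nsq n (\<lambda>k. ip p (\<lambda>i. \<Sum>l<Suc D. c l * span_family a S l i) (x k)) <
      (\<epsilon>\<^sup>2)\<^sup>2 * real n * qf p C (\<lambda>i. \<Sum>l<Suc D. c l * span_family a S l i) (\<lambda>i. \<Sum>l<Suc D. c l * span_family a S l i)} \<subseteq> B \<and>
    emeasure (sample_law n p C) B \<le> ennreal (real p ^ D * (real (Suc D) * exp (- real n) +
      exp (8 / (\<epsilon>\<^sup>2 * (1 - \<epsilon>\<^sup>2)) * real (Suc D)) * 3 ^ Suc D * exp (- real n * (1 - \<epsilon>)\<^sup>2)))"
proof -
  let ?L = "sample_law n p C"
  let ?b = "real (Suc D) * exp (- real n) +
      exp (8 / (\<epsilon>\<^sup>2 * (1 - \<epsilon>\<^sup>2)) * real (Suc D)) * 3 ^ Suc D * exp (- real n * (1 - \<epsilon>)\<^sup>2)"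
  let ?E = "\<lambda>S x. \<exists>c. nsq n (\<lambda>k. ip p (\<lambda>i. \<Sum>l<Suc D. c l * span_family a S l i) (x k)) <
      (\<epsilon>\<^sup>2)\<^sup>2 * real n * qf p C (\<lambda>i. \<Sum>l<Suc D. c l * span_family a S l i) (\<lambda>i. \<Sum>l<Suc D. c l * span_family a S l i)"
  have "\<forall>S. \<exists>B. B \<in> sets ?L \<and> {x \<in> space ?L. ?E S x} \<subseteq> B \<and> emeasure ?L B \<le> ennreal ?b"
    unfolding Bex_def[symmetric] by (intro allI subspace_small_ball[OF C \<epsilon> zero_less_Suc n])
  from choice[OF this] obtain B where
    B': "\<forall>S. B S \<in> sets ?L \<and> {x \<in> space ?L. ?E S x} \<subseteq> B S \<and> emeasure ?L (B S) \<le> ennreal ?b" ..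
  have B: "B S \<in> sets ?L" "emeasure ?L (B S) \<le> ennreal ?b" for S using B' by (blast, blast)
  have BE: "x \<in> B S" if "x \<in> space ?L" "?E S x" for S x
    using B'[THEN spec, of S, THEN conjunct2, THEN conjunct1] that by (intro subsetD[of _ "B S"]) (assumption, rule CollectI, rule conjI)
  let ?F = "{S. S \<subseteq> {..<p} - {j} \<and> card S = D}"
  have fin: "finite ?F" by (auto intro: finite_subset[of _ "Pow ({..<p} - {j})"])
  have b0: "0 \<le> ?b" by simp
  have card: "card ?F \<le> p ^ D"
  proof -
    have "card ?F = (p - 1) choose D" using j by (subst n_subsets) auto
    also have "\<dots> \<le> (p - 1) ^ D" by (cases "D \<le> p - 1") (auto simp: binomial_le_pow binomial_eq_0)
    also have "\<dots> \<le> p ^ D" by (intro power_mono) auto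
    finally show ?thesis .
  qed
  have "(\<Union>S\<in>?F. B S) \<in> sets ?L" using B fin by (intro sets.finite_UN) auto
  moreover have "{x \<in> space ?L. \<exists>S c. S \<subseteq> {..<p} - {j} \<and> card S = D \<and>
      nsq n (\<lambda>k. ip p (\<lambda>i. \<Sum>l<Suc D. c l * span_family a S l i) (x k)) <
      (\<epsilon>\<^sup>2)\<^sup>2 * real n * qf p C (\<lambda>i. \<Sum>l<Suc D. c l * span_family a S l i) (\<lambda>i. \<Sum>l<Suc D. c l * span_family a S l i)}
    \<subseteq> (\<Union>S\<in>?F. B S)"
  proof (intro subsetI, elim CollectE conjE exE)
    fix x S c
    assume x: "x \<in> space ?L" "S \<subseteq> {..<p} - {j}" "card S = D" and
      small: "nsq n (\<lambda>k. ip p (\<lambda>i. \<Sum>l<Suc D. c l * span_family a S l i) (x k)) <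
      (\<epsilon>\<^sup>2)\<^sup>2 * real n * qf p C (\<lambda>i. \<Sum>l<Suc D. c l * span_family a S l i) (\<lambda>i. \<Sum>l<Suc D. c l * span_family a S l i)"
    show "x \<in> (\<Union>S\<in>?F. B S)"
    proof (rule UN_I)
      show "S \<in> ?F" using x by simp
      show "x \<in> B S" by (rule BE[OF x(1)]) (rule exI, rule small)
    qed
  qed
  moreover have "emeasure ?L (\<Union>S\<in>?F. B S) \<le> ennreal (real p ^ D * ?b)"
  proof -
    have "emeasure ?L (\<Union>S\<in>?F. B S) \<le> (\<Sum>S\<in>?F. emeasure ?L (B S))"
      using B fin by (intro emeasure_subadditive_finite) auto
    also have "\<dots> \<le> (\<Sum>S\<in>?F. ennreal ?b)" by (intro sum_mono B)
    also have "\<dots> = ennreal (real (card ?F) * ?b)"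
      using b0 by (simp add: ennreal_mult ennreal_of_nat_eq_real_of_nat)
    also have "\<dots> \<le> ennreal (real p ^ D * ?b)"
    proof (intro ennreal_leI mult_right_mono b0)
      show "real (card ?F) \<le> real p ^ D" using card by (metis of_nat_le_iff of_nat_power)
    qed
    finally show ?thesis .
  qed
  ultimately show ?thesis by (intro bexI conjI)
qed

text \<open>
  The degree condition gives \<open>D ln p \<le> \<eta> n / 2\<close> and \<open>D + 1 \<le> n / ln n\<close>, so that the union over the supports
  costs at most \<open>exp (\<eta> n / 2)\<close> and the lattice only \<open>exp (o n)\<close>.
\<close>

lemma small_ball_asymptotics:
  assumes \<eta>: "0 < \<eta>" "\<eta> < 1"
  shows "\<exists>\<kappa>\<ge>0. \<forall>n p D. 3 \<le> n \<longrightarrow> n < p \<longrightarrow> 1 \<le> D \<longrightarrow>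
    real D \<le> \<eta> * (real n / (2 * (1.1 + sqrt (ln (real p)))\<^sup>2)) \<longrightarrow>
    real p ^ D * (real (Suc D) * exp (- real n) + exp (R * real (Suc D)) * 3 ^ Suc D * exp (- real n * \<eta>))
      \<le> \<kappa> * real n powr (- 8 * ln (real n))"
proof -
  define T where "T = max 0 R + 2"
  \<comment> \<open>The two exponential bounds divided by the target rate n^(-8 ln n) = exp (-8 (ln
    n)^2). The sequence tends to 0, so it is bounded, and a bound serves as \<kappa> for all
    \<open>n\<close> at once.\<close>
  define g where "g = (\<lambda>n::nat. (real n * exp (- real n / 2) + exp (T * (real n / ln (real n)) - real n * \<eta> / 2)) *
    exp (8 * (ln (real n))\<^sup>2))"
  have "0 < T" by (simp add: T_def)
  have 1: "(\<lambda>n::nat. real n * exp (- real n / 2) * exp (8 * (ln (real n))\<^sup>2)) \<longlonglongrightarrow> 0"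
    by real_asymp
  have 2: "(\<lambda>n::nat. exp (T * (real n / ln (real n)) - real n * \<eta> / 2) * exp (8 * (ln (real n))\<^sup>2)) \<longlonglongrightarrow> 0"
    using \<eta> \<open>0 < T\<close> by real_asymp
  have "g \<longlonglongrightarrow> 0"
    unfolding g_def using tendsto_add[OF 1 2] by (simp add: distrib_right)
  hence "Bseq g" by (intro convergent_imp_Bseq convergentI)
  then obtain \<kappa> where \<kappa>: "0 < \<kappa>" "\<And>n. norm (g n) \<le> \<kappa>" by (auto simp: Bseq_def)
  show ?thesis
  proof (intro exI[of _ \<kappa>] conjI allI impI)
    fix n p D :: nat
    assume n: "3 \<le> n" and np: "n < p" and D1: "1 \<le> D"
      and D: "real D \<le> \<eta> * (real n / (2 * (1.1 + sqrt (ln (real p)))\<^sup>2))"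
    have "exp 1 \<le> real n" using exp_le n by simp
    hence l1: "1 \<le> ln (real n)" using n by (subst ln_ge_iff) auto
    have lnp: "ln (real n) \<le> ln (real p)" using n np by simp
    have sq: "ln (real p) \<le> (1.1 + sqrt (ln (real p)))\<^sup>2"
    proof -
      have "ln (real p) = (sqrt (ln (real p)))\<^sup>2" using l1 lnp by simp
      also have "\<dots> \<le> (1.1 + sqrt (ln (real p)))\<^sup>2" using l1 lnp by (intro power_mono) auto
      finally show ?thesis .
    qed
    have lp: "0 < ln (real p)" using l1 lnp by linarith
    have "real D \<le> \<eta> * (real n / (2 * ln (real p)))"
      using sq lp \<eta> less_le_trans[OF lp sq] by (intro order.trans[OF D] mult_left_mono divide_left_mono mult_pos_pos) auto
    hence Dp: "real D * ln (real p) \<le> \<eta> * real n / 2" using lp by (simp add: field_simps)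
    have "real D * ln (real n) \<le> real D * ln (real p)" using lnp by (intro mult_left_mono) auto
    also have "\<dots> \<le> 1 * real n / 2" using Dp \<eta> mult_right_mono[of \<eta> 1 "real n"] by linarith
    finally have "2 * real D * ln (real n) \<le> real n" by simp
    hence "2 * real D \<le> real n / ln (real n)" using l1 by (simp add: field_simps)
    hence d: "real (Suc D) \<le> real n / ln (real n)" using D1 by simp
    have dn: "real (Suc D) \<le> real n" using l1 by (intro order.trans[OF d]) (use mult_left_mono[OF l1, of "real n"] in \<open>simp add: divide_le_eq\<close>)
    have pD: "real p ^ D \<le> exp (\<eta> * real n / 2)"
    proof -
      have "real p ^ D = exp (real D * ln (real p))" using np by (simp add: exp_of_nat_mult)
      thus ?thesis using Dp by simp
    qed
    have "R * real (Suc D) + real (Suc D) * ln 3 \<le> T * real (Suc D)"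
    proof -
      have "ln 3 \<le> (2::real)" using ln_le_minus_one[of 3] by simp
      hence "(R + ln 3) * real (Suc D) \<le> T * real (Suc D)" by (intro mult_right_mono) (auto simp: T_def)
      thus ?thesis by (simp add: algebra_simps)
    qed
    also have "\<dots> \<le> T * (real n / ln (real n))" using d by (intro mult_left_mono) (auto simp: T_def)
    finally have RT: "R * real (Suc D) + real (Suc D) * ln 3 \<le> T * (real n / ln (real n))" .
    have three: "(3::real) ^ Suc D = exp (real (Suc D) * ln 3)" by (subst exp_of_nat_mult) simp
    have 1: "exp (\<eta> * real n / 2) * (real (Suc D) * exp (- real n)) \<le> real n * exp (- real n / 2)"
    proof -
      have "exp (\<eta> * real n / 2) * (real (Suc D) * exp (- real n)) = real (Suc D) * exp (\<eta> * real n / 2 + - real n)"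
        unfolding exp_add by (simp only: mult_ac)
      also have "\<dots> \<le> real n * exp (- real n / 2)"
      proof (intro mult_mono dn)
        have "\<eta> * real n \<le> 1 * real n" using \<eta> by (intro mult_right_mono) auto
        thus "exp (\<eta> * real n / 2 + - real n) \<le> exp (- real n / 2)" by simp
      qed simp_all
      finally show ?thesis .
    qed
    have 2: "exp (\<eta> * real n / 2) * (exp (R * real (Suc D)) * 3 ^ Suc D * exp (- real n * \<eta>)) \<le>
      exp (T * (real n / ln (real n)) - real n * \<eta> / 2)"
      unfolding three exp_add[symmetric] using RT by (simp add: algebra_simps)
    have "real p ^ D * (real (Suc D) * exp (- real n) + exp (R * real (Suc D)) * 3 ^ Suc D * exp (- real n * \<eta>)) \<le>
      exp (\<eta> * real n / 2) * (real (Suc D) * exp (- real n) + exp (R * real (Suc D)) * 3 ^ Suc D * exp (- real n * \<eta>))"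
      by (intro mult_right_mono pD) auto
    also have "\<dots> \<le> real n * exp (- real n / 2) + exp (T * (real n / ln (real n)) - real n * \<eta> / 2)"
      using 1 2 by (simp add: distrib_left)
    also have "\<dots> = g n * exp (- 8 * (ln (real n))\<^sup>2)"
      by (simp add: g_def mult.assoc exp_add[symmetric])
    also have "\<dots> \<le> \<kappa> * exp (- 8 * (ln (real n))\<^sup>2)"
      using \<kappa>(2)[of n] by (intro mult_right_mono) auto
    also have "exp (- 8 * (ln (real n))\<^sup>2) = real n powr (- 8 * ln (real n))"
      using n by (simp add: powr_def power2_eq_square)
    finally show "real p ^ D * (real (Suc D) * exp (- real n) + exp (R * real (Suc D)) * 3 ^ Suc D * exp (- real n * \<eta>))
      \<le> \<kappa> * real n powr (- 8 * ln (real n))" .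
  qed (use \<kappa> in simp)
qed

section \<open>Truncation and the residual terms\<close>

definition lin_comb :: "nat \<Rightarrow> (nat \<Rightarrow> real) \<Rightarrow> (nat \<Rightarrow> nat \<Rightarrow> real) \<Rightarrow> nat \<Rightarrow> real" where
  "lin_comb d c W = (\<lambda>i. \<Sum>l<d. c l * W l i)"

lemma ip_lin_comb: "ip p (lin_comb d c W) y = (\<Sum>l<d. c l * ip p (W l) y)"
  unfolding lin_comb_def by (rule ip_sum_coeff)

text \<open>Both sides are continuous in the coefficients, so a strict inequality persists at nearby
  rational ones; this makes the event \<open>small_ratio\<close> a countable union.\<close>

lemma quadratic_form_rational:
  fixes W :: "nat \<Rightarrow> nat \<Rightarrow> real"
  assumes "nsq n (\<lambda>k. ip p (lin_comb d c W) (x k)) < \<rho> * qf p C (lin_comb d c W) (lin_comb d c W)"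
  shows "\<exists>q\<in>{..<d} \<rightarrow>\<^sub>E \<rat>. nsq n (\<lambda>k. ip p (lin_comb d q W) (x k)) < \<rho> * qf p C (lin_comb d q W) (lin_comb d q W)"
proof -
  have "\<exists>r. \<forall>l. (\<forall>m. r l m \<in> \<rat>) \<and> r l \<longlonglongrightarrow> c l"
    by (rule choice) (intro allI rational_approximation)
  then obtain r where r: "\<And>l m. r l m \<in> \<rat>" "\<And>l. r l \<longlonglongrightarrow> c l" by blast
  define q where "q m = (\<lambda>l\<in>{..<d}. r l m)" for m
  let ?g = "\<lambda>c. \<rho> * qf p C (lin_comb d c W) (lin_comb d c W) - nsq n (\<lambda>k. ip p (lin_comb d c W) (x k))"
  have lim: "(\<lambda>m. lin_comb d (q m) W i) \<longlonglongrightarrow> lin_comb d c W i" for i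
    unfolding lin_comb_def q_def by (auto intro!: tendsto_intros r)
  have "(\<lambda>m. ?g (q m)) \<longlonglongrightarrow> ?g c"
    unfolding qf_def ip_def mv_def by (intro tendsto_intros lim)
  moreover have "0 < ?g c" using assms by simp
  ultimately have "\<forall>\<^sub>F m in sequentially. 0 < ?g (q m)" by (rule order_tendstoD)
  then obtain m where "0 < ?g (q m)" by (auto simp: eventually_sequentially)
  moreover have "q m \<in> {..<d} \<rightarrow>\<^sub>E \<rat>"
    unfolding q_def by (rule restrict_PiE_iff[THEN iffD2]) (simp add: r(1))
  ultimately show ?thesis by (intro bexI[of _ "q m"]) auto
qed

text \<open>With \<open>\<rho> = \<lambda>\<^sub>0\<^sup>2 n\<close> this is the event that
  \<open>lambda_star\<close> is below \<open>\<lambda>\<^sub>0\<close>, freed of the infimum, the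
  quotient and the abstract span; see \<open>lambda_star_less_iff\<close>.\<close>

definition small_ratio ::
  "nat \<Rightarrow> nat \<Rightarrow> real mat \<Rightarrow> (nat \<Rightarrow> real) \<Rightarrow> nat \<Rightarrow> nat \<Rightarrow> real \<Rightarrow> (nat \<Rightarrow> nat \<Rightarrow> real) \<Rightarrow> bool" where
  "small_ratio n p C a D j \<rho> x \<longleftrightarrow> (\<exists>S c. S \<subseteq> {..<p} - {j} \<and> card S = D \<and>
     nsq n (\<lambda>k. ip p (lin_comb (Suc D) c (span_family a S)) (x k)) <
     \<rho> * qf p C (lin_comb (Suc D) c (span_family a S)) (lin_comb (Suc D) c (span_family a S)))"

lemma sets_small_ratio: "{x \<in> space (sample_law n p C). small_ratio n p C a D j \<rho> x} \<in> sets (sample_law n p C)"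
proof -
  let ?L = "sample_law n p C"
  let ?F = "{S. S \<subseteq> {..<p} - {j} \<and> card S = D}"
  let ?R = "{..<Suc D} \<rightarrow>\<^sub>E (\<rat> :: real set)"
  let ?P = "\<lambda>S c x. nsq n (\<lambda>k. ip p (lin_comb (Suc D) c (span_family a S)) (x k)) <
     \<rho> * qf p C (lin_comb (Suc D) c (span_family a S)) (lin_comb (Suc D) c (span_family a S))"
  have "small_ratio n p C a D j \<rho> x \<longleftrightarrow> (\<exists>S\<in>?F. \<exists>c\<in>?R. ?P S c x)" for x
  proof
    assume "small_ratio n p C a D j \<rho> x"
    then obtain S c where S: "S \<subseteq> {..<p} - {j}" "card S = D" and c: "?P S c x"
      unfolding small_ratio_def by blast
    from S have "S \<in> ?F" by simp
    with quadratic_form_rational[OF c] show "\<exists>S\<in>?F. \<exists>c\<in>?R. ?P S c x" by (rule bexI)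
  qed (unfold small_ratio_def, blast)
  hence "{x \<in> space ?L. small_ratio n p C a D j \<rho> x} = {x \<in> space ?L. \<exists>S\<in>?F. \<exists>c\<in>?R. ?P S c x}" by simp
  also have "\<dots> \<in> sets ?L"
  proof (intro sets.sets_Collect_countable_Ex')
    have "finite ?F" by (rule finite_subset[of _ "Pow ({..<p} - {j})"]) auto
    thus "countable ?F" by (rule countable_finite)
    show "countable ?R" by (intro countable_PiE countable_rat) auto
    show "{x \<in> space ?L. ?P S c x} \<in> sets ?L" for S c by measurable
  qed
  finally show ?thesis .
qed

lemma small_ratio_probability:
  assumes C: "pos_def p C" and \<epsilon>: "0 < \<epsilon>" "\<epsilon> < 1" and n: "0 < n" and j: "j < p"
  shows "emeasure (sample_law n p C) {x \<in> space (sample_law n p C). small_ratio n p C a D j ((\<epsilon>\<^sup>2)\<^sup>2 * real n) x} \<le>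
    ennreal (real p ^ D * (real (Suc D) * exp (- real n) +
      exp (8 / (\<epsilon>\<^sup>2 * (1 - \<epsilon>\<^sup>2)) * real (Suc D)) * 3 ^ Suc D * exp (- real n * (1 - \<epsilon>)\<^sup>2)))"
proof -
  from small_ball_union[OF C \<epsilon> n j, of D a]
  obtain B where B: "B \<in> sets (sample_law n p C)"
    "{x \<in> space (sample_law n p C). small_ratio n p C a D j ((\<epsilon>\<^sup>2)\<^sup>2 * real n) x} \<subseteq> B"
    "emeasure (sample_law n p C) B \<le> ennreal (real p ^ D * (real (Suc D) * exp (- real n) +
      exp (8 / (\<epsilon>\<^sup>2 * (1 - \<epsilon>\<^sup>2)) * real (Suc D)) * 3 ^ Suc D * exp (- real n * (1 - \<epsilon>)\<^sup>2)))"
    unfolding small_ratio_def lin_comb_def by (elim bexE conjE)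
  from emeasure_mono[OF B(2) B(1)] B(3) show ?thesis by (rule order.trans)
qed

text \<open>Supports in the event have exactly \<open>D\<close> elements, so \<open>S\<close> is
  first enlarged within the indices other than \<open>j\<close>, which is possible since
  \<open>D < p\<close>. In the loss estimates t = 1 treats the estimation error and t = 0 the
  estimator itself.\<close>

lemma not_small_ratioD:
  assumes ns: "\<not> small_ratio n p C a D j \<rho> x" and S: "S \<subseteq> {..<p} - {j}" "card S \<le> D" and D: "D < p" and j: "j < p"
    and b: "\<And>i. i < p \<Longrightarrow> i \<notin> S \<Longrightarrow> b i = 0"
  shows "\<rho> * qf p C (\<lambda>i. t * a i + b i) (\<lambda>i. t * a i + b i) \<le> nsq n (\<lambda>k. ip p (\<lambda>i. t * a i + b i) (x k))"
proof -
  obtain S' where S': "S \<subseteq> S'" "S' \<subseteq> {..<p} - {j}" "card S' = D"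
  proof -
    have "D \<le> p - Suc 0" using D by simp
    thus ?thesis using that exists_subset_between[of S D "{..<p} - {j}"] S j by auto
  qed
  define c where "c = (\<lambda>l. case l of 0 \<Rightarrow> t | Suc l \<Rightarrow> b (sorted_list_of_set S' ! l))"
  let ?u = "lin_comb (Suc D) c (span_family a S')"
  have S'p: "S' \<subseteq> {..<p}" using S' by blast
  have eq: "ip p ?u y = ip p (\<lambda>i. t * a i + b i) y" for y
  proof -
    have "ip p ?u y = t * ip p a y + (\<Sum>l<D. b (sorted_list_of_set S' ! l) * ip p (unit_family S' l) y)"
      unfolding ip_lin_comb sum.lessThan_Suc_shift by (simp add: c_def span_family_def)
    also have "\<dots> = t * ip p a y + ip p b y"
      unfolding S'(3)[symmetric] using b S'(1) by (subst ip_supported[OF S'p, of b y]) auto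
    finally show ?thesis by (simp add: ip_add_left ip_scale_left)
  qed
  have u: "?u i = t * a i + b i" if "i < p" for i
    using eq[of "\<lambda>k. of_bool (k = i)"] that by (simp add: ip_commute[of p _ "\<lambda>k. of_bool (k = i)"] ip_unit)
  have "\<rho> * qf p C ?u ?u \<le> nsq n (\<lambda>k. ip p ?u (x k))"
  proof (rule ccontr)
    assume "\<not> ?thesis"
    hence "small_ratio n p C a D j \<rho> x" unfolding small_ratio_def not_le using S'(2,3) by (intro exI conjI)
    with ns show False ..
  qed
  moreover have "qf p C ?u ?u = qf p C (\<lambda>i. t * a i + b i) (\<lambda>i. t * a i + b i)" by (intro qf_cong u)
  ultimately show ?thesis unfolding eq by simp
qed

lemma nsq_diff_le: "nsq n (\<lambda>k. u k - v k) \<le> 2 * nsq n u + 2 * nsq n v"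
proof -
  have "0 \<le> nsq n (\<lambda>k. u k + v k)" by simp
  thus ?thesis by (simp add: ip_linear ip_commute[of n v u])
qed

lemma qf_diff_le:
  assumes C: "pos_def p C"
  shows "qf p C (\<lambda>i. u i - v i) (\<lambda>i. u i - v i) \<le> 2 * qf p C u u + 2 * qf p C v v"
  using qf_nonneg[OF C, of "\<lambda>i. u i + v i"] by (simp add: qf_linear qf_commute[OF C, of v u])

section \<open>The two parts of the residual term\<close>

context model_selection
begin

abbreviation acol :: "nat \<Rightarrow> nat \<Rightarrow> real" where
  "acol j \<equiv> \<lambda>i. \<theta> $$ (i, j)"

abbreviation low_ratio :: "real \<Rightarrow> nat \<Rightarrow> (nat \<Rightarrow> nat \<Rightarrow> real) \<Rightarrow> bool" where
  "low_ratio \<epsilon> j x \<equiv> small_ratio n p C (acol j) D j ((\<epsilon>\<^sup>2)\<^sup>2 * real n) x"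

definition truncated :: "real \<Rightarrow> (nat \<Rightarrow> nat \<Rightarrow> real) \<Rightarrow> nat \<Rightarrow> bool" where
  "truncated T x j \<longleftrightarrow> real p * T\<^sup>2 < nsq p (asel x j)"

definition tsel :: "real \<Rightarrow> (nat \<Rightarrow> nat \<Rightarrow> real) \<Rightarrow> nat \<Rightarrow> nat \<Rightarrow> real" where
  "tsel T x j i = (if truncated T x j then 0 else asel x j i)"

lemma sets_truncated:
  assumes j: "j < p"
  shows "{x \<in> space (sample_law n p C). truncated T x j} \<in> sets (sample_law n p C)"
proof -
  have [measurable]: "(\<lambda>x. nsq p (asel x j)) \<in> borel_measurable (sample_law n p C)"
    by (intro measurable_ip measurable_asel j)
  show ?thesis unfolding truncated_def by measurable
qed

lemma measurable_tsel:
  assumes "i < p" "j < p"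
  shows "(\<lambda>x. tsel T x j i) \<in> borel_measurable (sample_law n p C)"
  unfolding tsel_def
  by (intro measurable_If borel_measurable_const measurable_asel assms sets_truncated)

lemma measurable_tsel_error:
  assumes j: "j < p"
  shows "(\<lambda>x. qf p C (\<lambda>i. tsel T x j i - \<theta> $$ (i, j)) (\<lambda>i. tsel T x j i - \<theta> $$ (i, j))) \<in> borel_measurable (sample_law n p C)"
  unfolding qf_def mv_def
  by (intro measurable_ip borel_measurable_sum borel_measurable_times borel_measurable_diff borel_measurable_const measurable_tsel j) auto

text \<open>Together with \<open>low_ratio_loss\<close> the two integrands of the residual term,
  rewritten with the measurable version \<open>asel\<close> of the estimator.\<close>

definition truncation_loss :: "real \<Rightarrow> real \<Rightarrow> nat \<Rightarrow> (nat \<Rightarrow> nat \<Rightarrow> real) \<Rightarrow> real" where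
  "truncation_loss \<epsilon> T j x = (if \<not> low_ratio \<epsilon> j x \<and> truncated T x j then qf p C (acol j) (acol j) else 0)"

definition low_ratio_loss :: "real \<Rightarrow> real \<Rightarrow> nat \<Rightarrow> (nat \<Rightarrow> nat \<Rightarrow> real) \<Rightarrow> real" where
  "low_ratio_loss \<epsilon> T j x = (if low_ratio \<epsilon> j x
     then qf p C (\<lambda>i. tsel T x j i - \<theta> $$ (i, j)) (\<lambda>i. tsel T x j i - \<theta> $$ (i, j)) else 0)"

lemma measurable_losses:
  assumes j: "j < p"
  shows "truncation_loss \<epsilon> T j \<in> borel_measurable (sample_law n p C)"
    "low_ratio_loss \<epsilon> T j \<in> borel_measurable (sample_law n p C)"
proof -
  let ?L = "sample_law n p C"
  have "{x \<in> space ?L. \<not> low_ratio \<epsilon> j x \<and> truncated T x j} \<in> sets ?L"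
    by (intro sets.sets_Collect_conj sets.sets_Collect_neg sets_small_ratio sets_truncated j)
  thus "truncation_loss \<epsilon> T j \<in> borel_measurable ?L"
    unfolding truncation_loss_def[abs_def] by (intro measurable_If borel_measurable_const)
  show "low_ratio_loss \<epsilon> T j \<in> borel_measurable ?L"
    unfolding low_ratio_loss_def[abs_def]
    by (intro measurable_If borel_measurable_const measurable_tsel_error j sets_small_ratio)
qed

lemma D_less_p: "D < p"
  using D np n3 by linarith

lemma dims_pos: "0 < p" "0 < n"
  using np n3 by simp_all

text \<open>Comparison with the zero column bounds the residual by |X_j|^2, and the parallelogram
  inequality then bounds the fit by 2 + 2 = 4 times that. Markov's inequality for the truncation
  rests on this.\<close>

lemma selected_supported: "AE x in sample_law n p C. \<forall>j<p.
   \<exists>S. S \<subseteq> {..<p} - {j} \<and> card S \<le> D \<and> (\<forall>i<p. i \<notin> S \<longrightarrow> asel x j i = 0) \<and>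
     nsq n (\<lambda>k. ip p (asel x j) (x k)) \<le> 4 * nsq n (\<lambda>k. x k j)"
  using A_ls mh_min
proof eventually_elim
  fix x assume x: "\<forall>m\<in>M. \<forall>j<p. (\<forall>i<p. i \<notin> nbrs m j \<longrightarrow> A m x j i = 0) \<and>
      (\<forall>b. (\<forall>i<p. i \<notin> nbrs m j \<longrightarrow> b i = 0) \<longrightarrow>
        nsq n (\<lambda>k. ip p (res_coeff j (A m x j)) (x k)) \<le> nsq n (\<lambda>k. ip p (res_coeff j b) (x k)))"
    and sel: "mh x \<in> M \<and> (\<forall>m\<in>M.
      (\<Sum>j<p. nsq n (\<lambda>k. ip p (res_coeff j (A (mh x) x j)) (x k)) * (1 + K * pen_rate n p (card (nbrs (mh x) j)))) \<le>
      (\<Sum>j<p. nsq n (\<lambda>k. ip p (res_coeff j (A m x j)) (x k)) * (1 + K * pen_rate n p (card (nbrs m j)))))"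
  hence mM: "mh x \<in> M" by blast
  show "\<forall>j<p. \<exists>S. S \<subseteq> {..<p} - {j} \<and> card S \<le> D \<and> (\<forall>i<p. i \<notin> S \<longrightarrow> asel x j i = 0) \<and>
     nsq n (\<lambda>k. ip p (asel x j) (x k)) \<le> 4 * nsq n (\<lambda>k. x k j)"
  proof (intro allI impI exI conjI)
    fix j assume j: "j < p"
    have as: "asel x j = A (mh x) x j" using mM by (intro ext asel_eq)
    show "nbrs (mh x) j \<subseteq> {..<p} - {j}" by (rule nbrs_subset[OF mM])
    show "card (nbrs (mh x) j) \<le> D" by (rule deg[OF mM j])
    show "asel x j i = 0" if "i < p" "i \<notin> nbrs (mh x) j" for i
      unfolding as using x mM j that by blast
    have res: "ip p (res_coeff j b) (x k) = x k j - ip p b (x k)" for b k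
      unfolding res_coeff_def using j by (simp add: ip_diff_left ip_unit)
    have "nsq n (\<lambda>k. ip p (res_coeff j (asel x j)) (x k)) \<le> nsq n (\<lambda>k. ip p (res_coeff j (\<lambda>_. 0)) (x k))"
      unfolding as using x mM j by simp
    hence "nsq n (\<lambda>k. x k j - ip p (asel x j) (x k)) \<le> nsq n (\<lambda>k. x k j)"
      unfolding res by (simp add: ip_def)
    moreover have "nsq n (\<lambda>k. x k j - (x k j - ip p (asel x j) (x k))) \<le>
        2 * nsq n (\<lambda>k. x k j) + 2 * nsq n (\<lambda>k. x k j - ip p (asel x j) (x k))" by (rule nsq_diff_le)
    ultimately show "nsq n (\<lambda>k. ip p (asel x j) (x k)) \<le> 4 * nsq n (\<lambda>k. x k j)" by simp
  qed
qed

text \<open>Low ratios and truncated columns are charged to the residual term in full; otherwise the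
  error lies in the span of the column of \<theta> and at most \<open>D\<close> unit vectors, where
  the prediction norm dominates.\<close>

lemma tsel_pointwise:
  assumes \<epsilon>: "0 < \<epsilon>" "\<epsilon> < 1" and j: "j < p"
    and S: "S \<subseteq> {..<p} - {j}" "card S \<le> D" "\<And>i. i < p \<Longrightarrow> i \<notin> S \<Longrightarrow> asel x j i = 0"
  shows "qf p C (\<lambda>i. tsel T x j i - \<theta> $$ (i, j)) (\<lambda>i. tsel T x j i - \<theta> $$ (i, j)) \<le>
    1 / ((\<epsilon>\<^sup>2)\<^sup>2 * real n) * nsq n (\<lambda>k. ip p (\<lambda>i. \<theta> $$ (i, j) - asel x j i) (x k)) +
    (truncation_loss \<epsilon> T j x + low_ratio_loss \<epsilon> T j x)"
proof -
  have \<rho>: "0 < (\<epsilon>\<^sup>2)\<^sup>2 * real n" using \<epsilon> n3 by simp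
  let ?N = "nsq n (\<lambda>k. ip p (\<lambda>i. \<theta> $$ (i, j) - asel x j i) (x k))"
  have N0: "0 \<le> 1 / ((\<epsilon>\<^sup>2)\<^sup>2 * real n) * ?N" using \<rho> by simp
  have neg: "qf p C (\<lambda>i. - u i) (\<lambda>i. - u i) = qf p C u u" for u
    using qf_linear(3)[of p C "\<lambda>i. - u i" "-1" u] qf_linear(6)[of p C "-1" u u] by simp
  consider "low_ratio \<epsilon> j x" | "\<not> low_ratio \<epsilon> j x" "truncated T x j" | "\<not> low_ratio \<epsilon> j x" "\<not> truncated T x j" by blast
  thus ?thesis
  proof cases
    case 1
    thus ?thesis using N0 by (simp add: truncation_loss_def low_ratio_loss_def)
  next
    case 2
    thus ?thesis using N0 neg[of "acol j"] by (simp add: truncation_loss_def low_ratio_loss_def tsel_def)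
  next
    case 3
    have "(\<epsilon>\<^sup>2)\<^sup>2 * real n * qf p C (\<lambda>i. 1 * \<theta> $$ (i, j) + - asel x j i) (\<lambda>i. 1 * \<theta> $$ (i, j) + - asel x j i) \<le>
      nsq n (\<lambda>k. ip p (\<lambda>i. 1 * \<theta> $$ (i, j) + - asel x j i) (x k))"
      using S by (intro not_small_ratioD[OF 3(1) S(1,2) D_less_p j]) auto
    hence "qf p C (\<lambda>i. \<theta> $$ (i, j) - asel x j i) (\<lambda>i. \<theta> $$ (i, j) - asel x j i) \<le> 1 / ((\<epsilon>\<^sup>2)\<^sup>2 * real n) * ?N"
      using \<rho> by (simp add: pos_le_divide_eq mult.commute)
    moreover have "qf p C (\<lambda>i. tsel T x j i - \<theta> $$ (i, j)) (\<lambda>i. tsel T x j i - \<theta> $$ (i, j)) =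
      qf p C (\<lambda>i. \<theta> $$ (i, j) - asel x j i) (\<lambda>i. \<theta> $$ (i, j) - asel x j i)"
      using neg[of "\<lambda>i. \<theta> $$ (i, j) - asel x j i"] 3 by (simp add: tsel_def)
    ultimately show ?thesis using 3 by (simp add: truncation_loss_def low_ratio_loss_def)
  qed
qed

end

context model_selection
begin

theorem truncated_risk:
  assumes \<epsilon>: "0 < \<epsilon>" "\<epsilon> < 1" and m: "m \<in> M" and b: "\<And>i j. i < p \<Longrightarrow> j < p \<Longrightarrow> i \<notin> nbrs m j \<Longrightarrow> b j i = 0"
  shows "(\<integral>\<^sup>+x. ennreal (\<Sum>j<p. qf p C (\<lambda>i. tsel T x j i - \<theta> $$ (i, j)) (\<lambda>i. tsel T x j i - \<theta> $$ (i, j))) \<partial>sample_law n p C) \<le>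
    ennreal (1 / ((\<epsilon>\<^sup>2)\<^sup>2 * real n) * (K / (K - 1) * (\<Sum>j<p.
      real n * qf p C (\<lambda>i. \<theta> $$ (i, j) - b j i) (\<lambda>i. \<theta> $$ (i, j) - b j i) * (1 + K * pen_rate n p (card (nbrs m j)))
      + sigma2 C j * (K * pen_rate n p (card (nbrs m j)) * (real n - real (card (nbrs m j))) + K * ln (real n))))) +
    (\<Sum>j<p. (\<integral>\<^sup>+x. ennreal (truncation_loss \<epsilon> T j x) \<partial>sample_law n p C) +
      (\<integral>\<^sup>+x. ennreal (low_ratio_loss \<epsilon> T j x) \<partial>sample_law n p C))"
proof -
  let ?L = "sample_law n p C"
  let ?c = "1 / ((\<epsilon>\<^sup>2)\<^sup>2 * real n)"
  let ?N = "\<lambda>x. \<Sum>j<p. nsq n (\<lambda>k. ip p (\<lambda>i. \<theta> $$ (i, j) - asel x j i) (x k))"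
  have c0: "0 \<le> ?c" using \<epsilon> by simp
  have N0: "0 \<le> ?N x" for x by (intro sum_nonneg ip_nonneg)
  have t0: "0 \<le> truncation_loss \<epsilon> T j x" "0 \<le> low_ratio_loss \<epsilon> T j x" for j x
    using qf_nonneg[OF C] by (simp_all add: truncation_loss_def low_ratio_loss_def)
  have tm: "(\<lambda>x. ennreal (truncation_loss \<epsilon> T j x)) \<in> borel_measurable ?L"
    "(\<lambda>x. ennreal (low_ratio_loss \<epsilon> T j x)) \<in> borel_measurable ?L" if "j < p" for j
    using measurable_losses[OF that] by (auto intro: measurable_compose[OF _ measurable_ennreal])
  have ts: "(\<lambda>x. ennreal (truncation_loss \<epsilon> T j x) + ennreal (low_ratio_loss \<epsilon> T j x)) \<in> borel_measurable ?L" if "j < p" for j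
    by (rule borel_measurable_add[OF tm[OF that]])
  have Nm: "(\<lambda>x. ennreal (?N x)) \<in> borel_measurable ?L"
    by (rule measurable_compose[OF borel_measurable_sum measurable_ennreal]) (intro measurable_asel_error, simp)
  have cN: "(\<lambda>x. ennreal ?c * ennreal (?N x)) \<in> borel_measurable ?L"
    by (rule borel_measurable_times_ennreal[OF borel_measurable_const Nm])
  have sm: "(\<lambda>x. \<Sum>j<p. ennreal (truncation_loss \<epsilon> T j x) + ennreal (low_ratio_loss \<epsilon> T j x)) \<in> borel_measurable ?L"
    by (rule borel_measurable_sum, rule ts, simp)
  have "(\<integral>\<^sup>+x. ennreal (\<Sum>j<p. qf p C (\<lambda>i. tsel T x j i - \<theta> $$ (i, j)) (\<lambda>i. tsel T x j i - \<theta> $$ (i, j))) \<partial>?L) \<le>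
    (\<integral>\<^sup>+x. ennreal ?c * ennreal (?N x) + (\<Sum>j<p. ennreal (truncation_loss \<epsilon> T j x) + ennreal (low_ratio_loss \<epsilon> T j x)) \<partial>?L)"
  proof (rule nn_integral_mono_AE, rule AE_mp[OF selected_supported], rule AE_I2, rule impI)
    fix x assume x: "\<forall>j<p. \<exists>S. S \<subseteq> {..<p} - {j} \<and> card S \<le> D \<and> (\<forall>i<p. i \<notin> S \<longrightarrow> asel x j i = 0) \<and>
      nsq n (\<lambda>k. ip p (asel x j) (x k)) \<le> 4 * nsq n (\<lambda>k. x k j)"
    have "(\<Sum>j<p. qf p C (\<lambda>i. tsel T x j i - \<theta> $$ (i, j)) (\<lambda>i. tsel T x j i - \<theta> $$ (i, j))) \<le>
      (\<Sum>j<p. ?c * nsq n (\<lambda>k. ip p (\<lambda>i. \<theta> $$ (i, j) - asel x j i) (x k)) +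
        (truncation_loss \<epsilon> T j x + low_ratio_loss \<epsilon> T j x))"
    proof (rule sum_mono)
      fix j assume "j \<in> {..<p}"
      hence j: "j < p" by simp
      with x obtain S where "S \<subseteq> {..<p} - {j}" "card S \<le> D" "\<forall>i<p. i \<notin> S \<longrightarrow> asel x j i = 0" by blast
      thus "qf p C (\<lambda>i. tsel T x j i - \<theta> $$ (i, j)) (\<lambda>i. tsel T x j i - \<theta> $$ (i, j)) \<le>
          ?c * nsq n (\<lambda>k. ip p (\<lambda>i. \<theta> $$ (i, j) - asel x j i) (x k)) +
          (truncation_loss \<epsilon> T j x + low_ratio_loss \<epsilon> T j x)"
        by (intro tsel_pointwise[OF \<epsilon> j]) auto
    qed
    also have "\<dots> = ?c * ?N x + (\<Sum>j<p. truncation_loss \<epsilon> T j x + low_ratio_loss \<epsilon> T j x)"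
      by (simp only: sum.distrib sum_distrib_left)
    finally have "ennreal (\<Sum>j<p. qf p C (\<lambda>i. tsel T x j i - \<theta> $$ (i, j)) (\<lambda>i. tsel T x j i - \<theta> $$ (i, j))) \<le>
        ennreal (?c * ?N x + (\<Sum>j<p. truncation_loss \<epsilon> T j x + low_ratio_loss \<epsilon> T j x))"
      by (rule ennreal_leI)
    also have "\<dots> = ennreal ?c * ennreal (?N x) + (\<Sum>j<p. ennreal (truncation_loss \<epsilon> T j x) + ennreal (low_ratio_loss \<epsilon> T j x))"
    proof -
      have "(\<Sum>j<p. ennreal (truncation_loss \<epsilon> T j x) + ennreal (low_ratio_loss \<epsilon> T j x)) =
        ennreal (\<Sum>j<p. truncation_loss \<epsilon> T j x + low_ratio_loss \<epsilon> T j x)"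
        unfolding ennreal_plus[OF t0, symmetric] using t0 by (intro sum_ennreal add_nonneg_nonneg)
      moreover have "0 \<le> (\<Sum>j<p. truncation_loss \<epsilon> T j x + low_ratio_loss \<epsilon> T j x)"
        using t0 by (intro sum_nonneg add_nonneg_nonneg)
      ultimately show ?thesis
        by (simp only: ennreal_plus mult_nonneg_nonneg[OF c0 N0] ennreal_mult[OF c0 N0])
    qed
    finally show "ennreal (\<Sum>j<p. qf p C (\<lambda>i. tsel T x j i - \<theta> $$ (i, j)) (\<lambda>i. tsel T x j i - \<theta> $$ (i, j))) \<le>
      ennreal ?c * ennreal (?N x) + (\<Sum>j<p. ennreal (truncation_loss \<epsilon> T j x) + ennreal (low_ratio_loss \<epsilon> T j x))" .
  qed
  also have "\<dots> = (\<integral>\<^sup>+x. ennreal ?c * ennreal (?N x) \<partial>?L) +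
      (\<integral>\<^sup>+x. (\<Sum>j<p. ennreal (truncation_loss \<epsilon> T j x) + ennreal (low_ratio_loss \<epsilon> T j x)) \<partial>?L)"
    by (rule nn_integral_add[OF cN sm])
  also have "(\<integral>\<^sup>+x. ennreal ?c * ennreal (?N x) \<partial>?L) = ennreal ?c * (\<integral>\<^sup>+x. ennreal (?N x) \<partial>?L)"
    by (rule nn_integral_cmult[OF Nm])
  also have "(\<integral>\<^sup>+x. (\<Sum>j<p. ennreal (truncation_loss \<epsilon> T j x) + ennreal (low_ratio_loss \<epsilon> T j x)) \<partial>?L) =
      (\<Sum>j<p. \<integral>\<^sup>+x. ennreal (truncation_loss \<epsilon> T j x) + ennreal (low_ratio_loss \<epsilon> T j x) \<partial>?L)"
    by (rule nn_integral_sum, rule ts, simp)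
  also have "\<dots> = (\<Sum>j<p. (\<integral>\<^sup>+x. ennreal (truncation_loss \<epsilon> T j x) \<partial>?L) + (\<integral>\<^sup>+x. ennreal (low_ratio_loss \<epsilon> T j x) \<partial>?L))"
    by (intro sum.cong refl nn_integral_add tm) simp_all
  finally have main: "(\<integral>\<^sup>+x. ennreal (\<Sum>j<p. qf p C (\<lambda>i. tsel T x j i - \<theta> $$ (i, j)) (\<lambda>i. tsel T x j i - \<theta> $$ (i, j))) \<partial>?L) \<le>
    ennreal ?c * (\<integral>\<^sup>+x. ennreal (?N x) \<partial>?L) +
    (\<Sum>j<p. (\<integral>\<^sup>+x. ennreal (truncation_loss \<epsilon> T j x) \<partial>?L) + (\<integral>\<^sup>+x. ennreal (low_ratio_loss \<epsilon> T j x) \<partial>?L))" .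
  show ?thesis
    unfolding ennreal_mult'[OF c0]
    by (rule order.trans[OF main]) (intro add_right_mono mult_left_mono selected_prediction_risk[OF m b] zero_le)
qed

text \<open>The variance of variable \<open>j\<close> is that of its regression on the others plus
  that of the noise.\<close>

lemma qf_acol_le:
  assumes j: "j < p"
  shows "qf p C (acol j) (acol j) \<le> qf p C (\<lambda>i. of_bool (i = j)) (\<lambda>i. of_bool (i = j))"
proof -
  have "(\<lambda>i. of_bool (i = j)) = (\<lambda>i. acol j i + res_coeff j (acol j) i)"
    by (auto simp: res_coeff_def)
  thus ?thesis using qf_noise[OF j, of "acol j"] theta_facts(1,3)[OF j] by simp
qed

text \<open>If the column is truncated although the ratio is not low, its image under X is long,
  which forces |X_j|^2 to be at least \<open>\<rho> / 4\<close>; Markov's inequality with the second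
  moment of X_j concludes. The loss itself is at most \<beta> by \<open>qf_acol_le\<close>.\<close>

lemma truncation_loss_mean:
  assumes \<epsilon>: "0 < \<epsilon>" "\<epsilon> < 1" and j: "j < p" and T: "0 < T"
    and a: "0 < \<alpha>" "\<And>u. \<alpha> * nsq p u \<le> qf p C u u" and \<beta>: "\<And>u. qf p C u u \<le> \<beta> * nsq p u"
  shows "(\<integral>\<^sup>+x. ennreal (truncation_loss \<epsilon> T j x) \<partial>sample_law n p C) \<le> ennreal (4 * \<beta>\<^sup>2 / (\<alpha> * (\<epsilon>\<^sup>2)\<^sup>2 * T\<^sup>2))"
proof -
  let ?L = "sample_law n p C" and ?e = "\<lambda>i. of_bool (i = j) :: real"
  define \<rho> where "\<rho> = (\<epsilon>\<^sup>2)\<^sup>2 * real n * (\<alpha> * T\<^sup>2)"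
  have \<rho>: "0 < \<rho>" using \<epsilon> n3 T a by (simp add: \<rho>_def)
  have e: "qf p C ?e ?e \<le> \<beta>" using \<beta>[of ?e] j by (simp add: ip_unit)
  hence ab: "qf p C (acol j) (acol j) \<le> \<beta>" using qf_acol_le[OF j] by linarith
  have \<beta>0: "0 \<le> \<beta>" using e qf_nonneg[OF C, of ?e] by linarith
  have c0: "0 \<le> 4 * \<beta> / \<rho>" using \<beta>0 \<rho> by simp
  have unit: "ip p ?e (x k) = x k j" for x :: "nat \<Rightarrow> nat \<Rightarrow> real" and k using j by (simp add: ip_unit)
  have Nm: "(\<lambda>x. ennreal (nsq n (\<lambda>k. x k j))) \<in> borel_measurable ?L"
    using measurable_sample_law_nsq[of n p ?e C] unfolding unit by (rule measurable_compose) simp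
  have "(\<integral>\<^sup>+x. ennreal (truncation_loss \<epsilon> T j x) \<partial>?L) \<le> (\<integral>\<^sup>+x. ennreal (4 * \<beta> / \<rho>) * ennreal (nsq n (\<lambda>k. x k j)) \<partial>?L)"
  proof (rule nn_integral_mono_AE, rule AE_mp[OF selected_supported], rule AE_I2, rule impI)
    fix x assume x: "\<forall>j<p. \<exists>S. S \<subseteq> {..<p} - {j} \<and> card S \<le> D \<and> (\<forall>i<p. i \<notin> S \<longrightarrow> asel x j i = 0) \<and>
      nsq n (\<lambda>k. ip p (asel x j) (x k)) \<le> 4 * nsq n (\<lambda>k. x k j)"
    then obtain S where S: "S \<subseteq> {..<p} - {j}" "card S \<le> D" "\<forall>i<p. i \<notin> S \<longrightarrow> asel x j i = 0"
      and X: "nsq n (\<lambda>k. ip p (asel x j) (x k)) \<le> 4 * nsq n (\<lambda>k. x k j)" using j by blast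
    have "truncation_loss \<epsilon> T j x \<le> 4 * \<beta> / \<rho> * nsq n (\<lambda>k. x k j)"
    proof (cases "\<not> low_ratio \<epsilon> j x \<and> truncated T x j")
      case True
      hence ns: "\<not> low_ratio \<epsilon> j x" and tr: "real p * T\<^sup>2 < nsq p (asel x j)" by (simp_all add: truncated_def)
      have "(\<epsilon>\<^sup>2)\<^sup>2 * real n * qf p C (\<lambda>i. 0 * \<theta> $$ (i, j) + asel x j i) (\<lambda>i. 0 * \<theta> $$ (i, j) + asel x j i) \<le>
        nsq n (\<lambda>k. ip p (\<lambda>i. 0 * \<theta> $$ (i, j) + asel x j i) (x k))"
        using S by (intro not_small_ratioD[OF ns S(1,2) D_less_p j]) auto
      hence 1: "(\<epsilon>\<^sup>2)\<^sup>2 * real n * qf p C (asel x j) (asel x j) \<le> 4 * nsq n (\<lambda>k. x k j)"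
        using X by simp
      \<comment> \<open>The factor \<open>p\<close> of the truncation level is given away here;
        \<open>residual_sum_le\<close> reinserts it for the sake of a common rate.\<close>
      have "1 * T\<^sup>2 \<le> real p * T\<^sup>2" using np by (intro mult_right_mono) auto
      hence "\<alpha> * T\<^sup>2 \<le> \<alpha> * nsq p (asel x j)" using tr a by simp
      also have "\<dots> \<le> qf p C (asel x j) (asel x j)" by (rule a)
      finally have "\<rho> \<le> (\<epsilon>\<^sup>2)\<^sup>2 * real n * qf p C (asel x j) (asel x j)"
        unfolding \<rho>_def by (rule mult_left_mono) simp
      hence "\<rho> \<le> 4 * nsq n (\<lambda>k. x k j)" using 1 by linarith
      hence "1 \<le> 4 * nsq n (\<lambda>k. x k j) / \<rho>" using \<rho> by simp
      hence "\<beta> * 1 \<le> \<beta> * (4 * nsq n (\<lambda>k. x k j) / \<rho>)" using \<beta>0 by (rule mult_left_mono)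
      moreover have "truncation_loss \<epsilon> T j x \<le> \<beta>" using ab True by (simp add: truncation_loss_def)
      ultimately show ?thesis by (simp add: mult_ac)
    next
      case False
      thus ?thesis using \<beta>0 \<rho> by (auto simp: truncation_loss_def)
    qed
    hence "ennreal (truncation_loss \<epsilon> T j x) \<le> ennreal (4 * \<beta> / \<rho> * nsq n (\<lambda>k. x k j))" by (rule ennreal_leI)
    thus "ennreal (truncation_loss \<epsilon> T j x) \<le> ennreal (4 * \<beta> / \<rho>) * ennreal (nsq n (\<lambda>k. x k j))"
      unfolding ennreal_mult'[OF c0] .
  qed
  also have "\<dots> = ennreal (4 * \<beta> / \<rho>) * ennreal (real n * qf p C ?e ?e)"
    unfolding nn_integral_cmult[OF Nm] using sample_second_moment[OF C, of n ?e] unfolding unit by simp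
  also have "\<dots> = ennreal (4 * \<beta> / \<rho> * (real n * qf p C ?e ?e))"
    unfolding ennreal_mult'[OF c0] ..
  also have "\<dots> \<le> ennreal (4 * \<beta> / \<rho> * (real n * \<beta>))"
    using e \<beta>0 \<rho> by (intro ennreal_leI mult_left_mono) auto
  also have "4 * \<beta> / \<rho> * (real n * \<beta>) = 4 * \<beta>\<^sup>2 / (\<alpha> * (\<epsilon>\<^sup>2)\<^sup>2 * T\<^sup>2)"
    using n3 by (simp add: \<rho>_def power2_eq_square mult_ac)
  finally show ?thesis .
qed

text \<open>Here the truncation pays off: on an event without control of the estimator a column
  still has squared norm at most \<open>real p * T\<^sup>2\<close>, so the loss is bounded and only
  the probability of the event matters.\<close>

lemma low_ratio_loss_mean:
  assumes j: "j < p" and T: "1 \<le> T" and \<beta>: "\<And>u. qf p C u u \<le> \<beta> * nsq p u" and q: "0 \<le> q"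
    and P: "emeasure (sample_law n p C) {x \<in> space (sample_law n p C). low_ratio \<epsilon> j x} \<le> ennreal q"
  shows "(\<integral>\<^sup>+x. ennreal (low_ratio_loss \<epsilon> T j x) \<partial>sample_law n p C) \<le> ennreal (4 * \<beta> * (real p * T\<^sup>2) * q)"
proof -
  let ?L = "sample_law n p C" and ?e = "\<lambda>i. of_bool (i = j) :: real"
  let ?B = "{x \<in> space ?L. low_ratio \<epsilon> j x}"
  have e: "qf p C ?e ?e \<le> \<beta>" using \<beta>[of ?e] j by (simp add: ip_unit)
  hence ab: "qf p C (acol j) (acol j) \<le> \<beta>" using qf_acol_le[OF j] by linarith
  have \<beta>0: "0 \<le> \<beta>" using e qf_nonneg[OF C, of ?e] by linarith
  have pT: "1 \<le> real p * T\<^sup>2" using np T by (intro mult_ge1_I) auto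
  have le: "low_ratio_loss \<epsilon> T j x \<le> 4 * \<beta> * (real p * T\<^sup>2) * indicator ?B x" if "x \<in> space ?L" for x
  proof (cases "low_ratio \<epsilon> j x")
    case True
    have "nsq p (tsel T x j) \<le> real p * T\<^sup>2"
      using pT by (cases "truncated T x j") (auto simp: tsel_def truncated_def ip_def)
    hence "\<beta> * nsq p (tsel T x j) \<le> \<beta> * (real p * T\<^sup>2)" using \<beta>0 by (rule mult_left_mono)
    hence "qf p C (tsel T x j) (tsel T x j) \<le> \<beta> * (real p * T\<^sup>2)"
      using \<beta>[of "tsel T x j"] by linarith
    moreover have "\<beta> * 1 \<le> \<beta> * (real p * T\<^sup>2)" using pT \<beta>0 by (rule mult_left_mono)
    moreover have "qf p C (\<lambda>i. tsel T x j i - acol j i) (\<lambda>i. tsel T x j i - acol j i) \<le>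
        2 * qf p C (tsel T x j) (tsel T x j) + 2 * qf p C (acol j) (acol j)" by (rule qf_diff_le[OF C])
    ultimately show ?thesis using ab True that by (simp add: low_ratio_loss_def)
  qed (simp add: low_ratio_loss_def)
  have "(\<integral>\<^sup>+x. ennreal (low_ratio_loss \<epsilon> T j x) \<partial>?L) \<le> (\<integral>\<^sup>+x. ennreal (4 * \<beta> * (real p * T\<^sup>2)) * indicator ?B x \<partial>?L)"
  proof (rule nn_integral_mono)
    fix x assume "x \<in> space ?L"
    from ennreal_leI[OF le[OF this]] show "ennreal (low_ratio_loss \<epsilon> T j x) \<le> ennreal (4 * \<beta> * (real p * T\<^sup>2)) * indicator ?B x"
      by (cases "x \<in> ?B") auto
  qed
  also have "\<dots> = ennreal (4 * \<beta> * (real p * T\<^sup>2)) * emeasure ?L ?B"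
    by (rule nn_integral_cmult_indicator[OF sets_small_ratio])
  also have "\<dots> \<le> ennreal (4 * \<beta> * (real p * T\<^sup>2)) * ennreal q" by (intro mult_left_mono P) simp
  also have "\<dots> = ennreal (4 * \<beta> * (real p * T\<^sup>2) * q)" using \<beta>0 q by (simp add: ennreal_mult)
  finally show ?thesis .
qed

end

section \<open>Reduction of the matrix statement to columns\<close>

lemma vnorm_eq_nsq: "v \<in> carrier_vec p \<Longrightarrow> vnorm v = sqrt (nsq p (vec_index v))"
  by (auto simp: vnorm_def scalar_prod_def ip_def atLeast0LessThan)

lemma data_mat_mult_index:
  assumes "v \<in> carrier_vec p" "k < n"
  shows "vec_index (data_mat n p x *\<^sub>v v) k = ip p (vec_index v) (x k)"
  using assms by (auto simp: data_mat_def scalar_prod_def ip_def atLeast0LessThan mult.commute intro!: sum.cong)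

lemma vnorm_data_mat_mult:
  assumes "v \<in> carrier_vec p"
  shows "(vnorm (data_mat n p x *\<^sub>v v))\<^sup>2 = nsq n (\<lambda>k. ip p (vec_index v) (x k))"
proof -
  have "data_mat n p x *\<^sub>v v \<in> carrier_vec n" by (simp add: data_mat_def carrier_vecI)
  thus ?thesis using data_mat_mult_index[OF assms] by (simp add: vnorm_eq_nsq cong: ip_cong)
qed

lemma frob_norm_columns: "(frob_norm A)\<^sup>2 = (\<Sum>j<dim_col A. (vnorm (col A j))\<^sup>2)"
proof -
  have "(frob_norm A)\<^sup>2 = (\<Sum>i<dim_row A. \<Sum>j<dim_col A. (A $$ (i, j))\<^sup>2)"
    by (simp add: frob_norm_def sum_nonneg)
  also have "\<dots> = (\<Sum>j<dim_col A. \<Sum>i<dim_row A. (A $$ (i, j))\<^sup>2)" by (rule sum.swap)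
  also have "\<dots> = (\<Sum>j<dim_col A. (vnorm (col A j))\<^sup>2)"
    by (intro sum.cong refl)
      (simp add: vnorm_eq_nsq[of _ "dim_row A"] ip_def power2_eq_square sum_nonneg)
  finally show ?thesis .
qed

lemma frob_norm_mult:
  assumes "A \<in> carrier_mat n p" "B \<in> carrier_mat p p"
  shows "(frob_norm (A * B))\<^sup>2 = (\<Sum>j<p. (vnorm (A *\<^sub>v col B j))\<^sup>2)"
proof -
  have "dim_col (A * B) = p" using assms by simp
  thus ?thesis unfolding frob_norm_columns by (auto intro!: sum.cong simp del: col_mult simp: col_mult2[OF assms])
qed

lemma frob_norm_residuals:
  assumes A: "A \<in> carrier_mat p p"
  shows "(frob_norm (data_mat n p x * (1\<^sub>m p - A)))\<^sup>2 =
    (\<Sum>j<p. nsq n (\<lambda>k. ip p (res_coeff j (\<lambda>i. A $$ (i, j))) (x k)))"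
proof -
  have "(frob_norm (data_mat n p x * (1\<^sub>m p - A)))\<^sup>2 = (\<Sum>j<p. (vnorm (data_mat n p x *\<^sub>v col (1\<^sub>m p - A) j))\<^sup>2)"
    using A by (intro frob_norm_mult) (auto simp: data_mat_def)
  also have "\<dots> = (\<Sum>j<p. nsq n (\<lambda>k. ip p (res_coeff j (\<lambda>i. A $$ (i, j))) (x k)))"
  proof (intro sum.cong refl)
    fix j assume j: "j \<in> {..<p}"
    have "(vnorm (data_mat n p x *\<^sub>v col (1\<^sub>m p - A) j))\<^sup>2 = nsq n (\<lambda>k. ip p (vec_index (col (1\<^sub>m p - A) j)) (x k))"
      using A by (intro vnorm_data_mat_mult carrier_vecI) simp
    also have "\<dots> = nsq n (\<lambda>k. ip p (res_coeff j (\<lambda>i. A $$ (i, j))) (x k))"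
      using A j by (intro ip_cong) (auto simp: res_coeff_def)
    finally show "(vnorm (data_mat n p x *\<^sub>v col (1\<^sub>m p - A) j))\<^sup>2 = \<dots>" .
  qed
  finally show ?thesis .
qed

lemma frob_norm_sqrt_mat:
  assumes C: "pos_def p C" and B: "B \<in> carrier_mat p p"
  shows "(frob_norm (sqrt_mat p C * B))\<^sup>2 = (\<Sum>j<p. qf p C (\<lambda>i. B $$ (i, j)) (\<lambda>i. B $$ (i, j)))"
proof -
  have "(frob_norm (sqrt_mat p C * B))\<^sup>2 = (\<Sum>j<p. (vnorm (sqrt_mat p C *\<^sub>v col B j))\<^sup>2)"
    by (rule frob_norm_mult[OF pos_def_carrier[OF sqrt_mat(1)[OF C]] B])
  also have "\<dots> = (\<Sum>j<p. qf p C (\<lambda>i. B $$ (i, j)) (\<lambda>i. B $$ (i, j)))"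
  proof (intro sum.cong refl)
    fix j assume "j \<in> {..<p}"
    thus "(vnorm (sqrt_mat p C *\<^sub>v col B j))\<^sup>2 = qf p C (\<lambda>i. B $$ (i, j)) (\<lambda>i. B $$ (i, j))"
      using B by (subst vnorm_sqrt_mat[OF C]) (auto intro!: qf_cong)
  qed
  finally show ?thesis .
qed

lemma frob_norm_sqrt_mat_diff:
  assumes C: "pos_def p C" and "A \<in> carrier_mat p p" "B \<in> carrier_mat p p"
  shows "(frob_norm (sqrt_mat p C * (A - B)))\<^sup>2 =
    (\<Sum>j<p. qf p C (\<lambda>i. A $$ (i, j) - B $$ (i, j)) (\<lambda>i. A $$ (i, j) - B $$ (i, j)))"
  using assms(2,3) by (subst frob_norm_sqrt_mat[OF C]) (auto intro!: sum.cong qf_cong)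

text \<open>The criterion decouples over the columns, so each column of a minimizer is itself a least squares solution.\<close>

lemma least_squares_columns:
  assumes m: "is_arg_min (\<lambda>A. (frob_norm (data_mat n p x * (1\<^sub>m p - A)))\<^sup>2) (\<lambda>A. A \<in> Theta p m) A" and j: "j < p"
  shows "\<forall>i<p. i \<notin> nbrs m j \<longrightarrow> A $$ (i, j) = 0"
    "\<forall>b. (\<forall>i<p. i \<notin> nbrs m j \<longrightarrow> b i = 0) \<longrightarrow>
      nsq n (\<lambda>k. ip p (res_coeff j (\<lambda>i. A $$ (i, j))) (x k)) \<le> nsq n (\<lambda>k. ip p (res_coeff j b) (x k))"
proof -
  have AT: "A \<in> Theta p m" using m by (simp add: is_arg_min_def)
  hence A: "A \<in> carrier_mat p p" by (simp add: Theta_def)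
  show "\<forall>i<p. i \<notin> nbrs m j \<longrightarrow> A $$ (i, j) = 0" using AT j by (simp add: Theta_def nbrs_def)
  show "\<forall>b. (\<forall>i<p. i \<notin> nbrs m j \<longrightarrow> b i = 0) \<longrightarrow>
      nsq n (\<lambda>k. ip p (res_coeff j (\<lambda>i. A $$ (i, j))) (x k)) \<le> nsq n (\<lambda>k. ip p (res_coeff j b) (x k))"
  proof (intro allI impI)
    fix b :: "nat \<Rightarrow> real" assume b: "\<forall>i<p. i \<notin> nbrs m j \<longrightarrow> b i = 0"
    define B where "B = Matrix.mat p p (\<lambda>(i, l). if l = j then b i else A $$ (i, l))"
    let ?r = "\<lambda>A l. nsq n (\<lambda>k. ip p (res_coeff l (\<lambda>i. A $$ (i, l))) (x k))"
    have B: "B \<in> carrier_mat p p" by (simp add: B_def)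
    have "B \<in> Theta p m" using AT b by (auto simp: Theta_def B_def nbrs_def)
    hence "(frob_norm (data_mat n p x * (1\<^sub>m p - A)))\<^sup>2 \<le> (frob_norm (data_mat n p x * (1\<^sub>m p - B)))\<^sup>2"
      using m by (auto simp: is_arg_min_def not_less)
    hence "(\<Sum>l<p. ?r A l) \<le> (\<Sum>l<p. ?r B l)"
      unfolding frob_norm_residuals[OF A] frob_norm_residuals[OF B] .
    moreover have "(\<Sum>l<p. ?r A l) = ?r A j + (\<Sum>l\<in>{..<p} - {j}. ?r A l)"
      "(\<Sum>l<p. ?r B l) = ?r B j + (\<Sum>l\<in>{..<p} - {j}. ?r B l)"
      using j by (auto intro!: sum.remove)
    moreover have "(\<Sum>l\<in>{..<p} - {j}. ?r B l) = (\<Sum>l\<in>{..<p} - {j}. ?r A l)"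
    proof (intro sum.cong refl)
      fix l assume "l \<in> {..<p} - {j}"
      thus "?r B l = ?r A l" by (intro ip_cong) (auto simp: B_def res_coeff_def)
    qed
    ultimately have "?r A j \<le> ?r B j" by linarith
    also have "?r B j = nsq n (\<lambda>k. ip p (res_coeff j b) (x k))"
      using j by (intro ip_cong) (auto simp: B_def res_coeff_def)
    finally show "?r A j \<le> nsq n (\<lambda>k. ip p (res_coeff j b) (x k))" .
  qed
qed

lemma crit_eq:
  assumes A: "\<theta>h m \<in> carrier_mat p p" and d: "\<And>j. j < p \<Longrightarrow> card (nbrs m j) + 1 < n"
  shows "crit K n p (data_mat n p x) \<theta>h m = (\<Sum>j<p. nsq n (\<lambda>k. ip p (res_coeff j (\<lambda>i. \<theta>h m $$ (i, j))) (x k)) *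
    (1 + K * pen_rate n p (card (nbrs m j))))"
  unfolding crit_def
proof (intro sum.cong refl arg_cong2[of _ _ _ _ "(*)"])
  fix j assume "j \<in> {..<p}"
  hence j: "j < p" by simp
  let ?X = "data_mat n p x"
  have "col ?X j - ?X *\<^sub>v col (\<theta>h m) j \<in> carrier_vec n"
    by (intro carrier_vecI) (simp add: data_mat_def)
  hence "(vnorm (col ?X j - ?X *\<^sub>v col (\<theta>h m) j))\<^sup>2 = nsq n (vec_index (col ?X j - ?X *\<^sub>v col (\<theta>h m) j))"
    by (simp add: vnorm_eq_nsq)
  also have "\<dots> = nsq n (\<lambda>k. ip p (res_coeff j (\<lambda>i. \<theta>h m $$ (i, j))) (x k))"
  proof -
    have "vec_index (col ?X j - ?X *\<^sub>v col (\<theta>h m) j) k = ip p (res_coeff j (\<lambda>i. \<theta>h m $$ (i, j))) (x k)" if k: "k < n" for k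
    proof -
      have "vec_index (col ?X j - ?X *\<^sub>v col (\<theta>h m) j) k = vec_index (col ?X j) k - vec_index (?X *\<^sub>v col (\<theta>h m) j) k"
        using k by (intro index_minus_vec) (simp add: data_mat_def)
      also have "vec_index (?X *\<^sub>v col (\<theta>h m) j) k = ip p (vec_index (col (\<theta>h m) j)) (x k)"
        using A k by (intro data_mat_mult_index) auto
      also have "\<dots> = ip p (\<lambda>i. \<theta>h m $$ (i, j)) (x k)" using A j by (intro ip_cong) auto
      also have "vec_index (col ?X j) k = x k j" using j k by (simp add: data_mat_def)
      finally show ?thesis using j by (simp add: res_coeff_def ip_diff_left ip_unit)
    qed
    thus ?thesis by (intro ip_cong) auto
  qed
  finally show "(vnorm (col ?X j - ?X *\<^sub>v col (\<theta>h m) j))\<^sup>2 = \<dots>" .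
  show "1 + pen K n p (card (nbrs m j)) / (real n - real (card (nbrs m j))) = 1 + K * pen_rate n p (card (nbrs m j))"
    using d[OF j] pen_eq_pen_rate[OF d[OF j], of K p] by simp
qed

section \<open>Translation of the infimum defining the ratio\<close>

lemma span_insert_units:
  fixes a :: "real Matrix.vec"
  assumes a: "a \<in> carrier_vec p" and S: "S \<subseteq> {..<p}"
  shows "u \<in> LinearCombinations.module.span class_ring (module_vec TYPE(real) p) (insert a (unit_vec p ` S)) \<longleftrightarrow>
    u \<in> carrier_vec p \<and> (\<exists>t b. (\<forall>i<p. i \<notin> S \<longrightarrow> b i = 0) \<and> (\<forall>i<p. vec_index u i = t * vec_index a i + b i))"
proof -
  interpret vec_space "TYPE(real)" p .
  let ?W = "insert a (unit_vec p ` S)"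
  have U: "unit_vec p ` S \<subseteq> carrier_vec p" and W: "?W \<subseteq> carrier_vec p" using a by auto
  have fS: "finite S" using S finite_subset by blast
  have vanish: "vec_index w i = 0" if "w \<in> unit_vec p ` S" "i < p" "i \<notin> S" for w :: "real Matrix.vec" and i
    using that S by (auto simp: index_unit_vec)
  show ?thesis
  proof
    assume u: "u \<in> span ?W"
    then obtain c A where A: "u = lincomb c A" "finite A" "A \<subseteq> ?W" using in_spanE by blast
    have AW: "A \<subseteq> carrier_vec p" using A W by blast
    \<comment> \<open>\<open>a\<close> may itself be one of the unit vectors, so its coefficient is
      taken out of the combination and the rest is summed over \<open>A - {a}\<close>.\<close>
    have ind: "vec_index u i = (if a \<in> A then c a else 0) * vec_index a i + (\<Sum>w\<in>A - {a}. c w * vec_index w i)" if "i < p" for i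
    proof -
      have "vec_index u i = (\<Sum>w\<in>A. c w * vec_index w i)" unfolding A(1) by (rule lincomb_index[OF that AW])
      thus ?thesis using A(2) by (cases "a \<in> A") (simp_all add: sum.remove)
    qed
    have "(\<Sum>w\<in>A - {a}. c w * vec_index w i) = 0" if "i < p" "i \<notin> S" for i
      using A(3) vanish[OF _ that] by (intro sum.neutral) auto
    with ind show "u \<in> carrier_vec p \<and> (\<exists>t b. (\<forall>i<p. i \<notin> S \<longrightarrow> b i = 0) \<and> (\<forall>i<p. vec_index u i = t * vec_index a i + b i))"
      using span_is_subset2[OF W] u by (intro conjI exI[of _ "if a \<in> A then c a else 0"] exI[of _ "\<lambda>i. \<Sum>w\<in>A - {a}. c w * vec_index w i"]) auto
  next
    assume "u \<in> carrier_vec p \<and> (\<exists>t b. (\<forall>i<p. i \<notin> S \<longrightarrow> b i = 0) \<and> (\<forall>i<p. vec_index u i = t * vec_index a i + b i))"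
    then obtain t b where u: "u \<in> carrier_vec p" and b: "\<And>i. i < p \<Longrightarrow> i \<notin> S \<Longrightarrow> b i = 0"
      and ui: "\<And>i. i < p \<Longrightarrow> vec_index u i = t * vec_index a i + b i" by blast
    \<comment> \<open>Coefficients are functions of the vector: the scalar product with
      \<open>b\<close> takes the value \<open>b k\<close> at the unit vector
      \<open>k\<close>.\<close>
    let ?f = "\<lambda>w. scalar_prod w (Matrix.vec p b)"
    have "lincomb ?f (unit_vec p ` S) \<in> span ?W"
      using fS by (intro in_spanI[OF refl]) auto
    moreover have "t \<cdot>\<^sub>v a \<in> span ?W"
      by (intro smult_in_span W subsetD[OF in_own_span[OF W]]) simp
    ultimately have "t \<cdot>\<^sub>v a + lincomb ?f (unit_vec p ` S) \<in> span ?W"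
      using W by (intro span_add1) auto
    also have "t \<cdot>\<^sub>v a + lincomb ?f (unit_vec p ` S) = u"
    proof (rule eq_vecI)
      fix i assume "i < dim_vec u"
      hence i: "i < p" using u by simp
      have inj: "inj_on (unit_vec p :: nat \<Rightarrow> real Matrix.vec) S"
        using S by (auto simp: inj_on_def subset_iff unit_vec_eq)
      have "vec_index (lincomb ?f (unit_vec p ` S)) i = (\<Sum>w\<in>unit_vec p ` S. ?f w * vec_index w i)"
        by (rule lincomb_index[OF i U])
      also have "\<dots> = (\<Sum>k\<in>S. b k * of_bool (k = i))"
        unfolding sum.reindex[OF inj] using S i by (intro sum.cong) auto
      also have "\<dots> = (\<Sum>k\<in>S. if k = i then b k else 0)" by (intro sum.cong) auto
      also have "\<dots> = b i" using b[OF i] fS by simp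
      finally show "vec_index (t \<cdot>\<^sub>v a + lincomb ?f (unit_vec p ` S)) i = vec_index u i"
        using a i ui[OF i] lincomb_dim[OF _ U, of ?f] fS by simp
    qed (use u lincomb_dim[OF _ U, of ?f] fS in auto)
    finally show "u \<in> span ?W" .
  qed
qed

lemma lin_comb_span_family:
  assumes S: "S \<subseteq> {..<p} - {j}" "card S = D"
  shows "\<exists>t b. (\<forall>i<p. i \<notin> S \<longrightarrow> b i = 0) \<and> (\<forall>i<p. lin_comb (Suc D) c (span_family a S) i = t * a i + b i)"
proof (intro exI conjI allI impI)
  have fin: "finite S" using S(1) by (rule finite_subset) simp
  show "lin_comb (Suc D) c (span_family a S) i = c 0 * a i + (\<Sum>l<D. c (Suc l) * unit_family S l i)" for i
    unfolding lin_comb_def sum.lessThan_Suc_shift by (simp add: span_family_def)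
  show "(\<Sum>l<D. c (Suc l) * unit_family S l i) = 0" if "i \<notin> S" for i
    using S(2) unit_family_outside[OF fin _ that] by simp
qed

text \<open>An infimum over a nonempty set bounded below is less than \<rho> exactly if some element
  is; strictness is preserved when the quotient is cleared and squared, as the denominator is
  positive for u \<noteq> 0.\<close>

lemma lambda_star_less_iff:
  fixes x :: "nat \<Rightarrow> nat \<Rightarrow> real"
  assumes C: "pos_def p C" and n: "0 < n" and \<theta>: "\<theta> \<in> carrier_mat p p" and j: "j < p" and D: "1 \<le> D" "D < p"
    and \<rho>: "0 < \<rho>"
  shows "lambda_star n p C \<theta> D (data_mat n p x) j < \<rho> \<longleftrightarrow>
    small_ratio n p C (\<lambda>i. \<theta> $$ (i, j)) D j (\<rho>\<^sup>2 * real n) x"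
proof -
  let ?X = "data_mat n p x" and ?a = "\<lambda>i. \<theta> $$ (i, j)"
  let ?span = "\<lambda>S. LinearCombinations.module.span class_ring (module_vec TYPE(real) p) (insert (col \<theta> j) (unit_vec p ` S))"
  define P where "P u \<longleftrightarrow> u \<noteq> 0\<^sub>v p \<and> (\<exists>S\<subseteq>{..<p} - {j}. card S = D \<and> u \<in> ?span S)" for u
  define q where "q u = (vnorm (?X *\<^sub>v u) / sqrt n) / vnorm (sqrt_mat p C *\<^sub>v u)" for u
  have star: "lambda_star n p C \<theta> D ?X j = Inf (q ` {u. P u})"
    unfolding lambda_star_def P_def q_def by (rule arg_cong[of _ _ Inf]) auto
  have colj: "col \<theta> j \<in> carrier_vec p" using \<theta> by (intro carrier_vecI) simp
  have coli: "vec_index (col \<theta> j) i = ?a i" if "i < p" for i using that \<theta> j by simp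
  have span: "u \<in> ?span S \<longleftrightarrow> u \<in> carrier_vec p \<and>
      (\<exists>t b. (\<forall>i<p. i \<notin> S \<longrightarrow> b i = 0) \<and> (\<forall>i<p. vec_index u i = t * ?a i + b i))" if "S \<subseteq> {..<p} - {j}" for u S
  proof -
    have Sp: "S \<subseteq> {..<p}" using that by blast
    have eq: "(\<forall>i<p. vec_index u i = t * vec_index (col \<theta> j) i + b i) = (\<forall>i<p. vec_index u i = t * ?a i + b i)" for t b
      using coli by simp
    show ?thesis unfolding span_insert_units[OF colj Sp] eq ..
  qed
  have nonneg: "0 \<le> vnorm v" for v by (simp add: vnorm_def scalar_prod_self_ge_0)
  have q_less: "q u < \<rho> \<longleftrightarrow> nsq n (\<lambda>k. ip p (vec_index u) (x k)) < \<rho>\<^sup>2 * real n * qf p C (vec_index u) (vec_index u)"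
    if u: "u \<in> carrier_vec p" "u \<noteq> 0\<^sub>v p" for u
  proof -
    have "\<exists>i<p. vec_index u i \<noteq> 0" using u by (metis carrier_vecD eq_vecI index_zero_vec)
    hence "0 < qf p C (vec_index u) (vec_index u)" by (rule qf_pos[OF C])
    hence pos: "0 < vnorm (sqrt_mat p C *\<^sub>v u)"
      unfolding vnorm_sqrt_mat[OF C u(1), symmetric] using nonneg[of "sqrt_mat p C *\<^sub>v u"] by (simp add: zero_less_power2)
    have "q u < \<rho> \<longleftrightarrow> vnorm (?X *\<^sub>v u) < \<rho> * (sqrt n * vnorm (sqrt_mat p C *\<^sub>v u))"
      unfolding q_def using pos n by (simp add: pos_divide_less_eq mult_ac)
    also have "\<dots> \<longleftrightarrow> (vnorm (?X *\<^sub>v u))\<^sup>2 < (\<rho> * (sqrt n * vnorm (sqrt_mat p C *\<^sub>v u)))\<^sup>2"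
      using power_mono_iff[of "\<rho> * (sqrt n * vnorm (sqrt_mat p C *\<^sub>v u))" "vnorm (?X *\<^sub>v u)" 2] \<rho> pos nonneg
      by (simp add: not_le[symmetric])
    also have "(\<rho> * (sqrt n * vnorm (sqrt_mat p C *\<^sub>v u)))\<^sup>2 = \<rho>\<^sup>2 * real n * (vnorm (sqrt_mat p C *\<^sub>v u))\<^sup>2"
      by (simp add: power_mult_distrib)
    finally show ?thesis unfolding vnorm_data_mat_mult[OF u(1)] vnorm_sqrt_mat[OF C u(1)] .
  qed
  have "Inf (q ` {u. P u}) < \<rho> \<longleftrightarrow> (\<exists>u. P u \<and> q u < \<rho>)"
  proof -
    \<comment> \<open>Since \<open>1 \<le> D\<close>, the span contains a unit vector; for an empty
      set \<open>Inf\<close> would say nothing.\<close>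
    have ne: "q ` {u. P u} \<noteq> {}"
    proof -
      have "D \<le> card ({..<p} - {j})" using D j by simp
      then obtain S where S: "S \<subseteq> {..<p} - {j}" "card S = D" by (meson obtain_subset_with_card_n)
      with D obtain i where i: "i \<in> S" by fastforce
      have "unit_vec p i \<in> ?span S"
        unfolding span[OF S(1)] using i S by (intro conjI exI[of _ 0] exI[of _ "\<lambda>k. of_bool (k = i)"]) auto
      moreover have "(unit_vec p i :: real Matrix.vec) \<noteq> 0\<^sub>v p"
        using i S(1) arg_cong[of "unit_vec p i :: real Matrix.vec" "0\<^sub>v p" "\<lambda>v. vec_index v i"] by auto
      ultimately have "P (unit_vec p i)" unfolding P_def using S by blast
      thus ?thesis by blast
    qed
    have bdd: "bdd_below (q ` {u. P u})"
      using nonneg by (intro bdd_belowI2[of _ 0]) (simp add: q_def)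
    show ?thesis using cInf_less_iff[OF ne bdd, of \<rho>] by blast
  qed
  also have "\<dots> \<longleftrightarrow> small_ratio n p C ?a D j (\<rho>\<^sup>2 * real n) x"
  proof
    assume "\<exists>u. P u \<and> q u < \<rho>"
    then obtain u S where u: "u \<noteq> 0\<^sub>v p" "q u < \<rho>" and S: "S \<subseteq> {..<p} - {j}" "card S = D" and us: "u \<in> ?span S"
      unfolding P_def by blast
    from us obtain t b where uc: "u \<in> carrier_vec p" and b: "\<And>i. i < p \<Longrightarrow> i \<notin> S \<Longrightarrow> b i = 0"
      and ui: "\<And>i. i < p \<Longrightarrow> vec_index u i = t * ?a i + b i"
      unfolding span[OF S(1)] by blast
    show "small_ratio n p C ?a D j (\<rho>\<^sup>2 * real n) x"
    proof (rule ccontr)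
      assume "\<not> small_ratio n p C ?a D j (\<rho>\<^sup>2 * real n) x"
      from not_small_ratioD[OF this S(1) _ D(2) j, of b t] b S(2)
      have "\<rho>\<^sup>2 * real n * qf p C (\<lambda>i. t * ?a i + b i) (\<lambda>i. t * ?a i + b i) \<le> nsq n (\<lambda>k. ip p (\<lambda>i. t * ?a i + b i) (x k))"
        by simp
      moreover have "qf p C (vec_index u) (vec_index u) = qf p C (\<lambda>i. t * ?a i + b i) (\<lambda>i. t * ?a i + b i)"
        using ui by (intro qf_cong) auto
      moreover have "ip p (vec_index u) y = ip p (\<lambda>i. t * ?a i + b i) y" for y
        using ui by (intro ip_cong) auto
      ultimately show False using u(2) unfolding q_less[OF uc u(1)] by simp
    qed
  next
    assume "small_ratio n p C ?a D j (\<rho>\<^sup>2 * real n) x"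
    then obtain S c where S: "S \<subseteq> {..<p} - {j}" "card S = D"
      and less: "nsq n (\<lambda>k. ip p (lin_comb (Suc D) c (span_family ?a S)) (x k)) <
        \<rho>\<^sup>2 * real n * qf p C (lin_comb (Suc D) c (span_family ?a S)) (lin_comb (Suc D) c (span_family ?a S))"
      unfolding small_ratio_def by blast
    let ?w = "lin_comb (Suc D) c (span_family ?a S)"
    define u where "u = Matrix.vec p ?w"
    have uc: "u \<in> carrier_vec p" by (simp add: u_def)
    have us: "u \<in> ?span S" unfolding span[OF S(1)] using lin_comb_span_family[OF S, of c ?a] uc by (simp add: u_def)
    have qu: "qf p C (vec_index u) (vec_index u) = qf p C ?w ?w" by (intro qf_cong) (auto simp: u_def)
    have iu: "ip p (vec_index u) y = ip p ?w y" for y by (intro ip_cong) (auto simp: u_def)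
    have u0: "u \<noteq> 0\<^sub>v p"
    proof
      assume "u = 0\<^sub>v p"
      hence "qf p C ?w ?w = 0" unfolding qu[symmetric] by (simp add: qf_sum)
      thus False using less ip_nonneg[of n "\<lambda>k. ip p ?w (x k)"] by simp
    qed
    have "P u" unfolding P_def using u0 S us by blast
    moreover have "q u < \<rho>" unfolding q_less[OF uc u0] qu iu by (rule less)
    ultimately show "\<exists>u. P u \<and> q u < \<rho>" by blast
  qed
  finally show ?thesis unfolding star .
qed

text \<open>\<open>n\<close>, \<open>p\<close>, \<open>D\<close> and \<open>C\<close> are quantified
  after \<kappa>, so that a constant chosen by \<open>SOME\<close> depends on \<eta> alone, as the
  uniformity of the residual bound demands.\<close>

definition small_ratio_rate :: "real \<Rightarrow> real \<Rightarrow> bool" where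
  "small_ratio_rate \<eta> \<kappa> \<longleftrightarrow> 0 \<le> \<kappa> \<and> (\<forall>n p D C j a. pos_def p C \<longrightarrow> 3 \<le> n \<longrightarrow> n < p \<longrightarrow> 1 \<le> D \<longrightarrow>
     real D \<le> \<eta> * (real n / (2 * (1.1 + sqrt (ln (real p)))\<^sup>2)) \<longrightarrow> j < p \<longrightarrow>
     emeasure (sample_law n p C) {x \<in> space (sample_law n p C). small_ratio n p C a D j (((1 - sqrt \<eta>)\<^sup>2)\<^sup>2 * real n) x}
     \<le> ennreal (\<kappa> * real n powr (- 8 * ln (real n))))"

lemma small_ratio_rate_exists:
  assumes \<eta>: "0 < \<eta>" "\<eta> < 1"
  shows "\<exists>\<kappa>. small_ratio_rate \<eta> \<kappa>"
proof -
  let ?e = "1 - sqrt \<eta>"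
  have e: "0 < ?e" "?e < 1" using \<eta> by auto
  have e2: "(1 - ?e)\<^sup>2 = \<eta>" using \<eta> by simp
  from small_ball_asymptotics[OF \<eta>, of "8 / (?e\<^sup>2 * (1 - ?e\<^sup>2))"]
  obtain \<kappa> where \<kappa>: "0 \<le> \<kappa>" and bnd: "\<And>n p D. 3 \<le> n \<Longrightarrow> n < p \<Longrightarrow> 1 \<le> D \<Longrightarrow>
      real D \<le> \<eta> * (real n / (2 * (1.1 + sqrt (ln (real p)))\<^sup>2)) \<Longrightarrow>
      real p ^ D * (real (Suc D) * exp (- real n) + exp (8 / (?e\<^sup>2 * (1 - ?e\<^sup>2)) * real (Suc D)) * 3 ^ Suc D * exp (- real n * \<eta>))
      \<le> \<kappa> * real n powr (- 8 * ln (real n))" by blast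
  show ?thesis
    unfolding small_ratio_rate_def
  proof (intro exI[of _ \<kappa>] impI conjI allI \<kappa>)
    fix n p D j :: nat and C :: "real mat" and a :: "nat \<Rightarrow> real"
    assume C: "pos_def p C" and n: "3 \<le> n" "n < p" "1 \<le> D"
      "real D \<le> \<eta> * (real n / (2 * (1.1 + sqrt (ln (real p)))\<^sup>2))" and j: "j < p"
    have n0: "0 < n" using n by simp
    from small_ratio_probability[OF C e n0 j, of a D] ennreal_leI[OF bnd[OF n]]
    show "emeasure (sample_law n p C) {x \<in> space (sample_law n p C). small_ratio n p C a D j ((?e\<^sup>2)\<^sup>2 * real n) x}
        \<le> ennreal (\<kappa> * real n powr (- 8 * ln (real n)))"
      unfolding e2 by (rule order.trans)
  qed
qed

definition small_ratio_const :: "real \<Rightarrow> real" where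
  "small_ratio_const \<eta> = (SOME \<kappa>. small_ratio_rate \<eta> \<kappa>)"

lemma small_ratio_const:
  assumes \<eta>: "0 < \<eta>" "\<eta> < 1"
  shows "0 \<le> small_ratio_const \<eta>"
    "pos_def p C \<Longrightarrow> 3 \<le> n \<Longrightarrow> n < p \<Longrightarrow> 1 \<le> D \<Longrightarrow>
     real D \<le> \<eta> * (real n / (2 * (1.1 + sqrt (ln (real p)))\<^sup>2)) \<Longrightarrow> j < p \<Longrightarrow>
     emeasure (sample_law n p C) {x \<in> space (sample_law n p C). small_ratio n p C a D j (((1 - sqrt \<eta>)\<^sup>2)\<^sup>2 * real n) x}
     \<le> ennreal (small_ratio_const \<eta> * real n powr (- 8 * ln (real n)))"
proof -
  have "small_ratio_rate \<eta> (small_ratio_const \<eta>)"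
    unfolding small_ratio_const_def by (rule someI_ex[OF small_ratio_rate_exists[OF \<eta>]])
  note rate = this[unfolded small_ratio_rate_def]
  show "0 \<le> small_ratio_const \<eta>" by (rule conjunct1[OF rate])
  show "pos_def p C \<Longrightarrow> 3 \<le> n \<Longrightarrow> n < p \<Longrightarrow> 1 \<le> D \<Longrightarrow>
     real D \<le> \<eta> * (real n / (2 * (1.1 + sqrt (ln (real p)))\<^sup>2)) \<Longrightarrow> j < p \<Longrightarrow>
     emeasure (sample_law n p C) {x \<in> space (sample_law n p C). small_ratio n p C a D j (((1 - sqrt \<eta>)\<^sup>2)\<^sup>2 * real n) x}
     \<le> ennreal (small_ratio_const \<eta> * real n powr (- 8 * ln (real n)))"
    by (rule conjunct2[OF rate, rule_format])
qed

text \<open>A column above the threshold is not zero, so replacing it by 0 does change it; this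
  links the inequality of columns in \<open>residual\<close> to the norm condition.\<close>

lemma truncation_column:
  assumes A: "A \<in> carrier_mat p p" and i: "i < p" and j: "j < p" and a: "\<And>i. i < p \<Longrightarrow> A $$ (i, j) = a i"
  shows "truncation n p A $$ (i, j) = (if real p * (real n powr (2 * ln n))\<^sup>2 < nsq p a then 0 else a i)"
    "col (truncation n p A) j \<noteq> col A j \<longleftrightarrow> real p * (real n powr (2 * ln n))\<^sup>2 < nsq p a"
proof -
  let ?T = "real n powr (2 * ln n)"
  have "vnorm (col A j) = sqrt (nsq p a)"
    using A j a by (subst vnorm_eq_nsq[of _ p]) (auto intro!: carrier_vecI arg_cong[of _ _ sqrt] ip_cong)
  moreover have "sqrt p * ?T = sqrt (real p * ?T\<^sup>2)" by (simp add: real_sqrt_mult)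
  ultimately have iff: "vnorm (col A j) \<le> sqrt p * ?T \<longleftrightarrow> \<not> real p * ?T\<^sup>2 < nsq p a"
    by (simp add: not_less)
  have entry: "truncation n p A $$ (i, j) = (if real p * ?T\<^sup>2 < nsq p a then 0 else a i)" if "i < p" for i
    using that j a unfolding truncation_def by (simp add: iff)
  thus "truncation n p A $$ (i, j) = (if real p * ?T\<^sup>2 < nsq p a then 0 else a i)" using i .
  show "col (truncation n p A) j \<noteq> col A j \<longleftrightarrow> real p * ?T\<^sup>2 < nsq p a"
  proof
    assume ne: "col (truncation n p A) j \<noteq> col A j"
    show "real p * ?T\<^sup>2 < nsq p a"
    proof (rule ccontr)
      assume "\<not> ?thesis"
      hence "col (truncation n p A) j = col A j"
        using A j a entry by (intro eq_vecI) (auto simp: truncation_def)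
      with ne show False ..
    qed
  next
    assume big: "real p * ?T\<^sup>2 < nsq p a"
    show "col (truncation n p A) j \<noteq> col A j"
    proof
      assume eq: "col (truncation n p A) j = col A j"
      have "a i = 0" if "i < p" for i
        using arg_cong[OF eq, of "\<lambda>v. vec_index v i"] that j A a[OF that] entry[OF that] big
        by (simp add: truncation_def)
      hence "nsq p a = 0" by (simp add: ip_def)
      moreover have "0 \<le> real p * ?T\<^sup>2" by simp
      ultimately show False using big by simp
    qed
  qed
qed

context model_selection
begin

lemma tsel_truncation:
  assumes B: "B \<in> carrier_mat p p" "\<And>i j. i < p \<Longrightarrow> j < p \<Longrightarrow> B $$ (i, j) = asel x j i" and j: "j < p"
  shows "i < p \<Longrightarrow> truncation n p B $$ (i, j) = tsel (real n powr (2 * ln n)) x j i"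
    "col (truncation n p B) j \<noteq> col B j \<longleftrightarrow> truncated (real n powr (2 * ln n)) x j"
  using truncation_column[OF B(1) _ j B(2)[OF _ j], of _ n] truncation_column(2)[OF B(1) j j B(2)[OF _ j], of n]
  by (simp_all add: tsel_def truncated_def)

lemma frob_norm_truncation:
  assumes B: "B \<in> carrier_mat p p" "\<And>i j. i < p \<Longrightarrow> j < p \<Longrightarrow> B $$ (i, j) = asel x j i"
  shows "(frob_norm (sqrt_mat p C * (truncation n p B - \<theta>)))\<^sup>2 =
    (\<Sum>j<p. qf p C (\<lambda>i. tsel (real n powr (2 * ln n)) x j i - \<theta> $$ (i, j)) (\<lambda>i. tsel (real n powr (2 * ln n)) x j i - \<theta> $$ (i, j)))"
proof -
  have \<theta>: "\<theta> \<in> carrier_mat p p" using reg by (simp add: regression_mat_def)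
  have "truncation n p B \<in> carrier_mat p p" by (simp add: truncation_def)
  thus ?thesis
    using \<theta> by (subst frob_norm_sqrt_mat_diff[OF C]) (auto intro!: sum.cong qf_cong simp: tsel_truncation[OF B])
qed

text \<open>\<open>residual\<close> takes the estimator as a function of the data matrix. Outside a
  null set it agrees with \<open>asel\<close>, and null sets do not affect the integrals.\<close>

lemma residual_eq:
  assumes \<eta>: "0 < \<eta>" "\<eta> < 1" and D1: "1 \<le> D"
    and B: "AE x in sample_law n p C. B (data_mat n p x) \<in> carrier_mat p p \<and>
      (\<forall>i<p. \<forall>j<p. B (data_mat n p x) $$ (i, j) = asel x j i)"
  shows "residual n p \<eta> C \<theta> D B = (\<Sum>j<p.
    (\<integral>\<^sup>+x. ennreal (truncation_loss (1 - sqrt \<eta>) (real n powr (2 * ln n)) j x) \<partial>sample_law n p C) +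
    (\<integral>\<^sup>+x. ennreal (low_ratio_loss (1 - sqrt \<eta>) (real n powr (2 * ln n)) j x) \<partial>sample_law n p C))"
  unfolding residual_def Let_def
proof (intro sum.cong refl arg_cong2[of _ _ _ _ "(+)"])
  fix j assume "j \<in> {..<p}"
  hence j: "j < p" by simp
  have \<theta>: "\<theta> \<in> carrier_mat p p" using reg by (simp add: regression_mat_def)
  have "0 < (1 - sqrt \<eta>)\<^sup>2" using \<eta> by simp
  note star = lambda_star_less_iff[OF C dims_pos(2) \<theta> j D1 D_less_p this]
  have acol: "(vnorm (sqrt_mat p C *\<^sub>v col \<theta> j))\<^sup>2 = qf p C (acol j) (acol j)"
    using \<theta> j by (subst vnorm_sqrt_mat[OF C]) (auto intro!: carrier_vecI qf_cong)
  show "(\<integral>\<^sup>+x. ennreal (if lambda_star n p C \<theta> D (data_mat n p x) j \<ge> (1 - sqrt \<eta>)\<^sup>2 \<and>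
        col (truncation n p (B (data_mat n p x))) j \<noteq> col (B (data_mat n p x)) j
      then (vnorm (sqrt_mat p C *\<^sub>v col \<theta> j))\<^sup>2 else 0) \<partial>sample_law n p C) =
    (\<integral>\<^sup>+x. ennreal (truncation_loss (1 - sqrt \<eta>) (real n powr (2 * ln n)) j x) \<partial>sample_law n p C)"
    by (rule nn_integral_cong_AE, rule AE_mp[OF B], rule AE_I2, rule impI, rule arg_cong[of _ _ ennreal])
      (simp only: truncation_loss_def acol not_less[symmetric] star tsel_truncation(2)[OF _ _ j])
  show "(\<integral>\<^sup>+x. ennreal (if lambda_star n p C \<theta> D (data_mat n p x) j < (1 - sqrt \<eta>)\<^sup>2
      then (vnorm (sqrt_mat p C *\<^sub>v (col (truncation n p (B (data_mat n p x))) j - col \<theta> j)))\<^sup>2 else 0) \<partial>sample_law n p C) =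
    (\<integral>\<^sup>+x. ennreal (low_ratio_loss (1 - sqrt \<eta>) (real n powr (2 * ln n)) j x) \<partial>sample_law n p C)"
  proof (rule nn_integral_cong_AE, rule AE_mp[OF B], rule AE_I2, rule impI, rule arg_cong[of _ _ ennreal])
    fix x assume Bx: "B (data_mat n p x) \<in> carrier_mat p p \<and> (\<forall>i<p. \<forall>j<p. B (data_mat n p x) $$ (i, j) = asel x j i)"
    have "(vnorm (sqrt_mat p C *\<^sub>v (col (truncation n p (B (data_mat n p x))) j - col \<theta> j)))\<^sup>2 =
      qf p C (\<lambda>i. tsel (real n powr (2 * ln n)) x j i - \<theta> $$ (i, j)) (\<lambda>i. tsel (real n powr (2 * ln n)) x j i - \<theta> $$ (i, j))"
    proof (subst vnorm_sqrt_mat[OF C])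
      have tr: "truncation n p (B (data_mat n p x)) \<in> carrier_mat p p" by (simp add: truncation_def)
      show "col (truncation n p (B (data_mat n p x))) j - col \<theta> j \<in> carrier_vec p"
        using \<theta> tr by (intro carrier_vecI) simp
      have "vec_index (col (truncation n p (B (data_mat n p x))) j - col \<theta> j) i =
          tsel (real n powr (2 * ln n)) x j i - \<theta> $$ (i, j)" if "i < p" for i
        using \<theta> tr j that Bx tsel_truncation(1)[of "B (data_mat n p x)" x j i] by simp
      thus "qf p C (vec_index (col (truncation n p (B (data_mat n p x))) j - col \<theta> j))
          (vec_index (col (truncation n p (B (data_mat n p x))) j - col \<theta> j)) =
        qf p C (\<lambda>i. tsel (real n powr (2 * ln n)) x j i - \<theta> $$ (i, j)) (\<lambda>i. tsel (real n powr (2 * ln n)) x j i - \<theta> $$ (i, j))"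
        by (intro qf_cong)
    qed
    thus "(if lambda_star n p C \<theta> D (data_mat n p x) j < (1 - sqrt \<eta>)\<^sup>2
      then (vnorm (sqrt_mat p C *\<^sub>v (col (truncation n p (B (data_mat n p x))) j - col \<theta> j)))\<^sup>2 else 0) =
      low_ratio_loss (1 - sqrt \<eta>) (real n powr (2 * ln n)) j x"
      by (simp only: low_ratio_loss_def star)
  qed
qed

end

section \<open>From the sample to its law\<close>

lemma normal_sample_distr:
  assumes X: "normal_sample \<Omega> X n p C" and n: "0 < n"
  shows "(\<lambda>\<omega>. \<lambda>k\<in>{..<n}. X k \<omega>) \<in> measurable \<Omega> (sample_law n p C)"
    "distr \<Omega> (sample_law n p C) (\<lambda>\<omega>. \<lambda>k\<in>{..<n}. X k \<omega>) = sample_law n p C"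
proof -
  let ?B = "\<Pi>\<^sub>M j\<in>{..<p}. borel :: real measure"
  interpret prob_space \<Omega> using X by (simp add: normal_sample_def)
  have ind: "indep_vars (\<lambda>_. ?B) X {..<n}" and d: "\<And>k. k < n \<Longrightarrow> distr \<Omega> ?B (X k) = normal_dist p C"
    using X by (simp_all add: normal_sample_def)
  have rv: "random_variable ?B (X k)" if "k \<in> {..<n}" for k
    using ind that by (simp add: indep_vars_def)
  have "distr \<Omega> (\<Pi>\<^sub>M k\<in>{..<n}. ?B) (\<lambda>\<omega>. \<lambda>k\<in>{..<n}. X k \<omega>) = (\<Pi>\<^sub>M k\<in>{..<n}. distr \<Omega> ?B (X k))"
    using ind n by (subst indep_vars_iff_distr_eq_PiM'[symmetric]) (auto simp: rv)
  also have "\<dots> = sample_law n p C"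
    unfolding sample_law_def by (intro PiM_cong) (auto simp: d)
  finally show "distr \<Omega> (sample_law n p C) (\<lambda>\<omega>. \<lambda>k\<in>{..<n}. X k \<omega>) = sample_law n p C"
    by (subst distr_cong[OF refl sets_sample_law refl])
  have "(\<lambda>\<omega>. \<lambda>k\<in>{..<n}. X k \<omega>) \<in> measurable \<Omega> (\<Pi>\<^sub>M k\<in>{..<n}. ?B)"
    by (intro measurable_restrict rv)
  thus "(\<lambda>\<omega>. \<lambda>k\<in>{..<n}. X k \<omega>) \<in> measurable \<Omega> (sample_law n p C)"
    unfolding measurable_cong_sets[OF refl sets_sample_law] .
qed

text \<open>\<open>data_mat\<close> reads only the rows below \<open>n\<close>, so the sample may be
  restricted to them; the almost sure identification with the measurable \<open>f\<close> is pulled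
  back along the sample.\<close>

lemma nn_integral_normal_sample:
  assumes X: "normal_sample \<Omega> X n p C" and n: "0 < n" and f: "f \<in> borel_measurable (sample_law n p C)"
    and g: "AE x in sample_law n p C. g (data_mat n p x) = f x"
  shows "(\<integral>\<^sup>+\<omega>. g (data_mat n p (\<lambda>k. X k \<omega>)) \<partial>\<Omega>) = (\<integral>\<^sup>+x. f x \<partial>sample_law n p C)"
proof -
  let ?h = "\<lambda>\<omega>. \<lambda>k\<in>{..<n}. X k \<omega>"
  note h = normal_sample_distr[OF X n]
  have d: "data_mat n p (\<lambda>k. X k \<omega>) = data_mat n p (?h \<omega>)" for \<omega>
    unfolding data_mat_def by (intro cong_mat) auto
  have "AE x in distr \<Omega> (sample_law n p C) ?h. g (data_mat n p x) = f x" unfolding h(2) by (rule g)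
  hence "AE \<omega> in \<Omega>. g (data_mat n p (?h \<omega>)) = f (?h \<omega>)" by (rule AE_distrD[OF h(1)])
  hence "(\<integral>\<^sup>+\<omega>. g (data_mat n p (\<lambda>k. X k \<omega>)) \<partial>\<Omega>) = (\<integral>\<^sup>+\<omega>. f (?h \<omega>) \<partial>\<Omega>)"
    unfolding d by (rule nn_integral_cong_AE)
  also have "\<dots> = (\<integral>\<^sup>+x. f x \<partial>distr \<Omega> (sample_law n p C) ?h)"
    using f by (subst nn_integral_distr[OF h(1)]) simp_all
  finally show ?thesis unfolding h(2) .
qed

lemma digraph_degrees:
  assumes M: "\<M> \<subseteq> digraphs p"
  shows "finite \<M>" "m \<in> \<M> \<Longrightarrow> j < p \<Longrightarrow> card (nbrs m j) \<le> gdeg p m" "m \<in> \<M> \<Longrightarrow> gdeg p m \<le> max_deg p \<M>"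
proof -
  show fin: "finite \<M>"
    by (rule finite_subset[OF M]) (auto simp: digraphs_def intro: finite_subset[of _ "Pow ({..<p} \<times> {..<p})"])
  show "card (nbrs m j) \<le> gdeg p m" if "j < p"
    unfolding gdeg_def using that by (intro Max_ge) auto
  show "gdeg p m \<le> max_deg p \<M>" if "m \<in> \<M>"
    unfolding max_deg_def using that fin by (intro Max_ge) auto
qed

text \<open>The least squares property holds almost surely for each model separately; as there are
  finitely many, it holds for all at once, and the matrix minimizers decouple into the column
  conditions of the locale.\<close>

lemma model_selection_sample_law:
  assumes n: "n \<ge> 3" and np: "p > n" and C: "pos_def p C" and K: "K > 1" and \<eta>: "0 < \<eta>" "\<eta> < 1"
    and M: "\<M> \<subseteq> digraphs p" and D1: "1 \<le> max_deg p \<M>"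
    and D: "real (max_deg p \<M>) \<le> \<eta> * (real n / (2 * (1.1 + sqrt (ln p))\<^sup>2))"
    and reg: "regression_mat p C \<theta>"
    and ls: "\<forall>m\<in>\<M>. AE x in sample_law n p C. let X = data_mat n p x in
         is_arg_min (\<lambda>A. (frob_norm (X * (1\<^sub>m p - A)))\<^sup>2) (\<lambda>A. A \<in> Theta p m) (\<theta>hat m X)"
    and meas: "\<forall>m\<in>\<M>. \<forall>i<p. \<forall>j<p.
         (\<lambda>x. \<theta>hat m (data_mat n p x) $$ (i, j)) \<in> borel_measurable (sample_law n p C)"
    and sel: "AE x in sample_law n p C. let X = data_mat n p x in
         is_arg_min (crit K n p X (\<lambda>m. \<theta>hat m X)) (\<lambda>m. m \<in> \<M>) (mhat X)"
    and mh: "(\<lambda>x. mhat (data_mat n p x)) \<in> measurable (sample_law n p C) (count_space UNIV)"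
  shows "model_selection n p (max_deg p \<M>) C \<theta> K \<M> (\<lambda>m x j i. \<theta>hat m (data_mat n p x) $$ (i, j)) (\<lambda>x. mhat (data_mat n p x))"
    "AE x in sample_law n p C. mhat (data_mat n p x) \<in> \<M> \<and> (\<forall>m\<in>\<M>. \<theta>hat m (data_mat n p x) \<in> carrier_mat p p)"
proof -
  note dg = digraph_degrees[OF M]
  note db = degree_bounds[OF n np \<eta> D1 D]
  have deg: "card (nbrs m j) \<le> max_deg p \<M>" if "m \<in> \<M>" "j < p" for m j
    using dg(2,3)[OF that(1)] that(2) le_trans by blast
  have deg': "card (nbrs m j) + 1 < n" if "m \<in> \<M>" "j < p" for m j
    using deg[OF that] db(1) n by linarith
  have ls': "AE x in sample_law n p C. \<forall>m\<in>\<M>. is_arg_min (\<lambda>A. (frob_norm (data_mat n p x * (1\<^sub>m p - A)))\<^sup>2)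
      (\<lambda>A. A \<in> Theta p m) (\<theta>hat m (data_mat n p x))"
    using ls unfolding Let_def by (intro AE_finite_allI[OF dg(1)]) blast
  have carrier: "\<theta>hat m X \<in> carrier_mat p p" if "is_arg_min f (\<lambda>A. A \<in> Theta p m) (\<theta>hat m X)" for f :: "real mat \<Rightarrow> real" and m X
    using that by (simp add: is_arg_min_def Theta_def)
  show "AE x in sample_law n p C. mhat (data_mat n p x) \<in> \<M> \<and> (\<forall>m\<in>\<M>. \<theta>hat m (data_mat n p x) \<in> carrier_mat p p)"
    using sel ls' unfolding Let_def
    by eventually_elim (auto simp: is_arg_min_def[of "crit _ _ _ _ _"] intro: carrier)
  show "model_selection n p (max_deg p \<M>) C \<theta> K \<M> (\<lambda>m x j i. \<theta>hat m (data_mat n p x) $$ (i, j)) (\<lambda>x. mhat (data_mat n p x))"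
  proof (rule model_selection.intro)
    show "AE x in sample_law n p C. \<forall>m\<in>\<M>. \<forall>j<p. (\<forall>i<p. i \<notin> nbrs m j \<longrightarrow> \<theta>hat m (data_mat n p x) $$ (i, j) = 0) \<and>
      (\<forall>b. (\<forall>i<p. i \<notin> nbrs m j \<longrightarrow> b i = 0) \<longrightarrow>
        nsq n (\<lambda>k. ip p (res_coeff j (\<lambda>i. \<theta>hat m (data_mat n p x) $$ (i, j))) (x k)) \<le> nsq n (\<lambda>k. ip p (res_coeff j b) (x k)))"
      using ls'
    proof eventually_elim
      fix x assume ls: "\<forall>m\<in>\<M>. is_arg_min (\<lambda>A. (frob_norm (data_mat n p x * (1\<^sub>m p - A)))\<^sup>2)
          (\<lambda>A. A \<in> Theta p m) (\<theta>hat m (data_mat n p x))"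
      show "\<forall>m\<in>\<M>. \<forall>j<p. (\<forall>i<p. i \<notin> nbrs m j \<longrightarrow> \<theta>hat m (data_mat n p x) $$ (i, j) = 0) \<and>
        (\<forall>b. (\<forall>i<p. i \<notin> nbrs m j \<longrightarrow> b i = 0) \<longrightarrow>
          nsq n (\<lambda>k. ip p (res_coeff j (\<lambda>i. \<theta>hat m (data_mat n p x) $$ (i, j))) (x k)) \<le> nsq n (\<lambda>k. ip p (res_coeff j b) (x k)))"
      proof (rule ballI, rule allI, rule impI, rule conjI)
        fix m j assume "m \<in> \<M>" "j < p"
        note lsc = least_squares_columns[OF bspec[OF ls this(1)] this(2)]
        show "\<forall>i<p. i \<notin> nbrs m j \<longrightarrow> \<theta>hat m (data_mat n p x) $$ (i, j) = 0" by (rule lsc(1))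
        show "\<forall>b. (\<forall>i<p. i \<notin> nbrs m j \<longrightarrow> b i = 0) \<longrightarrow>
          nsq n (\<lambda>k. ip p (res_coeff j (\<lambda>i. \<theta>hat m (data_mat n p x) $$ (i, j))) (x k)) \<le> nsq n (\<lambda>k. ip p (res_coeff j b) (x k))"
          by (rule lsc(2))
      qed
    qed
    show "AE x in sample_law n p C. mhat (data_mat n p x) \<in> \<M> \<and> (\<forall>m\<in>\<M>.
      (\<Sum>j<p. nsq n (\<lambda>k. ip p (res_coeff j (\<lambda>i. \<theta>hat (mhat (data_mat n p x)) (data_mat n p x) $$ (i, j))) (x k)) *
        (1 + K * pen_rate n p (card (nbrs (mhat (data_mat n p x)) j)))) \<le>
      (\<Sum>j<p. nsq n (\<lambda>k. ip p (res_coeff j (\<lambda>i. \<theta>hat m (data_mat n p x) $$ (i, j))) (x k)) * (1 + K * pen_rate n p (card (nbrs m j)))))"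
      using sel ls' unfolding Let_def
    proof eventually_elim
      fix x assume min: "is_arg_min (crit K n p (data_mat n p x) (\<lambda>m. \<theta>hat m (data_mat n p x))) (\<lambda>m. m \<in> \<M>) (mhat (data_mat n p x))"
        and ls: "\<forall>m\<in>\<M>. is_arg_min (\<lambda>A. (frob_norm (data_mat n p x * (1\<^sub>m p - A)))\<^sup>2)
          (\<lambda>A. A \<in> Theta p m) (\<theta>hat m (data_mat n p x))"
      have mM: "mhat (data_mat n p x) \<in> \<M>" using min by (simp add: is_arg_min_def)
      have cr: "crit K n p (data_mat n p x) (\<lambda>m. \<theta>hat m (data_mat n p x)) m =
          (\<Sum>j<p. nsq n (\<lambda>k. ip p (res_coeff j (\<lambda>i. \<theta>hat m (data_mat n p x) $$ (i, j))) (x k)) * (1 + K * pen_rate n p (card (nbrs m j))))"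
        if "m \<in> \<M>" for m
        using ls that deg' by (intro crit_eq carrier) auto
      show "mhat (data_mat n p x) \<in> \<M> \<and> (\<forall>m\<in>\<M>.
        (\<Sum>j<p. nsq n (\<lambda>k. ip p (res_coeff j (\<lambda>i. \<theta>hat (mhat (data_mat n p x)) (data_mat n p x) $$ (i, j))) (x k)) *
          (1 + K * pen_rate n p (card (nbrs (mhat (data_mat n p x)) j)))) \<le>
        (\<Sum>j<p. nsq n (\<lambda>k. ip p (res_coeff j (\<lambda>i. \<theta>hat m (data_mat n p x) $$ (i, j))) (x k)) * (1 + K * pen_rate n p (card (nbrs m j)))))"
        using mM min cr[OF mM, symmetric] cr[symmetric] by (auto simp: is_arg_min_def not_less)
    qed
  qed (use C reg K n np M deg db meas mh in auto)
qed

context model_selection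
begin

text \<open>In the bias term the normalized penalty of each column is raised to that of the degree
  by monotonicity; in the variance term the column sizes are kept. The scaling \<open>c\<close>
  stands for the fourth power of 1 - sqrt \<eta>.\<close>

lemma oracle_bound_le:
  assumes m: "m \<in> M" and g: "\<And>j. j < p \<Longrightarrow> card (nbrs m j) \<le> d" and d: "d \<le> D"
    and q: "\<And>j. 0 \<le> q j" and c: "0 < c"
  shows "1 / (c * real n) * (K / (K - 1) * (\<Sum>j<p. real n * q j * (1 + K * pen_rate n p (card (nbrs m j)))
      + sigma2 C j * (K * pen_rate n p (card (nbrs m j)) * (real n - real (card (nbrs m j))) + K * ln (real n)))) \<le>
    K / ((K - 1) * c) * ((\<Sum>j<p. q j) * (1 + pen K n p d / (real n - real d)) +
      1 / real n * (\<Sum>j<p. (pen K n p (card (nbrs m j)) + K * ln (real n)) * sigma2 C j))"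
proof -
  have dn: "d + 1 < n" "2 * d \<le> p" using d D n3 np by linarith+
  have pd: "pen K n p d / (real n - real d) = K * pen_rate n p d"
    using dn by (simp add: pen_eq_pen_rate)
  have pj: "pen K n p (card (nbrs m j)) = K * pen_rate n p (card (nbrs m j)) * (real n - real (card (nbrs m j)))" if "j < p" for j
    using g[OF that] dn by (subst pen_eq_pen_rate) auto
  have "(\<Sum>j<p. real n * q j * (1 + K * pen_rate n p (card (nbrs m j)))
      + sigma2 C j * (K * pen_rate n p (card (nbrs m j)) * (real n - real (card (nbrs m j))) + K * ln (real n))) \<le>
    (\<Sum>j<p. real n * q j * (1 + K * pen_rate n p d)
      + (pen K n p (card (nbrs m j)) + K * ln (real n)) * sigma2 C j)"
  proof (intro sum_mono add_mono mult_left_mono)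
    fix j assume "j \<in> {..<p}"
    hence j: "j < p" by simp
    show "pen_rate n p (card (nbrs m j)) \<le> pen_rate n p d"
      using g[OF j] dn by (intro pen_rate_mono)
    show "sigma2 C j * (K * pen_rate n p (card (nbrs m j)) * (real n - real (card (nbrs m j))) + K * ln (real n)) \<le>
      (pen K n p (card (nbrs m j)) + K * ln (real n)) * sigma2 C j"
      unfolding pj[OF j] by (simp add: mult_ac)
  qed (use q K in auto)
  also have "\<dots> = real n * ((\<Sum>j<p. q j) * (1 + K * pen_rate n p d)) +
      (\<Sum>j<p. (pen K n p (card (nbrs m j)) + K * ln (real n)) * sigma2 C j)"
    by (simp only: sum.distrib sum_distrib_left sum_distrib_right mult.assoc)
  finally have "1 / (c * real n) * (K / (K - 1) * (\<Sum>j<p. real n * q j * (1 + K * pen_rate n p (card (nbrs m j)))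
      + sigma2 C j * (K * pen_rate n p (card (nbrs m j)) * (real n - real (card (nbrs m j))) + K * ln (real n)))) \<le>
    1 / (c * real n) * (K / (K - 1) * (real n * ((\<Sum>j<p. q j) * (1 + K * pen_rate n p d)) +
      (\<Sum>j<p. (pen K n p (card (nbrs m j)) + K * ln (real n)) * sigma2 C j)))"
    using K c by (intro mult_left_mono) auto
  also have "\<dots> = K / ((K - 1) * c) * ((\<Sum>j<p. q j) * (1 + K * pen_rate n p d) +
      1 / real n * (\<Sum>j<p. (pen K n p (card (nbrs m j)) + K * ln (real n)) * sigma2 C j))"
    using n3 K c by (simp add: field_simps)
  finally show ?thesis unfolding pd .
qed

text \<open>The two parts balance: with T = n^(2 ln n), both 1 / T^2 and T^2 n^(-8 ln n) equal n^(-4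
  ln n). One factor \<open>p\<close> comes from the sum over the columns, the other from the
  truncation level in the low ratio part.\<close>

lemma residual_sum_le:
  assumes \<epsilon>: "0 < \<epsilon>" "\<epsilon> < 1" and a: "0 < \<alpha>" "\<And>u. \<alpha> * nsq p u \<le> qf p C u u" and \<beta>: "\<And>u. qf p C u u \<le> \<beta> * nsq p u"
    and \<kappa>: "0 \<le> \<kappa>" and P: "\<And>j. j < p \<Longrightarrow> emeasure (sample_law n p C) {x \<in> space (sample_law n p C). low_ratio \<epsilon> j x} \<le>
      ennreal (\<kappa> * real n powr (- 8 * ln n))"
  shows "(\<Sum>j<p. (\<integral>\<^sup>+x. ennreal (truncation_loss \<epsilon> (real n powr (2 * ln n)) j x) \<partial>sample_law n p C) +
    (\<integral>\<^sup>+x. ennreal (low_ratio_loss \<epsilon> (real n powr (2 * ln n)) j x) \<partial>sample_law n p C)) \<le>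
    ennreal ((4 * \<beta>\<^sup>2 / (\<alpha> * (\<epsilon>\<^sup>2)\<^sup>2) + 4 * \<beta> * \<kappa>) * (real p)\<^sup>2 * real n powr (- 4 * ln n))"
proof -
  let ?T = "real n powr (2 * ln n)" and ?N = "real n powr (- 4 * ln n)"
  have n1: "1 \<le> real n" using n3 by simp
  have T: "1 \<le> ?T" "0 < ?T" using n1 by (auto simp: ge_one_powr_ge_zero)
  have T2: "?T\<^sup>2 = real n powr (4 * ln n)" using n1 by (simp add: power2_eq_square flip: powr_add)
  have invT: "1 / ?T\<^sup>2 = ?N" unfolding T2 by (simp add: powr_minus_divide)
  have TP: "?T\<^sup>2 * real n powr (- 8 * ln n) = ?N" unfolding T2 by (simp flip: powr_add)
  have \<beta>0: "0 \<le> \<beta>"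
  proof -
    have "0 \<le> qf p C (\<lambda>i. of_bool (i = 0)) (\<lambda>i. of_bool (i = 0))" by (rule qf_nonneg[OF C])
    also have "\<dots> \<le> \<beta>" using \<beta>[of "\<lambda>i. of_bool (i = 0)"] np by (simp add: ip_unit)
    finally show ?thesis .
  qed
  let ?c1 = "4 * \<beta>\<^sup>2 / (\<alpha> * (\<epsilon>\<^sup>2)\<^sup>2)" and ?c2 = "4 * \<beta> * \<kappa>"
  have c: "0 \<le> ?c1" "0 \<le> ?c2" using a(1) \<beta>0 \<kappa> by (simp_all add: less_imp_le)
  have bnd: "(\<integral>\<^sup>+x. ennreal (truncation_loss \<epsilon> ?T j x) \<partial>sample_law n p C) +
    (\<integral>\<^sup>+x. ennreal (low_ratio_loss \<epsilon> ?T j x) \<partial>sample_law n p C) \<le> ennreal ((?c1 + ?c2) * real p * ?N)" if j: "j < p" for j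
  proof -
    have "(\<integral>\<^sup>+x. ennreal (truncation_loss \<epsilon> ?T j x) \<partial>sample_law n p C) \<le> ennreal (?c1 * ?N)"
    proof -
      have "4 * \<beta>\<^sup>2 / (\<alpha> * (\<epsilon>\<^sup>2)\<^sup>2 * ?T\<^sup>2) = ?c1 * (1 / ?T\<^sup>2)" by simp
      thus ?thesis using truncation_loss_mean[OF \<epsilon> j T(2) a \<beta>] unfolding invT by simp
    qed
    also have "\<dots> \<le> ennreal (?c1 * real p * ?N)"
    proof (intro ennreal_leI mult_right_mono)
      have "?c1 * 1 \<le> ?c1 * real p" using c(1) np by (intro mult_left_mono) auto
      thus "?c1 \<le> ?c1 * real p" by simp
    qed simp
    finally have 1: "(\<integral>\<^sup>+x. ennreal (truncation_loss \<epsilon> ?T j x) \<partial>sample_law n p C) \<le> ennreal (?c1 * real p * ?N)" .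
    have "(\<integral>\<^sup>+x. ennreal (low_ratio_loss \<epsilon> ?T j x) \<partial>sample_law n p C) \<le>
      ennreal (4 * \<beta> * (real p * ?T\<^sup>2) * (\<kappa> * real n powr (- 8 * ln n)))"
      using \<kappa> by (intro low_ratio_loss_mean[OF j T(1) \<beta> _ P[OF j]]) simp
    also have "4 * \<beta> * (real p * ?T\<^sup>2) * (\<kappa> * real n powr (- 8 * ln n)) = ?c2 * real p * (?T\<^sup>2 * real n powr (- 8 * ln n))"
      by (simp only: mult_ac)
    finally have 2: "(\<integral>\<^sup>+x. ennreal (low_ratio_loss \<epsilon> ?T j x) \<partial>sample_law n p C) \<le> ennreal (?c2 * real p * ?N)"
      unfolding TP .
    have "ennreal (?c1 * real p * ?N) + ennreal (?c2 * real p * ?N) = ennreal ((?c1 + ?c2) * real p * ?N)"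
      unfolding distrib_right by (intro ennreal_plus[symmetric] mult_nonneg_nonneg c) simp_all
    with add_mono[OF 1 2] show ?thesis by simp
  qed
  have "(\<Sum>j<p. (\<integral>\<^sup>+x. ennreal (truncation_loss \<epsilon> ?T j x) \<partial>sample_law n p C) +
    (\<integral>\<^sup>+x. ennreal (low_ratio_loss \<epsilon> ?T j x) \<partial>sample_law n p C)) \<le> (\<Sum>j<p. ennreal ((?c1 + ?c2) * real p * ?N))"
    by (intro sum_mono bnd) simp
  also have "\<dots> = ennreal (\<Sum>j<p. (?c1 + ?c2) * real p * ?N)"
    by (intro sum_ennreal mult_nonneg_nonneg add_nonneg_nonneg c) simp_all
  also have "(\<Sum>j<p. (?c1 + ?c2) * real p * ?N) = (?c1 + ?c2) * (real p)\<^sup>2 * ?N"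
    by (simp add: power2_eq_square)
  finally show ?thesis .
qed

end

theorem theorem1:
  shows "\<exists>\<kappa> :: real \<Rightarrow> real \<Rightarrow> real \<Rightarrow> real.
    \<forall>(n::nat) (p::nat) (C::real mat) (K::real) (\<eta>::real) (\<M>::(nat \<times> nat) set set) (\<theta>::real mat)
      (\<theta>m :: (nat \<times> nat) set \<Rightarrow> real mat)
      (\<theta>hat :: (nat \<times> nat) set \<Rightarrow> real mat \<Rightarrow> real mat)
      (mhat :: real mat \<Rightarrow> (nat \<times> nat) set).
      n \<ge> 3 \<longrightarrow> p > n \<longrightarrow> pos_def p C \<longrightarrow> K > 1 \<longrightarrow> 0 < \<eta> \<longrightarrow> \<eta> < 1 \<longrightarrow>
      \<M> \<noteq> {} \<longrightarrow> \<M> \<subseteq> graphs p \<or> \<M> \<subseteq> digraphs p \<longrightarrow>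
      1 \<le> max_deg p \<M> \<longrightarrow>
      real (max_deg p \<M>) \<le> \<eta> * (real n / (2 * (1.1 + sqrt (ln p))\<^sup>2)) \<longrightarrow>
      regression_mat p C \<theta> \<longrightarrow>
      (\<forall>m\<in>\<M>. is_arg_min (\<lambda>A. (frob_norm (sqrt_mat p C * (\<theta> - A)))\<^sup>2) (\<lambda>A. A \<in> Theta p m) (\<theta>m m)) \<longrightarrow>
      (\<forall>m\<in>\<M>. AE x in sample_law n p C. let X = data_mat n p x in
         is_arg_min (\<lambda>A. (frob_norm (X * (1\<^sub>m p - A)))\<^sup>2) (\<lambda>A. A \<in> Theta p m) (\<theta>hat m X)) \<longrightarrow>
      (\<forall>m\<in>\<M>. \<forall>i<p. \<forall>j<p.
         (\<lambda>x. \<theta>hat m (data_mat n p x) $$ (i, j)) \<in> borel_measurable (sample_law n p C)) \<longrightarrow>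
      (AE x in sample_law n p C. let X = data_mat n p x in
         is_arg_min (crit K n p X (\<lambda>m. \<theta>hat m X)) (\<lambda>m. m \<in> \<M>) (mhat X)) \<longrightarrow>
      (\<lambda>x. mhat (data_mat n p x)) \<in> measurable (sample_law n p C) (count_space UNIV) \<longrightarrow>
      (let \<theta>sel = (\<lambda>X. \<theta>hat (mhat X) X);
           R = residual n p \<eta> C \<theta> (max_deg p \<M>) \<theta>sel in
       (\<forall>(\<Omega> :: 'a measure) X. normal_sample \<Omega> X n p C \<longrightarrow>
          (\<integral>\<^sup>+\<omega>. ennreal ((frob_norm (sqrt_mat p C *
              (truncation n p (\<theta>sel (data_mat n p (\<lambda>k. X k \<omega>))) - \<theta>)))\<^sup>2) \<partial>\<Omega>)
          \<le> ennreal (K / ((K - 1) * (1 - sqrt \<eta>) ^ 4) * Min ((\<lambda>m.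
                (frob_norm (sqrt_mat p C * (\<theta> - \<theta>m m)))\<^sup>2 *
                  (1 + pen K n p (gdeg p m) / (real n - real (gdeg p m)))
                + 1 / real n * (\<Sum>j<p. (pen K n p (card (nbrs m j)) + K * ln n) * sigma2 C j)) ` \<M>))
            + R) \<and>
       R \<le> ennreal (\<kappa> \<eta> (Min (spectrum C)) (Max (spectrum C))
             * (real p)\<^sup>2 * real n powr (- 4 * ln n)))"
\<comment> \<open>\<open>a\<close> and \<open>b\<close> are the smallest and the largest eigenvalue;
  the summands come from \<open>truncation_loss_mean\<close> and
  \<open>low_ratio_loss_mean\<close>.\<close>
proof (rule exI[of _ "\<lambda>\<eta> a b. 4 * b\<^sup>2 / (a * ((1 - sqrt \<eta>)\<^sup>2)\<^sup>2) + 4 * b * small_ratio_const \<eta>"],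
    intro allI impI, subst Let_def, subst Let_def)
  fix n p :: nat and C :: "real mat" and K \<eta> :: real and \<M> :: "(nat \<times> nat) set set" and \<theta> :: "real mat"
    and \<theta>m :: "(nat \<times> nat) set \<Rightarrow> real mat" and \<theta>hat :: "(nat \<times> nat) set \<Rightarrow> real mat \<Rightarrow> real mat"
    and mhat :: "real mat \<Rightarrow> (nat \<times> nat) set"
  assume n: "n \<ge> 3" and np: "p > n" and C: "pos_def p C" and K: "K > 1" and \<eta>: "0 < \<eta>" "\<eta> < 1"
    and ne: "\<M> \<noteq> {}" and M: "\<M> \<subseteq> graphs p \<or> \<M> \<subseteq> digraphs p" and D1: "1 \<le> max_deg p \<M>"
    and D\<eta>: "real (max_deg p \<M>) \<le> \<eta> * (real n / (2 * (1.1 + sqrt (ln p))\<^sup>2))"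
    and reg: "regression_mat p C \<theta>"
    and \<theta>m: "\<forall>m\<in>\<M>. is_arg_min (\<lambda>A. (frob_norm (sqrt_mat p C * (\<theta> - A)))\<^sup>2) (\<lambda>A. A \<in> Theta p m) (\<theta>m m)"
    and ls: "\<forall>m\<in>\<M>. AE x in sample_law n p C. let X = data_mat n p x in
       is_arg_min (\<lambda>A. (frob_norm (X * (1\<^sub>m p - A)))\<^sup>2) (\<lambda>A. A \<in> Theta p m) (\<theta>hat m X)"
    and meas: "\<forall>m\<in>\<M>. \<forall>i<p. \<forall>j<p. (\<lambda>x. \<theta>hat m (data_mat n p x) $$ (i, j)) \<in> borel_measurable (sample_law n p C)"
    and sel: "AE x in sample_law n p C. let X = data_mat n p x in
       is_arg_min (crit K n p X (\<lambda>m. \<theta>hat m X)) (\<lambda>m. m \<in> \<M>) (mhat X)"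
    and mh: "(\<lambda>x. mhat (data_mat n p x)) \<in> measurable (sample_law n p C) (count_space UNIV)"
  let ?L = "sample_law n p C" and ?D = "max_deg p \<M>" and ?e = "1 - sqrt \<eta>" and ?T = "real n powr (2 * ln n)"
  let ?B = "\<lambda>X. \<theta>hat (mhat X) X"
  let ?R = "residual n p \<eta> C \<theta> ?D ?B"
  let ?risk = "\<lambda>m. (frob_norm (sqrt_mat p C * (\<theta> - \<theta>m m)))\<^sup>2 *
      (1 + pen K n p (gdeg p m) / (real n - real (gdeg p m)))
    + 1 / real n * (\<Sum>j<p. (pen K n p (card (nbrs m j)) + K * ln n) * sigma2 C j)"
  have M': "\<M> \<subseteq> digraphs p" using M by (auto simp: graphs_def)
  note ms = model_selection_sample_law[OF n np C K \<eta> M' D1 D\<eta> reg ls meas sel mh]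
  note dg = digraph_degrees[OF M']
  interpret model_selection n p ?D C \<theta> K \<M> "\<lambda>m x j i. \<theta>hat m (data_mat n p x) $$ (i, j)" "\<lambda>x. mhat (data_mat n p x)"
    by (rule ms(1))
  have e: "0 < ?e" "?e < 1" using \<eta> by auto
  have B: "AE x in ?L. ?B (data_mat n p x) \<in> carrier_mat p p \<and> (\<forall>i<p. \<forall>j<p. ?B (data_mat n p x) $$ (i, j) = asel x j i)"
    using ms(2) by eventually_elim (simp add: asel_eq)
  have R: "?R = (\<Sum>j<p. (\<integral>\<^sup>+x. ennreal (truncation_loss ?e ?T j x) \<partial>?L) + (\<integral>\<^sup>+x. ennreal (low_ratio_loss ?e ?T j x) \<partial>?L))"
    by (rule residual_eq[OF \<eta> D1 B])
  show "(\<forall>(\<Omega> :: 'a measure) X. normal_sample \<Omega> X n p C \<longrightarrow>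
      (\<integral>\<^sup>+\<omega>. ennreal ((frob_norm (sqrt_mat p C * (truncation n p (?B (data_mat n p (\<lambda>k. X k \<omega>))) - \<theta>)))\<^sup>2) \<partial>\<Omega>)
      \<le> ennreal (K / ((K - 1) * (1 - sqrt \<eta>) ^ 4) * Min (?risk ` \<M>)) + ?R) \<and>
    ?R \<le> ennreal ((4 * (Max (spectrum C))\<^sup>2 / (Min (spectrum C) * (?e\<^sup>2)\<^sup>2) + 4 * Max (spectrum C) * small_ratio_const \<eta>) * (real p)\<^sup>2 * real n powr (- 4 * ln n))"
  proof (intro conjI allI impI)
    note spec = qf_spectral_bounds[OF C dims_pos(1)]
    show "?R \<le> ennreal ((4 * (Max (spectrum C))\<^sup>2 / (Min (spectrum C) * (?e\<^sup>2)\<^sup>2) + 4 * Max (spectrum C) * small_ratio_const \<eta>) * (real p)\<^sup>2 * real n powr (- 4 * ln n))"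
      unfolding R by (rule residual_sum_le[OF e spec small_ratio_const(1)[OF \<eta>] small_ratio_const(2)[OF \<eta> C n np D1 D\<eta>]])
  next
    fix \<Omega> :: "'a measure" and X assume X: "normal_sample \<Omega> X n p C"
    let ?G = "\<lambda>x. ennreal (\<Sum>j<p. qf p C (\<lambda>i. tsel ?T x j i - \<theta> $$ (i, j)) (\<lambda>i. tsel ?T x j i - \<theta> $$ (i, j)))"
    \<comment> \<open>The minimum is attained, so the bound has to be shown for one model only, with
      its \<open>\<theta>m m\<close> as comparison matrix.\<close>
    have "Min (?risk ` \<M>) \<in> ?risk ` \<M>" using dg(1) ne by (intro Min_in) auto
    then obtain m where m: "m \<in> \<M>" "Min (?risk ` \<M>) = ?risk m" by blast
    have \<theta>c: "\<theta> \<in> carrier_mat p p" using reg by (simp add: regression_mat_def)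
    have \<theta>mT: "\<theta>m m \<in> Theta p m" using \<theta>m m(1) by (simp add: is_arg_min_def)
    hence \<theta>mc: "\<theta>m m \<in> carrier_mat p p" by (simp add: Theta_def)
    let ?q = "\<lambda>j. qf p C (\<lambda>i. \<theta> $$ (i, j) - \<theta>m m $$ (i, j)) (\<lambda>i. \<theta> $$ (i, j) - \<theta>m m $$ (i, j))"
    have Gm: "?G \<in> borel_measurable ?L"
      by (rule measurable_compose[OF borel_measurable_sum measurable_ennreal]) (intro measurable_tsel_error, simp)
    have GB: "AE x in ?L. ennreal ((frob_norm (sqrt_mat p C * (truncation n p (?B (data_mat n p x)) - \<theta>)))\<^sup>2) = ?G x"
      using B by eventually_elim (subst frob_norm_truncation, auto)
    have "(\<integral>\<^sup>+\<omega>. ennreal ((frob_norm (sqrt_mat p C * (truncation n p (?B (data_mat n p (\<lambda>k. X k \<omega>))) - \<theta>)))\<^sup>2) \<partial>\<Omega>) =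
        (\<integral>\<^sup>+x. ?G x \<partial>?L)"
      by (rule nn_integral_normal_sample[OF X dims_pos(2) Gm GB])
    also have "\<dots> \<le> ennreal (1 / ((?e\<^sup>2)\<^sup>2 * real n) * (K / (K - 1) * (\<Sum>j<p.
        real n * ?q j * (1 + K * pen_rate n p (card (nbrs m j)))
        + sigma2 C j * (K * pen_rate n p (card (nbrs m j)) * (real n - real (card (nbrs m j))) + K * ln (real n))))) + ?R"
      unfolding R using \<theta>mT by (intro truncated_risk[OF e m(1)]) (auto simp: Theta_def nbrs_def)
    also have "\<dots> \<le> ennreal (K / ((K - 1) * ?e ^ 4) * Min (?risk ` \<M>)) + ?R"
    proof (intro add_right_mono ennreal_leI)
      have e4: "(?e\<^sup>2)\<^sup>2 = ?e ^ 4" by (simp flip: power_mult)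
      have fr: "(frob_norm (sqrt_mat p C * (\<theta> - \<theta>m m)))\<^sup>2 = (\<Sum>j<p. ?q j)"
        by (rule frob_norm_sqrt_mat_diff[OF C \<theta>c \<theta>mc])
      show "1 / ((?e\<^sup>2)\<^sup>2 * real n) * (K / (K - 1) * (\<Sum>j<p.
        real n * ?q j * (1 + K * pen_rate n p (card (nbrs m j)))
        + sigma2 C j * (K * pen_rate n p (card (nbrs m j)) * (real n - real (card (nbrs m j))) + K * ln (real n)))) \<le>
        K / ((K - 1) * ?e ^ 4) * Min (?risk ` \<M>)"
        unfolding m(2) fr e4 using e by (intro oracle_bound_le[OF m(1) dg(2)[OF m(1)] dg(3)[OF m(1)] qf_nonneg[OF C]]) simp_all
    qed
    finally show "(\<integral>\<^sup>+\<omega>. ennreal ((frob_norm (sqrt_mat p C * (truncation n p (?B (data_mat n p (\<lambda>k. X k \<omega>))) - \<theta>)))\<^sup>2) \<partial>\<Omega>)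
      \<le> ennreal (K / ((K - 1) * ?e ^ 4) * Min (?risk ` \<M>)) + ?R" .
  qed
qed

end
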